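(* Let $6 < p \leq \infty$ and $s > 1 - \frac1p$. Then the cubic nonlinear Schrödinger equation $$ i\partial_t u + \partial_x^2u = |u|^2u, \quad u(0) = f \in D,$$ on the line is quantitatively well-posed with $D = L^p_s(\mathbb{R})$ and $S = L_t^\infty([0,1], M_{\infty,1}(\mathbb{R}))$. That is, there is a constant $C$ such that for all $f\in D$ and $u_1,u_2,u_3\in S$, $$ \|Lf\|_S \le C\|f\|_D, \qquad \|N_3(u_1,u_2,u_3)\|_S \le C\|u_1\|_S\|u_2\|_S\|u_3\|_S.$$
   Context: With $U(t) = e^{it\partial_x^2}$ on $\mathbb{R}$, $Lf(t) = U(t)f$ and $N_3(u_1,u_2,u_3)(t) = -i\int_0^t U(t-\tau)(u_1\overline{u_2}u_3)(\tau)\,d\tau$, so that the equation reads $u = Lf + N_3(u,u,u)$. $\|f\|_{L^p_s(\mathbb{R})} = \|\langle\partial_x\rangle^s f\|_{L^p}$, with $\langle\partial_x\rangle^s$ the Fourier multiplier with symbol $(1+\xi^2)^{s/2}$. Modulation spaces: let $\sigma_0 \in C_c^\infty(\mathbb{R})$ be such that $\sigma_k(\xi) := \sigma_0(\xi - k)$, $k \in \mathbb{Z}$, is a smooth partition of unity on $\mathbb{R}$ adapted to the intervals $k + [-\frac12,\frac12)$; set $\widehat{\Box_k f} = \sigma_k \hat f$ and $\|f\|_{M_{\infty,1}(\mathbb{R})} = \sum_{k \in \mathbb{Z}} \|\Box_k f\|_{L^\infty(\mathbb{R})}$. *)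

theory Defs
  imports "HOL-Analysis.Analysis" "HOL-Probability.Essential_Supremum"
begin

definition nderiv :: "nat \<Rightarrow> (real \<Rightarrow> 'a::real_normed_vector) \<Rightarrow> real \<Rightarrow> 'a" where
  "nderiv n f = ((\<lambda>g x. vector_derivative g (at x)) ^^ n) f"

definition smooth :: "(real \<Rightarrow> 'a::real_normed_vector) \<Rightarrow> bool" where
  "smooth f \<longleftrightarrow> (\<forall>n x. nderiv n f differentiable (at x))"

definition schwartz :: "(real \<Rightarrow> complex) set" where
  "schwartz = {\<phi>. smooth \<phi> \<and>
     (\<forall>m n. bdd_above (range (\<lambda>x. \<bar>x\<bar> ^ m * norm (nderiv n \<phi> x))))}"

definition schwartz_seminorm :: "nat \<Rightarrow> nat \<Rightarrow> (real \<Rightarrow> complex) \<Rightarrow> real" where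
  "schwartz_seminorm m n \<phi> = (SUP x. \<bar>x\<bar> ^ m * norm (nderiv n \<phi> x))"

text \<open>Distributions are functionals on all functions, but only their values on Schwartz functions
  are meaningful: nothing below depends on the other values, so that two functionals which agree on
  \<^const>\<open>schwartz\<close> are the same distribution.\<close>

type_synonym distr = "(real \<Rightarrow> complex) \<Rightarrow> complex"

definition tempered :: "distr set" where
  "tempered = {T.
     (\<forall>\<phi>\<in>schwartz. \<forall>\<psi>\<in>schwartz. \<forall>a b.
        T (\<lambda>x. a * \<phi> x + b * \<psi> x) = a * T \<phi> + b * T \<psi>) \<and>
     (\<exists>N C. \<forall>\<phi>\<in>schwartz. norm (T \<phi>) \<le> C * (\<Sum>m\<le>N. \<Sum>n\<le>N. schwartz_seminorm m n \<phi>))}"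

definition distr_of :: "(real \<Rightarrow> complex) \<Rightarrow> distr" where
  "distr_of g = (\<lambda>\<phi>. LBINT x. g x * \<phi> x)"

definition represents :: "(real \<Rightarrow> complex) \<Rightarrow> distr \<Rightarrow> bool" where
  "represents g T \<longleftrightarrow> g \<in> borel_measurable lborel \<and>
     (\<forall>\<phi>\<in>schwartz. integrable lborel (\<lambda>x. g x * \<phi> x) \<and> T \<phi> = distr_of g \<phi>)"

text \<open>Unique up to null sets whenever the distribution is a function.\<close>

definition density_of :: "distr \<Rightarrow> real \<Rightarrow> complex" where
  "density_of T = (SOME g. represents g T)"

definition fourier :: "(real \<Rightarrow> complex) \<Rightarrow> real \<Rightarrow> complex" where
  "fourier \<phi> \<xi> = (LBINT x. cis (- (x * \<xi>)) * \<phi> x)"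

definition inv_fourier :: "(real \<Rightarrow> complex) \<Rightarrow> real \<Rightarrow> complex" where
  "inv_fourier \<phi> x = (LBINT \<xi>. cis (x * \<xi>) * \<phi> \<xi>) / (2 * pi)"

definition fourier_distr :: "distr \<Rightarrow> distr" where
  "fourier_distr T = (\<lambda>\<phi>. T (fourier \<phi>))"

definition inv_fourier_distr :: "distr \<Rightarrow> distr" where
  "inv_fourier_distr T = (\<lambda>\<phi>. T (inv_fourier \<phi>))"

definition mult_distr :: "(real \<Rightarrow> complex) \<Rightarrow> distr \<Rightarrow> distr" where
  "mult_distr m T = (\<lambda>\<phi>. T (\<lambda>\<xi>. m \<xi> * \<phi> \<xi>))"

text \<open>Only used with smooth symbols all of whose derivatives have at most polynomial growth; such
  symbols act on tempered distributions.\<close>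

definition fourier_multiplier :: "(real \<Rightarrow> complex) \<Rightarrow> distr \<Rightarrow> distr" where
  "fourier_multiplier m T = inv_fourier_distr (mult_distr m (fourier_distr T))"

definition Lp_norm_fun :: "ereal \<Rightarrow> (real \<Rightarrow> complex) \<Rightarrow> ennreal" where
  "Lp_norm_fun p g =
     (if p = \<infinity> then esssup lborel (\<lambda>x. ennreal (norm (g x)))
      else let I = (\<integral>\<^sup>+x. ennreal (norm (g x) powr real_of_ereal p) \<partial>lborel)
           in if I = \<infinity> then \<infinity> else ennreal (enn2real I powr (1 / real_of_ereal p)))"

text \<open>The infimum is over functions that agree almost everywhere; it is \<open>\<infinity>\<close> if the distribution is
  not a function.\<close>

definition Lp_norm :: "ereal \<Rightarrow> distr \<Rightarrow> ennreal" where
  "Lp_norm p T = Inf {Lp_norm_fun p g | g. represents g T}"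

definition bessel_norm :: "ereal \<Rightarrow> real \<Rightarrow> distr \<Rightarrow> ennreal" where
  "bessel_norm p s f =
     Lp_norm p (fourier_multiplier (\<lambda>\<xi>. complex_of_real ((1 + \<xi>\<^sup>2) powr (s / 2))) f)"

definition bessel_space :: "ereal \<Rightarrow> real \<Rightarrow> distr set" where
  "bessel_space p s = {f \<in> tempered. bessel_norm p s f < \<infinity>}"

text \<open>The translate \<open>\<sigma>(\<xi> - k)\<close> vanishes outside the \<open>r\<close>-neighbourhood of \<open>k + [-1/2, 1/2)\<close>, with
  \<open>r\<close> independent of \<open>k\<close>; in particular \<open>\<sigma>\<close> has compact support.\<close>

definition unit_partition :: "(real \<Rightarrow> real) \<Rightarrow> bool" where
  "unit_partition \<sigma> \<longleftrightarrow> smooth \<sigma> \<and> (\<forall>\<xi>. 0 \<le> \<sigma> \<xi>) \<and>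
     (\<exists>r>0. \<forall>\<xi>. \<xi> \<notin> {- 1/2 - r..1/2 + r} \<longrightarrow> \<sigma> \<xi> = 0) \<and>
     (\<forall>\<xi>. ((\<lambda>k::int. \<sigma> (\<xi> - of_int k)) has_sum 1) UNIV)"

definition freq_box :: "(real \<Rightarrow> real) \<Rightarrow> int \<Rightarrow> distr \<Rightarrow> distr" where
  "freq_box \<sigma> k = fourier_multiplier (\<lambda>\<xi>. complex_of_real (\<sigma> (\<xi> - of_int k)))"

definition mod_norm :: "(real \<Rightarrow> real) \<Rightarrow> distr \<Rightarrow> ennreal" where
  "mod_norm \<sigma> f = (\<Sum>\<^sub>\<infinity>k\<in>(UNIV::int set). Lp_norm \<infinity> (freq_box \<sigma> k f))"

definition mod_space :: "(real \<Rightarrow> real) \<Rightarrow> distr set" where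
  "mod_space \<sigma> = {f \<in> tempered. mod_norm \<sigma> f < \<infinity>}"

text \<open>The measurability is Bochner's: almost everywhere limits in norm of simple functions. The
  modulation space is not separable, so that the Bochner integral of the library does not apply.\<close>

definition strongly_measurable :: "(real \<Rightarrow> real) \<Rightarrow> (real \<Rightarrow> distr) \<Rightarrow> bool" where
  "strongly_measurable \<sigma> u \<longleftrightarrow>
     (\<exists>v :: nat \<Rightarrow> real \<Rightarrow> distr.
        (\<forall>n. simple_function (lebesgue_on {0..1}) (v n) \<and> v n ` {0..1} \<subseteq> mod_space \<sigma>) \<and>
        (AE t in lebesgue_on {0..1}.
           (\<lambda>n. mod_norm \<sigma> (\<lambda>\<phi>. v n t \<phi> - u t \<phi>)) \<longlonglongrightarrow> 0))"

definition S_norm :: "(real \<Rightarrow> real) \<Rightarrow> (real \<Rightarrow> distr) \<Rightarrow> ennreal" where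
  "S_norm \<sigma> u = esssup (lebesgue_on {0..1}) (\<lambda>t. mod_norm \<sigma> (u t))"

definition S_space :: "(real \<Rightarrow> real) \<Rightarrow> (real \<Rightarrow> distr) set" where
  "S_space \<sigma> = {u. (\<forall>t\<in>{0..1}. u t \<in> mod_space \<sigma>) \<and> strongly_measurable \<sigma> u \<and> S_norm \<sigma> u < \<infinity>}"

text \<open>The symbol of \<open>i t \<partial>\<^sub>x\<^sup>2\<close> is \<open>- i t \<xi>\<^sup>2\<close>.\<close>

definition schroedinger :: "real \<Rightarrow> distr \<Rightarrow> distr" where
  "schroedinger t = fourier_multiplier (\<lambda>\<xi>. cis (- (t * \<xi>\<^sup>2)))"

definition free_evolution :: "distr \<Rightarrow> real \<Rightarrow> distr" where
  "free_evolution f = (\<lambda>t. schroedinger t f)"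

text \<open>Elements of the modulation space are bounded functions, which gives the product its meaning.\<close>

definition cubic_product :: "distr \<Rightarrow> distr \<Rightarrow> distr \<Rightarrow> distr" where
  "cubic_product f g h =
     distr_of (\<lambda>x. density_of f x * cnj (density_of g x) * density_of h x)"

text \<open>The time integral of distributions is tested against Schwartz functions.\<close>

definition duhamel ::
  "(real \<Rightarrow> distr) \<Rightarrow> (real \<Rightarrow> distr) \<Rightarrow> (real \<Rightarrow> distr) \<Rightarrow> real \<Rightarrow> distr" where
  "duhamel u\<^sub>1 u\<^sub>2 u\<^sub>3 t = (\<lambda>\<phi>. - \<i> *
     (LINT \<tau>|lebesgue_on {0..t}. schroedinger (t - \<tau>) (cubic_product (u\<^sub>1 \<tau>) (u\<^sub>2 \<tau>) (u\<^sub>3 \<tau>)) \<phi>))"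

end

theory Submission
  imports Defs "HOL-Probability.Probability"
begin

text \<open>
The two estimates are proved in a form that is stronger in time: the frequency pieces are bounded
uniformly in time and space before they are summed. If \<open>D k t\<close> is a function representing
\<open>\<box>\<^sub>k u(t)\<close>, then \<open>u\<close> lies in \<open>S_space\<close> with norm at most \<open>B\<close> as soon as each \<open>D k\<close> is Lipschitz in
time, \<open>\<bar>D k t x\<bar> \<le> b k\<close>, and the finite sums of \<open>b\<close> are at most \<open>B\<close> (\<open>S_spaceI\<close>); indeed \<open>u\<close> is then
continuous in time with values in the modulation space, hence strongly measurable.

Both estimates rest on the kernel \<open>K\<^sub>k(t)\<close> with symbol \<open>\<sigma>(\<xi> - k) cis (- (t \<xi>\<^sup>2)) (1 + \<xi>\<^sup>2)\<^bsup>-s/2\<^esup>\<close>. The Galilei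
transformation moves the frequency \<open>k\<close> to \<open>0\<close>, which gives for \<open>\<bar>t\<bar> \<le> 1\<close>, uniformly in \<open>k\<close>, the bound
\<open>\<bar>K\<^sub>k(t, x)\<bar> \<le> C (1 + k\<^sup>2)\<^bsup>-s/2\<^esup> / (1 + (x - 2tk)\<^sup>2)\<close> (\<open>box_kernel_bound\<close>).

For the linear estimate put \<open>g = \<langle>\<partial>\<rangle>\<^sup>s f\<close>, a function in \<open>L\<^sup>p\<close>, so that \<open>\<box>\<^sub>k U(t) f = g * K\<^sub>k(t)\<close>. Choose a
time \<open>t\<^sub>k\<close> and a point \<open>x\<^sub>k\<close> for every \<open>k\<close>. By duality \<open>\<Sum>\<^sub>k \<bar>g * K\<^sub>k(t\<^sub>k)(x\<^sub>k)\<bar>\<close> is the integral of \<open>g\<close>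
against a packet \<open>P = \<Sum>\<^sub>k c\<^sub>k K\<^sub>k(t\<^sub>k, x\<^sub>k - y)\<close> with \<open>\<bar>c\<^sub>k\<bar> \<le> 1\<close>. Let \<open>k\<close> range over a dyadic block
\<open>\<bar>k\<bar> \<sim> 2\<^sup>j\<close>. The \<open>L\<^sup>1\<close> norm of \<open>P\<close> is at most a multiple of \<open>2\<^bsup>(1 - s)j\<^esup>\<close> by the triangle inequality, and
its \<open>L\<^sup>2\<close> norm at most a multiple of \<open>2\<^bsup>(1/2 - s)j\<^esup>\<close> because kernels with distant frequencies are
orthogonal. Interpolation bounds the norm of \<open>P\<close> in the dual of \<open>L\<^sup>p\<close> by a multiple of
\<open>2\<^bsup>(1 - 1/p - s)j\<^esup>\<close> (\<open>sum_conv_Lp_level\<close>), which is summable over \<open>j\<close> exactly because \<open>s > 1 - 1/p\<close>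
(\<open>sum_conv_Lp\<close>). Since the points \<open>t\<^sub>k\<close>, \<open>x\<^sub>k\<close> are arbitrary, the same bound holds for the sum of the
suprema over \<open>t\<close> and \<open>x\<close> (\<open>free_evolution_bound\<close>).

For the trilinear estimate an element of the modulation space is expanded as the sum of its boxes
(\<open>mod_space_represents\<close>). The product of the pieces with frequencies \<open>a\<close>, \<open>-b\<close>, \<open>c\<close> has its spectrum
in a fixed neighbourhood of \<open>a - b + c\<close>, so that only the triples with \<open>a - b + c\<close> near \<open>k\<close> contribute
to \<open>\<box>\<^sub>k U(t - \<tau>)(u v\<^sup>* w)\<close>, and each of these is bounded by the product of three supremum norms, as
the kernel of \<open>\<box>\<^sub>k U(t - \<tau>)\<close> is bounded in \<open>L\<^sup>1\<close> uniformly in \<open>k\<close> (\<open>conv_cubic_bound\<close>). A triple is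
counted for a bounded number of \<open>k\<close>, so that the sum over \<open>k\<close> is at most a multiple of the product of
the three norms (\<open>sum_trilinear_sum_le\<close>). The integral over \<open>\<tau>\<close> and Fubini's theorem give the estimate
for the Duhamel term (\<open>duhamel_bound\<close>). Here the integrand must be shown to be measurable in \<open>\<tau>\<close>,
although the curves are measurable only as limits of simple functions
(\<open>cubic_integral_measurable\<close>, \<open>piece_jointly_measurable\<close>).
\<close>

section \<open>Iterated derivatives\<close>

text \<open>The derivative as an operation on functions, so that \<open>nderiv\<close> is its iteration.\<close>

definition vderiv :: "(real \<Rightarrow> 'a::real_normed_vector) \<Rightarrow> real \<Rightarrow> 'a" where
  "vderiv f = (\<lambda>x. vector_derivative f (at x))"

lemma vderivI: "(\<And>x. (f has_vector_derivative g x) (at x)) \<Longrightarrow> vderiv f = g"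
  unfolding vderiv_def by (auto simp: vector_derivative_at)

lemma vderiv_works: "f differentiable (at x) \<Longrightarrow> (f has_vector_derivative vderiv f x) (at x)"
  by (simp add: vderiv_def vector_derivative_works)

lemma nderiv_0 [simp]: "nderiv 0 f = f"
  by (simp add: nderiv_def)

lemma nderiv_Suc: "nderiv (Suc n) f = nderiv n (vderiv f)"
  by (simp add: nderiv_def vderiv_def funpow_Suc_right del: funpow.simps)

lemma nderiv_Suc': "nderiv (Suc n) f = vderiv (nderiv n f)"
  by (simp add: nderiv_def vderiv_def)

text \<open>Differentiability of order \<open>n\<close>. The recursion peels off the innermost derivative,
which suits inductions along the Leibniz rule; \<open>smooth_iff\<close> connects it with
\<open>smooth\<close>.\<close>

fun ntimes_diff :: "nat \<Rightarrow> (real \<Rightarrow> 'a::real_normed_vector) \<Rightarrow> bool" where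
  "ntimes_diff 0 f = True"
| "ntimes_diff (Suc n) f = ((\<forall>x. f differentiable (at x)) \<and> ntimes_diff n (vderiv f))"

lemma ntimes_diff_iff: "ntimes_diff n f \<longleftrightarrow> (\<forall>j<n. \<forall>x. nderiv j f differentiable (at x))"
proof (induction n arbitrary: f)
  case (Suc n)
  have "(\<forall>j<Suc n. \<forall>x. nderiv j f differentiable (at x)) \<longleftrightarrow>
      (\<forall>x. f differentiable (at x)) \<and> (\<forall>j<n. \<forall>x. nderiv (Suc j) f differentiable (at x))"
    by (metis less_Suc_eq_0_disj nderiv_0)
  with Suc show ?case by (simp add: nderiv_Suc)
qed simp

lemma smooth_iff: "smooth f \<longleftrightarrow> (\<forall>n. ntimes_diff n f)"
  unfolding ntimes_diff_iff smooth_def by auto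

lemma smooth_vderiv: "smooth f \<Longrightarrow> smooth (vderiv f)"
  unfolding smooth_def by (metis nderiv_Suc)

lemma smooth_nderiv: "smooth f \<Longrightarrow> smooth (nderiv n f)"
  by (induction n) (auto simp: nderiv_Suc' smooth_vderiv)

lemma smooth_differentiable: "smooth f \<Longrightarrow> f differentiable (at x)"
  unfolding smooth_def by (metis nderiv_0)

lemma smooth_has_vderiv: "smooth f \<Longrightarrow> (f has_vector_derivative vderiv f x) (at x)"
  by (simp add: smooth_differentiable vderiv_works)

lemma smooth_continuous: "smooth f \<Longrightarrow> continuous_on A f"
  by (meson continuous_at_imp_continuous_on differentiable_imp_continuous_within smooth_differentiable)

lemma smooth_measurable: "smooth (f :: real \<Rightarrow> complex) \<Longrightarrow> f \<in> borel_measurable borel"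
  by (intro borel_measurable_continuous_onI smooth_continuous)

lemma ntimes_diff_mono: "ntimes_diff (Suc n) f \<Longrightarrow> ntimes_diff n f"
  unfolding ntimes_diff_iff by simp

lemma vderiv_add:
  assumes "\<forall>x. f differentiable (at x)" "\<forall>x. g differentiable (at x)"
  shows "vderiv (\<lambda>x. f x + g x) = (\<lambda>x. vderiv f x + vderiv g x)"
  using assms by (intro vderivI has_vector_derivative_add vderiv_works) auto

lemma vderiv_mult:
  fixes f g :: "real \<Rightarrow> complex"
  assumes "\<forall>x. f differentiable (at x)" "\<forall>x. g differentiable (at x)"
  shows "vderiv (\<lambda>x. f x * g x) = (\<lambda>x. vderiv f x * g x + f x * vderiv g x)"
proof (rule vderivI)
  fix x
  have "((\<lambda>x. f x * g x) has_vector_derivative f x * vderiv g x + vderiv f x * g x) (at x)"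
    using assms by (intro has_vector_derivative_mult vderiv_works) auto
  then show "((\<lambda>x. f x * g x) has_vector_derivative vderiv f x * g x + f x * vderiv g x) (at x)"
    by (simp add: add.commute)
qed

lemma ntimes_diff_add:
  "ntimes_diff n f \<Longrightarrow> ntimes_diff n g \<Longrightarrow> ntimes_diff n (\<lambda>x. f x + g x)"
  by (induction n arbitrary: f g) (auto simp: vderiv_add intro: differentiable_add)

lemma ntimes_diff_mult:
  fixes f g :: "real \<Rightarrow> complex"
  shows "ntimes_diff n f \<Longrightarrow> ntimes_diff n g \<Longrightarrow> ntimes_diff n (\<lambda>x. f x * g x)"
proof (induction n arbitrary: f g)
  case (Suc n)
  have "ntimes_diff n f" "ntimes_diff n g"
    using Suc.prems ntimes_diff_mono by blast+
  with Suc show ?case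
    by (auto simp: vderiv_mult differentiable_mult intro!: ntimes_diff_add)
qed simp

lemma smooth_add: "smooth f \<Longrightarrow> smooth g \<Longrightarrow> smooth (\<lambda>x. f x + g x)"
  by (simp add: smooth_iff ntimes_diff_add)

lemma smooth_mult:
  fixes f g :: "real \<Rightarrow> complex"
  shows "smooth f \<Longrightarrow> smooth g \<Longrightarrow> smooth (\<lambda>x. f x * g x)"
  by (simp add: smooth_iff ntimes_diff_mult)

lemma nderiv_add:
  "ntimes_diff n f \<Longrightarrow> ntimes_diff n g \<Longrightarrow> nderiv n (\<lambda>x. f x + g x) = (\<lambda>x. nderiv n f x + nderiv n g x)"
  by (induction n arbitrary: f g) (auto simp: vderiv_add nderiv_Suc)

lemma vderiv_linear:
  assumes "bounded_linear L" "\<forall>x. f differentiable (at x)"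
  shows "\<forall>x. (\<lambda>x. L (f x)) differentiable (at x)" "vderiv (\<lambda>x. L (f x)) = (\<lambda>x. L (vderiv f x))"
proof -
  have *: "((\<lambda>x. L (f x)) has_vector_derivative L (vderiv f x)) (at x)" for x
    by (rule bounded_linear.has_vector_derivative[OF assms(1) vderiv_works]) (use assms(2) in simp)
  show "\<forall>x. (\<lambda>x. L (f x)) differentiable (at x)" by (intro allI differentiableI_vector[OF *])
  show "vderiv (\<lambda>x. L (f x)) = (\<lambda>x. L (vderiv f x))" by (rule vderivI[OF *])
qed

lemma ntimes_diff_linear:
  assumes "bounded_linear L"
  shows "ntimes_diff n f \<Longrightarrow> ntimes_diff n (\<lambda>x. L (f x)) \<and> nderiv n (\<lambda>x. L (f x)) = (\<lambda>x. L (nderiv n f x))"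
  by (induction n arbitrary: f) (auto simp: vderiv_linear[OF assms] nderiv_Suc)

lemma smooth_linear:
  assumes "bounded_linear L" "smooth f"
  shows "smooth (\<lambda>x. L (f x))" "nderiv n (\<lambda>x. L (f x)) = (\<lambda>x. L (nderiv n f x))"
  using assms ntimes_diff_linear[OF assms(1)] by (auto simp: smooth_iff)

lemma vderiv_affine:
  assumes "\<forall>x. f differentiable (at x)"
  shows "\<forall>x. (\<lambda>x. f (a * x + b)) differentiable (at x)"
    "vderiv (\<lambda>x. f (a * x + b)) = (\<lambda>x. a *\<^sub>R vderiv f (a * x + b))"
proof -
  have *: "((\<lambda>x. f (a * x + b)) has_vector_derivative a *\<^sub>R vderiv f (a * x + b)) (at x)" for x
  proof -
    have "((\<lambda>x. a * x + b) has_vector_derivative a) (at x)"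
      by (auto intro!: derivative_eq_intros simp: has_real_derivative_iff_has_vector_derivative[symmetric])
    then have "((f \<circ> (\<lambda>x. a * x + b)) has_vector_derivative a *\<^sub>R vderiv f (a * x + b)) (at x)"
      by (rule vector_diff_chain_at) (use assms vderiv_works in auto)
    then show ?thesis by (simp add: o_def)
  qed
  show "\<forall>x. (\<lambda>x. f (a * x + b)) differentiable (at x)" by (intro allI differentiableI_vector[OF *])
  show "vderiv (\<lambda>x. f (a * x + b)) = (\<lambda>x. a *\<^sub>R vderiv f (a * x + b))" by (rule vderivI[OF *])
qed

lemma ntimes_diff_affine:
  "ntimes_diff n f \<Longrightarrow> ntimes_diff n (\<lambda>x. f (a * x + b)) \<and>
     nderiv n (\<lambda>x. f (a * x + b)) = (\<lambda>x. a ^ n *\<^sub>R nderiv n f (a * x + b))"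
proof (induction n arbitrary: f)
  case (Suc n)
  have d: "ntimes_diff n (vderiv f)" and f: "\<forall>x. f differentiable (at x)" using Suc.prems by auto
  note IH = Suc.IH[OF d]
  have "ntimes_diff n (\<lambda>x. a *\<^sub>R vderiv f (a * x + b)) \<and>
    nderiv n (\<lambda>x. a *\<^sub>R vderiv f (a * x + b)) = (\<lambda>x. a *\<^sub>R (a ^ n *\<^sub>R nderiv n (vderiv f) (a * x + b)))"
    using ntimes_diff_linear[OF bounded_linear_scaleR_right, of n "\<lambda>x. vderiv f (a * x + b)" a] IH by simp
  then show ?case using f vderiv_affine[of f a b] by (simp add: nderiv_Suc)
qed simp

lemma smooth_affine:
  assumes "smooth f"
  shows "smooth (\<lambda>x. f (a * x + b))" "nderiv n (\<lambda>x. f (a * x + b)) = (\<lambda>x. a ^ n *\<^sub>R nderiv n f (a * x + b))"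
  using assms ntimes_diff_affine[of _ f a b] unfolding smooth_iff by blast+

section \<open>Families of symbols of uniformly polynomial growth\<close>

text \<open>\<open>slow n A\<close> says that the derivatives up to order \<open>n\<close> of the functions in \<open>A\<close> have at most polynomial
growth, with exponent and constant uniform over \<open>A\<close>. Working with sets of symbols, rather than with
single symbols, yields the uniformity in the time and in the frequency that the kernel bounds need.\<close>

fun slow :: "nat \<Rightarrow> (real \<Rightarrow> complex) set \<Rightarrow> bool" where
  "slow 0 A = (\<exists>N C. \<forall>a\<in>A. \<forall>x. norm (a x) \<le> C * (1 + \<bar>x\<bar>) ^ N)"
| "slow (Suc n) A = (slow 0 A \<and> (\<forall>a\<in>A. \<forall>x. a differentiable (at x)) \<and> slow n (vderiv ` A))"

text \<open>A set of symbols, all of whose derivatives have polynomial growth uniformly over the set.\<close>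

definition slow_family :: "(real \<Rightarrow> complex) set \<Rightarrow> bool" where
  "slow_family A \<longleftrightarrow> (\<forall>n. slow n A)"

declare slow.simps(1) [simp del]

lemma slow_0I: "(\<And>a x. a \<in> A \<Longrightarrow> norm (a x) \<le> C * (1 + \<bar>x\<bar>) ^ N) \<Longrightarrow> slow 0 A"
  unfolding slow.simps(1) by blast

lemma slow_0D:
  assumes "slow 0 A"
  shows "\<exists>C N. C \<ge> 0 \<and> (\<forall>a\<in>A. \<forall>x. norm (a x) \<le> C * (1 + \<bar>x\<bar>) ^ N)"
proof -
  obtain N C where *: "\<forall>a\<in>A. \<forall>x. norm (a x) \<le> C * (1 + \<bar>x\<bar>) ^ N"
    using assms by (auto simp: slow.simps(1))
  have "norm (a x) \<le> \<bar>C\<bar> * (1 + \<bar>x\<bar>) ^ N" if "a \<in> A" for a x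
    using *[rule_format, OF that, of x] by (rule order_trans) (simp add: mult_right_mono)
  then show ?thesis by (intro exI[of _ "\<bar>C\<bar>"] exI[of _ N]) auto
qed

lemma slow_imp_0: "slow n A \<Longrightarrow> slow 0 A"
  by (cases n) auto

lemma slow_0_subset: "slow 0 A \<Longrightarrow> B \<subseteq> A \<Longrightarrow> slow 0 B"
  unfolding slow.simps(1) by blast

lemma slow_subset: "slow n A \<Longrightarrow> B \<subseteq> A \<Longrightarrow> slow n B"
proof (induction n arbitrary: A B)
  case 0 then show ?case by (rule slow_0_subset)
next
  case (Suc n)
  have "slow 0 B" using Suc.prems slow_0_subset by auto
  moreover have "slow n (vderiv ` B)"
    by (rule Suc.IH[of "vderiv ` A"]) (use Suc.prems in auto)
  ultimately show ?case using Suc.prems by auto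
qed

lemma slow_SucD: "slow (Suc n) A \<Longrightarrow> slow n A"
proof (induction n arbitrary: A)
  case (Suc n)
  from Suc.prems have "slow (Suc n) (vderiv ` A)" by simp
  from Suc.IH[OF this] Suc.prems show ?case by simp
qed simp

lemma slow_imp_ntimes_diff: "slow n A \<Longrightarrow> a \<in> A \<Longrightarrow> ntimes_diff n a"
  by (induction n arbitrary: A a) auto

lemma slow_family_smooth: "slow_family A \<Longrightarrow> a \<in> A \<Longrightarrow> smooth a"
  unfolding slow_family_def smooth_iff using slow_imp_ntimes_diff by blast

lemma slow_0_add:
  assumes "slow 0 A" "slow 0 B" shows "slow 0 {\<lambda>x. a x + b x |a b. a \<in> A \<and> b \<in> B}"
proof -
  obtain C N where A: "C \<ge> 0" "\<And>a x. a \<in> A \<Longrightarrow> norm (a x) \<le> C * (1 + \<bar>x\<bar>) ^ N"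
    using slow_0D[OF assms(1)] by blast
  obtain D M where B: "D \<ge> 0" "\<And>a x. a \<in> B \<Longrightarrow> norm (a x) \<le> D * (1 + \<bar>x\<bar>) ^ M"
    using slow_0D[OF assms(2)] by blast
  show ?thesis
  proof (rule slow_0I[of _ "C + D" "N + M"], clarify)
    fix x a b assume ab: "a \<in> A" "b \<in> B"
    have "C * (1 + \<bar>x\<bar>) ^ N \<le> C * (1 + \<bar>x\<bar>) ^ (N + M)" "D * (1 + \<bar>x\<bar>) ^ M \<le> D * (1 + \<bar>x\<bar>) ^ (N + M)"
      using A(1) B(1) by (auto intro!: mult_left_mono power_increasing)
    with A(2)[OF ab(1), of x] B(2)[OF ab(2), of x] norm_triangle_ineq[of "a x" "b x"]
    show "norm (a x + b x) \<le> (C + D) * (1 + \<bar>x\<bar>) ^ (N + M)" by (simp add: distrib_right)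
  qed
qed

lemma slow_0_mult:
  assumes "slow 0 A" "slow 0 B" shows "slow 0 {\<lambda>x. a x * b x |a b. a \<in> A \<and> b \<in> B}"
proof -
  obtain C N where A: "C \<ge> 0" "\<And>a x. a \<in> A \<Longrightarrow> norm (a x) \<le> C * (1 + \<bar>x\<bar>) ^ N"
    using slow_0D[OF assms(1)] by blast
  obtain D M where B: "D \<ge> 0" "\<And>a x. a \<in> B \<Longrightarrow> norm (a x) \<le> D * (1 + \<bar>x\<bar>) ^ M"
    using slow_0D[OF assms(2)] by blast
  show ?thesis
  proof (rule slow_0I[of _ "C * D" "N + M"], clarify)
    fix x a b assume ab: "a \<in> A" "b \<in> B"
    have "norm (a x) * norm (b x) \<le> (C * (1 + \<bar>x\<bar>) ^ N) * (D * (1 + \<bar>x\<bar>) ^ M)"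
      using A(1) by (intro mult_mono A(2) B(2) ab) auto
    then show "norm (a x * b x) \<le> (C * D) * (1 + \<bar>x\<bar>) ^ (N + M)"
      by (simp add: norm_mult power_add mult_ac)
  qed
qed

lemma slow_add:
  "slow n A \<Longrightarrow> slow n B \<Longrightarrow> slow n {\<lambda>x. a x + b x |a b. a \<in> A \<and> b \<in> B}"
proof (induction n arbitrary: A B)
  case (Suc n)
  let ?X = "{\<lambda>x. a x + b x |a b. a \<in> vderiv ` A \<and> b \<in> vderiv ` B}"
  have "vderiv ` {\<lambda>x. a x + b x |a b. a \<in> A \<and> b \<in> B} \<subseteq> ?X"
  proof clarify
    fix a b assume ab: "a \<in> A" "b \<in> B"
    have "vderiv (\<lambda>x. a x + b x) = (\<lambda>x. vderiv a x + vderiv b x)"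
      using Suc.prems ab by (auto intro!: vderiv_add)
    then show "\<exists>u v. vderiv (\<lambda>x. a x + b x) = (\<lambda>x. u x + v x) \<and> u \<in> vderiv ` A \<and> v \<in> vderiv ` B"
      using ab by blast
  qed
  moreover have "slow n ?X" using Suc by simp
  ultimately have "slow n (vderiv ` {\<lambda>x. a x + b x |a b. a \<in> A \<and> b \<in> B})"
    by (rule slow_subset[rotated])
  then show ?case using Suc.prems slow_0_add[of A B] by (auto intro: differentiable_add)
qed (rule slow_0_add)

lemma slow_mult:
  "slow n A \<Longrightarrow> slow n B \<Longrightarrow> slow n {\<lambda>x. a x * b x |a b. a \<in> A \<and> b \<in> B}"
proof (induction n arbitrary: A B)
  case (Suc n)
  let ?X = "{\<lambda>x. a x * b x |a b. a \<in> vderiv ` A \<and> b \<in> B}"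
  let ?Y = "{\<lambda>x. a x * b x |a b. a \<in> A \<and> b \<in> vderiv ` B}"
  have "vderiv ` {\<lambda>x. a x * b x |a b. a \<in> A \<and> b \<in> B} \<subseteq> {\<lambda>x. a x + b x |a b. a \<in> ?X \<and> b \<in> ?Y}"
  proof clarify
    fix a b assume ab: "a \<in> A" "b \<in> B"
    have "vderiv (\<lambda>x. a x * b x) = (\<lambda>x. vderiv a x * b x + a x * vderiv b x)"
      using Suc.prems ab by (auto intro!: vderiv_mult)
    moreover have "(\<lambda>x. vderiv a x * b x) \<in> ?X" "(\<lambda>x. a x * vderiv b x) \<in> ?Y"
      using ab by blast+
    ultimately show "\<exists>u v. vderiv (\<lambda>x. a x * b x) = (\<lambda>x. u x + v x) \<and> u \<in> ?X \<and> v \<in> ?Y"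
      by (intro exI[of _ "\<lambda>x. vderiv a x * b x"] exI[of _ "\<lambda>x. a x * vderiv b x"]) blast
  qed
  moreover have "slow n {\<lambda>x. a x + b x |a b. a \<in> ?X \<and> b \<in> ?Y}"
    using Suc.prems by (intro slow_add Suc.IH slow_SucD[OF Suc.prems(1)] slow_SucD[OF Suc.prems(2)]) simp_all
  ultimately have "slow n (vderiv ` {\<lambda>x. a x * b x |a b. a \<in> A \<and> b \<in> B})"
    by (rule slow_subset[rotated])
  then show ?case using Suc.prems slow_0_mult[of A B] by (auto intro: differentiable_mult)
qed (rule slow_0_mult)

lemma vderiv_const [simp]: "vderiv (\<lambda>x. c) = (\<lambda>x. 0)"
  by (rule vderivI) simp

lemma slow_const: "slow n {\<lambda>x::real. c |c. norm c \<le> B}"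
proof (induction n arbitrary: B)
  case 0
  show ?case by (rule slow_0I[of _ B 0]) auto
next
  case (Suc n)
  have "vderiv ` {\<lambda>x::real. c |c::complex. norm c \<le> B} \<subseteq> {\<lambda>x. c |c. norm c \<le> 0}"
    by auto
  moreover have "slow 0 {\<lambda>x::real. c |c. norm c \<le> B}" by (rule slow_0I[of _ B 0]) auto
  ultimately show ?case using slow_subset[OF Suc.IH[of 0]] by auto
qed

lemma has_vector_derivative_complex_of_real:
  "((\<lambda>x. complex_of_real x) has_vector_derivative 1) (at x within A)"
  using has_vector_derivative_of_real[of "\<lambda>x. x" 1 "at x within A"] by simp

lemma slow_ident: "slow n {\<lambda>x. complex_of_real x}"
proof (cases n)
  case 0
  show ?thesis unfolding 0 by (rule slow_0I[of _ 1 1]) auto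
next
  case (Suc m)
  note d = has_vector_derivative_complex_of_real
  have "slow 0 {\<lambda>x. complex_of_real x}" by (rule slow_0I[of _ 1 1]) auto
  moreover have "vderiv (\<lambda>x. complex_of_real x) = (\<lambda>x. 1)" by (rule vderivI[OF d])
  moreover have "slow m {\<lambda>x. 1}" by (rule slow_subset[OF slow_const[of m 1]]) auto
  ultimately show ?thesis unfolding Suc using differentiableI_vector[OF d] by auto
qed

text \<open>If every \<open>a\<close> in \<open>A\<close> solves a linear equation \<open>a' = b a + c\<close> with coefficients from \<open>B\<close> and \<open>C\<close>, then
control of \<open>n\<close> derivatives improves to \<open>n + 1\<close>. In this way only the undifferentiated phases and
weights ever have to be estimated.\<close>

lemma slow_Suc_ode:
  assumes "slow n A" "slow n B" "slow n C"
    and "\<And>a. a \<in> A \<Longrightarrow> \<exists>b\<in>B. \<exists>c\<in>C. \<forall>x. (a has_vector_derivative b x * a x + c x) (at x)"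
  shows "slow (Suc n) A"
proof -
  let ?X = "{\<lambda>x. u x + c x |u c. u \<in> {\<lambda>x. b x * a x |b a. b \<in> B \<and> a \<in> A} \<and> c \<in> C}"
  have "vderiv ` A \<subseteq> ?X"
  proof clarify
    fix a assume a: "a \<in> A"
    from assms(4)[OF this] obtain b c where bc: "b \<in> B" "c \<in> C"
      "\<forall>x. (a has_vector_derivative b x * a x + c x) (at x)" by blast
    have "vderiv a = (\<lambda>x. b x * a x + c x)" using bc by (intro vderivI) auto
    then show "\<exists>u c. vderiv a = (\<lambda>x. u x + c x) \<and> u \<in> {\<lambda>x. b x * a x |b a. b \<in> B \<and> a \<in> A} \<and> c \<in> C"
      using a bc by (intro exI[of _ "\<lambda>x. b x * a x"] exI[of _ c]) blast
  qed
  moreover have "slow n ?X" using assms(1-3) by (intro slow_add slow_mult)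
  ultimately have "slow n (vderiv ` A)" by (rule slow_subset[rotated])
  moreover have "\<forall>a\<in>A. \<forall>x. a differentiable (at x)" by (meson assms(4) differentiableI_vector)
  ultimately show ?thesis using assms(1) slow_imp_0 by auto
qed

lemma slow_family_ode:
  assumes "slow 0 A" "slow_family B" "slow_family C"
    and "\<And>a. a \<in> A \<Longrightarrow> \<exists>b\<in>B. \<exists>c\<in>C. \<forall>x. (a has_vector_derivative b x * a x + c x) (at x)"
  shows "slow_family A"
proof -
  have "slow n A" for n
  proof (induction n)
    case 0 show ?case by fact
  next
    case (Suc n) show ?case
      by (rule slow_Suc_ode[OF Suc _ _ assms(4)]) (use assms in \<open>auto simp: slow_family_def\<close>)
  qed
  then show ?thesis by (simp add: slow_family_def)
qed

lemma slow_family_mult: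
  "slow_family A \<Longrightarrow> slow_family B \<Longrightarrow> slow_family {\<lambda>x. a x * b x |a b. a \<in> A \<and> b \<in> B}"
  by (simp add: slow_family_def slow_mult)

lemma slow_family_add:
  "slow_family A \<Longrightarrow> slow_family B \<Longrightarrow> slow_family {\<lambda>x. a x + b x |a b. a \<in> A \<and> b \<in> B}"
  by (simp add: slow_family_def slow_add)

lemma slow_family_subset: "slow_family A \<Longrightarrow> B \<subseteq> A \<Longrightarrow> slow_family B"
  unfolding slow_family_def using slow_subset by blast

lemma slow_family_const: "slow_family {\<lambda>x::real. c |c. norm c \<le> B}"
  by (simp add: slow_family_def slow_const)

lemma slow_family_ident: "slow_family {\<lambda>x. complex_of_real x}"
  by (simp add: slow_family_def slow_ident)

lemma slow_family_vderiv: "slow_family A \<Longrightarrow> slow_family (vderiv ` A)"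
  unfolding slow_family_def by (metis slow.simps(2))

lemma slow_familyI:
  assumes "\<And>a. a \<in> A \<Longrightarrow> smooth a"
    "\<And>n. \<exists>C N. \<forall>a\<in>A. \<forall>x. norm (nderiv n a x) \<le> C * (1 + \<bar>x\<bar>) ^ N"
  shows "slow_family A"
proof -
  have "slow n A" if "\<And>a. a \<in> A \<Longrightarrow> smooth a"
    "\<And>n. \<exists>C N. \<forall>a\<in>A. \<forall>x. norm (nderiv n a x) \<le> C * (1 + \<bar>x\<bar>) ^ N" for n
    using that
  proof (induction n arbitrary: A)
    case 0 from 0(2)[of 0] show ?case unfolding slow.simps(1) nderiv_0 by blast
  next
    case (Suc n)
    have "slow n (vderiv ` A)"
    proof (rule Suc.IH)
      show "\<exists>C N. \<forall>a\<in>vderiv ` A. \<forall>x. norm (nderiv n a x) \<le> C * (1 + \<bar>x\<bar>) ^ N" for n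
        using Suc.prems(2)[of "Suc n"] by (auto simp: nderiv_Suc)
    qed (use Suc.prems(1) in \<open>auto intro!: smooth_vderiv\<close>)
    moreover have "slow 0 A" using Suc.prems(2)[of 0] unfolding slow.simps(1) nderiv_0 by blast
    ultimately show ?case using Suc.prems(1) smooth_differentiable by auto
  qed
  with assms show ?thesis by (simp add: slow_family_def)
qed

lemma has_vector_derivative_cis:
  "((\<lambda>x. cis (c * x)) has_vector_derivative (\<i> * of_real c * cis (c * x))) (at x within A)"
proof -
  have "((\<lambda>x. cis (c * x)) has_derivative (\<lambda>t. (c * t) *\<^sub>R (\<i> * cis (c * x)))) (at x within A)"
    by (intro has_derivative_cis) (auto intro!: derivative_eq_intros)
  moreover have "(\<lambda>t. (c * t) *\<^sub>R (\<i> * cis (c * x))) = (\<lambda>t. t *\<^sub>R (\<i> * of_real c * cis (c * x)))"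
    by (auto simp: scaleR_conv_of_real algebra_simps)
  ultimately show ?thesis by (simp add: has_vector_derivative_def)
qed

lemma slow_family_single: "slow_family A \<Longrightarrow> a \<in> A \<Longrightarrow> slow_family {a}"
  by (rule slow_family_subset) auto

lemma slow_family_const1: "slow_family {\<lambda>x::real. c}"
  by (rule slow_family_subset[OF slow_family_const[of "norm c"]]) auto

lemma slow_family_mult1: "slow_family {a} \<Longrightarrow> slow_family {b} \<Longrightarrow> slow_family {\<lambda>x. a x * b x}"
  by (rule slow_family_subset[OF slow_family_mult[of "{a}" "{b}"]]) auto

lemma slow_family_cis_linear: "slow_family {\<lambda>x. cis (c * x)}"
proof (rule slow_family_ode[OF _ slow_family_const1[of "\<i> * of_real c"] slow_family_const1[of 0]])
  show "slow 0 {\<lambda>x. cis (c * x)}" by (rule slow_0I[of _ 1 0]) auto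
qed (auto intro!: has_vector_derivative_eq_rhs[OF has_vector_derivative_cis])

section \<open>Schwartz functions and operators acting on them\<close>

lemma schwartz_smooth: "\<phi> \<in> schwartz \<Longrightarrow> smooth \<phi>"
  by (simp add: schwartz_def)

lemma schwartz_bdd: "\<phi> \<in> schwartz \<Longrightarrow> bdd_above (range (\<lambda>x. \<bar>x\<bar> ^ m * norm (nderiv n \<phi> x)))"
  by (simp add: schwartz_def)

lemma schwartz_seminorm_upper: "\<phi> \<in> schwartz \<Longrightarrow> \<bar>x\<bar> ^ m * norm (nderiv n \<phi> x) \<le> schwartz_seminorm m n \<phi>"
  unfolding schwartz_seminorm_def by (rule cSUP_upper[OF UNIV_I schwartz_bdd])

lemma schwartz_seminorm_least: "(\<And>x. \<bar>x\<bar> ^ m * norm (nderiv n \<phi> x) \<le> B) \<Longrightarrow> schwartz_seminorm m n \<phi> \<le> B"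
  unfolding schwartz_seminorm_def by (rule cSUP_least) auto

lemma schwartz_seminorm_nonneg: "\<phi> \<in> schwartz \<Longrightarrow> 0 \<le> schwartz_seminorm m n \<phi>"
  by (rule order_trans[OF _ schwartz_seminorm_upper[of _ 0]]) auto

lemma schwartzI:
  assumes "smooth \<phi>" "\<And>m n. \<exists>B. \<forall>x. \<bar>x\<bar> ^ m * norm (nderiv n \<phi> x) \<le> B"
  shows "\<phi> \<in> schwartz"
  unfolding schwartz_def
proof (intro CollectI conjI allI)
  fix m n
  from assms(2)[of m n] obtain B where "\<forall>x. \<bar>x\<bar> ^ m * norm (nderiv n \<phi> x) \<le> B" by blast
  then show "bdd_above (range (\<lambda>x. \<bar>x\<bar> ^ m * norm (nderiv n \<phi> x)))" by (intro bdd_aboveI[of _ B]) auto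
qed fact

text \<open>The sum of the seminorms that occurs in the definition of a tempered distribution.\<close>

definition schwartz_norm :: "nat \<Rightarrow> (real \<Rightarrow> complex) \<Rightarrow> real" where
  "schwartz_norm N \<phi> = (\<Sum>m\<le>N. \<Sum>n\<le>N. schwartz_seminorm m n \<phi>)"

lemma schwartz_norm_nonneg: "\<phi> \<in> schwartz \<Longrightarrow> 0 \<le> schwartz_norm N \<phi>"
  unfolding schwartz_norm_def by (intro sum_nonneg schwartz_seminorm_nonneg)

lemma schwartz_seminorm_le_norm:
  assumes "\<phi> \<in> schwartz" "m \<le> N" "n \<le> N"
  shows "schwartz_seminorm m n \<phi> \<le> schwartz_norm N \<phi>"
proof -
  have "schwartz_seminorm m n \<phi> \<le> (\<Sum>n\<le>N. schwartz_seminorm m n \<phi>)"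
    using assms by (intro member_le_sum) (auto intro: schwartz_seminorm_nonneg)
  also have "\<dots> \<le> schwartz_norm N \<phi>"
    unfolding schwartz_norm_def using assms
    by (intro member_le_sum[where f = "\<lambda>m. \<Sum>n\<le>N. schwartz_seminorm m n \<phi>"])
      (auto intro!: sum_nonneg schwartz_seminorm_nonneg)
  finally show ?thesis .
qed

lemma schwartz_norm_mono:
  assumes "\<phi> \<in> schwartz" "N \<le> M"
  shows "schwartz_norm N \<phi> \<le> schwartz_norm M \<phi>"
proof -
  have "schwartz_norm N \<phi> \<le> (\<Sum>m\<le>N. \<Sum>n\<le>M. schwartz_seminorm m n \<phi>)"
    unfolding schwartz_norm_def using assms
    by (intro sum_mono sum_mono2) (auto intro: schwartz_seminorm_nonneg)
  also have "\<dots> \<le> schwartz_norm M \<phi>"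
    unfolding schwartz_norm_def using assms
    by (intro sum_mono2) (auto intro!: sum_nonneg schwartz_seminorm_nonneg)
  finally show ?thesis .
qed

lemma schwartz_norm_upper:
  assumes "\<phi> \<in> schwartz" "m \<le> N" "n \<le> N"
  shows "\<bar>x\<bar> ^ m * norm (nderiv n \<phi> x) \<le> schwartz_norm N \<phi>"
  using schwartz_seminorm_upper[OF assms(1)] schwartz_seminorm_le_norm[OF assms] by (rule order_trans)

lemma schwartz_norm_least:
  assumes "\<And>m n x. m \<le> N \<Longrightarrow> n \<le> N \<Longrightarrow> \<bar>x\<bar> ^ m * norm (nderiv n \<phi> x) \<le> B"
  shows "schwartz_norm N \<phi> \<le> (real N + 1)\<^sup>2 * B"
proof -
  have "schwartz_norm N \<phi> \<le> (\<Sum>m\<le>N. \<Sum>n\<le>N. B)"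
    unfolding schwartz_norm_def by (intro sum_mono schwartz_seminorm_least assms) auto
  then show ?thesis by (simp add: power2_eq_square algebra_simps)
qed

text \<open>A set of operators on the Schwartz space that is equicontinuous for the Schwartz topology: every
norm of \<open>P \<phi>\<close> is bounded by a norm of \<open>\<phi>\<close>, uniformly over the set.\<close>

definition tame :: "((real \<Rightarrow> complex) \<Rightarrow> real \<Rightarrow> complex) set \<Rightarrow> bool" where
  "tame \<P> \<longleftrightarrow> (\<forall>P\<in>\<P>. \<forall>\<phi>\<in>schwartz. P \<phi> \<in> schwartz) \<and>
     (\<forall>M. \<exists>C N. C \<ge> 0 \<and> (\<forall>P\<in>\<P>. \<forall>\<phi>\<in>schwartz. schwartz_norm M (P \<phi>) \<le> C * schwartz_norm N \<phi>))"

lemma tame_schwartz: "tame \<P> \<Longrightarrow> P \<in> \<P> \<Longrightarrow> \<phi> \<in> schwartz \<Longrightarrow> P \<phi> \<in> schwartz"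
  by (auto simp: tame_def)

lemma tame_bound:
  "tame \<P> \<Longrightarrow> \<exists>C N. C \<ge> 0 \<and> (\<forall>P\<in>\<P>. \<forall>\<phi>\<in>schwartz. schwartz_norm M (P \<phi>) \<le> C * schwartz_norm N \<phi>)"
  unfolding tame_def by blast

lemma tameI:
  assumes "\<And>P \<phi>. P \<in> \<P> \<Longrightarrow> \<phi> \<in> schwartz \<Longrightarrow> smooth (P \<phi>)"
    and "\<And>m n. \<exists>C N. C \<ge> 0 \<and> (\<forall>P\<in>\<P>. \<forall>\<phi>\<in>schwartz. \<forall>x. \<bar>x\<bar> ^ m * norm (nderiv n (P \<phi>) x) \<le> C * schwartz_norm N \<phi>)"
  shows "tame \<P>"
  unfolding tame_def
proof (intro conjI ballI allI)
  fix P \<phi> assume P: "P \<in> \<P>" "\<phi> \<in> schwartz"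
  show "P \<phi> \<in> schwartz"
  proof (rule schwartzI)
    fix m n
    from assms(2)[of m n] P show "\<exists>B. \<forall>x. \<bar>x\<bar> ^ m * cmod (nderiv n (P \<phi>) x) \<le> B" by blast
  qed (use assms(1) P in auto)
next
  fix M
  have "\<forall>m. \<forall>n. \<exists>C N. C \<ge> 0 \<and> (\<forall>P\<in>\<P>. \<forall>\<phi>\<in>schwartz. \<forall>x. \<bar>x\<bar> ^ m * norm (nderiv n (P \<phi>) x) \<le> C * schwartz_norm N \<phi>)"
    using assms(2) by blast
  then obtain C N where CN: "\<And>m n. C m n \<ge> 0"
    "\<And>m n P \<phi> x. P \<in> \<P> \<Longrightarrow> \<phi> \<in> schwartz \<Longrightarrow> \<bar>x\<bar> ^ m * norm (nderiv n (P \<phi>) x) \<le> C m n * schwartz_norm (N m n) \<phi>"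
    by metis
  define C' where "C' = (\<Sum>m\<le>M. \<Sum>n\<le>M. C m n)"
  define N' where "N' = (\<Sum>m\<le>M. \<Sum>n\<le>M. N m n)"
  have C': "C m n \<le> C'" "N m n \<le> N'" if "m \<le> M" "n \<le> M" for m n
  proof -
    have "C m n \<le> (\<Sum>n\<le>M. C m n)" using that CN(1) by (intro member_le_sum) auto
    also have "\<dots> \<le> C'" unfolding C'_def using that CN(1)
      by (intro member_le_sum[where f = "\<lambda>m. \<Sum>n\<le>M. C m n"]) (auto intro: sum_nonneg)
    finally show "C m n \<le> C'" .
    have "N m n \<le> (\<Sum>n\<le>M. N m n)" using that by (intro member_le_sum) auto
    also have "\<dots> \<le> N'" unfolding N'_def using that
      by (intro member_le_sum[where f = "\<lambda>m. \<Sum>n\<le>M. N m n"]) auto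
    finally show "N m n \<le> N'" .
  qed
  have "schwartz_norm M (P \<phi>) \<le> (real M + 1)\<^sup>2 * (C' * schwartz_norm N' \<phi>)" if P: "P \<in> \<P>" "\<phi> \<in> schwartz" for P \<phi>
  proof (rule schwartz_norm_least)
    fix m n x assume mn: "m \<le> M" "n \<le> M"
    have "\<bar>x\<bar> ^ m * norm (nderiv n (P \<phi>) x) \<le> C m n * schwartz_norm (N m n) \<phi>" by (rule CN(2)[OF P])
    also have "\<dots> \<le> C' * schwartz_norm N' \<phi>"
      using C'[OF mn] CN(1) P order_trans[OF CN(1) C'(1)[OF mn]]
      by (intro mult_mono schwartz_norm_mono schwartz_norm_nonneg) auto
    finally show "\<bar>x\<bar> ^ m * norm (nderiv n (P \<phi>) x) \<le> C' * schwartz_norm N' \<phi>" .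
  qed
  moreover have "C' \<ge> 0" unfolding C'_def by (intro sum_nonneg CN)
  ultimately show "\<exists>C N. 0 \<le> C \<and> (\<forall>P\<in>\<P>. \<forall>\<phi>\<in>schwartz. schwartz_norm M (P \<phi>) \<le> C * schwartz_norm N \<phi>)"
    by (intro exI[of _ "(real M + 1)\<^sup>2 * C'"] exI[of _ N']) (auto simp: mult_ac)
qed

lemma tame_subset:
  assumes "tame \<P>" "\<Q> \<subseteq> \<P>" shows "tame \<Q>"
  unfolding tame_def
proof (intro conjI ballI allI)
  fix M
  from tame_bound[OF assms(1), of M] obtain C N where "C \<ge> 0"
    "\<forall>P\<in>\<P>. \<forall>\<phi>\<in>schwartz. schwartz_norm M (P \<phi>) \<le> C * schwartz_norm N \<phi>" by blast
  then show "\<exists>C N. 0 \<le> C \<and> (\<forall>P\<in>\<Q>. \<forall>\<phi>\<in>schwartz. schwartz_norm M (P \<phi>) \<le> C * schwartz_norm N \<phi>)"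
    using assms(2) by (intro exI[of _ C] exI[of _ N]) blast
qed (use assms in \<open>auto simp: tame_def\<close>)

lemma tame_comp:
  assumes "tame \<P>" "tame \<Q>"
  shows "tame {\<lambda>\<phi>. P (Q \<phi>) |P Q. P \<in> \<P> \<and> Q \<in> \<Q>}"
  unfolding tame_def
proof (intro conjI ballI allI)
  fix M
  from tame_bound[OF assms(1), of M] obtain C N where CN: "C \<ge> 0"
    "\<forall>P\<in>\<P>. \<forall>\<phi>\<in>schwartz. schwartz_norm M (P \<phi>) \<le> C * schwartz_norm N \<phi>" by blast
  from tame_bound[OF assms(2), of N] obtain C' N' where CN': "C' \<ge> 0"
    "\<forall>P\<in>\<Q>. \<forall>\<phi>\<in>schwartz. schwartz_norm N (P \<phi>) \<le> C' * schwartz_norm N' \<phi>" by blast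
  have "schwartz_norm M (P (Q \<phi>)) \<le> C * C' * schwartz_norm N' \<phi>"
    if "P \<in> \<P>" "Q \<in> \<Q>" "\<phi> \<in> schwartz" for P Q \<phi>
  proof -
    have "schwartz_norm M (P (Q \<phi>)) \<le> C * schwartz_norm N (Q \<phi>)"
      using CN(2) that tame_schwartz[OF assms(2) that(2,3)] by simp
    also have "\<dots> \<le> C * (C' * schwartz_norm N' \<phi>)" using CN'(2) that by (intro mult_left_mono CN(1)) simp
    finally show ?thesis by (simp add: mult_ac)
  qed
  then show "\<exists>C N. 0 \<le> C \<and> (\<forall>P\<in>{\<lambda>\<phi>. P (Q \<phi>) |P Q. P \<in> \<P> \<and> Q \<in> \<Q>}. \<forall>\<phi>\<in>schwartz. schwartz_norm M (P \<phi>) \<le> C * schwartz_norm N \<phi>)"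
    using CN(1) CN'(1) by (intro exI[of _ "C * C'"] exI[of _ N']) force
next
  fix P \<phi> assume "P \<in> {\<lambda>\<phi>. P (Q \<phi>) |P Q. P \<in> \<P> \<and> Q \<in> \<Q>}" "\<phi> \<in> schwartz"
  then obtain P' Q where "P = (\<lambda>\<phi>. P' (Q \<phi>))" "P' \<in> \<P>" "Q \<in> \<Q>" by blast
  then show "P \<phi> \<in> schwartz" 
    using tame_schwartz[OF assms(1) _ tame_schwartz[OF assms(2) _ \<open>\<phi> \<in> schwartz\<close>], of P' Q] by simp
qed

lemma tame_comp1: "tame {P} \<Longrightarrow> tame {Q} \<Longrightarrow> tame {\<lambda>\<phi>. P (Q \<phi>)}"
  by (rule tame_subset[OF tame_comp[of "{P}" "{Q}"]]) auto

lemma schwartz_vderiv: assumes "\<phi> \<in> schwartz" shows "vderiv \<phi> \<in> schwartz"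
proof (rule schwartzI)
  show "smooth (vderiv \<phi>)" using assms by (simp add: smooth_vderiv schwartz_smooth)
  show "\<exists>B. \<forall>x. \<bar>x\<bar> ^ m * norm (nderiv n (vderiv \<phi>) x) \<le> B" for m n
    using schwartz_seminorm_upper[OF assms, of _ m "Suc n"] by (auto simp: nderiv_Suc)
qed

lemma tame_vderiv: "tame {vderiv}"
proof (rule tameI)
  fix m n :: nat
  show "\<exists>C N. 0 \<le> C \<and> (\<forall>P\<in>{vderiv}. \<forall>\<phi>\<in>schwartz. \<forall>x. \<bar>x\<bar> ^ m * cmod (nderiv n (P \<phi>) x) \<le> C * schwartz_norm N \<phi>)"
    using schwartz_norm_upper[of _ m "Suc (max m n)" "Suc n"]
    by (intro exI[of _ 1] exI[of _ "Suc (max m n)"]) (auto simp: nderiv_Suc)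
qed (auto simp: smooth_vderiv schwartz_smooth)

lemma schwartz_vderiv_norm:
  assumes "\<phi> \<in> schwartz" shows "schwartz_norm N (vderiv \<phi>) \<le> (real N + 1)\<^sup>2 * schwartz_norm (Suc N) \<phi>"
  using schwartz_norm_upper[OF assms, of _ "Suc N"] 
  by (intro schwartz_norm_least) (simp add: nderiv_Suc[symmetric])

text \<open>The Leibniz rule, as an induction on the order of the derivative over all families at once.\<close>

lemma slow_mult_schwartz_bound:
  assumes "slow_family A"
  shows "\<exists>C N. C \<ge> 0 \<and> (\<forall>a\<in>A. \<forall>\<phi>\<in>schwartz. \<forall>x. \<bar>x\<bar> ^ m * norm (nderiv n (\<lambda>x. a x * \<phi> x) x) \<le> C * schwartz_norm N \<phi>)"
  using assms
proof (induction n arbitrary: A)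
  case 0
  have "slow 0 A" using 0 by (simp add: slow_family_def)
  from slow_0D[OF this] obtain C N where C: "C \<ge> 0" "\<And>a x. a \<in> A \<Longrightarrow> norm (a x) \<le> C * (1 + \<bar>x\<bar>) ^ N"
    by blast
  have "\<bar>x\<bar> ^ m * norm (a x * \<phi> x) \<le> C * 2 ^ N * 2 * schwartz_norm (N + m) \<phi>"
    if a: "a \<in> A" "\<phi> \<in> schwartz" for a \<phi> x
  proof -
    have "(1 + \<bar>x\<bar>) ^ N \<le> (2 * max 1 \<bar>x\<bar>) ^ N" by (intro power_mono) auto
    also have "\<dots> \<le> 2 ^ N * (1 + \<bar>x\<bar> ^ N)" by (auto simp: power_mult_distrib max_def)
    finally have *: "(1 + \<bar>x\<bar>) ^ N \<le> 2 ^ N * (1 + \<bar>x\<bar> ^ N)" .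
    have "\<bar>x\<bar> ^ m * norm (a x * \<phi> x) \<le> \<bar>x\<bar> ^ m * ((C * (2 ^ N * (1 + \<bar>x\<bar> ^ N))) * norm (\<phi> x))"
      unfolding norm_mult
      by (intro mult_left_mono mult_right_mono order_trans[OF C(2)[OF a(1), of x]] * C(1)) auto
    also have "\<dots> = C * 2 ^ N * (\<bar>x\<bar> ^ m * norm (nderiv 0 \<phi> x) + \<bar>x\<bar> ^ (N + m) * norm (nderiv 0 \<phi> x))"
      by (simp add: algebra_simps power_add)
    also have "\<dots> \<le> C * 2 ^ N * (schwartz_norm (N + m) \<phi> + schwartz_norm (N + m) \<phi>)"
      using C(1) by (intro mult_left_mono add_mono schwartz_norm_upper a) auto
    finally show ?thesis by simp
  qed
  then show ?case using C(1)
    by (intro exI[of _ "C * 2 ^ N * 2"] exI[of _ "N + m"]) auto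
next
  case (Suc n)
  from Suc.IH[OF slow_family_vderiv[OF Suc.prems]] obtain C N where C: "C \<ge> 0"
    "\<And>a \<phi> x. a\<in>A \<Longrightarrow> \<phi>\<in>schwartz \<Longrightarrow> \<bar>x\<bar> ^ m * norm (nderiv n (\<lambda>x. vderiv a x * \<phi> x) x) \<le> C * schwartz_norm N \<phi>"
    by blast
  from Suc.IH[OF Suc.prems] obtain D M where D: "D \<ge> 0"
    "\<And>a \<phi> x. a\<in>A \<Longrightarrow> \<phi>\<in>schwartz \<Longrightarrow> \<bar>x\<bar> ^ m * norm (nderiv n (\<lambda>x. a x * \<phi> x) x) \<le> D * schwartz_norm M \<phi>"
    by blast
  let ?D = "D * (real M + 1)\<^sup>2"
  have "\<bar>x\<bar> ^ m * norm (nderiv (Suc n) (\<lambda>x. a x * \<phi> x) x) \<le> (C + ?D) * schwartz_norm (N + Suc M) \<phi>"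
    if a: "a \<in> A" "\<phi> \<in> schwartz" for a \<phi> x
  proof -
    note sa = slow_family_smooth[OF Suc.prems a(1)] and sp = schwartz_smooth[OF a(2)]
    have "vderiv (\<lambda>x. a x * \<phi> x) = (\<lambda>x. vderiv a x * \<phi> x + a x * vderiv \<phi> x)"
      using sa sp by (intro vderiv_mult) (auto simp: smooth_differentiable)
    moreover have "smooth (\<lambda>x. vderiv a x * \<phi> x)" "smooth (\<lambda>x. a x * vderiv \<phi> x)"
      by (intro smooth_mult smooth_vderiv sa sp)+
    ultimately have "nderiv (Suc n) (\<lambda>x. a x * \<phi> x) x = nderiv n (\<lambda>x. vderiv a x * \<phi> x) x + nderiv n (\<lambda>x. a x * vderiv \<phi> x) x"
      by (simp add: nderiv_Suc nderiv_add smooth_iff)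
    then have "\<bar>x\<bar> ^ m * norm (nderiv (Suc n) (\<lambda>x. a x * \<phi> x) x) \<le>
       \<bar>x\<bar> ^ m * norm (nderiv n (\<lambda>x. vderiv a x * \<phi> x) x) + \<bar>x\<bar> ^ m * norm (nderiv n (\<lambda>x. a x * vderiv \<phi> x) x)"
      by (simp add: distrib_left[symmetric] mult_left_mono norm_triangle_ineq)
    also have "\<dots> \<le> C * schwartz_norm N \<phi> + D * schwartz_norm M (vderiv \<phi>)"
      by (intro add_mono C D a schwartz_vderiv)
    also have "\<dots> \<le> C * schwartz_norm (N + Suc M) \<phi> + D * ((real M + 1)\<^sup>2 * schwartz_norm (N + Suc M) \<phi>)"
      by (intro add_mono mult_left_mono C D schwartz_norm_mono a order_trans[OF schwartz_vderiv_norm[OF a(2)]]) auto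
    finally show ?thesis by (simp add: algebra_simps)
  qed
  then show ?case using C(1) D(1)
    by (intro exI[of _ "C + ?D"] exI[of _ "N + Suc M"]) auto
qed

lemma tame_mult:
  assumes "slow_family A" shows "tame {\<lambda>\<phi> x. a x * \<phi> x |a. a \<in> A}"
proof (rule tameI)
  fix P \<phi> assume "P \<in> {\<lambda>\<phi> x. a x * \<phi> x |a. a \<in> A}" "\<phi> \<in> schwartz"
  then show "smooth (P \<phi>)" using smooth_mult[OF slow_family_smooth[OF assms] schwartz_smooth] by auto
next
  fix m n
  from slow_mult_schwartz_bound[OF assms, of m n] obtain C N where "C \<ge> 0"
    "\<forall>a\<in>A. \<forall>\<phi>\<in>schwartz. \<forall>x. \<bar>x\<bar> ^ m * norm (nderiv n (\<lambda>x. a x * \<phi> x) x) \<le> C * schwartz_norm N \<phi>"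
    by blast
  then show "\<exists>C N. 0 \<le> C \<and> (\<forall>P\<in>{\<lambda>\<phi> x. a x * \<phi> x |a. a \<in> A}. \<forall>\<phi>\<in>schwartz. \<forall>x. \<bar>x\<bar> ^ m * cmod (nderiv n (P \<phi>) x) \<le> C * schwartz_norm N \<phi>)"
    by (intro exI[of _ C] exI[of _ N]) auto
qed

lemma schwartz_mult_slow: "slow_family {a} \<Longrightarrow> \<phi> \<in> schwartz \<Longrightarrow> (\<lambda>x. a x * \<phi> x) \<in> schwartz"
  by (rule tame_schwartz[OF tame_mult[of "{a}"], of "\<lambda>\<phi> x. a x * \<phi> x"]) auto

lemma schwartz_slow_family:
  assumes "\<phi> \<in> schwartz" shows "slow_family {\<phi>}"
proof (rule slow_familyI)
  fix n
  show "\<exists>C N. \<forall>a\<in>{\<phi>}. \<forall>x. norm (nderiv n a x) \<le> C * (1 + \<bar>x\<bar>) ^ N"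
    using schwartz_seminorm_upper[OF assms, of _ 0 n]
    by (intro exI[of _ "schwartz_seminorm 0 n \<phi>"] exI[of _ 0]) auto
qed (use assms schwartz_smooth in auto)

lemma schwartz_mult: "\<phi> \<in> schwartz \<Longrightarrow> \<psi> \<in> schwartz \<Longrightarrow> (\<lambda>x. \<phi> x * \<psi> x) \<in> schwartz"
  by (intro schwartz_mult_slow schwartz_slow_family)

lemma schwartz_cmult: "\<phi> \<in> schwartz \<Longrightarrow> (\<lambda>x. c * \<phi> x) \<in> schwartz"
  by (intro schwartz_mult_slow slow_family_const1)

lemma schwartz_add: 
  assumes "\<phi> \<in> schwartz" "\<psi> \<in> schwartz" shows "(\<lambda>x. \<phi> x + \<psi> x) \<in> schwartz"
proof (rule schwartzI)
  fix m n
  have "\<bar>x\<bar> ^ m * norm (nderiv n (\<lambda>x. \<phi> x + \<psi> x) x) \<le> schwartz_seminorm m n \<phi> + schwartz_seminorm m n \<psi>" for x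
  proof -
    have "nderiv n (\<lambda>x. \<phi> x + \<psi> x) x = nderiv n \<phi> x + nderiv n \<psi> x"
      using assms by (subst nderiv_add) (auto dest!: schwartz_smooth simp: smooth_iff)
    then have "\<bar>x\<bar> ^ m * norm (nderiv n (\<lambda>x. \<phi> x + \<psi> x) x) \<le> \<bar>x\<bar> ^ m * norm (nderiv n \<phi> x) + \<bar>x\<bar> ^ m * norm (nderiv n \<psi> x)"
      by (simp add: distrib_left[symmetric] mult_left_mono norm_triangle_ineq)
    also have "\<dots> \<le> schwartz_seminorm m n \<phi> + schwartz_seminorm m n \<psi>"
      by (intro add_mono schwartz_seminorm_upper assms)
    finally show ?thesis .
  qed
  then show "\<exists>B. \<forall>x. \<bar>x\<bar> ^ m * norm (nderiv n (\<lambda>x. \<phi> x + \<psi> x) x) \<le> B" by blast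
qed (use assms in \<open>auto intro: smooth_add schwartz_smooth\<close>)

lemma schwartz_zero: "(\<lambda>x. 0) \<in> schwartz"
proof (rule schwartzI)
  have z: "nderiv n (\<lambda>x. 0 :: complex) = (\<lambda>x. 0)" for n by (induction n) (auto simp: nderiv_Suc)
  show "smooth (\<lambda>x. 0 :: complex)" by (simp add: smooth_def z)
  show "\<exists>B. \<forall>x::real. \<bar>x\<bar> ^ m * cmod (nderiv n (\<lambda>x. 0) x) \<le> B" for m n by (auto simp: z)
qed

lemma schwartz_sum: "(\<And>i. i \<in> I \<Longrightarrow> \<phi> i \<in> schwartz) \<Longrightarrow> (\<lambda>x. \<Sum>i\<in>I. \<phi> i x) \<in> schwartz"
  by (induction I rule: infinite_finite_induct) (auto intro: schwartz_zero schwartz_add)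

lemma schwartz_cnj: 
  assumes "\<phi> \<in> schwartz" shows "(\<lambda>x. cnj (\<phi> x)) \<in> schwartz"
proof (rule schwartzI)
  note * = smooth_linear[OF bounded_linear_cnj schwartz_smooth[OF assms]]
  show "smooth (\<lambda>x. cnj (\<phi> x))" by fact
  show "\<exists>B. \<forall>x. \<bar>x\<bar> ^ m * cmod (nderiv n (\<lambda>x. cnj (\<phi> x)) x) \<le> B" for m n
    using schwartz_seminorm_upper[OF assms, of _ m n] by (auto simp: *)
qed

lemma smooth_reflect:
  assumes "smooth f"
  shows "smooth (\<lambda>x. f (- x))" "nderiv n (\<lambda>x. f (- x)) x = (- 1) ^ n *\<^sub>R nderiv n f (- x)"
  using smooth_affine(1)[OF assms, of "-1" 0] smooth_affine(2)[OF assms, of n "-1" 0] by simp_all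

lemma tame_reflect: "tame {\<lambda>\<phi> x. \<phi> (- x)}"
proof (rule tameI)
  fix P :: "(real \<Rightarrow> complex) \<Rightarrow> real \<Rightarrow> complex" and \<phi> :: "real \<Rightarrow> complex"
  assume P: "P \<in> {\<lambda>\<phi> x. \<phi> (- x)}" and p: "\<phi> \<in> schwartz"
  from P have P: "P = (\<lambda>\<phi> x. \<phi> (- x))" by (rule singletonD)
  show "smooth (P \<phi>)" unfolding P by (rule smooth_reflect(1)[OF schwartz_smooth[OF p]])
next
  fix m n :: nat
  show "\<exists>C N. 0 \<le> C \<and> (\<forall>P\<in>{\<lambda>\<phi> x. \<phi> (- x)}. \<forall>\<phi>\<in>schwartz. \<forall>x. \<bar>x\<bar> ^ m * cmod (nderiv n (P \<phi>) x) \<le> C * schwartz_norm N \<phi>)"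
  proof (rule exI[of _ "1::real"], rule exI[of _ "max m n"], rule conjI, simp, rule ballI, rule ballI, rule allI)
    fix P :: "(real \<Rightarrow> complex) \<Rightarrow> real \<Rightarrow> complex" and \<phi> :: "real \<Rightarrow> complex" and x :: real
    assume P: "P \<in> {\<lambda>\<phi> x. \<phi> (- x)}" and p: "\<phi> \<in> schwartz"
    from P have P: "P = (\<lambda>\<phi> x. \<phi> (- x))" by (rule singletonD)
    show "\<bar>x\<bar> ^ m * cmod (nderiv n (P \<phi>) x) \<le> 1 * schwartz_norm (max m n) \<phi>"
      unfolding P smooth_reflect(2)[OF schwartz_smooth[OF p]]
      using schwartz_norm_upper[OF p, of m "max m n" n "-x"] by simp
  qed
qed

lemma schwartz_reflect: "\<phi> \<in> schwartz \<Longrightarrow> (\<lambda>x. \<phi> (- x)) \<in> schwartz"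
  using tame_schwartz[OF tame_reflect, of "\<lambda>\<phi> x. \<phi> (- x)" \<phi>] by simp

lemma schwartz_translate:
  assumes "\<phi> \<in> schwartz" shows "(\<lambda>x. \<phi> (x + b)) \<in> schwartz"
proof (rule schwartzI)
  note * = smooth_affine[where a = "1" and b = b, simplified, OF schwartz_smooth[OF assms]]
  show "smooth (\<lambda>x. \<phi> (x + b))" by fact
  fix m n
  have "\<bar>x\<bar> ^ m * cmod (nderiv n \<phi> (x + b)) \<le> (2 * \<bar>b\<bar>) ^ m * schwartz_seminorm 0 n \<phi> + 2 ^ m * schwartz_seminorm m n \<phi>" for x
  proof (cases "\<bar>x\<bar> \<le> 2 * \<bar>b\<bar>")
    case True
    have "\<bar>x\<bar> ^ m * cmod (nderiv n \<phi> (x + b)) \<le> (2 * \<bar>b\<bar>) ^ m * schwartz_seminorm 0 n \<phi>"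
      using schwartz_seminorm_upper[OF assms, of "x + b" 0 n] True by (intro mult_mono power_mono) auto
    then show ?thesis using schwartz_seminorm_nonneg[OF assms, of m n] by (simp add: add_increasing2)
  next
    case False
    have "\<bar>x\<bar> ^ m * cmod (nderiv n \<phi> (x + b)) \<le> (2 * \<bar>x + b\<bar>) ^ m * cmod (nderiv n \<phi> (x + b))"
      using False by (intro mult_right_mono power_mono) (auto simp: abs_if split: if_splits)
    also have "\<dots> \<le> 2 ^ m * schwartz_seminorm m n \<phi>"
      using schwartz_seminorm_upper[OF assms, of "x + b" m n] by (simp add: power_mult_distrib mult.assoc)
    finally show ?thesis using schwartz_seminorm_nonneg[OF assms, of 0 n] by (simp add: add_increasing)
  qed
  then show "\<exists>B. \<forall>x. \<bar>x\<bar> ^ m * cmod (nderiv n (\<lambda>x. \<phi> (x + b)) x) \<le> B" unfolding * by blast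
qed

lemma nderiv_eq_0_open:
  assumes "open S" "\<And>x. x \<in> S \<Longrightarrow> f x = 0" "x \<in> S"
  shows "nderiv n f x = 0"
  using assms(2)
proof (induction n arbitrary: f)
  case 0
  then show ?case using assms(3) by simp
next
  case (Suc n)
  show ?case unfolding nderiv_Suc
  proof (rule Suc.IH)
    fix y assume "y \<in> S"
    have "(f has_vector_derivative 0) (at y)"
      by (rule has_vector_derivative_transform_within_open[of "\<lambda>x. 0", OF _ assms(1) \<open>y \<in> S\<close>])
        (use Suc.prems in auto)
    then show "vderiv f y = 0" by (simp add: vderiv_def vector_derivative_at)
  qed
qed

lemma nderiv_eq_0_outside:
  assumes "\<And>x. R < \<bar>x\<bar> \<Longrightarrow> f x = 0" "R < \<bar>x\<bar>"
  shows "nderiv n f x = 0"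
  by (rule nderiv_eq_0_open[of "{x. R < \<bar>x\<bar>}"])
    (use assms in \<open>auto intro!: open_Collect_less continuous_intros\<close>)

lemma compact_support_schwartz:
  fixes f :: "real \<Rightarrow> complex"
  assumes "smooth f" "\<And>x. R < \<bar>x\<bar> \<Longrightarrow> f x = 0"
  shows "f \<in> schwartz"
proof (rule schwartzI[OF assms(1)])
  fix m n
  have "continuous_on {- \<bar>R\<bar>..\<bar>R\<bar>} (\<lambda>x. \<bar>x\<bar> ^ m * norm (nderiv n f x))"
    using smooth_continuous[OF smooth_nderiv[OF assms(1)], of _ n] by (intro continuous_intros)
  then have "bounded ((\<lambda>x. \<bar>x\<bar> ^ m * norm (nderiv n f x)) ` {- \<bar>R\<bar>..\<bar>R\<bar>})"
    by (intro compact_imp_bounded compact_continuous_image) auto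
  then obtain B where B: "\<And>x. x \<in> {- \<bar>R\<bar>..\<bar>R\<bar>} \<Longrightarrow> norm (\<bar>x\<bar> ^ m * norm (nderiv n f x)) \<le> B"
    unfolding bounded_iff by blast
  have "\<bar>x\<bar> ^ m * norm (nderiv n f x) \<le> max B 0" for x
    using B[of x] nderiv_eq_0_outside[of R f x n] assms(2) by (cases "x \<in> {- \<bar>R\<bar>..\<bar>R\<bar>}") auto
  then show "\<exists>B. \<forall>x. \<bar>x\<bar> ^ m * norm (nderiv n f x) \<le> B" by blast
qed

section \<open>The Fourier transform on Schwartz functions\<close>

lemma has_bochner_integral_inverse_1_plus_square:
  "integrable lborel (\<lambda>x::real. 1 / (1 + x\<^sup>2))" "(LBINT x. 1 / (1 + x\<^sup>2)) = pi"
proof -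
  have ne: "1 + x\<^sup>2 \<noteq> 0" for x :: real by (metis add_pos_nonneg less_irrefl zero_le_power2 zero_less_one)
  have 1: "DERIV arctan x :> 1 / (1 + x\<^sup>2)" for x by (auto intro!: derivative_eq_intros simp: divide_inverse)
  have 2: "isCont (\<lambda>x. 1 / (1 + x\<^sup>2)) x" for x :: real using ne by (intro continuous_intros) auto
  have 3: "((arctan \<circ> real_of_ereal) \<longlongrightarrow> - (pi / 2)) (at_right (-\<infinity>))" "((arctan \<circ> real_of_ereal) \<longlongrightarrow> pi / 2) (at_left \<infinity>)"
    unfolding ereal_tendsto_simps by (rule tendsto_arctan_at_bot tendsto_arctan_at_top)+
  have 4: "0 \<le> 1 / (1 + x\<^sup>2)" for x :: real by simp
  have *: "(LBINT x=-\<infinity>..\<infinity>. 1 / (1 + x\<^sup>2)) = pi / 2 - (- (pi / 2))"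
    "set_integrable lborel (einterval (-\<infinity>) \<infinity>) (\<lambda>x. 1 / (1 + x\<^sup>2))"
    using interval_integral_FTC_nonneg[where F = arctan and f = "\<lambda>x. 1 / (1 + x\<^sup>2)" and a = "-\<infinity>" and b = \<infinity>, OF _ 1 2 _ 3] 4
    by auto
  have e: "einterval (-\<infinity>) \<infinity> = (UNIV :: real set)" by (auto simp: einterval_def)
  show "integrable lborel (\<lambda>x::real. 1 / (1 + x\<^sup>2))" using *(2) by (simp add: set_integrable_def e)
  show "(LBINT x. 1 / (1 + x\<^sup>2)) = pi"
    using *(1) by (simp add: interval_lebesgue_integral_def set_lebesgue_integral_def e)
qed

text \<open>Two powers of decay, which make Schwartz functions integrable; \<open>1 / (1 + x\<^sup>2)\<close>
is the majorant used throughout.\<close>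

lemma schwartz_decay:
  assumes "\<phi> \<in> schwartz" shows "norm (\<phi> x) \<le> 2 * schwartz_norm 2 \<phi> * (1 / (1 + x\<^sup>2))"
proof -
  have "norm (\<phi> x) * (1 + x\<^sup>2) \<le> 2 * schwartz_norm 2 \<phi>"
    using schwartz_norm_upper[OF assms, of 0 2 0 x] schwartz_norm_upper[OF assms, of 2 2 0 x]
    by (simp add: algebra_simps)
  then show ?thesis by (simp add: pos_le_divide_eq add_pos_nonneg)
qed

lemma schwartz_measurable: "\<phi> \<in> schwartz \<Longrightarrow> \<phi> \<in> borel_measurable borel"
  by (simp add: schwartz_smooth smooth_measurable)

lemma schwartz_integrable: assumes "\<phi> \<in> schwartz" shows "integrable lborel \<phi>"
proof (rule Bochner_Integration.integrable_bound)
  show "integrable lborel (\<lambda>x. 2 * schwartz_norm 2 \<phi> * (1 / (1 + x\<^sup>2)))"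
    by (intro integrable_mult_right has_bochner_integral_inverse_1_plus_square)
  show "AE x in lborel. norm (\<phi> x) \<le> norm (2 * schwartz_norm 2 \<phi> * (1 / (1 + x\<^sup>2)))"
    by (intro AE_I2 order_trans[OF schwartz_decay[OF assms]]) (simp only: real_norm_def abs_ge_self)
qed (use schwartz_measurable[OF assms] in simp)

lemma schwartz_L1_bound:
  assumes "\<phi> \<in> schwartz" shows "(LBINT x. norm (\<phi> x)) \<le> 2 * pi * schwartz_norm 2 \<phi>"
proof -
  have "(LBINT x. norm (\<phi> x)) \<le> (LBINT x. 2 * schwartz_norm 2 \<phi> * (1 / (1 + x\<^sup>2)))"
    by (intro integral_mono integrable_norm integrable_mult_right has_bochner_integral_inverse_1_plus_square(1)
      schwartz_integrable schwartz_decay assms)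
  also have "\<dots> = 2 * schwartz_norm 2 \<phi> * pi"
    by (subst integral_mult_right_zero) (simp only: has_bochner_integral_inverse_1_plus_square)
  finally show ?thesis by (simp add: mult_ac)
qed

lemma measurable_cis [measurable]: "cis \<in> borel_measurable borel"
  by (intro borel_measurable_continuous_onI continuous_intros)

lemma integrable_cis_mult:
  fixes \<phi> :: "real \<Rightarrow> complex"
  assumes "integrable lborel \<phi>" "f \<in> borel_measurable borel"
  shows "integrable lborel (\<lambda>x. cis (f x) * \<phi> x)"
proof (rule Bochner_Integration.integrable_bound[OF assms(1)])
  have [measurable]: "\<phi> \<in> borel_measurable borel" using assms(1) by auto
  note assms(2)[measurable]
  show "(\<lambda>x. cis (f x) * \<phi> x) \<in> borel_measurable lborel" by measurable
qed (simp add: norm_mult)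

lemma norm_fourier_le: "integrable lborel \<phi> \<Longrightarrow> norm (fourier \<phi> \<xi>) \<le> (LBINT x. norm (\<phi> x))"
  unfolding fourier_def by (rule order_trans[OF integral_norm_bound]) (simp add: norm_mult)

lemma Fubini_bounded_kernel:
  fixes f g :: "real \<Rightarrow> complex"
  assumes f: "integrable lborel f" and g: "integrable lborel g"
    and k: "(\<lambda>(x, y). k x y) \<in> borel_measurable (borel \<Otimes>\<^sub>M borel)" "\<And>x y. norm (k x y) \<le> B"
  shows "(LBINT x. f x * (LBINT y. g y * k x y)) = (LBINT y. g y * (LBINT x. f x * k x y))"
proof -
  have [measurable]: "f \<in> borel_measurable borel" "g \<in> borel_measurable borel" using f g by auto
  note k(1)[measurable]
  have "integrable (lborel \<Otimes>\<^sub>M lborel) (\<lambda>(x, y). f x * (g y * k x y))"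
  proof (rule lborel_pair.Fubini_integrable)
    have gk: "integrable lborel (\<lambda>y. f x * (g y * k x y))" for x
    proof (rule integrable_mult_right, rule Bochner_Integration.integrable_bound)
      show "integrable lborel (\<lambda>y. B *\<^sub>R g y)" using g by simp
      show "AE y in lborel. norm (g y * k x y) \<le> norm (B *\<^sub>R g y)"
        by (intro AE_I2) (simp add: norm_mult mult.commute[of "norm (g _)"] mult_right_mono order_trans[OF k(2) abs_ge_self])
    qed measurable
    then show "AE x in lborel. integrable lborel (\<lambda>y. case (x, y) of (x, y) \<Rightarrow> f x * (g y * k x y))" by simp
    show "integrable lborel (\<lambda>x. LINT y|lborel. norm (case (x, y) of (x, y) \<Rightarrow> f x * (g y * k x y)))"
    proof (rule Bochner_Integration.integrable_bound)
      show "integrable lborel (\<lambda>x. norm (f x) * (B * (LBINT y. norm (g y))))" using f by simp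
      show "AE x in lborel. norm (LINT y|lborel. norm (case (x, y) of (x, y) \<Rightarrow> f x * (g y * k x y)))
          \<le> norm (norm (f x) * (B * (LBINT y. norm (g y))))"
      proof (intro AE_I2)
        fix x
        have "(LBINT y. norm (f x * (g y * k x y))) \<le> (LBINT y. norm (f x) * B * norm (g y))"
          using gk g k(2) by (intro integral_mono integrable_norm)
            (auto simp: norm_mult mult.assoc mult.commute[of B] intro!: mult_left_mono)
        also have "\<dots> = norm (f x) * (B * (LBINT y. norm (g y)))" by simp
        finally show "norm (LINT y|lborel. norm (case (x, y) of (x, y) \<Rightarrow> f x * (g y * k x y)))
          \<le> norm (norm (f x) * (B * (LBINT y. norm (g y))))" by simp
      qed
    qed measurable
  qed measurable
  from lborel_pair.Fubini_integral[OF this]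
  have "(LBINT y. LBINT x. f x * (g y * k x y)) = (LBINT x. LBINT y. f x * (g y * k x y))" by simp
  moreover have "(LBINT x. f x * (g y * k x y)) = g y * (LBINT x. f x * k x y)" for y
    by (subst integral_mult_right_zero[symmetric]) (simp add: mult_ac)
  ultimately show ?thesis by simp
qed

lemma integral_gaussian_cis:
  "integrable lborel (\<lambda>\<eta>. cis (y * \<eta>) * complex_of_real (exp (- (\<eta>\<^sup>2) / 2)))"
  "(LBINT \<eta>. cis (y * \<eta>) * complex_of_real (exp (- (\<eta>\<^sup>2) / 2))) = sqrt (2 * pi) * exp (- (y\<^sup>2) / 2)"
proof -
  have i: "integrable lborel (\<lambda>x. std_normal_density x)" by (rule integrable_normal_density) simp
  have e: "complex_of_real (exp (- (\<eta>\<^sup>2) / 2)) = sqrt (2 * pi) * std_normal_density \<eta>" for \<eta>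
    by (simp add: std_normal_density_def)
  have "integrable lborel (\<lambda>\<eta>. complex_of_real (exp (- (\<eta>\<^sup>2) / 2)))"
    unfolding e by (intro integrable_mult_right integrable_of_real i)
  then show "integrable lborel (\<lambda>\<eta>. cis (y * \<eta>) * complex_of_real (exp (- (\<eta>\<^sup>2) / 2)))"
    by (rule integrable_cis_mult) auto
  have "complex_of_real (exp (- (y\<^sup>2) / 2)) = char std_normal_distribution y"
    by (simp add: char_std_normal_distribution)
  also have "\<dots> = (LBINT x. std_normal_density x *\<^sub>R exp (\<i> * complex_of_real (y * x)))"
    unfolding char_def by (subst integral_density) (auto simp: normal_density_nonneg)
  finally have 1: "complex_of_real (exp (- (y\<^sup>2) / 2)) = (LBINT x. std_normal_density x *\<^sub>R exp (\<i> * complex_of_real (y * x)))" .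
  have "(LBINT \<eta>. cis (y * \<eta>) * complex_of_real (exp (- (\<eta>\<^sup>2) / 2))) =
     (LBINT x. sqrt (2 * pi) * (std_normal_density x *\<^sub>R exp (\<i> * complex_of_real (y * x))))"
    unfolding e by (simp add: cis_conv_exp scaleR_conv_of_real mult_ac)
  also have "\<dots> = complex_of_real (sqrt (2 * pi)) * exp (- (y\<^sup>2) / 2)"
    unfolding 1 by (rule integral_mult_right_zero)
  finally show "(LBINT \<eta>. cis (y * \<eta>) * complex_of_real (exp (- (\<eta>\<^sup>2) / 2))) = sqrt (2 * pi) * exp (- (y\<^sup>2) / 2)"
    by simp
qed

lemma integral_gaussian: "integrable lborel (\<lambda>\<eta>. exp (- (\<eta>\<^sup>2) / 2) :: real)"
  "(LBINT \<eta>. complex_of_real (exp (- (\<eta>\<^sup>2) / 2))) = sqrt (2 * pi)"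
proof -
  have "integrable lborel (\<lambda>\<eta>. Re (complex_of_real (exp (- (\<eta>\<^sup>2) / 2))))"
    using integral_gaussian_cis(1)[of 0] by (intro integrable_Re) simp
  then show "integrable lborel (\<lambda>\<eta>. exp (- (\<eta>\<^sup>2) / 2) :: real)" by simp
  show "(LBINT \<eta>. complex_of_real (exp (- (\<eta>\<^sup>2) / 2))) = sqrt (2 * pi)"
    using integral_gaussian_cis(2)[of 0] by simp
qed

text \<open>The inverse Fourier transform, regularised by a Gaussian factor, is a convolution of \<open>\<phi>\<close> with a
Gaussian of width \<open>e\<close>; Fubini's theorem applies since the regularised integral converges absolutely.\<close>

lemma fourier_gaussian_mollified:
  assumes i: "integrable lborel \<phi>" and e: "e > 0"
  shows "(LBINT \<xi>. fourier \<phi> \<xi> * (cis (x * \<xi>) * complex_of_real (exp (- ((e * \<xi>)\<^sup>2) / 2)))) =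
     (LBINT z. \<phi> (x + e * z) * complex_of_real (sqrt (2 * pi) * exp (- (z\<^sup>2) / 2)))"
proof -
  let ?g = "\<lambda>\<xi>. complex_of_real (exp (- (\<xi>\<^sup>2) / 2))"
  have gi: "integrable lborel ?g" using integral_gaussian_cis(1)[of 0] by simp
  have "integrable lborel (\<lambda>\<xi>. ?g (e * \<xi>))"
    using lborel_integrable_real_affine[OF gi, of e 0] e by simp
  then have i2: "integrable lborel (\<lambda>\<xi>. cis (x * \<xi>) * ?g (e * \<xi>))" by (rule integrable_cis_mult) auto
  have "(LBINT \<xi>. fourier \<phi> \<xi> * (cis (x * \<xi>) * ?g (e * \<xi>))) =
    (LBINT \<xi>. (cis (x * \<xi>) * ?g (e * \<xi>)) * (LBINT y. \<phi> y * cis (- (y * \<xi>))))"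
    unfolding fourier_def by (simp add: mult_ac)
  also have "\<dots> = (LBINT y. \<phi> y * (LBINT \<xi>. (cis (x * \<xi>) * ?g (e * \<xi>)) * cis (- (y * \<xi>))))"
    by (rule Fubini_bounded_kernel[OF i2 i, where B = 1]) auto
  also have "\<dots> = \<bar>e\<bar> *\<^sub>R (LBINT z. \<phi> (x + e * z) * (LBINT \<xi>. (cis (x * \<xi>) * ?g (e * \<xi>)) * cis (- ((x + e * z) * \<xi>))))"
    by (rule lborel_integral_real_affine) (use e in simp)
  also have "(\<lambda>z. LBINT \<xi>. (cis (x * \<xi>) * ?g (e * \<xi>)) * cis (- ((x + e * z) * \<xi>))) =
     (\<lambda>z. (1 / e) *\<^sub>R complex_of_real (sqrt (2 * pi) * exp (- (z\<^sup>2) / 2)))"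
  proof
    fix z
    have "(LBINT \<xi>. (cis (x * \<xi>) * ?g (e * \<xi>)) * cis (- ((x + e * z) * \<xi>))) =
      (LBINT \<xi>. cis (- z * (e * \<xi>)) * ?g (e * \<xi>))"
    proof (intro Bochner_Integration.integral_cong refl)
      fix \<xi>
      have "cis (x * \<xi>) * cis (- ((x + e * z) * \<xi>)) = cis (- z * (e * \<xi>))" by (simp add: cis_mult algebra_simps)
      then show "cis (x * \<xi>) * ?g (e * \<xi>) * cis (- ((x + e * z) * \<xi>)) = cis (- z * (e * \<xi>)) * ?g (e * \<xi>)"
        by (metis mult.assoc mult.commute)
    qed
    also have "\<dots> = (1 / e) *\<^sub>R (LBINT \<eta>. cis (- z * \<eta>) * ?g \<eta>)"
      using lborel_integral_real_affine[of e "\<lambda>\<eta>. cis (- z * \<eta>) * ?g \<eta>" 0] e by simp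
    also have "\<dots> = (1 / e) *\<^sub>R complex_of_real (sqrt (2 * pi) * exp (- (z\<^sup>2) / 2))"
      unfolding integral_gaussian_cis by simp
    finally show "(LBINT \<xi>. (cis (x * \<xi>) * ?g (e * \<xi>)) * cis (- ((x + e * z) * \<xi>))) =
      (1 / e) *\<^sub>R complex_of_real (sqrt (2 * pi) * exp (- (z\<^sup>2) / 2))" .
  qed
  also have "\<bar>e\<bar> *\<^sub>R (LBINT z. \<phi> (x + e * z) * ((1 / e) *\<^sub>R complex_of_real (sqrt (2 * pi) * exp (- (z\<^sup>2) / 2)))) =
     (LBINT z. \<phi> (x + e * z) * complex_of_real (sqrt (2 * pi) * exp (- (z\<^sup>2) / 2)))"
    using e by simp
  finally show ?thesis .
qed

proposition fourier_inversion:
  assumes i: "integrable lborel \<phi>" and c: "continuous_on UNIV \<phi>" and b: "\<And>x. norm (\<phi> x) \<le> B"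
    and fi: "integrable lborel (fourier \<phi>)"
  shows "inv_fourier (fourier \<phi>) x = \<phi> x"
proof -
  let ?e = "\<lambda>n. 1 / (real n + 1)"
  have e0: "?e \<longlonglongrightarrow> 0" by real_asymp
  have [measurable]: "\<phi> \<in> borel_measurable borel" "fourier \<phi> \<in> borel_measurable borel" using i fi by auto
  have "(\<lambda>n. LBINT \<xi>. fourier \<phi> \<xi> * (cis (x * \<xi>) * complex_of_real (exp (- ((?e n * \<xi>)\<^sup>2) / 2)))) \<longlonglongrightarrow>
     (LBINT \<xi>. fourier \<phi> \<xi> * (cis (x * \<xi>) * complex_of_real (exp (- ((0 * \<xi>)\<^sup>2) / 2))))"
  proof (rule integral_dominated_convergence[where w = "\<lambda>\<xi>. norm (fourier \<phi> \<xi>)"])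
    show "AE \<xi> in lborel. (\<lambda>n. fourier \<phi> \<xi> * (cis (x * \<xi>) * complex_of_real (exp (- ((?e n * \<xi>)\<^sup>2) / 2))))
      \<longlonglongrightarrow> fourier \<phi> \<xi> * (cis (x * \<xi>) * complex_of_real (exp (- ((0 * \<xi>)\<^sup>2) / 2)))"
      by (intro AE_I2 tendsto_intros e0) auto
    show "AE \<xi> in lborel. norm (fourier \<phi> \<xi> * (cis (x * \<xi>) * complex_of_real (exp (- ((?e n * \<xi>)\<^sup>2) / 2)))) \<le> norm (fourier \<phi> \<xi>)" for n
      by (auto simp: norm_mult intro!: mult_right_le_one_le)
  qed (use fi in auto)
  moreover have "(\<lambda>n. LBINT z. \<phi> (x + ?e n * z) * complex_of_real (sqrt (2 * pi) * exp (- (z\<^sup>2) / 2))) \<longlonglongrightarrow>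
     (LBINT z. \<phi> (x + 0 * z) * complex_of_real (sqrt (2 * pi) * exp (- (z\<^sup>2) / 2)))"
  proof (rule integral_dominated_convergence[where w = "\<lambda>z. B * (sqrt (2 * pi) * exp (- (z\<^sup>2) / 2))"])
    have "isCont \<phi> y" for y using c by (simp add: continuous_on_eq_continuous_at)
    then show "AE z in lborel. (\<lambda>n. \<phi> (x + ?e n * z) * complex_of_real (sqrt (2 * pi) * exp (- (z\<^sup>2) / 2))) \<longlonglongrightarrow>
       \<phi> (x + 0 * z) * complex_of_real (sqrt (2 * pi) * exp (- (z\<^sup>2) / 2))"
      by (intro AE_I2 tendsto_mult isCont_tendsto_compose[where g = \<phi>] tendsto_intros e0)
    show "AE z in lborel. norm (\<phi> (x + ?e n * z) * complex_of_real (sqrt (2 * pi) * exp (- (z\<^sup>2) / 2))) \<le> B * (sqrt (2 * pi) * exp (- (z\<^sup>2) / 2))" for n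
      using b by (auto simp: norm_mult intro!: mult_right_mono)
  qed (use integral_gaussian(1) in \<open>auto intro!: integrable_mult_right\<close>)
  moreover have *: "(LBINT \<xi>. fourier \<phi> \<xi> * (cis (x * \<xi>) * complex_of_real (exp (- ((?e n * \<xi>)\<^sup>2) / 2)))) =
     (LBINT z. \<phi> (x + ?e n * z) * complex_of_real (sqrt (2 * pi) * exp (- (z\<^sup>2) / 2)))" for n
    by (intro fourier_gaussian_mollified i) auto
  ultimately have "(LBINT \<xi>. fourier \<phi> \<xi> * (cis (x * \<xi>) * complex_of_real (exp (- ((0 * \<xi>)\<^sup>2) / 2)))) =
     (LBINT z. \<phi> (x + 0 * z) * complex_of_real (sqrt (2 * pi) * exp (- (z\<^sup>2) / 2)))"
    unfolding * by (blast intro: LIMSEQ_unique)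
  then have "(LBINT \<xi>. cis (x * \<xi>) * fourier \<phi> \<xi>) = (LBINT z. (\<phi> x * sqrt (2 * pi)) * complex_of_real (exp (- (z\<^sup>2) / 2)))"
    by (simp add: mult_ac)
  also have "\<dots> = (\<phi> x * sqrt (2 * pi)) * sqrt (2 * pi)" by (subst integral_mult_right_zero) (simp only: integral_gaussian)
  also have "\<dots> = 2 * pi * \<phi> x" using real_sqrt_mult_self[of "2 * pi"]
    by (metis (no_types, lifting) abs_of_nonneg mult.assoc mult.commute of_real_mult pi_ge_zero zero_le_mult_iff zero_le_numeral of_real_numeral)
  finally show ?thesis by (simp add: inv_fourier_def)
qed

text \<open>A quadratic error bound implies differentiability; it avoids differentiating under the integral
sign.\<close>

lemma has_vector_derivative_quadratic:
  fixes F :: "real \<Rightarrow> 'a::real_normed_vector"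
  assumes "\<And>h. norm (F (x + h) - F x - h *\<^sub>R G) \<le> K * h\<^sup>2"
  shows "(F has_vector_derivative G) (at x)"
  unfolding has_vector_derivative_def has_derivative_at
proof (intro conjI bounded_linear_scaleR_left)
  show "(\<lambda>h. norm (F (x + h) - F x - h *\<^sub>R G) / norm h) \<midarrow>0\<rightarrow> 0"
  proof (rule tendsto_sandwich[of "\<lambda>h. 0" _ _ "\<lambda>h. K * \<bar>h\<bar>"])
    show "\<forall>\<^sub>F h in at 0. norm (F (x + h) - F x - h *\<^sub>R G) / norm h \<le> K * \<bar>h\<bar>"
      using assms by (auto simp: eventually_at_filter divide_le_eq power2_eq_square abs_mult_self_eq mult.assoc)
    show "((\<lambda>h. K * \<bar>h\<bar>) \<longlongrightarrow> 0) (at 0)" by (rule tendsto_eq_intros | simp)+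
  qed auto
qed

lemma fourier_has_vector_derivative:
  assumes "\<phi> \<in> schwartz"
  shows "(fourier \<phi> has_vector_derivative fourier (\<lambda>x. (- \<i> * of_real x) * \<phi> x) \<xi>) (at \<xi>)"
proof (rule has_vector_derivative_quadratic)
  fix h :: real
  have s: "slow_family {\<lambda>x. - \<i> * complex_of_real x}"
    by (intro slow_family_mult1 slow_family_const1 slow_family_ident)
  let ?X = "\<lambda>\<phi> x. (- \<i> * of_real x) * \<phi> x"
  have S: "?X \<phi> \<in> schwartz" "?X (?X \<phi>) \<in> schwartz" by (intro schwartz_mult_slow[OF s] assms)+
  have I: "integrable lborel (\<lambda>x. cis (- (x * t)) * ?X \<phi> x)" "integrable lborel (\<lambda>x. cis (- (x * t)) * \<phi> x)" for t
    by (intro integrable_cis_mult schwartz_integrable assms S; simp)+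
  have I2: "integrable lborel (\<lambda>x. (x * h)\<^sup>2 / 2 * norm (\<phi> x))"
  proof -
    have "(\<lambda>x. h\<^sup>2 / 2 * norm (?X (?X \<phi>) x)) = (\<lambda>x. (x * h)\<^sup>2 / 2 * norm (\<phi> x))"
      by (auto simp: norm_mult power2_eq_square mult_ac abs_mult_self_eq)
    then show ?thesis
      using schwartz_integrable[OF S(2), THEN integrable_norm, THEN integrable_mult_right[of "h\<^sup>2 / 2"]] by metis
  qed
  have I3: "integrable lborel (\<lambda>x. cis (- (x * (\<xi> + h))) * \<phi> x - cis (- (x * \<xi>)) * \<phi> x - h *\<^sub>R (cis (- (x * \<xi>)) * ?X \<phi> x))"
    by (intro Bochner_Integration.integrable_diff integrable_scaleR_right I)
  have "fourier \<phi> (\<xi> + h) - fourier \<phi> \<xi> - h *\<^sub>R fourier (?X \<phi>) \<xi> =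
     (LBINT x. cis (- (x * (\<xi> + h))) * \<phi> x - cis (- (x * \<xi>)) * \<phi> x - h *\<^sub>R (cis (- (x * \<xi>)) * ?X \<phi> x))"
    unfolding fourier_def using I
    by (subst Bochner_Integration.integral_diff integral_scaleR_right | auto intro!: Bochner_Integration.integrable_diff integrable_scaleR_right)+
  also have "norm \<dots> \<le> (LBINT x. (x * h)\<^sup>2 / 2 * norm (\<phi> x))"
  proof (rule order_trans[OF integral_norm_bound integral_mono[OF integrable_norm[OF I3] I2]])
    fix x
    have a: "norm (cis (- (x * h)) - 1 + \<i> * of_real (x * h)) \<le> (x * h)\<^sup>2 / 2"
      using iexp_approx1[of "- (x * h)" 1] by (simp add: cis_conv_exp numeral_2_eq_2 algebra_simps power2_eq_square abs_mult_self_eq)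
    have "cis (- (x * (\<xi> + h))) * \<phi> x - cis (- (x * \<xi>)) * \<phi> x - h *\<^sub>R (cis (- (x * \<xi>)) * ?X \<phi> x) =
        cis (- (x * \<xi>)) * \<phi> x * (cis (- (x * h)) - 1 + \<i> * of_real (x * h))"
    proof -
      have "cis (- (x * (\<xi> + h))) = cis (- (x * \<xi>)) * cis (- (x * h))" by (simp add: cis_mult algebra_simps)
      then show ?thesis by (simp add: algebra_simps scaleR_conv_of_real)
    qed
    then show "norm (cis (- (x * (\<xi> + h))) * \<phi> x - cis (- (x * \<xi>)) * \<phi> x - h *\<^sub>R (cis (- (x * \<xi>)) * ?X \<phi> x)) \<le> (x * h)\<^sup>2 / 2 * norm (\<phi> x)"
      using mult_right_mono[OF a norm_ge_zero[of "\<phi> x"]] by (simp add: norm_mult mult_ac)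
  qed
  also have "\<dots> = (LBINT x. x\<^sup>2 / 2 * norm (\<phi> x)) * h\<^sup>2"
    by (subst integral_mult_left_zero[symmetric]) (simp add: power_mult_distrib mult_ac)
  finally show "norm (fourier \<phi> (\<xi> + h) - fourier \<phi> \<xi> - h *\<^sub>R fourier (?X \<phi>) \<xi>) \<le> (LBINT x. x\<^sup>2 / 2 * norm (\<phi> x)) * h\<^sup>2" .
qed

lemma schwartz_tendsto_0:
  assumes "\<phi> \<in> schwartz" shows "(\<phi> \<longlongrightarrow> 0) at_top" "(\<phi> \<longlongrightarrow> 0) at_bot"
proof -
  let ?b = "\<lambda>x::real. 2 * schwartz_norm 2 \<phi> * (1 / (1 + x\<^sup>2))"
  have d: "\<forall>\<^sub>F x in F. norm (\<phi> x) \<le> ?b x" for F by (intro always_eventually allI schwartz_decay assms)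
  have "((\<lambda>x. c * (1 / (1 + x\<^sup>2))) \<longlongrightarrow> 0) at_top" for c :: real by real_asymp
  then show "(\<phi> \<longlongrightarrow> 0) at_top" by (rule Lim_null_comparison[OF d])
  have "((\<lambda>x. c * (1 / (1 + x\<^sup>2))) \<longlongrightarrow> 0) at_bot" for c :: real by real_asymp
  then show "(\<phi> \<longlongrightarrow> 0) at_bot" by (rule Lim_null_comparison[OF d])
qed

lemma integral_vderiv_schwartz:
  assumes "\<phi> \<in> schwartz" shows "(LBINT x. vderiv \<phi> x) = 0"
proof -
  have e: "einterval (-\<infinity>) \<infinity> = (UNIV :: real set)" by (auto simp: einterval_def)
  have "(LBINT x=-\<infinity>..\<infinity>. vderiv \<phi> x) = 0 - 0"
  proof (rule interval_integral_FTC_integrable[where F = \<phi>])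
    show "(\<phi> has_vector_derivative vderiv \<phi> x) (at x)" for x
      by (intro smooth_has_vderiv schwartz_smooth assms)
    have "continuous_on UNIV (vderiv \<phi>)" by (intro smooth_continuous smooth_vderiv schwartz_smooth assms)
    then show "isCont (vderiv \<phi>) x" for x by (simp add: continuous_on_eq_continuous_at)
    show "set_integrable lborel (einterval (-\<infinity>) \<infinity>) (vderiv \<phi>)"
      using schwartz_integrable[OF schwartz_vderiv[OF assms]] by (simp add: set_integrable_def e)
  qed (use schwartz_tendsto_0[OF assms] in \<open>auto simp: ereal_tendsto_simps\<close>)
  then show ?thesis by (simp add: interval_lebesgue_integral_def set_lebesgue_integral_def e)
qed

lemma fourier_vderiv:
  assumes "\<phi> \<in> schwartz" shows "fourier (vderiv \<phi>) \<xi> = \<i> * of_real \<xi> * fourier \<phi> \<xi>"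
proof -
  let ?c = "\<lambda>x. cis (- \<xi> * x)"
  have "vderiv (\<lambda>x. ?c x * \<phi> x) = (\<lambda>x. \<i> * of_real (-\<xi>) * ?c x * \<phi> x + ?c x * vderiv \<phi> x)"
  proof (rule vderivI)
    fix x
    show "((\<lambda>x. ?c x * \<phi> x) has_vector_derivative \<i> * of_real (-\<xi>) * ?c x * \<phi> x + ?c x * vderiv \<phi> x) (at x)"
      using has_vector_derivative_mult[OF has_vector_derivative_cis[of "-\<xi>" x UNIV] smooth_has_vderiv[OF schwartz_smooth[OF assms], of x]]
      by (simp add: add.commute)
  qed
  moreover have "(\<lambda>x. ?c x * \<phi> x) \<in> schwartz" by (intro schwartz_mult_slow slow_family_cis_linear assms)
  ultimately have "0 = (LBINT x. \<i> * of_real (-\<xi>) * ?c x * \<phi> x + ?c x * vderiv \<phi> x)"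
    using integral_vderiv_schwartz by metis
  also have "\<dots> = (LBINT x. (\<i> * of_real (-\<xi>)) * (?c x * \<phi> x)) + (LBINT x. ?c x * vderiv \<phi> x)"
  proof -
    have "integrable lborel (\<lambda>x. (\<i> * of_real (-\<xi>)) * (?c x * \<phi> x))" "integrable lborel (\<lambda>x. ?c x * vderiv \<phi> x)"
      by (intro integrable_mult_right integrable_cis_mult schwartz_integrable schwartz_vderiv assms; simp)+
    from Bochner_Integration.integral_add[OF this] show ?thesis by (simp only: mult.assoc)
  qed
  also have "\<dots> = \<i> * of_real (-\<xi>) * fourier \<phi> \<xi> + fourier (vderiv \<phi>) \<xi>"
    unfolding fourier_def by (subst integral_mult_right_zero) (simp add: mult.commute)
  finally show ?thesis by (simp add: algebra_simps)
qed

text \<open>Multiplication by \<open>-ix\<close>, which the Fourier transform turns into differentiation.\<close>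

definition mult_ix :: "(real \<Rightarrow> complex) \<Rightarrow> real \<Rightarrow> complex" where
  "mult_ix \<phi> = (\<lambda>x. (- \<i> * of_real x) * \<phi> x)"

lemma tame_mult_ix: "tame {mult_ix}"
proof -
  have s: "slow_family {\<lambda>x. - \<i> * complex_of_real x}"
    by (intro slow_family_mult1 slow_family_const1 slow_family_ident)
  show ?thesis by (rule tame_subset[OF tame_mult[OF s]]) (auto simp: mult_ix_def)
qed

lemma tame_funpow: assumes "tame {P}" shows "tame {P ^^ n}"
proof (induction n)
  case 0
  show ?case unfolding tame_def
  proof (intro conjI allI)
    fix M show "\<exists>C N. 0 \<le> C \<and> (\<forall>P\<in>{(^^) P 0}. \<forall>\<phi>\<in>schwartz. schwartz_norm M (P \<phi>) \<le> C * schwartz_norm N \<phi>)"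
      by (intro exI[of _ "1::real"] exI[of _ M]) auto
  qed auto
next
  case (Suc n)
  from tame_comp1[OF assms Suc] show ?case by (simp add: o_def)
qed

lemma schwartz_mult_ix: "\<phi> \<in> schwartz \<Longrightarrow> (mult_ix ^^ n) \<phi> \<in> schwartz"
  by (rule tame_schwartz[OF tame_funpow[OF tame_mult_ix]]) auto

lemma vderiv_fourier: "\<phi> \<in> schwartz \<Longrightarrow> vderiv (fourier \<phi>) = fourier (mult_ix \<phi>)"
  unfolding mult_ix_def by (rule vderivI[OF fourier_has_vector_derivative])

lemma nderiv_fourier: "\<phi> \<in> schwartz \<Longrightarrow> nderiv n (fourier \<phi>) = fourier ((mult_ix ^^ n) \<phi>)"
  by (induction n) (auto simp: nderiv_Suc' vderiv_fourier schwartz_mult_ix)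

lemma smooth_fourier: assumes "\<phi> \<in> schwartz" shows "smooth (fourier \<phi>)"
  unfolding smooth_def nderiv_fourier[OF assms]
  using differentiableI_vector[OF fourier_has_vector_derivative[OF schwartz_mult_ix[OF assms]]] by simp

lemma norm_power_fourier:
  assumes "\<phi> \<in> schwartz"
  shows "\<bar>\<xi>\<bar> ^ m * norm (fourier \<phi> \<xi>) = norm (fourier ((vderiv ^^ m) \<phi>) \<xi>)"
proof -
  have S: "(vderiv ^^ m) \<phi> \<in> schwartz" for m by (induction m) (auto simp: assms schwartz_vderiv)
  show ?thesis
  proof (induction m)
    case (Suc m)
    have "norm (fourier ((vderiv ^^ Suc m) \<phi>) \<xi>) = \<bar>\<xi>\<bar> * norm (fourier ((vderiv ^^ m) \<phi>) \<xi>)"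
      by (simp add: fourier_vderiv[OF S] norm_mult)
    with Suc show ?case by simp
  qed simp
qed

lemma tame_fourier: "tame {fourier}"
proof (rule tameI)
  fix P \<phi> assume "P \<in> {fourier}" "\<phi> \<in> schwartz"
  then show "smooth (P \<phi>)" using smooth_fourier[of \<phi>] by simp
next
  fix m n :: nat
  have t: "tame {\<lambda>\<phi>. (vderiv ^^ m) ((mult_ix ^^ n) \<phi>)}"
    by (rule tame_comp1[OF tame_funpow[OF tame_vderiv] tame_funpow[OF tame_mult_ix]])
  from tame_bound[OF this, of 2] obtain C N where C: "C \<ge> 0"
    "\<forall>\<phi>\<in>schwartz. schwartz_norm 2 ((vderiv ^^ m) ((mult_ix ^^ n) \<phi>)) \<le> C * schwartz_norm N \<phi>" by auto
  have "\<bar>\<xi>\<bar> ^ m * norm (nderiv n (fourier \<phi>) \<xi>) \<le> (2 * pi * C) * schwartz_norm N \<phi>" if "\<phi> \<in> schwartz" for \<phi> \<xi>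
  proof -
    have S: "(vderiv ^^ m) ((mult_ix ^^ n) \<phi>) \<in> schwartz" by (rule tame_schwartz[OF t _ that]) simp
    have "\<bar>\<xi>\<bar> ^ m * norm (nderiv n (fourier \<phi>) \<xi>) = norm (fourier ((vderiv ^^ m) ((mult_ix ^^ n) \<phi>)) \<xi>)"
      by (simp add: nderiv_fourier that norm_power_fourier schwartz_mult_ix)
    also have "\<dots> \<le> 2 * pi * schwartz_norm 2 ((vderiv ^^ m) ((mult_ix ^^ n) \<phi>))"
      using norm_fourier_le[OF schwartz_integrable[OF S]] schwartz_L1_bound[OF S] by (rule order_trans)
    also have "\<dots> \<le> 2 * pi * (C * schwartz_norm N \<phi>)" using C(2) that by (intro mult_left_mono) auto
    finally show ?thesis by (simp add: mult_ac)
  qed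
  then show "\<exists>C N. 0 \<le> C \<and> (\<forall>P\<in>{fourier}. \<forall>\<phi>\<in>schwartz. \<forall>x. \<bar>x\<bar> ^ m * cmod (nderiv n (P \<phi>) x) \<le> C * schwartz_norm N \<phi>)"
    using C(1) by (intro exI[of _ "2 * pi * C"] exI[of _ N]) simp
qed

lemma schwartz_fourier: "\<phi> \<in> schwartz \<Longrightarrow> fourier \<phi> \<in> schwartz"
  by (rule tame_schwartz[OF tame_fourier]) auto

lemma inv_fourier_conv_fourier: "inv_fourier \<phi> = (\<lambda>x. (1 / (2 * pi)) * fourier \<phi> (- x))"
  by (rule ext) (simp add: inv_fourier_def fourier_def mult.commute[of _ "_ :: real"])

lemma tame_mult1: assumes "slow_family {a}" shows "tame {\<lambda>\<phi> x. a x * \<phi> x}"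
proof -
  have "{\<lambda>\<phi> x. a' x * \<phi> x |a'. a' \<in> {a}} = {\<lambda>\<phi> x. a x * \<phi> x}" by simp
  with tame_mult[OF assms] show ?thesis by simp
qed

lemma tame_inv_fourier: "tame {inv_fourier}"
proof -
  have "inv_fourier = (\<lambda>\<phi> x. complex_of_real (1 / (2 * pi)) * fourier \<phi> (- x))"
    by (rule ext) (simp add: inv_fourier_conv_fourier)
  with tame_comp1[OF tame_mult1[OF slow_family_const1[of "complex_of_real (1 / (2 * pi))"]] tame_comp1[OF tame_reflect tame_fourier]]
  show ?thesis by simp
qed

lemma schwartz_inv_fourier: "\<phi> \<in> schwartz \<Longrightarrow> inv_fourier \<phi> \<in> schwartz"
  by (rule tame_schwartz[OF tame_inv_fourier]) auto

lemma schwartz_bounded: assumes "\<phi> \<in> schwartz" shows "norm (\<phi> x) \<le> schwartz_norm 0 \<phi>"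
  using schwartz_norm_upper[OF assms, of 0 0 0 x] by simp

lemma inv_fourier_fourier: "\<phi> \<in> schwartz \<Longrightarrow> inv_fourier (fourier \<phi>) = \<phi>"
  by (intro ext fourier_inversion[where B = "schwartz_norm 0 \<phi>"] schwartz_integrable schwartz_fourier
      smooth_continuous schwartz_smooth schwartz_bounded)

lemma fourier_inv_fourier: assumes "\<phi> \<in> schwartz" shows "fourier (inv_fourier \<phi>) = \<phi>"
proof
  fix x
  have "fourier (inv_fourier \<phi>) x = (LBINT y. cis (y * (- x)) * (fourier \<phi> (- y) / (2 * pi)))"
  proof -
    have "fourier (inv_fourier \<phi>) x = (LBINT y. cis (- (y * x)) * inv_fourier \<phi> y)"
      by (simp only: fourier_def[of "inv_fourier \<phi>"])
    then show ?thesis by (simp add: inv_fourier_conv_fourier)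
  qed
  also have "\<dots> = (LBINT y. cis (x * y) * (fourier \<phi> y / (2 * pi)))"
    by (subst lborel_integral_real_affine[of "-1" _ 0]) (auto simp: mult.commute[of x])
  also have "\<dots> = inv_fourier (fourier \<phi>) x" unfolding inv_fourier_def by simp
  also have "\<dots> = \<phi> x" using inv_fourier_fourier[OF assms] by simp
  finally show "fourier (inv_fourier \<phi>) x = \<phi> x" .
qed

section \<open>Fourier multipliers of tempered distributions\<close>

text \<open>The transpose of the Fourier multiplier with symbol \<open>m\<close>: \<open>fourier_multiplier m T\<close> is
\<open>\<phi> \<mapsto> T (mult_op m \<phi>)\<close>. As an operator on functions it has the reflected symbol \<open>m (- \<xi>)\<close>.\<close>

definition mult_op :: "(real \<Rightarrow> complex) \<Rightarrow> (real \<Rightarrow> complex) \<Rightarrow> real \<Rightarrow> complex" where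
  "mult_op m \<phi> = fourier (\<lambda>\<xi>. m \<xi> * inv_fourier \<phi> \<xi>)"

lemma fourier_multiplier_eq: "fourier_multiplier m T = (\<lambda>\<phi>. T (mult_op m \<phi>))"
  by (simp add: fourier_multiplier_def inv_fourier_distr_def mult_distr_def fourier_distr_def mult_op_def)

lemma tame_compI:
  assumes "tame \<P>" "tame \<Q>" "\<And>R. R \<in> \<R> \<Longrightarrow> \<exists>P\<in>\<P>. \<exists>Q\<in>\<Q>. R = (\<lambda>\<phi>. P (Q \<phi>))"
  shows "tame \<R>"
proof (rule tame_subset[OF tame_comp[OF assms(1,2)]], rule subsetI)
  fix R assume "R \<in> \<R>"
  from assms(3)[OF this] obtain P Q where "P \<in> \<P>" "Q \<in> \<Q>" "R = (\<lambda>\<phi>. P (Q \<phi>))" by metis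
  then show "R \<in> {\<lambda>\<phi>. P (Q \<phi>) |P Q. P \<in> \<P> \<and> Q \<in> \<Q>}" by (intro CollectI exI[of _ P] exI[of _ Q] conjI)
qed

lemma slow_family_multI:
  assumes "slow_family A" "slow_family B" "\<And>c. c \<in> C \<Longrightarrow> \<exists>a\<in>A. \<exists>b\<in>B. c = (\<lambda>x. a x * b x)"
  shows "slow_family C"
proof (rule slow_family_subset[OF slow_family_mult[OF assms(1,2)]], rule subsetI)
  fix c assume "c \<in> C"
  from assms(3)[OF this] obtain a b where "a \<in> A" "b \<in> B" "c = (\<lambda>x. a x * b x)" by metis
  then show "c \<in> {\<lambda>x. a x * b x |a b. a \<in> A \<and> b \<in> B}" by (intro CollectI exI[of _ a] exI[of _ b] conjI)
qed

lemma slow_family_addI: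
  assumes "slow_family A" "slow_family B" "\<And>c. c \<in> C \<Longrightarrow> \<exists>a\<in>A. \<exists>b\<in>B. c = (\<lambda>x. a x + b x)"
  shows "slow_family C"
proof (rule slow_family_subset[OF slow_family_add[OF assms(1,2)]], rule subsetI)
  fix c assume "c \<in> C"
  from assms(3)[OF this] obtain a b where "a \<in> A" "b \<in> B" "c = (\<lambda>x. a x + b x)" by metis
  then show "c \<in> {\<lambda>x. a x + b x |a b. a \<in> A \<and> b \<in> B}" by (intro CollectI exI[of _ a] exI[of _ b] conjI)
qed

lemma tame_mult_image: assumes "slow_family A" shows "tame ((\<lambda>a \<phi> x. a x * \<phi> x) ` A)"
proof (rule tame_subset[OF tame_mult[OF assms]], rule subsetI)
  fix P assume "P \<in> (\<lambda>a \<phi> x. a x * \<phi> x) ` A"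
  then obtain a where "a \<in> A" "P = (\<lambda>\<phi> x. a x * \<phi> x)" by (rule imageE)
  then show "P \<in> {\<lambda>\<phi> x. a x * \<phi> x |a. a \<in> A}" by (intro CollectI exI[of _ a] conjI)
qed

lemma tame_mult_op: assumes "slow_family A" shows "tame (mult_op ` A)"
proof (rule tame_compI[OF tame_fourier])
  show "tame ((\<lambda>a \<phi> x. a x * inv_fourier \<phi> x) ` A)"
  proof (rule tame_compI[OF tame_mult_image[OF assms] tame_inv_fourier])
    fix R assume "R \<in> (\<lambda>a \<phi> x. a x * inv_fourier \<phi> x) ` A"
    then obtain a where "a \<in> A" "R = (\<lambda>\<phi> x. a x * inv_fourier \<phi> x)" by (rule imageE)
    then show "\<exists>P\<in>(\<lambda>a \<phi> x. a x * \<phi> x) ` A. \<exists>Q\<in>{inv_fourier}. R = (\<lambda>\<phi>. P (Q \<phi>))"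
      by (intro bexI[of _ "\<lambda>\<phi> x. a x * \<phi> x"] bexI[of _ inv_fourier] imageI) auto
  qed
  fix R assume "R \<in> mult_op ` A"
  then obtain a where "a \<in> A" "R = mult_op a" by (rule imageE)
  then show "\<exists>P\<in>{fourier}. \<exists>Q\<in>(\<lambda>a \<phi> x. a x * inv_fourier \<phi> x) ` A. R = (\<lambda>\<phi>. P (Q \<phi>))"
    by (intro bexI[of _ "\<lambda>\<phi> x. a x * inv_fourier \<phi> x"] bexI[of _ fourier] imageI) (auto simp: mult_op_def[abs_def])
qed

lemma tame_mult_op1: assumes "slow_family {a}" shows "tame {mult_op a}"
  using tame_mult_op[OF assms] by simp

lemma schwartz_mult_op: "slow_family {a} \<Longrightarrow> \<phi> \<in> schwartz \<Longrightarrow> mult_op a \<phi> \<in> schwartz"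
  by (rule tame_schwartz[OF tame_mult_op1]) auto

lemma inv_fourier_mult_op:
  "slow_family {b} \<Longrightarrow> \<phi> \<in> schwartz \<Longrightarrow> inv_fourier (mult_op b \<phi>) = (\<lambda>\<xi>. b \<xi> * inv_fourier \<phi> \<xi>)"
  unfolding mult_op_def by (intro inv_fourier_fourier schwartz_mult_slow schwartz_inv_fourier)

lemma mult_op_mult_op:
  "slow_family {b} \<Longrightarrow> \<phi> \<in> schwartz \<Longrightarrow> mult_op a (mult_op b \<phi>) = mult_op (\<lambda>\<xi>. a \<xi> * b \<xi>) \<phi>"
  by (simp add: mult_op_def[of a] mult_op_def[of "\<lambda>\<xi>. a \<xi> * b \<xi>"] inv_fourier_mult_op mult.assoc)

lemma mult_op_1: "\<phi> \<in> schwartz \<Longrightarrow> mult_op (\<lambda>\<xi>. 1) \<phi> = \<phi>"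
  by (simp add: mult_op_def fourier_inv_fourier)

lemma fourier_linear:
  assumes "integrable lborel \<phi>" "integrable lborel \<psi>"
  shows "fourier (\<lambda>x. a * \<phi> x + b * \<psi> x) \<xi> = a * fourier \<phi> \<xi> + b * fourier \<psi> \<xi>"
proof -
  have "integrable lborel (\<lambda>x. a * (cis (- (x * \<xi>)) * \<phi> x))" "integrable lborel (\<lambda>x. b * (cis (- (x * \<xi>)) * \<psi> x))"
    using assms by (auto intro!: integrable_mult_right integrable_cis_mult simp del: integrable_mult_left_iff integrable_mult_right_iff)
  from Bochner_Integration.integral_add[OF this]
  show ?thesis by (simp add: fourier_def algebra_simps)
qed

lemma inv_fourier_linear:
  assumes "integrable lborel \<phi>" "integrable lborel \<psi>"
  shows "inv_fourier (\<lambda>x. a * \<phi> x + b * \<psi> x) \<xi> = a * inv_fourier \<phi> \<xi> + b * inv_fourier \<psi> \<xi>"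
  by (simp add: inv_fourier_conv_fourier fourier_linear[OF assms] add_divide_distrib)

lemma mult_op_linear:
  assumes "slow_family {m}" "\<phi> \<in> schwartz" "\<psi> \<in> schwartz"
  shows "mult_op m (\<lambda>x. a * \<phi> x + b * \<psi> x) = (\<lambda>x. a * mult_op m \<phi> x + b * mult_op m \<psi> x)"
proof
  fix x
  have i: "integrable lborel (\<lambda>\<xi>. m \<xi> * inv_fourier \<phi> \<xi>)" if "\<phi> \<in> schwartz" for \<phi>
    by (intro schwartz_integrable schwartz_mult_slow assms schwartz_inv_fourier that)
  have "inv_fourier (\<lambda>x. a * \<phi> x + b * \<psi> x) = (\<lambda>x. a * inv_fourier \<phi> x + b * inv_fourier \<psi> x)"
    by (intro ext inv_fourier_linear schwartz_integrable assms)
  then have "mult_op m (\<lambda>x. a * \<phi> x + b * \<psi> x) x =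
     fourier (\<lambda>\<xi>. a * (m \<xi> * inv_fourier \<phi> \<xi>) + b * (m \<xi> * inv_fourier \<psi> \<xi>)) x"
    by (simp add: mult_op_def algebra_simps)
  also have "\<dots> = a * mult_op m \<phi> x + b * mult_op m \<psi> x"
    unfolding mult_op_def by (intro fourier_linear i assms)
  finally show "mult_op m (\<lambda>x. a * \<phi> x + b * \<psi> x) x = a * mult_op m \<phi> x + b * mult_op m \<psi> x" .
qed

lemma mult_op_add_symbol:
  assumes "slow_family {m}" "slow_family {m'}" "\<phi> \<in> schwartz"
  shows "mult_op (\<lambda>\<xi>. a * m \<xi> + b * m' \<xi>) \<phi> = (\<lambda>x. a * mult_op m \<phi> x + b * mult_op m' \<phi> x)"
proof
  fix x
  have i: "integrable lborel (\<lambda>\<xi>. m \<xi> * inv_fourier \<phi> \<xi>)" if "slow_family {m}" for m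
    by (intro schwartz_integrable schwartz_mult_slow assms schwartz_inv_fourier that)
  have "mult_op (\<lambda>\<xi>. a * m \<xi> + b * m' \<xi>) \<phi> x = 
     fourier (\<lambda>\<xi>. a * (m \<xi> * inv_fourier \<phi> \<xi>) + b * (m' \<xi> * inv_fourier \<phi> \<xi>)) x"
    by (simp add: mult_op_def algebra_simps)
  also have "\<dots> = a * mult_op m \<phi> x + b * mult_op m' \<phi> x"
    unfolding mult_op_def by (intro fourier_linear i assms)
  finally show "mult_op (\<lambda>\<xi>. a * m \<xi> + b * m' \<xi>) \<phi> x = a * mult_op m \<phi> x + b * mult_op m' \<phi> x" .
qed

text \<open>For a Schwartz symbol the operator is the convolution with the reflected kernel.\<close>

lemma mult_op_kernel:
  assumes M: "M \<in> schwartz" and p: "\<phi> \<in> schwartz"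
  shows "mult_op M \<phi> y = (LBINT x. \<phi> x * inv_fourier M (x - y))"
proof -
  have iM: "integrable lborel (\<lambda>\<xi>. cis (- (\<xi> * y)) * M \<xi> / (2 * pi))"
    using integrable_cis_mult[OF schwartz_integrable[OF M], of "\<lambda>\<xi>. - (\<xi> * y)"] by simp
  have "mult_op M \<phi> y = (LBINT \<xi>. (cis (- (\<xi> * y)) * M \<xi> / (2 * pi)) * (LBINT x. \<phi> x * cis (\<xi> * x)))"
    unfolding mult_op_def fourier_def inv_fourier_def by (simp add: mult_ac)
  also have "\<dots> = (LBINT x. \<phi> x * (LBINT \<xi>. (cis (- (\<xi> * y)) * M \<xi> / (2 * pi)) * cis (\<xi> * x)))"
    by (rule Fubini_bounded_kernel[OF iM schwartz_integrable[OF p], where B = 1]) auto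
  also have "(\<lambda>x. LBINT \<xi>. (cis (- (\<xi> * y)) * M \<xi> / (2 * pi)) * cis (\<xi> * x)) = (\<lambda>x. inv_fourier M (x - y))"
  proof
    fix x
    have c: "cis (- (\<xi> * y)) * cis (\<xi> * x) = cis ((x - y) * \<xi>)" for \<xi> by (simp add: cis_mult algebra_simps)
    have "(LBINT \<xi>. (cis (- (\<xi> * y)) * M \<xi> / (2 * pi)) * cis (\<xi> * x)) = (LBINT \<xi>. cis ((x - y) * \<xi>) * M \<xi> / (2 * pi))"
      by (intro Bochner_Integration.integral_cong refl) (simp flip: c)
    then show "(LBINT \<xi>. (cis (- (\<xi> * y)) * M \<xi> / (2 * pi)) * cis (\<xi> * x)) = inv_fourier M (x - y)"
      by (simp add: inv_fourier_def)
  qed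
  finally show ?thesis .
qed

lemma tempered_linear:
  "T \<in> tempered \<Longrightarrow> \<phi> \<in> schwartz \<Longrightarrow> \<psi> \<in> schwartz \<Longrightarrow> T (\<lambda>x. a * \<phi> x + b * \<psi> x) = a * T \<phi> + b * T \<psi>"
  unfolding tempered_def by blast

lemma tempered_bound:
  assumes "T \<in> tempered"
  shows "\<exists>C N. C \<ge> 0 \<and> (\<forall>\<phi>\<in>schwartz. norm (T \<phi>) \<le> C * schwartz_norm N \<phi>)"
proof -
  from assms obtain N C where *: "\<forall>\<phi>\<in>schwartz. norm (T \<phi>) \<le> C * schwartz_norm N \<phi>"
    unfolding tempered_def schwartz_norm_def by blast
  have "norm (T \<phi>) \<le> \<bar>C\<bar> * schwartz_norm N \<phi>" if "\<phi> \<in> schwartz" for \<phi>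
    using *[rule_format, OF that] by (rule order_trans) (simp add: mult_right_mono schwartz_norm_nonneg that)
  then show ?thesis by (intro exI[of _ "\<bar>C\<bar>"] exI[of _ N]) auto
qed

lemma temperedI:
  assumes "\<And>\<phi> \<psi> a b. \<phi> \<in> schwartz \<Longrightarrow> \<psi> \<in> schwartz \<Longrightarrow> T (\<lambda>x. a * \<phi> x + b * \<psi> x) = a * T \<phi> + b * T \<psi>"
    and "\<And>\<phi>. \<phi> \<in> schwartz \<Longrightarrow> norm (T \<phi>) \<le> C * schwartz_norm N \<phi>"
  shows "T \<in> tempered"
  unfolding tempered_def
proof (intro CollectI conjI)
  show "\<exists>N C. \<forall>\<phi>\<in>schwartz. cmod (T \<phi>) \<le> C * (\<Sum>m\<le>N. \<Sum>n\<le>N. schwartz_seminorm m n \<phi>)"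
    using assms(2) unfolding schwartz_norm_def by blast
qed (use assms(1) in blast)

lemma tempered_fourier_multiplier:
  assumes "T \<in> tempered" "slow_family {m}"
  shows "fourier_multiplier m T \<in> tempered"
proof -
  from tempered_bound[OF assms(1)] obtain C N where C: "C \<ge> 0" "\<forall>\<phi>\<in>schwartz. norm (T \<phi>) \<le> C * schwartz_norm N \<phi>" by blast
  from tame_bound[OF tame_mult_op1[OF assms(2)], of N] obtain D M where D: "D \<ge> 0"
    "\<forall>\<phi>\<in>schwartz. schwartz_norm N (mult_op m \<phi>) \<le> D * schwartz_norm M \<phi>" by auto
  show ?thesis
    unfolding fourier_multiplier_eq
  proof (rule temperedI)
    fix \<phi> \<psi> :: "real \<Rightarrow> complex" and a b assume "\<phi> \<in> schwartz" "\<psi> \<in> schwartz"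
    then show "T (mult_op m (\<lambda>x. a * \<phi> x + b * \<psi> x)) = a * T (mult_op m \<phi>) + b * T (mult_op m \<psi>)"
      using assms by (simp add: mult_op_linear tempered_linear schwartz_mult_op)
  next
    fix \<phi> assume p: "\<phi> \<in> schwartz"
    have "norm (T (mult_op m \<phi>)) \<le> C * schwartz_norm N (mult_op m \<phi>)"
      using C(2) schwartz_mult_op[OF assms(2) p] by blast
    also have "\<dots> \<le> C * (D * schwartz_norm M \<phi>)" using C(1) D(2) p by (intro mult_left_mono) auto
    finally show "norm (T (mult_op m \<phi>)) \<le> C * D * schwartz_norm M \<phi>" by (simp add: mult.assoc)
  qed
qed

lemma tempered_diff:
  assumes "T \<in> tempered" "U \<in> tempered" shows "(\<lambda>\<phi>. T \<phi> - U \<phi>) \<in> tempered"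
proof -
  from tempered_bound[OF assms(1)] obtain C N where C: "C \<ge> 0" "\<forall>\<phi>\<in>schwartz. norm (T \<phi>) \<le> C * schwartz_norm N \<phi>" by blast
  from tempered_bound[OF assms(2)] obtain D M where D: "D \<ge> 0" "\<forall>\<phi>\<in>schwartz. norm (U \<phi>) \<le> D * schwartz_norm M \<phi>" by blast
  show ?thesis
  proof (rule temperedI)
    fix \<phi> assume p: "\<phi> \<in> schwartz"
    have "norm (T \<phi> - U \<phi>) \<le> C * schwartz_norm N \<phi> + D * schwartz_norm M \<phi>"
      using C(2) D(2) p norm_triangle_ineq4[of "T \<phi>" "U \<phi>"] by fastforce
    also have "\<dots> \<le> C * schwartz_norm (max N M) \<phi> + D * schwartz_norm (max N M) \<phi>"
      using C(1) D(1) p by (intro add_mono mult_left_mono schwartz_norm_mono) auto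
    finally show "norm (T \<phi> - U \<phi>) \<le> (C + D) * schwartz_norm (max N M) \<phi>" by (simp add: distrib_right)
  qed (use assms in \<open>simp add: tempered_linear algebra_simps\<close>)
qed

section \<open>The decomposition into frequency boxes\<close>

lemma card_int_interval:
  fixes x R :: real
  assumes "R \<ge> 0"
  shows "finite {k::int. \<bar>x - of_int k\<bar> \<le> R}" "card {k::int. \<bar>x - of_int k\<bar> \<le> R} \<le> 2 * R + 1"
proof -
  have e: "{k::int. \<bar>x - of_int k\<bar> \<le> R} = {\<lceil>x - R\<rceil>..\<lfloor>x + R\<rfloor>}"
    by (auto simp: abs_le_iff ceiling_le_iff le_floor_iff algebra_simps)
  show "finite {k::int. \<bar>x - of_int k\<bar> \<le> R}" unfolding e by simp
  have "real (nat (\<lfloor>x + R\<rfloor> - \<lceil>x - R\<rceil> + 1)) \<le> 2 * R + 1"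
    using of_int_floor_le[of "x + R"] le_of_int_ceiling[of "x - R"] assms
      order_trans[of "real_of_int \<lfloor>x + R\<rfloor> - real_of_int \<lceil>x - R\<rceil>" "(x + R) - (x - R)" "2 * R", OF diff_mono]
    by (cases "\<lfloor>x + R\<rfloor> - \<lceil>x - R\<rceil> + 1 \<ge> 0") (auto simp: of_nat_nat)
  then show "card {k::int. \<bar>x - of_int k\<bar> \<le> R} \<le> 2 * R + 1" unfolding e by simp
qed

text \<open>The unit partition together with a radius \<open>\<rho>\<close> of an interval around
\<open>0\<close> that contains its support.\<close>

locale freq_partition =
  fixes \<sigma> :: "real \<Rightarrow> real" and \<rho> :: real
  assumes unit_partition: "unit_partition \<sigma>"
    and \<rho>_pos: "0 < \<rho>"
    and \<sigma>_supp: "\<rho> < \<bar>\<xi>\<bar> \<Longrightarrow> \<sigma> \<xi> = 0"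

lemma unit_partition_freq_partition:
  assumes "unit_partition \<sigma>" shows "\<exists>\<rho>. freq_partition \<sigma> \<rho>"
proof -
  from assms obtain r where r: "r > 0" "\<forall>\<xi>. \<xi> \<notin> {- 1/2 - r..1/2 + r} \<longrightarrow> \<sigma> \<xi> = 0"
    unfolding unit_partition_def by blast
  have "freq_partition \<sigma> (1/2 + r)"
    by standard (use assms r in \<open>auto simp: abs_if split: if_splits\<close>)
  then show ?thesis by blast
qed

context freq_partition
begin

text \<open>The symbol of the frequency box \<open>k\<close>, as a complex function.\<close>

definition box_symbol :: "int \<Rightarrow> real \<Rightarrow> complex" where
  "box_symbol k = (\<lambda>\<xi>. complex_of_real (\<sigma> (\<xi> - of_int k)))"

lemma \<sigma>_nonneg: "0 \<le> \<sigma> \<xi>" and \<sigma>_smooth: "smooth \<sigma>"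
  and \<sigma>_has_sum: "((\<lambda>k::int. \<sigma> (\<xi> - of_int k)) has_sum 1) UNIV"
  using unit_partition by (auto simp: unit_partition_def)

lemma sum_\<sigma>_le_1: "finite K \<Longrightarrow> (\<Sum>k\<in>K. \<sigma> (\<xi> - of_int k)) \<le> 1"
  by (rule has_sum_mono2[OF has_sum_finite \<sigma>_has_sum]) (auto simp: \<sigma>_nonneg)

lemma sum_\<sigma>_eq_1:
  assumes "finite K" "\<And>k::int. \<bar>\<xi> - of_int k\<bar> \<le> \<rho> \<Longrightarrow> k \<in> K"
  shows "(\<Sum>k\<in>K. \<sigma> (\<xi> - of_int k)) = 1"
proof -
  have "((\<lambda>k::int. \<sigma> (\<xi> - of_int k)) has_sum 1) K"
    by (rule has_sum_cong_neutral[THEN iffD1, OF _ _ _ \<sigma>_has_sum[of \<xi>]]) (use assms(2) \<sigma>_supp not_le in \<open>auto\<close>)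
  then show ?thesis using has_sum_finite[OF assms(1)] has_sum_unique by blast
qed

lemma box_symbol_supp: "\<rho> < \<bar>\<xi> - of_int k\<bar> \<Longrightarrow> box_symbol k \<xi> = 0"
  by (simp add: box_symbol_def \<sigma>_supp)

lemma box_symbol_conv: "box_symbol k = (\<lambda>\<xi>. box_symbol 0 (1 * \<xi> + (- of_int k)))"
  by (simp add: box_symbol_def)

lemma smooth_box_symbol0: "smooth (box_symbol 0)"
  using smooth_linear(1)[OF bounded_linear_of_real \<sigma>_smooth] by (simp add: box_symbol_def)

lemma smooth_box_symbol: "smooth (box_symbol k)"
  by (subst box_symbol_conv) (rule smooth_affine(1)[OF smooth_box_symbol0])

lemma nderiv_box_symbol: "nderiv n (box_symbol k) \<xi> = nderiv n (box_symbol 0) (\<xi> - of_int k)"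
  by (subst box_symbol_conv, subst smooth_affine(2)[OF smooth_box_symbol0]) simp

lemma nderiv_box_symbol_supp: "\<rho> < \<bar>\<xi> - of_int k\<bar> \<Longrightarrow> nderiv n (box_symbol k) \<xi> = 0"
  by (subst nderiv_box_symbol, rule nderiv_eq_0_outside[of \<rho>]) (auto intro: box_symbol_supp[of _ 0, simplified])

lemma schwartz_box_symbol: "box_symbol k \<in> schwartz"
proof (rule compact_support_schwartz[OF smooth_box_symbol])
  fix \<xi> :: real assume "\<rho> + \<bar>of_int k\<bar> < \<bar>\<xi>\<bar>"
  then have "\<rho> < \<bar>\<xi> - of_int k\<bar>" by linarith
  then show "box_symbol k \<xi> = 0" by (rule box_symbol_supp)
qed

lemma smooth_sum: "finite K \<Longrightarrow> (\<And>k. k \<in> K \<Longrightarrow> smooth (f k :: real \<Rightarrow> complex)) \<Longrightarrow>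
  smooth (\<lambda>x. \<Sum>k\<in>K. f k x) \<and> nderiv n (\<lambda>x. \<Sum>k\<in>K. f k x) x = (\<Sum>k\<in>K. nderiv n (f k) x)"
proof (induction K arbitrary: x rule: finite_induct)
  case empty
  have "nderiv n (\<lambda>x. 0 :: complex) = (\<lambda>x. 0)" for n by (induction n) (auto simp: nderiv_Suc)
  then show ?case by (simp add: smooth_def)
next
  case (insert k K)
  then have "smooth (f k)" "smooth (\<lambda>x. \<Sum>k\<in>K. f k x)" by auto
  moreover from this have "nderiv n (\<lambda>x. f k x + (\<Sum>k\<in>K. f k x)) = (\<lambda>x. nderiv n (f k) x + nderiv n (\<lambda>x. \<Sum>k\<in>K. f k x) x)"
    by (intro nderiv_add) (auto simp: smooth_iff)
  ultimately show ?case using insert by (simp add: smooth_add)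
qed

text \<open>Finite sums of box symbols are bounded with all derivatives, uniformly in the index set, since at
most \<open>2 \<rho> + 1\<close> boxes overlap at a point.\<close>

lemma slow_family_box_sums: "slow_family {\<lambda>\<xi>. \<Sum>k\<in>K. box_symbol k \<xi> |K. finite K}"
proof (rule slow_familyI)
  fix a assume "a \<in> {\<lambda>\<xi>. \<Sum>k\<in>K. box_symbol k \<xi> |K. finite K}"
  then obtain K where K: "finite K" "a = (\<lambda>\<xi>. \<Sum>k\<in>K. box_symbol k \<xi>)" by blast
  show "smooth a" unfolding K(2) using smooth_sum[OF K(1), of box_symbol] smooth_box_symbol by blast
next
  fix n
  define B where "B = schwartz_seminorm 0 n (box_symbol 0)"
  have B: "norm (nderiv n (box_symbol 0) \<xi>) \<le> B" for \<xi>
    using schwartz_seminorm_upper[OF schwartz_box_symbol[of 0], of \<xi> 0 n] by (simp add: B_def)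
  have "norm (nderiv n (\<lambda>\<xi>. \<Sum>k\<in>K. box_symbol k \<xi>) \<xi>) \<le> (2 * \<rho> + 1) * B" if K: "finite K" for K \<xi>
  proof -
    let ?I = "{k::int. \<bar>\<xi> - of_int k\<bar> \<le> \<rho>}"
    have I: "finite ?I" "card ?I \<le> 2 * \<rho> + 1" using card_int_interval[of \<rho> \<xi>] \<rho>_pos by auto
    have "nderiv n (\<lambda>\<xi>. \<Sum>k\<in>K. box_symbol k \<xi>) \<xi> = (\<Sum>k\<in>K. nderiv n (box_symbol k) \<xi>)"
      using smooth_sum[OF K, of box_symbol] smooth_box_symbol by blast
    also have "\<dots> = (\<Sum>k\<in>K \<inter> ?I. nderiv n (box_symbol k) \<xi>)"
      by (rule sum.mono_neutral_right) (use K nderiv_box_symbol_supp[of \<xi> _ n] in \<open>auto simp: not_le\<close>)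
    also have "norm \<dots> \<le> (\<Sum>k\<in>K \<inter> ?I. B)" by (intro sum_norm_le) (subst nderiv_box_symbol, rule B)
    also have "\<dots> = real (card (K \<inter> ?I)) * B" by simp
    also have "\<dots> \<le> real (card ?I) * B" using I(1) order_trans[OF norm_ge_zero B]
      by (intro mult_right_mono of_nat_mono card_mono) auto
    also have "\<dots> \<le> (2 * \<rho> + 1) * B" using I(2) order_trans[OF norm_ge_zero B] by (intro mult_right_mono) auto
    finally show ?thesis .
  qed
  then show "\<exists>C N. \<forall>a\<in>{\<lambda>\<xi>. \<Sum>k\<in>K. box_symbol k \<xi> |K. finite K}. \<forall>x. norm (nderiv n a x) \<le> C * (1 + \<bar>x\<bar>) ^ N"
    by (intro exI[of _ "(2 * \<rho> + 1) * B"] exI[of _ 0]) auto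
qed

lemma slow_family_box_sum: "finite K \<Longrightarrow> slow_family {\<lambda>\<xi>. \<Sum>k\<in>K. box_symbol k \<xi>}"
  by (rule slow_family_subset[OF slow_family_box_sums]) blast

text \<open>The truncation to the frequency boxes \<open>-n, \<dots>, n\<close>; it equals \<open>1\<close> on
an interval that grows with \<open>n\<close>.\<close>

definition trunc :: "nat \<Rightarrow> real \<Rightarrow> complex" where
  "trunc n \<xi> = (\<Sum>k\<in>{- int n..int n}. box_symbol k \<xi>)"

lemma trunc_eq_1: assumes "\<bar>\<xi>\<bar> + \<rho> < real n + 1" shows "trunc n \<xi> = 1"
proof -
  have "(\<Sum>k\<in>{- int n..int n}. \<sigma> (\<xi> - of_int k)) = 1"
  proof (rule sum_\<sigma>_eq_1)
    fix k :: int assume "\<bar>\<xi> - of_int k\<bar> \<le> \<rho>"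
    with assms have "\<bar>real_of_int k\<bar> < real n + 1" by linarith
    then show "k \<in> {- int n..int n}" by auto
  qed simp
  then show ?thesis unfolding trunc_def box_symbol_def by (metis of_real_1 of_real_sum)
qed

lemma schwartz_trunc: "trunc n \<in> schwartz"
  unfolding trunc_def[abs_def] by (intro schwartz_sum schwartz_box_symbol)

lemma slow_family_trunc: "slow_family {trunc n}"
  by (intro schwartz_slow_family schwartz_trunc)

lemma slow_family_tail: "slow_family (range (\<lambda>n \<xi>. 1 - trunc n \<xi>))"
proof (rule slow_family_addI[OF slow_family_const1[of 1]])
  show "slow_family (range (\<lambda>n \<xi>. - 1 * trunc n \<xi>))"
  proof (rule slow_family_multI[OF slow_family_const1[of "- 1"] slow_family_box_sums])
    fix c :: "real \<Rightarrow> complex" assume "c \<in> range (\<lambda>n \<xi>. - 1 * trunc n \<xi>)"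
    then obtain n where c: "c = (\<lambda>\<xi>. - 1 * trunc n \<xi>)" by (rule rangeE)
    have 1: "trunc n \<in> {\<lambda>\<xi>. \<Sum>k\<in>K. box_symbol k \<xi> |K. finite K}"
      by (intro CollectI exI[of _ "{- int n..int n}"]) (auto simp: trunc_def[abs_def])
    show "\<exists>a\<in>{\<lambda>x. - 1}. \<exists>b\<in>{\<lambda>\<xi>. \<Sum>k\<in>K. box_symbol k \<xi> |K. finite K}. c = (\<lambda>x. a x * b x)"
      by (intro bexI[of _ "\<lambda>x. - 1"] bexI[OF _ 1]) (auto simp: c)
  qed
  fix c :: "real \<Rightarrow> complex" assume "c \<in> range (\<lambda>n \<xi>. 1 - trunc n \<xi>)"
  then obtain n where c: "c = (\<lambda>\<xi>. 1 - trunc n \<xi>)" by (rule rangeE)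
  show "\<exists>a\<in>{\<lambda>x. 1}. \<exists>b\<in>range (\<lambda>n \<xi>. - 1 * trunc n \<xi>). c = (\<lambda>x. a x + b x)"
    by (intro bexI[of _ "\<lambda>x. 1"] bexI[of _ "\<lambda>x. - 1 * trunc n x"] rangeI) (auto simp: c)
qed

text \<open>Where \<open>1 - trunc n\<close> does not vanish, \<open>\<bar>\<xi>\<bar>\<close> is at least
\<open>n + 1 - \<rho>\<close>, so that one further power of \<open>\<xi>\<close> in the norm gives
decay in \<open>n\<close>.\<close>

lemma schwartz_norm_tail:
  assumes "\<psi> \<in> schwartz"
  shows "(\<lambda>n. schwartz_norm L (\<lambda>\<xi>. (1 - trunc n \<xi>) * \<psi> \<xi>)) \<longlonglongrightarrow> 0"
proof -
  let ?A = "(\<lambda>a \<phi> x. a x * \<phi> x) ` range (\<lambda>n \<xi>. 1 - trunc n \<xi>)"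
  from tame_bound[OF tame_mult_image[OF slow_family_tail], of "Suc L"] obtain C N where C: "C \<ge> 0"
    "\<forall>P\<in>?A. \<forall>\<phi>\<in>schwartz. schwartz_norm (Suc L) (P \<phi>) \<le> C * schwartz_norm N \<phi>" by blast
  define D where "D = C * schwartz_norm N \<psi>"
  have S: "(\<lambda>\<xi>. (1 - trunc n \<xi>) * \<psi> \<xi>) \<in> schwartz" for n
    by (intro schwartz_mult_slow slow_family_single[OF slow_family_tail] assms) simp
  have D: "schwartz_norm (Suc L) (\<lambda>\<xi>. (1 - trunc n \<xi>) * \<psi> \<xi>) \<le> D" for n
  proof -
    have "(\<lambda>\<phi> x. (1 - trunc n x) * \<phi> x) \<in> ?A" by (rule imageI[OF rangeI])
    from C(2)[rule_format, OF this assms] show ?thesis by (simp add: D_def)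
  qed
  have D0: "D \<ge> 0" using schwartz_norm_nonneg[OF S] D by (meson order_trans)
  have b: "schwartz_norm L (\<lambda>\<xi>. (1 - trunc n \<xi>) * \<psi> \<xi>) \<le> (real L + 1)\<^sup>2 * (D / (real n + 1 - \<rho>))"
    if n: "real n + 1 > \<rho>" for n
  proof (rule schwartz_norm_least)
    fix m j x assume mj: "m \<le> L" "j \<le> L"
    let ?f = "\<lambda>\<xi>. (1 - trunc n \<xi>) * \<psi> \<xi>"
    show "\<bar>x\<bar> ^ m * norm (nderiv j ?f x) \<le> D / (real n + 1 - \<rho>)"
    proof (cases "\<bar>x\<bar> + \<rho> < real n + 1")
      case True
      have "open {x::real. \<bar>x\<bar> + \<rho> < real n + 1}" by (intro open_Collect_less continuous_intros)
      then have "nderiv j ?f x = 0"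
        by (rule nderiv_eq_0_open) (use True trunc_eq_1 in auto)
      then show ?thesis using D0 n by simp
    next
      case False
      have "\<bar>x\<bar> ^ m * norm (nderiv j ?f x) * (real n + 1 - \<rho>) \<le> \<bar>x\<bar> ^ m * norm (nderiv j ?f x) * \<bar>x\<bar>"
        using False by (intro mult_left_mono) auto
      also have "\<dots> = \<bar>x\<bar> ^ Suc m * norm (nderiv j ?f x)" by simp
      also have "\<dots> \<le> schwartz_norm (Suc L) ?f" using mj by (intro schwartz_norm_upper S) auto
      also have "\<dots> \<le> D" by (rule D)
      finally show ?thesis using n by (simp add: pos_le_divide_eq)
    qed
  qed
  show ?thesis
  proof (rule tendsto_sandwich[of "\<lambda>n. 0" _ _ "\<lambda>n. (real L + 1)\<^sup>2 * (D / (real n + 1 - \<rho>))"])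
    have "eventually (\<lambda>n. real n > \<rho>) sequentially"
      using filterlim_real_sequentially by (auto simp: filterlim_at_top_dense)
    then show "\<forall>\<^sub>F n in sequentially. schwartz_norm L (\<lambda>\<xi>. (1 - trunc n \<xi>) * \<psi> \<xi>) \<le> (real L + 1)\<^sup>2 * (D / (real n + 1 - \<rho>))"
      by eventually_elim (use b in auto)
    show "(\<lambda>n. (real L + 1)\<^sup>2 * (D / (real n + 1 - \<rho>))) \<longlonglongrightarrow> 0" by real_asymp
  qed (auto intro!: always_eventually schwartz_norm_nonneg S)
qed

text \<open>Every tempered distribution is the limit of its partial sums over frequency boxes.\<close>

lemma tempered_trunc_tendsto:
  assumes "T \<in> tempered" "\<phi> \<in> schwartz"
  shows "(\<lambda>n. T (mult_op (trunc n) \<phi>)) \<longlonglongrightarrow> T \<phi>"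
proof -
  from tempered_bound[OF assms(1)] obtain C N where C: "C \<ge> 0" "\<forall>\<phi>\<in>schwartz. norm (T \<phi>) \<le> C * schwartz_norm N \<phi>" by blast
  from tame_bound[OF tame_fourier, of N] obtain D M where D: "D \<ge> 0"
    "\<forall>\<phi>\<in>schwartz. schwartz_norm N (fourier \<phi>) \<le> D * schwartz_norm M \<phi>" by auto
  let ?\<psi> = "inv_fourier \<phi>"
  have b: "norm (T \<phi> - T (mult_op (trunc n) \<phi>)) \<le> C * (D * schwartz_norm M (\<lambda>\<xi>. (1 - trunc n \<xi>) * ?\<psi> \<xi>))" for n
  proof -
    have S: "(\<lambda>\<xi>. (1 - trunc n \<xi>) * ?\<psi> \<xi>) \<in> schwartz"
      by (intro schwartz_mult_slow slow_family_single[OF slow_family_tail] assms schwartz_inv_fourier) simp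
    have "fourier (\<lambda>\<xi>. (1 - trunc n \<xi>) * ?\<psi> \<xi>) = mult_op (\<lambda>\<xi>. 1 * 1 + (- 1) * trunc n \<xi>) \<phi>"
      by (simp add: mult_op_def)
    also have "\<dots> = (\<lambda>x. 1 * mult_op (\<lambda>\<xi>. 1) \<phi> x + (- 1) * mult_op (trunc n) \<phi> x)"
      by (intro mult_op_add_symbol slow_family_const1 slow_family_trunc assms)
    finally have e: "fourier (\<lambda>\<xi>. (1 - trunc n \<xi>) * ?\<psi> \<xi>) = (\<lambda>x. 1 * \<phi> x + (- 1) * mult_op (trunc n) \<phi> x)"
      by (simp add: mult_op_1 assms)
    have "T \<phi> - T (mult_op (trunc n) \<phi>) = T (fourier (\<lambda>\<xi>. (1 - trunc n \<xi>) * ?\<psi> \<xi>))"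
      unfolding e using tempered_linear[OF assms schwartz_mult_op[OF slow_family_trunc assms(2)], of 1 "- 1" n] by simp
    also have "norm \<dots> \<le> C * schwartz_norm N (fourier (\<lambda>\<xi>. (1 - trunc n \<xi>) * ?\<psi> \<xi>))"
      using C(2) schwartz_fourier[OF S] by blast
    also have "\<dots> \<le> C * (D * schwartz_norm M (\<lambda>\<xi>. (1 - trunc n \<xi>) * ?\<psi> \<xi>))"
      using C(1) D(2) S by (intro mult_left_mono) auto
    finally show ?thesis .
  qed
  have "(\<lambda>n. C * (D * schwartz_norm M (\<lambda>\<xi>. (1 - trunc n \<xi>) * ?\<psi> \<xi>))) \<longlonglongrightarrow> C * (D * 0)"
    by (intro tendsto_mult tendsto_const schwartz_norm_tail schwartz_inv_fourier assms)
  then have "(\<lambda>n. C * (D * schwartz_norm M (\<lambda>\<xi>. (1 - trunc n \<xi>) * ?\<psi> \<xi>))) \<longlonglongrightarrow> 0" by simp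
  then have "(\<lambda>n. T \<phi> - T (mult_op (trunc n) \<phi>)) \<longlonglongrightarrow> 0"
    by (rule Lim_null_comparison[OF always_eventually[OF allI[OF b]]])
  then have "(\<lambda>n. T \<phi> - (T \<phi> - T (mult_op (trunc n) \<phi>))) \<longlonglongrightarrow> T \<phi> - 0"
    by (intro tendsto_diff tendsto_const)
  then show ?thesis by simp
qed

end

section \<open>Elements of the modulation space are bounded functions\<close>

lemma integrable_bounded_mult:
  fixes f \<phi> :: "real \<Rightarrow> complex"
  assumes [measurable]: "f \<in> borel_measurable borel" and f: "AE x in lborel. norm (f x) \<le> B"
    and p: "integrable lborel \<phi>"
  shows "integrable lborel (\<lambda>x. f x * \<phi> x)" "norm (LBINT x. f x * \<phi> x) \<le> B * (LBINT x. norm (\<phi> x))"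
proof -
  have [measurable]: "\<phi> \<in> borel_measurable borel" using p by auto
  have b: "AE x in lborel. norm (f x * \<phi> x) \<le> B * norm (\<phi> x)"
    using f by eventually_elim (simp add: norm_mult mult_right_mono)
  have i: "integrable lborel (\<lambda>x. B * norm (\<phi> x))" using p by simp
  show 1: "integrable lborel (\<lambda>x. f x * \<phi> x)"
    by (rule Bochner_Integration.integrable_bound[OF i]) (use b in \<open>auto elim!: eventually_mono\<close>)
  have "norm (LBINT x. f x * \<phi> x) \<le> (LBINT x. norm (f x * \<phi> x))" by (rule integral_norm_bound)
  also have "\<dots> \<le> (LBINT x. B * norm (\<phi> x))"
    by (rule integral_mono_AE[OF integrable_norm[OF 1] i b])
  finally show "norm (LBINT x. f x * \<phi> x) \<le> B * (LBINT x. norm (\<phi> x))" by simp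
qed

lemma filterlim_int_intervals: "filterlim (\<lambda>n::nat. {- int n..int n}) (finite_subsets_at_top UNIV) sequentially"
  unfolding filterlim_finite_subsets_at_top
proof (intro allI impI)
  fix X :: "int set" assume X: "finite X \<and> X \<subseteq> UNIV"
  define m where "m = Max (abs ` insert 0 X)"
  have m: "\<bar>x\<bar> \<le> m" if "x \<in> X" for x unfolding m_def using X that by (intro Max_ge) auto
  have "\<forall>\<^sub>F n in sequentially. n \<ge> nat m" by (rule eventually_ge_at_top)
  then show "\<forall>\<^sub>F n in sequentially. finite {- int n..int n} \<and> X \<subseteq> {- int n..int n} \<and> {- int n..int n} \<subseteq> UNIV"
  proof eventually_elim
    case (elim n)
    have "x \<in> {- int n..int n}" if "x \<in> X" for x using m[OF that] elim by auto
    then show ?case by auto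
  qed
qed

lemma mod_norm_eq_SUP:
  "mod_norm \<sigma> f = (SUP F\<in>{F. finite F}. \<Sum>k\<in>F. Lp_norm \<infinity> (freq_box \<sigma> k f))"
  unfolding mod_norm_def by (subst nonneg_infsum_complete) auto

lemma sum_le_mod_norm: "finite F \<Longrightarrow> (\<Sum>k\<in>F. Lp_norm \<infinity> (freq_box \<sigma> k f)) \<le> mod_norm \<sigma> f"
  unfolding mod_norm_eq_SUP by (rule SUP_upper) simp

lemma Linf_le_mod_norm: "Lp_norm \<infinity> (freq_box \<sigma> k f) \<le> mod_norm \<sigma> f"
  using sum_le_mod_norm[of "{k}"] by simp

lemma represents_measurable: "represents g T \<Longrightarrow> g \<in> borel_measurable borel"
  by (simp add: represents_def)

lemma Linf_finite_represents: "Lp_norm p T < \<infinity> \<Longrightarrow> represents (density_of T) T"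
proof -
  assume "Lp_norm p T < \<infinity>"
  then have "\<exists>g. represents g T" by (rule contrapos_pp) (simp add: Lp_norm_def)
  then show ?thesis unfolding density_of_def by (rule someI_ex)
qed

context freq_partition
begin

lemma freq_box_eq: "freq_box \<sigma> k T = (\<lambda>\<phi>. T (mult_op (box_symbol k) \<phi>))"
  by (simp add: freq_box_def fourier_multiplier_eq box_symbol_def)

lemma slow_family_box_symbol: "slow_family {box_symbol k}"
  by (intro schwartz_slow_family schwartz_box_symbol)

text \<open>A smooth approximation of the indicator function of \<open>{a..b}\<close>: the unit partition rescaled to the
mesh \<open>1 / n\<close> and summed over the mesh points in the interval.\<close>

definition bump :: "nat \<Rightarrow> real \<Rightarrow> real \<Rightarrow> real \<Rightarrow> complex" where
  "bump n a b x = (\<Sum>k\<in>{\<lceil>real n * a\<rceil>..\<lfloor>real n * b\<rfloor>}. box_symbol k (real n * x))"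

lemma schwartz_bump: assumes "n > 0" shows "bump n a b \<in> schwartz"
  unfolding bump_def[abs_def]
proof (rule schwartz_sum)
  fix k
  show "(\<lambda>x. box_symbol k (real n * x)) \<in> schwartz"
  proof (rule compact_support_schwartz)
    show "smooth (\<lambda>x. box_symbol k (real n * x))" using smooth_affine(1)[OF smooth_box_symbol, of k "real n" 0] by simp
    fix x assume x: "\<rho> + \<bar>of_int k\<bar> < \<bar>x\<bar>"
    have "1 * \<bar>x\<bar> \<le> real n * \<bar>x\<bar>" using assms by (intro mult_right_mono) auto
    then have "\<bar>x\<bar> \<le> \<bar>real n * x\<bar>" by (simp add: abs_mult)
    with x have "\<rho> < \<bar>real n * x - of_int k\<bar>" by linarith
    then show "box_symbol k (real n * x) = 0" by (rule box_symbol_supp)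
  qed
qed

lemma bump_real: "bump n a b x = complex_of_real (\<Sum>k\<in>{\<lceil>real n * a\<rceil>..\<lfloor>real n * b\<rfloor>}. \<sigma> (real n * x - of_int k))"
  by (simp add: bump_def box_symbol_def)

lemma norm_bump_le: "norm (bump n a b x) \<le> 1"
  unfolding bump_real norm_of_real using sum_\<sigma>_le_1[of "{\<lceil>real n * a\<rceil>..\<lfloor>real n * b\<rfloor>}" "real n * x"]
  by (simp add: sum_nonneg \<sigma>_nonneg)

lemma bump_tendsto:
  assumes "x \<noteq> a" "x \<noteq> b"
  shows "(\<lambda>n. bump (Suc n) a b x) \<longlonglongrightarrow> indicator {a..b} x"
proof (rule tendsto_eventually)
  define d where "d = min \<bar>x - a\<bar> \<bar>x - b\<bar>"
  have d: "d > 0" "d \<le> \<bar>x - a\<bar>" "d \<le> \<bar>x - b\<bar>" using assms by (auto simp: d_def)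
  have "filterlim (\<lambda>n. real (Suc n) * d) at_top sequentially"
    by (intro filterlim_at_top_mult_tendsto_pos[OF tendsto_const] d)
       (rule filterlim_compose[OF filterlim_real_sequentially filterlim_Suc])
  then have "\<forall>\<^sub>F n in sequentially. real (Suc n) * d > \<rho>" by (simp add: filterlim_at_top_dense)
  then show "\<forall>\<^sub>F n in sequentially. bump (Suc n) a b x = indicator {a..b} x"
  proof eventually_elim
    case (elim n)
    define N where "N = real (Suc n)"
    have N: "N > 0" "N * d > \<rho>" using elim by (auto simp: N_def)
    have "N * d \<le> N * \<bar>x - a\<bar>" "N * d \<le> N * \<bar>x - b\<bar>"
      using N(1) d by (auto intro!: mult_left_mono)
    then have "\<rho> < N * \<bar>x - a\<bar>" "\<rho> < N * \<bar>x - b\<bar>"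
      using N(2) by (auto intro: less_le_trans)
    then have da: "\<rho> < N * \<bar>x - a\<bar>" "\<rho> < N * \<bar>x - b\<bar>" by auto
    have bump: "bump (Suc n) a b x = complex_of_real (\<Sum>k\<in>{\<lceil>N * a\<rceil>..\<lfloor>N * b\<rfloor>}. \<sigma> (N * x - of_int k))"
      by (simp only: bump_real N_def)
    show ?case
    proof (cases "x \<in> {a..b}")
      case True
      have "(\<Sum>k\<in>{\<lceil>N * a\<rceil>..\<lfloor>N * b\<rfloor>}. \<sigma> (N * x - of_int k)) = 1"
      proof (rule sum_\<sigma>_eq_1)
        fix k :: int assume k: "\<bar>N * x - of_int k\<bar> \<le> \<rho>"
        have "N * \<bar>x - a\<bar> = N * x - N * a" "N * \<bar>x - b\<bar> = N * b - N * x"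
          using True by (auto simp: algebra_simps)
        with da have "\<rho> < N * x - N * a" "\<rho> < N * b - N * x" by metis+
        with k have "N * a \<le> of_int k" "of_int k \<le> N * b" by linarith+
        then show "k \<in> {\<lceil>N * a\<rceil>..\<lfloor>N * b\<rfloor>}" by (simp add: ceiling_le_iff le_floor_iff)
      qed simp
      then show ?thesis using True unfolding bump by simp
    next
      case False
      have "(\<Sum>k\<in>{\<lceil>N * a\<rceil>..\<lfloor>N * b\<rfloor>}. \<sigma> (N * x - of_int k)) = 0"
      proof (intro sum.neutral ballI)
        fix k :: int assume "k \<in> {\<lceil>N * a\<rceil>..\<lfloor>N * b\<rfloor>}"
        then have k: "N * a \<le> of_int k" "of_int k \<le> N * b" by (simp_all add: ceiling_le_iff le_floor_iff)
        show "\<sigma> (N * x - of_int k) = 0"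
        proof (rule \<sigma>_supp, cases "x < a")
          case True
          then have "N * \<bar>x - a\<bar> = N * a - N * x" by (simp add: algebra_simps)
          with da have "\<rho> < N * a - N * x" by metis
          with k show "\<rho> < \<bar>N * x - of_int k\<bar>" by linarith
        next
          case F: False
          then have "x > b" using False by auto
          then have "N * \<bar>x - b\<bar> = N * x - N * b" by (simp add: algebra_simps)
          with da have "\<rho> < N * x - N * b" by metis
          with k show "\<rho> < \<bar>N * x - of_int k\<bar>" by linarith
        qed
      qed
      then show ?thesis using False unfolding bump by simp
    qed
  qed
qed

text \<open>Intervals generate the Borel sets, and their indicator functions are limits of bumps.\<close>

lemma integrable_zero_distr_AE_0:
  assumes d: "integrable lborel d" and z: "\<And>\<phi>. \<phi> \<in> schwartz \<Longrightarrow> (LBINT x. d x * \<phi> x) = 0"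
  shows "AE x in lborel. d x = (0 :: complex)"
proof (rule sigma_finite_measure.density_zero[OF sigma_finite_lborel d])
  have [measurable]: "d \<in> borel_measurable borel" using d by auto
  have int: "(LBINT x:{a..b}. d x) = 0" for a b
  proof -
    have "(\<lambda>n. LBINT x. d x * bump (Suc n) a b x) \<longlonglongrightarrow> (LBINT x. d x * indicator {a..b} x)"
    proof (rule integral_dominated_convergence[where w = "\<lambda>x. norm (d x)"])
      have "AE x in lborel. x \<noteq> a" "AE x in lborel. x \<noteq> b" using AE_lborel_singleton by auto
      then show "AE x in lborel. (\<lambda>n. d x * bump (Suc n) a b x) \<longlonglongrightarrow> d x * indicator {a..b} x"
        by eventually_elim (intro tendsto_mult tendsto_const bump_tendsto)
      show "AE x in lborel. norm (d x * bump (Suc n) a b x) \<le> norm (d x)" for n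
        by (auto simp: norm_mult intro!: mult_right_le_one_le norm_bump_le)
      show "(\<lambda>x. d x * bump (Suc n) a b x) \<in> borel_measurable lborel" for n
        using schwartz_measurable[OF schwartz_bump[of "Suc n" a b]] by simp
    qed (use d in auto)
    then have "(LBINT x. d x * indicator {a..b} x) = 0"
      using z[OF schwartz_bump] by (simp add: LIMSEQ_const_iff)
    moreover have "d x * indicator {a..b} x = indicator {a..b} x *\<^sub>R d x" for x by (simp split: split_indicator)
    ultimately show ?thesis by (simp add: set_lebesgue_integral_def)
  qed
  have si: "set_integrable lborel A d" if "A \<in> sets borel" for A
    unfolding set_integrable_def using integrable_mult_indicator[of A lborel d] that d by simp
  have tot: "(LBINT x. d x) = 0"
  proof -
    have "(\<lambda>n. LBINT x. indicator {- real n..real n} x *\<^sub>R d x) \<longlonglongrightarrow> (LBINT x. d x)"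
    proof (rule integral_dominated_convergence[where w = "\<lambda>x. norm (d x)"])
      show "AE x in lborel. (\<lambda>n. indicator {- real n..real n} x *\<^sub>R d x) \<longlonglongrightarrow> d x"
      proof (intro AE_I2 tendsto_eventually)
        fix x :: real
        have "\<forall>\<^sub>F n in sequentially. real n > \<bar>x\<bar>" using filterlim_real_sequentially by (simp add: filterlim_at_top_dense)
        then show "\<forall>\<^sub>F n in sequentially. indicator {- real n..real n} x *\<^sub>R d x = d x"
          by eventually_elim (auto split: split_indicator)
      qed
    qed (use d in \<open>auto split: split_indicator\<close>)
    then show ?thesis using int by (simp add: set_lebesgue_integral_def LIMSEQ_const_iff)
  qed
  fix A :: "real set" assume "A \<in> sets lborel"
  then have "A \<in> sets borel" by simp
  then show "(LBINT x:A. d x) = 0"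
  proof (induction rule: borel_set_induct)
    case empty then show ?case by (simp add: set_lebesgue_integral_def)
  next
    case (interval a b) show ?case by (rule int)
  next
    case (compl A)
    have "(LBINT x:A \<union> - A. d x) = (LBINT x:A. d x) + (LBINT x:- A. d x)"
      using compl by (intro set_integral_Un si) auto
    then show ?case using tot compl by (simp add: set_lebesgue_integral_def)
  next
    case (union f)
    have "(LBINT x:(\<Union>i. f i). d x) = (\<Sum>i. (LBINT x:f i. d x))"
      using union by (intro lebesgue_integral_countable_add si) (auto simp: disjoint_family_on_def)
    then show ?case using union by simp
  qed
qed

text \<open>Represented densities need only be locally integrable; they are multiplied by the compactly
supported functions \<open>trunc n\<close> to make the preceding lemma applicable.\<close>

lemma represents_unique:
  assumes g: "represents g T" and h: "represents h T"
  shows "AE x in lborel. g x = h x"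
proof -
  note [measurable] = represents_measurable[OF g] represents_measurable[OF h]
  have "AE x in lborel. (g x - h x) * trunc n x = 0" for n
  proof (rule integrable_zero_distr_AE_0)
    have i: "integrable lborel (\<lambda>x. g x * \<phi> x)" "integrable lborel (\<lambda>x. h x * \<phi> x)"
       "(LBINT x. g x * \<phi> x) = (LBINT x. h x * \<phi> x)" if "\<phi> \<in> schwartz" for \<phi>
      using g h that unfolding represents_def distr_of_def by metis+
    show "integrable lborel (\<lambda>x. (g x - h x) * trunc n x)"
      using Bochner_Integration.integrable_diff[OF i(1)[OF schwartz_trunc[of n]] i(2)[OF schwartz_trunc[of n]]]
      by (simp add: algebra_simps)
    fix \<phi> assume "\<phi> \<in> schwartz"
    then have p: "(\<lambda>x. trunc n x * \<phi> x) \<in> schwartz" by (intro schwartz_mult schwartz_trunc)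
    show "(LBINT x. (g x - h x) * trunc n x * \<phi> x) = 0"
      using Bochner_Integration.integral_diff[OF i(1)[OF p] i(2)[OF p]] i(3)[OF p] by (simp add: algebra_simps)
  qed
  then have "AE x in lborel. \<forall>n. (g x - h x) * trunc n x = 0" unfolding AE_all_countable by blast
  then show ?thesis
  proof eventually_elim
    case (elim x)
    obtain n :: nat where "\<bar>x\<bar> + \<rho> < real n" using reals_Archimedean2 by blast
    then have "trunc n x = 1" by (intro trunc_eq_1) simp
    with elim[rule_format, of n] show ?case by simp
  qed
qed

lemma Lp_norm_fun_cong:
  assumes "AE x in lborel. g x = h x" "g \<in> borel_measurable borel" "h \<in> borel_measurable borel"
  shows "Lp_norm_fun p g = Lp_norm_fun p h"
proof -
  note [measurable] = assms(2,3)
  have "(\<integral>\<^sup>+x. ennreal (norm (g x) powr q) \<partial>lborel) = (\<integral>\<^sup>+x. ennreal (norm (h x) powr q) \<partial>lborel)" for q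
    by (rule nn_integral_cong_AE) (use assms(1) in \<open>eventually_elim, simp\<close>)
  moreover have "esssup lborel (\<lambda>x. ennreal (norm (g x))) = esssup lborel (\<lambda>x. ennreal (norm (h x)))"
    by (rule esssup_AE_cong) (measurable, use assms(1) in \<open>eventually_elim, simp\<close>)
  ultimately show ?thesis by (simp add: Lp_norm_fun_def)
qed

lemma Lp_norm_eq: assumes "represents g T" shows "Lp_norm p T = Lp_norm_fun p g"
proof -
  have "{Lp_norm_fun p h |h. represents h T} = {Lp_norm_fun p g}"
    using assms Lp_norm_fun_cong[OF represents_unique] represents_measurable by blast
  then show ?thesis by (simp add: Lp_norm_def)
qed

lemma Linf_AE:
  assumes "represents g T" shows "AE x in lborel. ennreal (norm (g x)) \<le> Lp_norm \<infinity> T"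
  using esssup_AE[of "\<lambda>x. ennreal (norm (g x))" lborel] by (simp add: Lp_norm_eq[OF assms] Lp_norm_fun_def)

lemma Linf_leI:
  assumes "represents g T" "AE x in lborel. ennreal (norm (g x)) \<le> B" shows "Lp_norm \<infinity> T \<le> B"
  using represents_measurable[OF assms(1)] assms(2)
  by (simp add: Lp_norm_eq[OF assms(1)] Lp_norm_fun_def esssup_I)

lemma tempered_sum:
  assumes "T \<in> tempered" "finite K" "\<And>k. k \<in> K \<Longrightarrow> \<psi> k \<in> schwartz"
  shows "T (\<lambda>x. \<Sum>k\<in>K. \<psi> k x) = (\<Sum>k\<in>K. T (\<psi> k))"
  using assms(2,3)
proof (induction K rule: finite_induct)
  case empty
  from tempered_linear[OF assms(1) schwartz_zero schwartz_zero, of 0 0] show ?case by simp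
next
  case (insert k K)
  have "T (\<lambda>x. 1 * \<psi> k x + 1 * (\<Sum>k\<in>K. \<psi> k x)) = 1 * T (\<psi> k) + 1 * T (\<lambda>x. \<Sum>k\<in>K. \<psi> k x)"
    using insert by (intro tempered_linear assms(1) schwartz_sum) auto
  with insert show ?case by simp
qed

lemma mult_op_box_sum:
  assumes "finite K" "\<phi> \<in> schwartz"
  shows "mult_op (\<lambda>\<xi>. \<Sum>k\<in>K. box_symbol k \<xi>) \<phi> = (\<lambda>x. \<Sum>k\<in>K. mult_op (box_symbol k) \<phi> x)"
  using assms(1)
proof (induction K rule: finite_induct)
  case empty
  show ?case by (simp add: mult_op_def fourier_def)
next
  case (insert k K)
  have "mult_op (\<lambda>\<xi>. 1 * box_symbol k \<xi> + 1 * (\<Sum>k\<in>K. box_symbol k \<xi>)) \<phi> =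
     (\<lambda>x. 1 * mult_op (box_symbol k) \<phi> x + 1 * mult_op (\<lambda>\<xi>. \<Sum>k\<in>K. box_symbol k \<xi>) \<phi> x)"
    using insert assms(2) by (intro mult_op_add_symbol slow_family_box_sum slow_family_box_symbol)
  with insert show ?case by simp
qed

lemma mod_norm_represents:
  assumes u: "u \<in> tempered" "mod_norm \<sigma> u < \<infinity>"
  shows "represents (density_of (freq_box \<sigma> k u)) (freq_box \<sigma> k u)"
  by (rule Linf_finite_represents[where p = \<infinity>]) (use Linf_le_mod_norm[of \<sigma> k u] u(2) in \<open>auto intro: le_less_trans\<close>)

text \<open>The boxes of \<open>u\<close> have absolutely summable supremum norms, so that their series converges almost
everywhere to a bounded function, and this function represents \<open>u\<close> by \<open>tempered_trunc_tendsto\<close>.\<close>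

lemma mod_space_expansion:
  assumes u: "u \<in> tempered" "mod_norm \<sigma> u < \<infinity>"
  shows "\<exists>f. represents f u \<and> (AE x in lborel. ennreal (norm (f x)) \<le> mod_norm \<sigma> u) \<and>
    (AE x in lborel. (\<lambda>n. \<Sum>k\<in>{- int n..int n}. density_of (freq_box \<sigma> k u) x) \<longlonglongrightarrow> f x)"
proof -
  define d where "d k = density_of (freq_box \<sigma> k u)" for k
  define a where "a k = enn2real (Lp_norm \<infinity> (freq_box \<sigma> k u))" for k
  define M where "M = enn2real (mod_norm \<sigma> u)"
  have M: "ennreal M = mod_norm \<sigma> u" using u(2) by (simp add: M_def)
  have a: "ennreal (a k) = Lp_norm \<infinity> (freq_box \<sigma> k u)" "a k \<ge> 0" for k
    using Linf_le_mod_norm[of \<sigma> k u] u(2) by (auto simp: a_def dest: le_less_trans)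
  have d: "represents (d k) (freq_box \<sigma> k u)" for k unfolding d_def by (rule mod_norm_represents[OF u])
  note [measurable] = represents_measurable[OF d]
  have suma: "(\<Sum>k\<in>F. a k) \<le> M" if "finite F" for F
  proof -
    have "ennreal (\<Sum>k\<in>F. a k) = (\<Sum>k\<in>F. Lp_norm \<infinity> (freq_box \<sigma> k u))"
      using a by (subst sum_ennreal[symmetric]) auto
    also have "\<dots> \<le> ennreal M" unfolding M by (rule sum_le_mod_norm[OF that])
    finally show ?thesis by (simp add: M_def)
  qed
  have asum: "a summable_on UNIV"
    by (rule nonneg_bdd_above_summable_on) (use a suma in \<open>auto intro!: bdd_aboveI[of _ M]\<close>)
  have "AE x in lborel. \<forall>k. ennreal (norm (d k x)) \<le> ennreal (a k)"
    unfolding AE_all_countable a using Linf_AE[OF d] by blast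
  then have ad: "AE x in lborel. \<forall>k. norm (d k x) \<le> a k" by eventually_elim (metis a(2) ennreal_le_iff)
  define F where "F n x = (\<Sum>k\<in>{- int n..int n}. d k x)" for n x
  define f where "f x = lim (\<lambda>n. F n x)" for x
  have [measurable]: "F n \<in> borel_measurable borel" for n unfolding F_def[abs_def] by measurable
  have [measurable]: "f \<in> borel_measurable borel" unfolding f_def[abs_def] by measurable
  have lim: "AE x in lborel. (\<lambda>n. F n x) \<longlonglongrightarrow> f x"
    using ad
  proof eventually_elim
    case (elim x)
    have "(\<lambda>k. norm (d k x)) summable_on UNIV"
      by (rule Infinite_Sum.abs_summable_on_comparison_test'[OF asum]) (use elim in simp)
    then have "(\<lambda>k. d k x) summable_on UNIV" by (rule abs_summable_summable)
    then obtain s where "((\<lambda>k. d k x) has_sum s) UNIV" unfolding summable_on_def by blast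
    then have "(\<lambda>n. F n x) \<longlonglongrightarrow> s"
      unfolding has_sum_def F_def by (rule filterlim_compose[OF _ filterlim_int_intervals])
    then show ?case unfolding f_def by (simp add: limI)
  qed
  have FM: "AE x in lborel. \<forall>n. norm (F n x) \<le> M"
    using ad
  proof eventually_elim
    case (elim x)
    show ?case
    proof
      fix n
      have "norm (F n x) \<le> (\<Sum>k\<in>{- int n..int n}. a k)" unfolding F_def using elim by (intro sum_norm_le) auto
      also have "\<dots> \<le> M" by (rule suma) simp
      finally show "norm (F n x) \<le> M" .
    qed
  qed
  have fM: "AE x in lborel. norm (f x) \<le> M"
    using FM lim by eventually_elim (rule Lim_norm_ubound[OF sequentially_bot], auto)
  have "represents f u"
    unfolding represents_def
  proof (intro conjI ballI)
    fix \<phi> :: "real \<Rightarrow> complex" assume p: "\<phi> \<in> schwartz"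
    note [measurable] = schwartz_measurable[OF p]
    show "integrable lborel (\<lambda>x. f x * \<phi> x)" by (rule integrable_bounded_mult[OF _ fM schwartz_integrable[OF p]]) simp
    have "(\<lambda>n. LBINT x. F n x * \<phi> x) \<longlonglongrightarrow> (LBINT x. f x * \<phi> x)"
    proof (rule integral_dominated_convergence[where w = "\<lambda>x. M * norm (\<phi> x)"])
      show "AE x in lborel. (\<lambda>n. F n x * \<phi> x) \<longlonglongrightarrow> f x * \<phi> x"
        using lim by eventually_elim (intro tendsto_mult tendsto_const)
      show "AE x in lborel. norm (F n x * \<phi> x) \<le> M * norm (\<phi> x)" for n
        using FM by eventually_elim (simp add: norm_mult mult_right_mono)
    qed (use schwartz_integrable[OF p] in auto)
    moreover have "(LBINT x. F n x * \<phi> x) = u (mult_op (trunc n) \<phi>)" for n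
    proof -
      have i: "integrable lborel (\<lambda>x. d k x * \<phi> x)" "(LBINT x. d k x * \<phi> x) = u (mult_op (box_symbol k) \<phi>)" for k
        using d[of k] p by (auto simp: represents_def distr_of_def freq_box_eq)
      have "(LBINT x. F n x * \<phi> x) = (\<Sum>k\<in>{- int n..int n}. LBINT x. d k x * \<phi> x)"
        unfolding F_def sum_distrib_right by (rule Bochner_Integration.integral_sum) (rule i)
      also have "\<dots> = u (\<lambda>x. \<Sum>k\<in>{- int n..int n}. mult_op (box_symbol k) \<phi> x)"
        unfolding i by (rule tempered_sum[symmetric, OF u(1)]) (auto intro: schwartz_mult_op slow_family_box_symbol p)
      also have "\<dots> = u (mult_op (trunc n) \<phi>)"
        unfolding trunc_def[abs_def] by (subst mult_op_box_sum) (use p in auto)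
      finally show ?thesis .
    qed
    ultimately have "(\<lambda>n. u (mult_op (trunc n) \<phi>)) \<longlonglongrightarrow> (LBINT x. f x * \<phi> x)" by simp
    from LIMSEQ_unique[OF tempered_trunc_tendsto[OF u(1) p] this]
    show "u \<phi> = distr_of f \<phi>" by (simp add: distr_of_def)
  qed simp
  moreover have "AE x in lborel. ennreal (norm (f x)) \<le> mod_norm \<sigma> u"
    using fM by eventually_elim (simp add: M[symmetric] ennreal_leI)
  ultimately show ?thesis using lim unfolding F_def d_def by blast
qed

text \<open>Transfers the expansion to the density that \<open>density_of\<close> chooses; densities agree
almost everywhere.\<close>

lemma mod_space_represents:
  assumes "u \<in> mod_space \<sigma>"
  shows "represents (density_of u) u"
    "AE x in lborel. ennreal (norm (density_of u x)) \<le> mod_norm \<sigma> u"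
    "AE x in lborel. (\<lambda>n. \<Sum>k\<in>{- int n..int n}. density_of (freq_box \<sigma> k u) x) \<longlonglongrightarrow> density_of u x"
proof -
  obtain f where f: "represents f u" "AE x in lborel. ennreal (norm (f x)) \<le> mod_norm \<sigma> u"
    "AE x in lborel. (\<lambda>n. \<Sum>k\<in>{- int n..int n}. density_of (freq_box \<sigma> k u) x) \<longlonglongrightarrow> f x"
    using mod_space_expansion[of u] assms unfolding mod_space_def by blast
  show 1: "represents (density_of u) u" unfolding density_of_def by (rule someI[where P = "\<lambda>g. represents g u", OF f(1)])
  have ae: "AE x in lborel. f x = density_of u x" by (rule represents_unique[OF f(1) 1])
  show "AE x in lborel. ennreal (norm (density_of u x)) \<le> mod_norm \<sigma> u"
    using ae f(2) by eventually_elim simp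
  show "AE x in lborel. (\<lambda>n. \<Sum>k\<in>{- int n..int n}. density_of (freq_box \<sigma> k u) x) \<longlonglongrightarrow> density_of u x"
    using ae f(3) by eventually_elim simp
qed

lemma represents_mod_norm_AE:
  assumes "u \<in> tempered" "represents g u"
  shows "AE x in lborel. ennreal (norm (g x)) \<le> mod_norm \<sigma> u"
proof (cases "mod_norm \<sigma> u < \<infinity>")
  case True
  then have u: "u \<in> mod_space \<sigma>" using assms(1) by (simp add: mod_space_def)
  show ?thesis using represents_unique[OF mod_space_represents(1)[OF u] assms(2)] mod_space_represents(2)[OF u]
    by eventually_elim simp
next
  case False
  then have "mod_norm \<sigma> u = \<top>" by (metis infinity_ennreal_def top.not_eq_extremum)
  then show ?thesis by simp
qed

end

section \<open>Kernels of the frequency-localised Schroedinger group\<close>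

text \<open>The symbol of the Schroedinger group at time \<open>t\<close>.\<close>

definition phase :: "real \<Rightarrow> real \<Rightarrow> complex" where
  "phase t \<xi> = cis (- (t * \<xi>\<^sup>2))"

lemma norm_phase [simp]: "norm (phase t \<xi>) = 1"
  by (simp add: phase_def)

lemma norm_cis_diff: "norm (cis a - cis b) \<le> \<bar>a - b\<bar>"
proof -
  have "norm (cis (a - b) - 1) \<le> \<bar>a - b\<bar>"
    using iexp_approx1[of "a - b" 0] by (simp add: cis_conv_exp)
  moreover have "cis a - cis b = cis b * (cis (a - b) - 1)" by (simp add: algebra_simps cis_mult)
  ultimately show ?thesis by (simp add: norm_mult)
qed

lemma phase_has_vector_derivative:
  "(phase t has_vector_derivative (- 2 * \<i> * of_real t * of_real \<xi>) * phase t \<xi>) (at \<xi>)"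
proof -
  have "((\<lambda>\<xi>. cis (- (t * \<xi>\<^sup>2))) has_derivative (\<lambda>h. (- (t * (2 * \<xi> * h))) *\<^sub>R (\<i> * cis (- (t * \<xi>\<^sup>2))))) (at \<xi>)"
    by (intro has_derivative_cis) (auto intro!: derivative_eq_intros)
  moreover have "(\<lambda>h. (- (t * (2 * \<xi> * h))) *\<^sub>R (\<i> * cis (- (t * \<xi>\<^sup>2)))) = (\<lambda>h. h *\<^sub>R ((- 2 * \<i> * of_real t * of_real \<xi>) * phase t \<xi>))"
    by (auto simp: phase_def scaleR_conv_of_real algebra_simps)
  ultimately show ?thesis unfolding has_vector_derivative_def phase_def[abs_def] by simp
qed

lemma slow_family_linear: "slow_family {\<lambda>\<xi>. c * complex_of_real \<xi> |c. norm c \<le> B}"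
proof (rule slow_family_multI[OF slow_family_const[of B] slow_family_ident])
  fix a :: "real \<Rightarrow> complex" assume "a \<in> {\<lambda>\<xi>. c * complex_of_real \<xi> |c. norm c \<le> B}"
  then obtain c where c: "norm c \<le> B" "a = (\<lambda>\<xi>. c * complex_of_real \<xi>)" by blast
  have "(\<lambda>x::real. c) \<in> {\<lambda>x. c |c. norm c \<le> B}" using c(1) by blast
  then show "\<exists>u\<in>{\<lambda>x. c |c. norm c \<le> B}. \<exists>b\<in>{complex_of_real}. a = (\<lambda>x. u x * b x)"
    by (rule bexI[rotated]) (simp add: c(2))
qed

lemma slow_family_phase: "slow_family (phase ` {-1..1})"
proof (rule slow_family_ode[OF _ slow_family_linear[of 2] slow_family_const1[of 0]])
  show "slow 0 (phase ` {-1..1})" by (rule slow_0I[of _ 1 0]) auto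
  fix a assume "a \<in> phase ` {-1..1}"
  then obtain t where t: "t \<in> {-1..1}" "a = phase t" by (rule imageE)
  have 1: "(\<lambda>\<xi>. (- 2 * \<i> * of_real t) * complex_of_real \<xi>) \<in> {\<lambda>\<xi>. c * complex_of_real \<xi> |c. norm c \<le> 2}"
    using t(1) by (intro CollectI exI[of _ "- 2 * \<i> * of_real t"]) (auto simp: norm_mult)
  show "\<exists>b\<in>{\<lambda>\<xi>. c * complex_of_real \<xi> |c. norm c \<le> 2}. \<exists>c\<in>{\<lambda>x. 0}. \<forall>x. (a has_vector_derivative b x * a x + c x) (at x)"
    by (rule bexI[OF _ 1], rule bexI[of _ "\<lambda>x. 0"]) (simp_all add: t(2) phase_has_vector_derivative[simplified])
qed

text \<open>Difference quotients in time of the phase; their uniform growth bounds give Lipschitz continuity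
in time of all operators below.\<close>

definition phase_quotient :: "real \<Rightarrow> real \<Rightarrow> real \<Rightarrow> complex" where
  "phase_quotient t t' \<xi> = (phase t \<xi> - phase t' \<xi>) / of_real (t - t')"

lemma slow_family_phase_quotient:
  "slow_family {phase_quotient t t' |t t'. t \<in> {-1..1} \<and> t' \<in> {-1..1} \<and> t \<noteq> t'}"
proof (rule slow_family_ode)
  let ?Q = "{phase_quotient t t' |t t'. t \<in> {-1..1} \<and> t' \<in> {-1..1} \<and> t \<noteq> t'}"
  let ?L = "{\<lambda>\<xi>. c * complex_of_real \<xi> |c. norm c \<le> 2}"
  let ?P = "{\<lambda>x. a x * b x |a b. a \<in> ?L \<and> b \<in> phase ` {-1..1}}"
  show "slow_family ?L" by (rule slow_family_linear)
  show "slow_family ?P" by (intro slow_family_mult slow_family_linear slow_family_phase)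
  show "slow 0 ?Q"
  proof (rule slow_0I[of _ 1 2], clarify)
    fix t t' \<xi> :: real assume t: "t \<noteq> t'"
    have "norm (phase t \<xi> - phase t' \<xi>) \<le> \<bar>- (t * \<xi>\<^sup>2) - (- (t' * \<xi>\<^sup>2))\<bar>"
      unfolding phase_def by (rule norm_cis_diff)
    also have "- (t * \<xi>\<^sup>2) - (- (t' * \<xi>\<^sup>2)) = - ((t - t') * \<xi>\<^sup>2)" by (simp add: algebra_simps)
    also have "\<bar>- ((t - t') * \<xi>\<^sup>2)\<bar> = \<xi>\<^sup>2 * \<bar>t - t'\<bar>" by (simp add: abs_mult)
    finally have "norm (phase_quotient t t' \<xi>) \<le> \<xi>\<^sup>2"
      using t unfolding phase_quotient_def norm_divide norm_of_real by (simp add: divide_le_eq)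
    also have "\<dots> \<le> (1 + \<bar>\<xi>\<bar>)\<^sup>2" using power_mono[of "\<bar>\<xi>\<bar>" "1 + \<bar>\<xi>\<bar>" 2] by simp
    finally show "norm (phase_quotient t t' \<xi>) \<le> 1 * (1 + \<bar>\<xi>\<bar>)\<^sup>2" by simp
  qed
  fix a assume "a \<in> ?Q"
  then obtain t t' where t: "t \<in> {-1..1}" "t' \<in> {-1..1}" "t \<noteq> t'" "a = phase_quotient t t'" by blast
  have 1: "(\<lambda>\<xi>. (- 2 * \<i> * of_real t) * complex_of_real \<xi>) \<in> ?L"
    using t(1) by (intro CollectI exI[of _ "- 2 * \<i> * of_real t"]) (auto simp: norm_mult)
  have "(\<lambda>\<xi>. (- 2 * \<i>) * complex_of_real \<xi>) \<in> ?L"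
    by (intro CollectI exI[of _ "- 2 * \<i>"]) (auto simp: norm_mult)
  then have 2: "(\<lambda>\<xi>. ((- 2 * \<i>) * complex_of_real \<xi>) * phase t' \<xi>) \<in> ?P"
    using t(2) by (intro CollectI exI[of _ "\<lambda>\<xi>. (- 2 * \<i>) * complex_of_real \<xi>"] exI[of _ "phase t'"]) auto
  have "(a has_vector_derivative (- 2 * \<i> * of_real t) * complex_of_real \<xi> * a \<xi> + ((- 2 * \<i>) * complex_of_real \<xi>) * phase t' \<xi>) (at \<xi>)" for \<xi>
  proof -
    have "((\<lambda>\<xi>. (phase t \<xi> - phase t' \<xi>) / of_real (t - t')) has_vector_derivative
       ((- 2 * \<i> * of_real t * of_real \<xi>) * phase t \<xi> - (- 2 * \<i> * of_real t' * of_real \<xi>) * phase t' \<xi>) / of_real (t - t')) (at \<xi>)"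
      by (intro has_vector_derivative_divide has_vector_derivative_diff phase_has_vector_derivative)
    moreover have "((- 2 * \<i> * of_real t * of_real \<xi>) * phase t \<xi> - (- 2 * \<i> * of_real t' * of_real \<xi>) * phase t' \<xi>) / of_real (t - t')
      = (- 2 * \<i> * of_real t) * complex_of_real \<xi> * a \<xi> + ((- 2 * \<i>) * complex_of_real \<xi>) * phase t' \<xi>"
    proof -
      have nz: "complex_of_real t - complex_of_real t' \<noteq> 0" using t(3) by simp
      show ?thesis using nz unfolding t(4) phase_quotient_def of_real_diff by (simp add: field_simps)
    qed
    ultimately show ?thesis unfolding t(4) phase_quotient_def[abs_def] by simp
  qed
  then show "\<exists>b\<in>?L. \<exists>c\<in>?P. \<forall>x. (a has_vector_derivative b x * a x + c x) (at x)"
    by (intro bexI[OF _ 1] bexI[OF _ 2] allI)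
qed

lemma one_plus_square_pos: "0 < 1 + (x::real)\<^sup>2"
  by (simp add: add_pos_nonneg)

text \<open>The functions \<open>jap0 k\<close> and \<open>jap1 k\<close> generate an algebra closed under
differentiation that contains the logarithmic derivatives of the weights \<open>(1 + (k +
\<eta>)\<^sup>2)\<^bsup>s/2\<^esup>\<close>.\<close>

definition jap0 :: "real \<Rightarrow> real \<Rightarrow> real" where
  "jap0 k \<eta> = 1 / (1 + (k + \<eta>)\<^sup>2)"

text \<open>Half of the logarithmic derivative of \<open>1 + (k + \<eta>)\<^sup>2\<close>.\<close>

definition jap1 :: "real \<Rightarrow> real \<Rightarrow> real" where
  "jap1 k \<eta> = (k + \<eta>) / (1 + (k + \<eta>)\<^sup>2)"

text \<open>All translates of the two functions, as complex symbols.\<close>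

definition japanese_derivs :: "(real \<Rightarrow> complex) set" where
  "japanese_derivs = range (\<lambda>k \<eta>. complex_of_real (jap0 k \<eta>)) \<union> range (\<lambda>k \<eta>. complex_of_real (jap1 k \<eta>))"

lemma jap_derivs:
  "(jap0 k has_field_derivative 0 + (- 2) * (jap0 k x * jap1 k x)) (at x)"
  "(jap1 k has_field_derivative jap0 k x + (- 2) * (jap1 k x * jap1 k x)) (at x)"
proof -
  have p: "1 + (k + x)\<^sup>2 \<noteq> 0" using one_plus_square_pos[of "k + x"] by simp
  show "(jap0 k has_field_derivative 0 + (- 2) * (jap0 k x * jap1 k x)) (at x)"
    unfolding jap0_def[abs_def] jap1_def using p
    by (auto intro!: derivative_eq_intros simp: divide_simps)
  show "(jap1 k has_field_derivative jap0 k x + (- 2) * (jap1 k x * jap1 k x)) (at x)"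
    unfolding jap1_def[abs_def] jap0_def using p
    by (auto intro!: derivative_eq_intros simp: divide_simps)
qed

lemma jap_bounded: "\<bar>jap0 k x\<bar> \<le> 1" "\<bar>jap1 k x\<bar> \<le> 1"
proof -
  have *: "\<bar>y\<bar> \<le> 1 + y\<^sup>2" for y :: real
  proof -
    have "0 \<le> (\<bar>y\<bar> - 1)\<^sup>2" by simp
    also have "(\<bar>y\<bar> - 1)\<^sup>2 = 1 + y\<^sup>2 - 2 * \<bar>y\<bar>" by (simp only: power2_diff power2_abs) simp
    finally show ?thesis by linarith
  qed
  have "\<bar>k + x\<bar> \<le> 1 + (k + x)\<^sup>2" by (rule *)
  then show "\<bar>jap1 k x\<bar> \<le> 1" unfolding jap1_def abs_divide using one_plus_square_pos[of "k + x"] by (simp add: divide_le_eq)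
  show "\<bar>jap0 k x\<bar> \<le> 1" unfolding jap0_def abs_divide using one_plus_square_pos[of "k + x"] by (simp add: divide_le_eq)
qed

text \<open>Derivatives of elements are linear combinations of elements and products of two elements, so that
each order follows from the previous one.\<close>

lemma slow_family_japanese_derivs: "slow_family japanese_derivs"
  unfolding slow_family_def
proof
  let ?J = japanese_derivs
  have J: "(\<lambda>\<eta>. complex_of_real (jap0 k \<eta>)) \<in> ?J" "(\<lambda>\<eta>. complex_of_real (jap1 k \<eta>)) \<in> ?J" for k
    unfolding japanese_derivs_def by blast+
  fix n show "slow n ?J"
  proof (induction n)
    case 0 show ?case
    proof (rule slow_0I[of _ 1 0])
      fix a and x :: real assume "a \<in> ?J"
      then show "norm (a x) \<le> 1 * (1 + \<bar>x\<bar>) ^ 0"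
        unfolding japanese_derivs_def using jap_bounded by auto
    qed
  next
    case (Suc n)
    let ?U = "{\<lambda>x. c x * a x |c a. c \<in> {\<lambda>x::real. c |c::complex. norm c \<le> 1} \<and> a \<in> ?J}"
    let ?M = "{\<lambda>x. u x * a x |u a. u \<in> {\<lambda>x::real. c |c::complex. norm c \<le> 2} \<and> a \<in> {\<lambda>x. a x * b x |a b. a \<in> ?J \<and> b \<in> ?J}}"
    let ?S = "{\<lambda>x. a x + b x |a b. a \<in> ?U \<and> b \<in> ?M}"
    have z: "slow n {\<lambda>x::real. 0 :: complex}" using slow_family_const1[of 0] by (simp add: slow_family_def)
    have S: "slow n ?S" by (intro slow_add slow_mult slow_const Suc)
    have inS: "(\<lambda>x. c * u x + (- 2) * (v x * w x)) \<in> ?S" if "norm c \<le> 1" "u \<in> ?J" "v \<in> ?J" "w \<in> ?J" for c u v w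
    proof -
      have c1: "(\<lambda>x::real. c) \<in> {\<lambda>x. c |c. norm c \<le> 1}" using that(1) by blast
      have c2: "(\<lambda>x::real. - 2 :: complex) \<in> {\<lambda>x. c |c. norm c \<le> 2}" by (intro CollectI exI[of _ "- 2"]) simp
      have vw: "(\<lambda>x. v x * w x) \<in> {\<lambda>x. a x * b x |a b. a \<in> ?J \<and> b \<in> ?J}" using that by blast
      have "(\<lambda>x. (- 2) * (v x * w x)) \<in> ?M"
        by (rule CollectI, rule exI[of _ "\<lambda>x. - 2"], rule exI[of _ "\<lambda>x. v x * w x"], intro conjI refl c2 vw)
      moreover have "(\<lambda>x. c * u x) \<in> ?U"
        by (rule CollectI, rule exI[of _ "\<lambda>x. c"], rule exI[of _ u], intro conjI refl c1 that)
      ultimately show ?thesis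
        by - (rule CollectI, rule exI[of _ "\<lambda>x. c * u x"], rule exI[of _ "\<lambda>x. (- 2) * (v x * w x)"], rule conjI, rule refl, rule conjI)
    qed
    show ?case
    proof (rule slow_Suc_ode[OF Suc z S])
      fix a assume a: "a \<in> ?J"
      have "\<exists>c\<in>?S. \<forall>x. (a has_vector_derivative c x) (at x)"
      proof -
        from a consider k where "a = (\<lambda>\<eta>. complex_of_real (jap0 k \<eta>))" | k where "a = (\<lambda>\<eta>. complex_of_real (jap1 k \<eta>))"
          unfolding japanese_derivs_def by blast
        then show ?thesis
        proof cases
          case (1 k)
          have "(a has_vector_derivative 0 * of_real (jap0 k x) + (- 2) * (of_real (jap0 k x) * of_real (jap1 k x))) (at x)" for x
            using has_vector_derivative_of_real[OF jap_derivs(1)[of k x]] unfolding 1 by simp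
          then show ?thesis using J by (intro bexI[OF _ inS[of 0]] allI) simp_all
        next
          case (2 k)
          have "(a has_vector_derivative 1 * of_real (jap0 k x) + (- 2) * (of_real (jap1 k x) * of_real (jap1 k x))) (at x)" for x
            using has_vector_derivative_of_real[OF jap_derivs(2)[of k x]] unfolding 2 by simp
          then show ?thesis using J by (intro bexI[OF _ inS[of 1]] allI) simp_all
        qed
      qed
      then obtain c where c: "c \<in> ?S" "\<forall>x. (a has_vector_derivative c x) (at x)" by blast
      have c': "\<forall>x. (a has_vector_derivative 0 * a x + c x) (at x)" using c(2) by simp
      show "\<exists>b\<in>{\<lambda>x. 0}. \<exists>c\<in>?S. \<forall>x. (a has_vector_derivative b x * a x + c x) (at x)"
        by (rule bexI[of _ "\<lambda>x. 0"], rule bexI[of _ c], rule c', rule c(1), rule singletonI)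
    qed
  qed
qed

text \<open>The weight \<open>(1 + \<xi>\<^sup>2)\<^bsup>s/2\<^esup>\<close> at \<open>\<xi> = k + \<eta>\<close>, normalised by its value at \<open>k\<close>. By Peetre's inequality it
is bounded by a power of \<open>1 + \<bar>\<eta>\<bar>\<close> that does not depend on \<open>k\<close>.\<close>

definition weight_quotient :: "real \<Rightarrow> real \<Rightarrow> real \<Rightarrow> complex" where
  "weight_quotient s k \<eta> = complex_of_real ((1 + (k + \<eta>)\<^sup>2) powr (s / 2) / (1 + k\<^sup>2) powr (s / 2))"

text \<open>Peetre's inequality; the difference of the two sides is a sum of squares.\<close>

lemma peetre: "1 + (x::real)\<^sup>2 \<le> 2 * (1 + (x + y)\<^sup>2) * (1 + y\<^sup>2)"
proof -
  have "0 \<le> (x + 2 * y)\<^sup>2 + (1 + 2 * ((x + y) * y)\<^sup>2)" by (intro add_nonneg_nonneg) auto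
  also have "\<dots> = 2 * (1 + (x + y)\<^sup>2) * (1 + y\<^sup>2) - (1 + x\<^sup>2)" by (simp add: power2_eq_square algebra_simps)
  finally show ?thesis by simp
qed

lemma slow_family_weight_quotient: "slow_family (range (weight_quotient s))"
proof (rule slow_family_ode[OF _ _ slow_family_const1[of 0]])
  let ?B = "{\<lambda>x. u x * a x |u a. u \<in> {\<lambda>x. complex_of_real s} \<and> a \<in> japanese_derivs}"
  show "slow_family ?B" by (intro slow_family_mult slow_family_const1 slow_family_japanese_derivs)
  show "slow 0 (range (weight_quotient s))"
  proof (rule slow_0I)
    fix a and \<eta> :: real assume "a \<in> range (weight_quotient s)"
    then obtain k where a: "a = weight_quotient s k" by (rule rangeE)
    let ?N = "nat \<lceil>\<bar>s\<bar>\<rceil>"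
    let ?r = "(1 + (k + \<eta>)\<^sup>2) / (1 + k\<^sup>2)" and ?y = "2 * (1 + \<eta>\<^sup>2)"
    note p = one_plus_square_pos[of k] one_plus_square_pos[of "k + \<eta>"] one_plus_square_pos[of \<eta>]
    have r0: "?r > 0" using p by simp
    have r1: "?r \<le> ?y"
      using peetre[of "k + \<eta>" "- \<eta>"] p by (simp add: pos_divide_le_eq algebra_simps)
    have r2: "1 / ?r \<le> ?y"
      using peetre[of k \<eta>] p by (simp add: pos_divide_le_eq algebra_simps)
    have y1: "?y \<ge> 1" using zero_le_power2[of \<eta>] by (simp add: distrib_left)
    have "?r powr (s / 2) \<le> ?y powr (\<bar>s\<bar> / 2)"
    proof (cases "s \<ge> 0")
      case True
      then show ?thesis using r0 r1 by (auto intro!: powr_mono2)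
    next
      case False
      have "?r powr (s / 2) = (1 / ?r) powr (\<bar>s\<bar> / 2)"
        using False r0 p by (simp add: powr_divide powr_minus_divide)
      also have "\<dots> \<le> ?y powr (\<bar>s\<bar> / 2)" using r2 r0 by (intro powr_mono2) auto
      finally show ?thesis .
    qed
    also have "\<dots> \<le> ?y powr real ?N" using y1 by (intro powr_mono) linarith+
    also have "\<dots> = ?y ^ ?N" using y1 by (intro powr_realpow) linarith
    also have "\<dots> \<le> (2 * (1 + \<bar>\<eta>\<bar>)\<^sup>2) ^ ?N"
      by (intro power_mono) (auto simp: power2_eq_square algebra_simps abs_mult_self_eq)
    also have "\<dots> = 2 ^ ?N * (1 + \<bar>\<eta>\<bar>) ^ (2 * ?N)" by (simp add: power_mult_distrib power_mult)
    finally show "norm (a \<eta>) \<le> 2 ^ ?N * (1 + \<bar>\<eta>\<bar>) ^ (2 * ?N)"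
      unfolding a weight_quotient_def norm_of_real using p by (simp add: powr_divide)
  qed
  fix a assume "a \<in> range (weight_quotient s)"
  then obtain k where a: "a = weight_quotient s k" by (rule rangeE)
  let ?d = "\<lambda>\<eta>. complex_of_real (jap1 k \<eta>)"
  have d: "?d \<in> japanese_derivs" unfolding japanese_derivs_def by blast
  have B: "(\<lambda>\<eta>. of_real s * ?d \<eta>) \<in> ?B"
    by (rule CollectI, rule exI[of _ "\<lambda>\<eta>. of_real s"], rule exI[of _ ?d], intro conjI refl singletonI d)
  have "(a has_vector_derivative (of_real s * ?d \<eta>) * a \<eta> + 0) (at \<eta>)" for \<eta>
  proof -
    let ?g = "\<lambda>\<eta>. (1 + (k + \<eta>)\<^sup>2) powr (s / 2) / (1 + k\<^sup>2) powr (s / 2)"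
    have p: "1 + (k + \<eta>)\<^sup>2 > 0" by (rule one_plus_square_pos)
    have "((\<lambda>\<eta>. 1 + (k + \<eta>)\<^sup>2) has_field_derivative 2 * (k + \<eta>)) (at \<eta>)"
      by (auto intro!: derivative_eq_intros)
    from DERIV_fun_powr[OF this p, of "s / 2"]
    have "((\<lambda>\<eta>. (1 + (k + \<eta>)\<^sup>2) powr (s / 2)) has_field_derivative s / 2 * (1 + (k + \<eta>)\<^sup>2) powr (s / 2 - 1) * (2 * (k + \<eta>))) (at \<eta>)"
      by simp
    then have "(?g has_field_derivative s / 2 * (1 + (k + \<eta>)\<^sup>2) powr (s / 2 - 1) * (2 * (k + \<eta>)) / (1 + k\<^sup>2) powr (s / 2)) (at \<eta>)"
      by (rule DERIV_cdivide)
    also have "s / 2 * (1 + (k + \<eta>)\<^sup>2) powr (s / 2 - 1) * (2 * (k + \<eta>)) / (1 + k\<^sup>2) powr (s / 2) = s * jap1 k \<eta> * ?g \<eta>"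
    proof -
      have e: "(1 + (k + \<eta>)\<^sup>2) powr (s / 2 - 1) = (1 + (k + \<eta>)\<^sup>2) powr (s / 2) / (1 + (k + \<eta>)\<^sup>2)"
        using p by (simp add: powr_diff)
      have "s / 2 * (P / Q) * (2 * y) / R = s * (y / Q) * (P / R)" for P Q R y :: real by simp
      then show ?thesis unfolding e jap1_def .
    qed
    finally have "((\<lambda>\<eta>. of_real (?g \<eta>)) has_vector_derivative of_real (s * jap1 k \<eta> * ?g \<eta>)) (at \<eta>)"
      by (rule has_vector_derivative_of_real)
    then show ?thesis
      unfolding a weight_quotient_def[abs_def] by (simp only: of_real_mult add_0_right)
  qed
  then show "\<exists>b\<in>?B. \<exists>c\<in>{\<lambda>x. 0}. \<forall>x. (a has_vector_derivative b x * a x + c x) (at x)"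
    by (intro bexI[OF _ B] bexI[of _ "\<lambda>x. 0"] allI singletonI)
qed

lemma inv_fourier_shift: "inv_fourier (\<lambda>\<xi>. m (\<xi> - k)) x = cis (k * x) * inv_fourier m x"
proof -
  have "(LBINT \<xi>. cis (x * \<xi>) * m (\<xi> - k)) = (LBINT \<eta>. cis (x * (k + 1 * \<eta>)) * m (k + 1 * \<eta> - k))"
    by (subst lborel_integral_real_affine[of 1 _ k]) auto
  also have "\<dots> = (LBINT \<eta>. cis (k * x) * (cis (x * \<eta>) * m \<eta>))"
    by (intro Bochner_Integration.integral_cong refl) (simp add: distrib_left mult.commute[of x k] cis_mult[symmetric] mult.assoc)
  also have "\<dots> = cis (k * x) * (LBINT \<eta>. cis (x * \<eta>) * m \<eta>)" by (rule integral_mult_right_zero)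
  finally show ?thesis by (simp add: inv_fourier_def)
qed

lemma inv_fourier_modulate: "inv_fourier (\<lambda>\<xi>. cis (- (c * \<xi>)) * m \<xi>) x = inv_fourier m (x - c)"
proof -
  have "cis (x * \<xi>) * cis (- (c * \<xi>)) = cis ((x - c) * \<xi>)" for \<xi>
    by (simp add: cis_mult left_diff_distrib)
  then have *: "cis (x * \<xi>) * (cis (- (c * \<xi>)) * m \<xi>) = cis ((x - c) * \<xi>) * m \<xi>" for \<xi>
    by (simp only: mult.assoc[symmetric])
  show ?thesis by (simp only: inv_fourier_def *)
qed

lemma inv_fourier_cmult: "inv_fourier (\<lambda>\<xi>. c * m \<xi>) x = c * inv_fourier m x"
proof -
  have "(LBINT \<xi>. cis (x * \<xi>) * (c * m \<xi>)) = c * (LBINT \<xi>. cis (x * \<xi>) * m \<xi>)"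
    by (subst integral_mult_right_zero[symmetric]) (simp add: mult_ac)
  then show ?thesis by (simp add: inv_fourier_def)
qed

context freq_partition
begin

text \<open>The symbol of \<open>\<box>\<^sub>k U(t) \<langle>\<partial>\<rangle>\<^bsup>-s\<^esup>\<close>.\<close>

definition box_mult :: "real \<Rightarrow> int \<Rightarrow> real \<Rightarrow> real \<Rightarrow> complex" where
  "box_mult s k t \<xi> = box_symbol k \<xi> * (phase t \<xi> * of_real ((1 + \<xi>\<^sup>2) powr (- s / 2)))"

text \<open>The convolution kernel of \<open>\<box>\<^sub>k U(t)
\<langle>\<partial>\<rangle>\<^bsup>-s\<^esup>\<close>.\<close>

definition box_kernel :: "real \<Rightarrow> int \<Rightarrow> real \<Rightarrow> real \<Rightarrow> complex" where
  "box_kernel s k t = inv_fourier (box_mult s k t)"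

lemma slow_family_phase1: "t \<in> {-1..1} \<Longrightarrow> slow_family {phase t}"
  by (rule slow_family_single[OF slow_family_phase imageI])

lemma slow_family_weight: "slow_family {\<lambda>\<xi>. complex_of_real ((1 + \<xi>\<^sup>2) powr (s / 2))}"
  using slow_family_single[OF slow_family_weight_quotient rangeI, of s 0] by (simp add: weight_quotient_def[abs_def])

lemma schwartz_box_mult:
  assumes "t \<in> {-1..1}" shows "box_mult s k t \<in> schwartz"
proof -
  have "(\<lambda>\<xi>. (phase t \<xi> * of_real ((1 + \<xi>\<^sup>2) powr (- s / 2))) * box_symbol k \<xi>) \<in> schwartz"
    by (intro schwartz_mult_slow slow_family_mult1 slow_family_phase1 slow_family_weight schwartz_box_symbol assms)
  then show ?thesis by (simp add: box_mult_def[abs_def] mult.commute)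
qed

lemma schwartz_box_kernel: "t \<in> {-1..1} \<Longrightarrow> box_kernel s k t \<in> schwartz"
  unfolding box_kernel_def by (intro schwartz_inv_fourier schwartz_box_mult)

lemma box_mult_supp: "\<rho> < \<bar>\<xi> - of_int k\<bar> \<Longrightarrow> box_mult s k t \<xi> = 0"
  by (simp add: box_mult_def box_symbol_supp)

lemma slow_mult_inv_fourier_bound:
  assumes "slow_family A" "\<psi> \<in> schwartz"
  shows "\<exists>C\<ge>0. \<forall>a\<in>A. \<forall>x. norm (inv_fourier (\<lambda>\<xi>. a \<xi> * \<psi> \<xi>) x) \<le> C * (1 / (1 + x\<^sup>2))"
proof -
  have t: "tame ((\<lambda>a \<phi>. inv_fourier (\<lambda>x. a x * \<phi> x)) ` A)"
  proof (rule tame_compI[OF tame_inv_fourier tame_mult_image[OF assms(1)]])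
    fix R assume "R \<in> (\<lambda>a \<phi>. inv_fourier (\<lambda>x. a x * \<phi> x)) ` A"
    then obtain a where "a \<in> A" "R = (\<lambda>\<phi>. inv_fourier (\<lambda>x. a x * \<phi> x))" by (rule imageE)
    then show "\<exists>P\<in>{inv_fourier}. \<exists>Q\<in>(\<lambda>a \<phi> x. a x * \<phi> x) ` A. R = (\<lambda>\<phi>. P (Q \<phi>))"
      by (intro bexI[of _ inv_fourier] bexI[of _ "\<lambda>\<phi> x. a x * \<phi> x"] imageI) auto
  qed
  from tame_bound[OF t, of 2] obtain C N where C: "C \<ge> 0"
    "\<forall>P\<in>(\<lambda>a \<phi>. inv_fourier (\<lambda>x. a x * \<phi> x)) ` A. \<forall>\<phi>\<in>schwartz. schwartz_norm 2 (P \<phi>) \<le> C * schwartz_norm N \<phi>" by blast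
  have "norm (inv_fourier (\<lambda>\<xi>. a \<xi> * \<psi> \<xi>) x) \<le> 2 * (C * schwartz_norm N \<psi>) * (1 / (1 + x\<^sup>2))" if a: "a \<in> A" for a x
  proof -
    have P: "(\<lambda>\<phi>. inv_fourier (\<lambda>x. a x * \<phi> x)) \<in> (\<lambda>a \<phi>. inv_fourier (\<lambda>x. a x * \<phi> x)) ` A" using a by (rule imageI)
    from C(2)[rule_format, OF P assms(2)] have "schwartz_norm 2 (inv_fourier (\<lambda>\<xi>. a \<xi> * \<psi> \<xi>)) \<le> C * schwartz_norm N \<psi>" .
    then have "2 * schwartz_norm 2 (inv_fourier (\<lambda>\<xi>. a \<xi> * \<psi> \<xi>)) * (1 / (1 + x\<^sup>2)) \<le> 2 * (C * schwartz_norm N \<psi>) * (1 / (1 + x\<^sup>2))"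
      by (intro mult_right_mono) (auto simp: one_plus_square_pos less_imp_le)
    with schwartz_decay[OF tame_schwartz[OF t P assms(2)], of x] show ?thesis by linarith
  qed
  moreover have "2 * (C * schwartz_norm N \<psi>) \<ge> 0" using C(1) assms(2) by (simp add: schwartz_norm_nonneg)
  ultimately show ?thesis by blast
qed

text \<open>The substitution \<open>\<xi> = k + \<eta>\<close> splits the phase \<open>t \<xi>\<^sup>2\<close> into a constant, a linear part, which translates
the kernel by \<open>2 t k\<close>, and \<open>t \<eta>\<^sup>2\<close>: up to a factor of modulus \<open>1\<close> and the weight at \<open>k\<close>, the kernel is a
translate of one with frequencies near \<open>0\<close>.\<close>

lemma box_kernel_galilei:
  "norm (box_kernel s k t x) = (1 + (of_int k)\<^sup>2) powr (- s / 2) *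
     norm (inv_fourier (\<lambda>\<eta>. (phase t \<eta> * weight_quotient (- s) (of_int k) \<eta>) * box_symbol 0 \<eta>) (x - 2 * t * of_int k))"
proof -
  let ?k = "real_of_int k"
  let ?m = "\<lambda>\<eta>. (phase t \<eta> * weight_quotient (- s) ?k \<eta>) * box_symbol 0 \<eta>"
  let ?c = "cis (- (t * ?k\<^sup>2)) * of_real ((1 + ?k\<^sup>2) powr (- s / 2))"
  have "box_mult s k t \<xi> = (\<lambda>\<eta>. ?c * (cis (- (2 * t * ?k * \<eta>)) * ?m \<eta>)) (\<xi> - ?k)" for \<xi>
  proof -
    define \<eta> where "\<eta> = \<xi> - ?k"
    have x: "\<xi> = ?k + \<eta>" by (simp add: \<eta>_def)
    have "phase t \<xi> = cis (- (t * ?k\<^sup>2)) * (cis (- (2 * t * ?k * \<eta>)) * phase t \<eta>)"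
      unfolding x phase_def cis_mult by (simp add: power2_eq_square algebra_simps)
    moreover have "complex_of_real ((1 + \<xi>\<^sup>2) powr (- s / 2)) = of_real ((1 + ?k\<^sup>2) powr (- s / 2)) * weight_quotient (- s) ?k \<eta>"
    proof -
      have "(1 + ?k\<^sup>2) powr (- s / 2) \<noteq> 0" using one_plus_square_pos[of ?k] by simp
      then have "(1 + \<xi>\<^sup>2) powr (- s / 2) = (1 + ?k\<^sup>2) powr (- s / 2) * ((1 + (?k + \<eta>)\<^sup>2) powr (- s / 2) / (1 + ?k\<^sup>2) powr (- s / 2))"
        by (simp add: x)
      then show ?thesis unfolding weight_quotient_def of_real_mult[symmetric] by (rule arg_cong)
    qed
    moreover have "box_symbol k \<xi> = box_symbol 0 \<eta>" by (simp add: box_symbol_def \<eta>_def)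
    ultimately show ?thesis unfolding box_mult_def \<eta>_def by (simp only: mult_ac)
  qed
  moreover define M where "M = (\<lambda>\<eta>. ?c * (cis (- (2 * t * ?k * \<eta>)) * ?m \<eta>))"
  ultimately have "box_mult s k t = (\<lambda>\<xi>. M (\<xi> - ?k))" by (intro ext) simp
  then have "box_kernel s k t x = cis (?k * x) * (?c * inv_fourier ?m (x - 2 * t * ?k))"
    unfolding box_kernel_def
    by (simp only: inv_fourier_shift[of M ?k x]) (simp only: M_def inv_fourier_cmult inv_fourier_modulate)
  then show ?thesis by (simp add: norm_mult)
qed

lemma box_kernel_bound:
  "\<exists>C\<ge>0. \<forall>k t x. t \<in> {-1..1} \<longrightarrow> norm (box_kernel s k t x) \<le> C * (1 + (of_int k)\<^sup>2) powr (- s / 2) * (1 / (1 + (x - 2 * t * of_int k)\<^sup>2))"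
proof -
  let ?A = "{\<lambda>x. a x * b x |a b. a \<in> phase ` {-1..1} \<and> b \<in> range (weight_quotient (- s))}"
  have "slow_family ?A" by (intro slow_family_mult slow_family_phase slow_family_weight_quotient)
  from slow_mult_inv_fourier_bound[OF this schwartz_box_symbol[of 0]] obtain C where C: "C \<ge> 0"
    "\<forall>a\<in>?A. \<forall>x. norm (inv_fourier (\<lambda>\<xi>. a \<xi> * box_symbol 0 \<xi>) x) \<le> C * (1 / (1 + x\<^sup>2))" by blast
  have "norm (box_kernel s k t x) \<le> C * (1 + (of_int k)\<^sup>2) powr (- s / 2) * (1 / (1 + (x - 2 * t * of_int k)\<^sup>2))"
    if t: "t \<in> {-1..1}" for k t x
  proof -
    have "(\<lambda>x. phase t x * weight_quotient (- s) (of_int k) x) \<in> ?A" using t by blast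
    from C(2)[rule_format, OF this, of "x - 2 * t * of_int k"]
    have "(1 + (real_of_int k)\<^sup>2) powr (- s / 2) * norm (inv_fourier (\<lambda>\<eta>. (phase t \<eta> * weight_quotient (- s) (of_int k) \<eta>) * box_symbol 0 \<eta>) (x - 2 * t * of_int k))
      \<le> (1 + (real_of_int k)\<^sup>2) powr (- s / 2) * (C * (1 / (1 + (x - 2 * t * of_int k)\<^sup>2)))"
      by (intro mult_left_mono) auto
    then show ?thesis unfolding box_kernel_galilei by (simp only: mult_ac)
  qed
  with C(1) show ?thesis by blast
qed

lemma box_kernel_lipschitz:
  "\<exists>C\<ge>0. \<forall>t t' x. t \<in> {-1..1} \<longrightarrow> t' \<in> {-1..1} \<longrightarrow>
     norm (box_kernel s k t x - box_kernel s k t' x) \<le> C * \<bar>t - t'\<bar> * (1 / (1 + x\<^sup>2))"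
proof -
  let ?A = "{phase_quotient t t' |t t'. t \<in> {-1..1} \<and> t' \<in> {-1..1} \<and> t \<noteq> t'}"
  let ?\<psi> = "\<lambda>\<xi>. of_real ((1 + \<xi>\<^sup>2) powr (- s / 2)) * box_symbol k \<xi>"
  have S: "?\<psi> \<in> schwartz" by (intro schwartz_mult_slow slow_family_weight schwartz_box_symbol)
  from slow_mult_inv_fourier_bound[OF slow_family_phase_quotient S] obtain C where C: "C \<ge> 0"
    "\<forall>a\<in>?A. \<forall>x. norm (inv_fourier (\<lambda>\<xi>. a \<xi> * ?\<psi> \<xi>) x) \<le> C * (1 / (1 + x\<^sup>2))" by blast
  have "norm (box_kernel s k t x - box_kernel s k t' x) \<le> C * \<bar>t - t'\<bar> * (1 / (1 + x\<^sup>2))"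
    if t: "t \<in> {-1..1}" "t' \<in> {-1..1}" for t t' x
  proof (cases "t = t'")
    case True
    then show ?thesis by simp
  next
    case False
    have "box_kernel s k t x - box_kernel s k t' x = 1 * inv_fourier (box_mult s k t) x + (- 1) * inv_fourier (box_mult s k t') x"
      by (simp add: box_kernel_def)
    also have "\<dots> = inv_fourier (\<lambda>\<xi>. 1 * box_mult s k t \<xi> + (- 1) * box_mult s k t' \<xi>) x"
      by (intro inv_fourier_linear[symmetric] schwartz_integrable schwartz_box_mult t)
    also have "(\<lambda>\<xi>. 1 * box_mult s k t \<xi> + (- 1) * box_mult s k t' \<xi>) = (\<lambda>\<xi>. of_real (t - t') * (phase_quotient t t' \<xi> * ?\<psi> \<xi>))"
    proof
      fix \<xi>
      have "of_real (t - t') * phase_quotient t t' \<xi> = phase t \<xi> - phase t' \<xi>"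
        unfolding phase_quotient_def using False by simp
      then have "of_real (t - t') * phase_quotient t t' \<xi> * ?\<psi> \<xi> = (phase t \<xi> - phase t' \<xi>) * ?\<psi> \<xi>" by (rule arg_cong)
      then show "1 * box_mult s k t \<xi> + (- 1) * box_mult s k t' \<xi> = of_real (t - t') * (phase_quotient t t' \<xi> * ?\<psi> \<xi>)"
        unfolding box_mult_def by (simp add: algebra_simps)
    qed
    also have "inv_fourier \<dots> x = of_real (t - t') * inv_fourier (\<lambda>\<xi>. phase_quotient t t' \<xi> * ?\<psi> \<xi>) x"
      by (rule inv_fourier_cmult)
    also have "norm \<dots> \<le> \<bar>t - t'\<bar> * (C * (1 / (1 + x\<^sup>2)))"
    proof -
      have "phase_quotient t t' \<in> ?A" using t False by blast
      from C(2)[rule_format, OF this, of x] show ?thesis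
        unfolding norm_mult norm_of_real by (intro mult_left_mono) auto
    qed
    finally show ?thesis by (simp only: mult_ac)
  qed
  with C(1) show ?thesis by blast
qed

end

section \<open>Convolutions and spectra of bounded functions\<close>

text \<open>Convolution on the line.\<close>

definition conv :: "(real \<Rightarrow> complex) \<Rightarrow> (real \<Rightarrow> complex) \<Rightarrow> real \<Rightarrow> complex" where
  "conv g K x = (LBINT y. g y * K (x - y))"

text \<open>The convolution of \<open>\<bar>g\<bar>\<close> with \<open>1 / (1 + x\<^sup>2)\<close> is bounded by \<open>B\<close>. This is what convolution with a
Schwartz kernel needs, and it covers \<open>L\<^sup>p\<close> functions for all \<open>p \<ge> 1\<close> and essentially bounded functions.\<close>

definition loc_bounded :: "(real \<Rightarrow> complex) \<Rightarrow> real \<Rightarrow> bool" where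
  "loc_bounded g B \<longleftrightarrow> g \<in> borel_measurable borel \<and>
     (\<forall>x. integrable lborel (\<lambda>y. norm (g y) * (1 / (1 + (x - y)\<^sup>2))) \<and>
          (LBINT y. norm (g y) * (1 / (1 + (x - y)\<^sup>2))) \<le> B)"

lemma integral_inverse_square_translate:
  "integrable lborel (\<lambda>y::real. 1 / (1 + (x - y)\<^sup>2))" "(LBINT y. 1 / (1 + (x - y)\<^sup>2)) = pi"
  using lborel_integrable_real_affine[OF has_bochner_integral_inverse_1_plus_square(1), of "-1" x]
    lborel_integral_real_affine[of "-1" "\<lambda>y. 1 / (1 + y\<^sup>2)" x] has_bochner_integral_inverse_1_plus_square(2)
  by simp_all

lemma loc_bounded_AE_bounded:
  assumes [measurable]: "g \<in> borel_measurable borel" and b: "AE y in lborel. norm (g y) \<le> B"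
  shows "loc_bounded g (B * pi)"
  unfolding loc_bounded_def
proof (intro conjI allI)
  fix x :: real
  have w: "0 \<le> 1 / (1 + (x - y)\<^sup>2)" for y by simp
  have ae: "AE y in lborel. norm (g y) * (1 / (1 + (x - y)\<^sup>2)) \<le> B * (1 / (1 + (x - y)\<^sup>2))"
    using b by eventually_elim (rule mult_right_mono[OF _ w])
  have i: "integrable lborel (\<lambda>y. B * (1 / (1 + (x - y)\<^sup>2)))"
    by (intro integrable_mult_right integral_inverse_square_translate)
  show 1: "integrable lborel (\<lambda>y. norm (g y) * (1 / (1 + (x - y)\<^sup>2)))"
  proof (rule Bochner_Integration.integrable_bound[OF i])
    show "AE y in lborel. norm (norm (g y) * (1 / (1 + (x - y)\<^sup>2))) \<le> norm (B * (1 / (1 + (x - y)\<^sup>2)))"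
      using ae
    proof eventually_elim
      case (elim y)
      have "norm (norm (g y) * (1 / (1 + (x - y)\<^sup>2))) = norm (g y) * (1 / (1 + (x - y)\<^sup>2))" by simp
      also have "\<dots> \<le> \<bar>B * (1 / (1 + (x - y)\<^sup>2))\<bar>" using elim by (rule order_trans[OF _ abs_ge_self])
      finally show ?case by simp
    qed
  qed measurable
  have "(LBINT y. norm (g y) * (1 / (1 + (x - y)\<^sup>2))) \<le> (LBINT y. B * (1 / (1 + (x - y)\<^sup>2)))"
    by (rule integral_mono_AE[OF 1 i ae])
  also have "\<dots> = B * pi" by (subst integral_mult_right_zero) (simp only: integral_inverse_square_translate)
  finally show "(LBINT y. norm (g y) * (1 / (1 + (x - y)\<^sup>2))) \<le> B * pi" .
qed simp

lemma loc_bounded_Lp: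
  assumes [measurable]: "g \<in> borel_measurable borel" and p: "p \<ge> 1" and i: "integrable lborel (\<lambda>x. norm (g x) powr p)"
  shows "loc_bounded g (pi + (LBINT x. norm (g x) powr p))"
  unfolding loc_bounded_def
proof (intro conjI allI)
  fix x
  have i2: "integrable lborel (\<lambda>y. 1 / (1 + (x - y)\<^sup>2) + norm (g y) powr p)"
    by (intro Bochner_Integration.integrable_add i integral_inverse_square_translate)
  have b: "norm (g y) * (1 / (1 + (x - y)\<^sup>2)) \<le> 1 / (1 + (x - y)\<^sup>2) + norm (g y) powr p" for y
  proof (cases "norm (g y) \<le> 1")
    case True
    then have "norm (g y) * (1 / (1 + (x - y)\<^sup>2)) \<le> 1 * (1 / (1 + (x - y)\<^sup>2))" by (intro mult_right_mono) auto
    then show ?thesis by (simp add: add_increasing2)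
  next
    case False
    have "norm (g y) * (1 / (1 + (x - y)\<^sup>2)) \<le> norm (g y) * 1"
      by (intro mult_left_mono) (auto simp: divide_le_eq add_pos_nonneg)
    also have "\<dots> \<le> norm (g y) powr p" using False p powr_mono[of 1 p "norm (g y)"] by simp
    finally show ?thesis by (simp add: add_increasing)
  qed
  show 1: "integrable lborel (\<lambda>y. norm (g y) * (1 / (1 + (x - y)\<^sup>2)))"
  proof (rule Bochner_Integration.integrable_bound[OF i2])
    show "AE y in lborel. norm (norm (g y) * (1 / (1 + (x - y)\<^sup>2))) \<le> norm (1 / (1 + (x - y)\<^sup>2) + norm (g y) powr p)"
    proof (intro AE_I2)
      fix y
      have "norm (norm (g y) * (1 / (1 + (x - y)\<^sup>2))) = norm (g y) * (1 / (1 + (x - y)\<^sup>2))" by simp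
      also have "\<dots> \<le> \<bar>1 / (1 + (x - y)\<^sup>2) + norm (g y) powr p\<bar>" using b by (rule order_trans[OF _ abs_ge_self])
      finally show "norm (norm (g y) * (1 / (1 + (x - y)\<^sup>2))) \<le> norm (1 / (1 + (x - y)\<^sup>2) + norm (g y) powr p)" by simp
    qed
  qed measurable
  have "(LBINT y. norm (g y) * (1 / (1 + (x - y)\<^sup>2))) \<le> (LBINT y. 1 / (1 + (x - y)\<^sup>2) + norm (g y) powr p)"
    by (rule integral_mono[OF 1 i2 b])
  also have "\<dots> = pi + (LBINT x. norm (g x) powr p)"
    by (subst Bochner_Integration.integral_add[OF integral_inverse_square_translate(1) i]) (simp only: integral_inverse_square_translate)
  finally show "(LBINT y. norm (g y) * (1 / (1 + (x - y)\<^sup>2))) \<le> pi + (LBINT x. norm (g x) powr p)" .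
qed simp

lemma conv_integrand_bound:
  fixes a x y :: real and g K :: "real \<Rightarrow> complex"
  assumes K: "\<And>z. norm (K z) \<le> c * (1 / (1 + (z - a)\<^sup>2))"
  shows "norm (g y * K (x - y)) \<le> c * (norm (g y) * (1 / (1 + ((x - a) - y)\<^sup>2)))"
proof -
  have "norm (g y) * norm (K (x - y)) \<le> norm (g y) * (c * (1 / (1 + (x - y - a)\<^sup>2)))"
    by (intro mult_left_mono K) auto
  moreover have "x - y - a = (x - a) - y" by simp
  ultimately show ?thesis by (simp only: norm_mult mult.left_commute)
qed

lemma conv_bound:
  assumes g: "loc_bounded g B" and [measurable]: "K \<in> borel_measurable borel"
    and K: "\<And>z. norm (K z) \<le> c * (1 / (1 + (z - a)\<^sup>2))" and c: "c \<ge> 0"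
  shows "integrable lborel (\<lambda>y. g y * K (x - y))" "norm (conv g K x) \<le> c * B"
    "(LBINT y. norm (g y * K (x - y))) \<le> c * B"
proof -
  have [measurable]: "g \<in> borel_measurable borel" using g by (simp add: loc_bounded_def)
  have i0: "integrable lborel (\<lambda>y. norm (g y) * (1 / (1 + ((x - a) - y)\<^sup>2)))"
    and le: "(LBINT y. norm (g y) * (1 / (1 + ((x - a) - y)\<^sup>2))) \<le> B"
    using g unfolding loc_bounded_def by blast+
  have i: "integrable lborel (\<lambda>y. c * (norm (g y) * (1 / (1 + ((x - a) - y)\<^sup>2))))"
    by (rule integrable_mult_right[OF i0])
  have b: "norm (g y * K (x - y)) \<le> c * (norm (g y) * (1 / (1 + ((x - a) - y)\<^sup>2)))" for y
    by (rule conv_integrand_bound[OF K])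
  show 1: "integrable lborel (\<lambda>y. g y * K (x - y))"
  proof (rule Bochner_Integration.integrable_bound[OF i])
    show "AE y in lborel. norm (g y * K (x - y)) \<le> norm (c * (norm (g y) * (1 / (1 + ((x - a) - y)\<^sup>2))))"
      by (intro AE_I2 order_trans[OF b]) (simp only: real_norm_def abs_ge_self)
  qed measurable
  have "(LBINT y. norm (g y * K (x - y))) \<le> (LBINT y. c * (norm (g y) * (1 / (1 + ((x - a) - y)\<^sup>2))))"
    by (rule integral_mono[OF integrable_norm[OF 1] i b])
  also have "\<dots> = c * (LBINT y. norm (g y) * (1 / (1 + ((x - a) - y)\<^sup>2)))" by (rule integral_mult_right_zero)
  also have "\<dots> \<le> c * B" by (intro mult_left_mono le c)
  finally show 2: "(LBINT y. norm (g y * K (x - y))) \<le> c * B" .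
  show "norm (conv g K x) \<le> c * B"
    unfolding conv_def using integral_norm_bound 2 by (rule order_trans)
qed

lemma schwartz_kernel_bound:
  assumes "K \<in> schwartz"
  shows "norm (K z) \<le> (2 * schwartz_norm 2 K) * (1 / (1 + (z - 0)\<^sup>2))" "2 * schwartz_norm 2 K \<ge> 0"
  using schwartz_decay[OF assms, of z] schwartz_norm_nonneg[OF assms] by simp_all

lemma conv_measurable:
  assumes [measurable]: "g \<in> borel_measurable borel" "K \<in> borel_measurable borel"
  shows "conv g K \<in> borel_measurable borel"
proof -
  have "(\<lambda>x. LINT y|lborel. (\<lambda>(x, y). g y * K (x - y)) (x, y)) \<in> borel_measurable borel"
    by (rule lborel.borel_measurable_lebesgue_integral) simp
  then show ?thesis by (simp add: conv_def[abs_def])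
qed

lemma conv_Fubini:
  assumes f: "integrable lborel f" and g: "loc_bounded g B" and K: "K \<in> schwartz"
  shows "integrable lborel (\<lambda>x. f x * conv g K x)"
    "(LBINT x. f x * conv g K x) = (LBINT y. g y * (LBINT x. f x * K (x - y)))"
proof -
  have [measurable]: "g \<in> borel_measurable borel" "f \<in> borel_measurable borel" "K \<in> borel_measurable borel"
    using g f schwartz_measurable[OF K] by (auto simp: loc_bounded_def)
  note [measurable] = conv_measurable[of g K]
  note cb = conv_bound[OF g _ schwartz_kernel_bound[OF K]]
  let ?c = "2 * schwartz_norm 2 K"
  have fi: "integrable lborel (\<lambda>x. norm (f x) * (?c * B))" using f by simp
  have "integrable (lborel \<Otimes>\<^sub>M lborel) (\<lambda>(x, y). f x * (g y * K (x - y)))"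
  proof (rule lborel_pair.Fubini_integrable)
    show "AE x in lborel. integrable lborel (\<lambda>y. case (x, y) of (x, y) \<Rightarrow> f x * (g y * K (x - y)))"
      using cb(1) by (intro AE_I2) (simp del: integrable_mult_right_iff add: integrable_mult_right)
    show "integrable lborel (\<lambda>x. LINT y|lborel. norm (case (x, y) of (x, y) \<Rightarrow> f x * (g y * K (x - y))))"
    proof (rule Bochner_Integration.integrable_bound[OF fi])
      show "AE x in lborel. norm (LINT y|lborel. norm (case (x, y) of (x, y) \<Rightarrow> f x * (g y * K (x - y)))) \<le> norm (norm (f x) * (?c * B))"
      proof (intro AE_I2)
        fix x
        have e: "norm (f x * (g y * K (x - y))) = norm (f x) * norm (g y * K (x - y))" for y by (simp add: norm_mult)
        have "(LBINT y. norm (f x * (g y * K (x - y)))) = norm (f x) * (LBINT y. norm (g y * K (x - y)))"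
          unfolding e by (rule integral_mult_right_zero)
        also have "\<dots> \<le> norm (f x) * (?c * B)" by (intro mult_left_mono cb(3)) auto
        also have "\<dots> \<le> norm (norm (f x) * (?c * B))" unfolding real_norm_def by (rule abs_ge_self)
        finally have "(LBINT y. norm (f x * (g y * K (x - y)))) \<le> norm (norm (f x) * (?c * B))" .
        moreover have "0 \<le> (LBINT y. norm (f x * (g y * K (x - y))))" by simp
        ultimately show "norm (LINT y|lborel. norm (case (x, y) of (x, y) \<Rightarrow> f x * (g y * K (x - y)))) \<le> norm (norm (f x) * (?c * B))"
          by simp
      qed
    qed measurable
  qed measurable
  from lborel_pair.Fubini_integral[OF this]
  have F: "(LBINT y. LBINT x. f x * (g y * K (x - y))) = (LBINT x. LBINT y. f x * (g y * K (x - y)))" by simp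
  have 1: "(LBINT y. f x * (g y * K (x - y))) = f x * conv g K x" for x
    unfolding conv_def by (rule integral_mult_right_zero)
  have 2: "(LBINT x. f x * (g y * K (x - y))) = g y * (LBINT x. f x * K (x - y))" for y
    by (subst integral_mult_right_zero[symmetric]) (simp add: mult_ac)
  show "(LBINT x. f x * conv g K x) = (LBINT y. g y * (LBINT x. f x * K (x - y)))"
    using F unfolding 1 2 by simp
  show "integrable lborel (\<lambda>x. f x * conv g K x)"
  proof (rule Bochner_Integration.integrable_bound[OF fi])
    show "AE x in lborel. norm (f x * conv g K x) \<le> norm (norm (f x) * (?c * B))"
    proof (intro AE_I2)
      fix x
      have "norm (f x * conv g K x) \<le> norm (f x) * (?c * B)" unfolding norm_mult by (intro mult_left_mono cb(2)) auto
      also have "\<dots> \<le> norm (norm (f x) * (?c * B))" unfolding real_norm_def by (rule abs_ge_self)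
      finally show "norm (f x * conv g K x) \<le> norm (norm (f x) * (?c * B))" .
    qed
  qed measurable
qed

text \<open>Convolution with \<open>inv_fourier M\<close> represents the multiplier with symbol
\<open>M\<close>.\<close>

lemma conv_mult_op:
  assumes g: "loc_bounded g B" and M: "M \<in> schwartz" and p: "\<phi> \<in> schwartz"
  shows "integrable lborel (\<lambda>x. conv g (inv_fourier M) x * \<phi> x)"
    "(LBINT y. g y * mult_op M \<phi> y) = (LBINT x. conv g (inv_fourier M) x * \<phi> x)"
  using conv_Fubini[OF schwartz_integrable[OF p] g schwartz_inv_fourier[OF M]]
  by (simp_all add: mult_op_kernel[OF M p] mult.commute)

lemma inverse_square_translate_le:
  fixes z h :: real
  assumes "\<bar>h\<bar> \<le> 1" shows "1 / (1 + (z + h)\<^sup>2) \<le> 4 * (1 / (1 + z\<^sup>2))"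
proof -
  have "h\<^sup>2 \<le> 1" using assms by (simp add: abs_square_le_1)
  then have "2 * (1 + (z + h)\<^sup>2) * (1 + h\<^sup>2) \<le> 2 * (1 + (z + h)\<^sup>2) * 2" by (intro mult_left_mono) auto
  with peetre[of z h] have "1 + z\<^sup>2 \<le> 4 * (1 + (z + h)\<^sup>2)" by simp
  then show ?thesis using one_plus_square_pos[of z] one_plus_square_pos[of "z + h"] by (simp add: divide_simps)
qed

lemma conv_tendsto:
  assumes g: "loc_bounded g B" and K: "K \<in> schwartz" and X: "X \<longlonglongrightarrow> x"
  shows "(\<lambda>n. conv g K (X n)) \<longlonglongrightarrow> conv g K x"
proof -
  have [measurable]: "g \<in> borel_measurable borel" "K \<in> borel_measurable borel"
    using g schwartz_measurable[OF K] by (auto simp: loc_bounded_def)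
  let ?c = "2 * schwartz_norm 2 K"
  obtain N where N': "\<forall>n\<ge>N. norm (X n - x) < 1" using LIMSEQ_D[OF X, of 1] by auto
  have N: "\<bar>X n - x\<bar> \<le> 1" if "n \<ge> N" for n using N' that by (auto intro: less_imp_le)
  have "(\<lambda>n. LBINT y. g y * K (X (n + N) - y)) \<longlonglongrightarrow> (LBINT y. g y * K (x - y))"
  proof (rule integral_dominated_convergence[where w = "\<lambda>y. (?c * 4) * (norm (g y) * (1 / (1 + (x - y)\<^sup>2)))"])
    have "integrable lborel (\<lambda>y. norm (g y) * (1 / (1 + (x - y)\<^sup>2)))" using g unfolding loc_bounded_def by blast
    then show "integrable lborel (\<lambda>y. (?c * 4) * (norm (g y) * (1 / (1 + (x - y)\<^sup>2))))" by (rule integrable_mult_right)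
    have "isCont K z" for z
      using smooth_continuous[OF schwartz_smooth[OF K], of UNIV] by (simp add: continuous_on_eq_continuous_at)
    then show "AE y in lborel. (\<lambda>n. g y * K (X (n + N) - y)) \<longlonglongrightarrow> g y * K (x - y)"
      by (intro AE_I2 tendsto_mult tendsto_const isCont_tendsto_compose[where g = K] tendsto_diff LIMSEQ_ignore_initial_segment X)
    show "AE y in lborel. norm (g y * K (X (n + N) - y)) \<le> (?c * 4) * (norm (g y) * (1 / (1 + (x - y)\<^sup>2)))" for n
    proof (intro AE_I2)
      fix y
      have "1 / (1 + ((x - y) + (X (n + N) - x))\<^sup>2) \<le> 4 * (1 / (1 + (x - y)\<^sup>2))"
        by (rule inverse_square_translate_le) (simp add: N)
      then have h: "1 / (1 + (X (n + N) - y)\<^sup>2) \<le> 4 * (1 / (1 + (x - y)\<^sup>2))" by simp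
      have "norm (g y * K (X (n + N) - y)) \<le> ?c * (norm (g y) * (1 / (1 + ((X (n + N) - 0) - y)\<^sup>2)))"
        by (rule conv_integrand_bound[OF schwartz_kernel_bound(1)[OF K]])
      also have "\<dots> \<le> ?c * (norm (g y) * (4 * (1 / (1 + (x - y)\<^sup>2))))"
        using h schwartz_kernel_bound(2)[OF K] by (intro mult_left_mono) auto
      finally show "norm (g y * K (X (n + N) - y)) \<le> (?c * 4) * (norm (g y) * (1 / (1 + (x - y)\<^sup>2)))"
        by (simp only: mult_ac)
    qed
  qed measurable
  then have "(\<lambda>n. conv g K (X (n + N))) \<longlonglongrightarrow> conv g K x" unfolding conv_def .
  then show ?thesis by (rule LIMSEQ_offset)
qed

text \<open>The Fourier transform of \<open>F\<close> is supported in \<open>{\<alpha>..\<beta>}\<close>, expressed by duality: \<open>F\<close> annihilates the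
Schwartz functions whose inverse Fourier transform vanishes on that interval.\<close>

definition spectrum_in :: "(real \<Rightarrow> complex) \<Rightarrow> real \<Rightarrow> real \<Rightarrow> bool" where
  "spectrum_in F \<alpha> \<beta> \<longleftrightarrow> (\<forall>\<psi>\<in>schwartz. (\<forall>\<xi>\<in>{\<alpha>..\<beta>}. inv_fourier \<psi> \<xi> = 0) \<longrightarrow> (LBINT y. F y * \<psi> y) = 0)"

lemma inv_fourier_mult_kernel:
  assumes M: "M \<in> schwartz" and p: "\<psi> \<in> schwartz"
  shows "inv_fourier (\<lambda>y. \<psi> y * inv_fourier M (y - z)) \<xi> =
     (LBINT \<eta>. (cis (- (z * \<eta>)) * M \<eta> / (2 * pi)) * inv_fourier \<psi> (\<xi> + \<eta>))"
proof -
  have iM: "integrable lborel (\<lambda>\<eta>. cis (- (z * \<eta>)) * M \<eta> / (2 * pi))"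
    using integrable_cis_mult[OF schwartz_integrable[OF M], of "\<lambda>\<eta>. - (z * \<eta>)"] by simp
  have ip: "integrable lborel (\<lambda>y. cis (\<xi> * y) * \<psi> y)"
    by (intro integrable_cis_mult schwartz_integrable p) simp
  have K: "inv_fourier M (y - z) = (LBINT \<eta>. (cis (- (z * \<eta>)) * M \<eta> / (2 * pi)) * cis (y * \<eta>))" for y
  proof -
    have c: "cis (- (z * \<eta>)) * cis (y * \<eta>) = cis ((y - z) * \<eta>)" for \<eta> by (simp add: cis_mult algebra_simps)
    have e: "(cis (- (z * \<eta>)) * M \<eta> / (2 * pi)) * cis (y * \<eta>) = cis ((y - z) * \<eta>) * M \<eta> / (2 * pi)" for \<eta>
      by (simp flip: c)
    show ?thesis unfolding e inv_fourier_def by simp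
  qed
  have "(LBINT y. cis (\<xi> * y) * (\<psi> y * inv_fourier M (y - z))) =
     (LBINT y. (cis (\<xi> * y) * \<psi> y) * (LBINT \<eta>. (cis (- (z * \<eta>)) * M \<eta> / (2 * pi)) * cis (y * \<eta>)))"
    by (simp only: K mult.assoc)
  also have "\<dots> = (LBINT \<eta>. (cis (- (z * \<eta>)) * M \<eta> / (2 * pi)) * (LBINT y. (cis (\<xi> * y) * \<psi> y) * cis (y * \<eta>)))"
    by (rule Fubini_bounded_kernel[OF ip iM, where B = 1]) auto
  also have "\<dots> = (LBINT \<eta>. (cis (- (z * \<eta>)) * M \<eta> / (2 * pi)) * (2 * pi * inv_fourier \<psi> (\<xi> + \<eta>)))"
  proof -
    have e: "(cis (\<xi> * y) * \<psi> y) * cis (y * \<eta>) = cis ((\<xi> + \<eta>) * y) * \<psi> y" for y \<eta>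
    proof -
      have "cis (\<xi> * y) * cis (y * \<eta>) = cis ((\<xi> + \<eta>) * y)" by (simp add: cis_mult algebra_simps)
      then show ?thesis by (metis mult.assoc mult.commute)
    qed
    show ?thesis unfolding e inv_fourier_def by simp
  qed
  also have "\<dots> = (LBINT \<eta>. (2 * pi) * ((cis (- (z * \<eta>)) * M \<eta> / (2 * pi)) * inv_fourier \<psi> (\<xi> + \<eta>)))"
    by (simp add: mult_ac)
  also have "\<dots> = 2 * pi * (LBINT \<eta>. (cis (- (z * \<eta>)) * M \<eta> / (2 * pi)) * inv_fourier \<psi> (\<xi> + \<eta>))"
    by (rule integral_mult_right_zero)
  finally show ?thesis unfolding inv_fourier_def[of "\<lambda>y. \<psi> y * inv_fourier M (y - z)"] by simp
qed

text \<open>The spectrum of a product lies in the sum of the spectra. Only one factor has to be given as a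
convolution: the product is then an average of modulations of the other factor.\<close>

lemma spectrum_in_mult:
  assumes F: "F \<in> borel_measurable borel" "AE y in lborel. norm (F y) \<le> B" "spectrum_in F \<alpha> \<beta>"
    and g: "loc_bounded g B'" and M: "M \<in> schwartz" "\<And>\<eta>. \<eta> \<notin> {\<gamma>..\<delta>} \<Longrightarrow> M \<eta> = 0"
  shows "spectrum_in (\<lambda>y. F y * conv g (inv_fourier M) y) (\<alpha> + \<gamma>) (\<beta> + \<delta>)"
  unfolding spectrum_in_def
proof (intro ballI impI)
  fix \<psi> assume p: "\<psi> \<in> schwartz" and z: "\<forall>\<xi>\<in>{\<alpha> + \<gamma>..\<beta> + \<delta>}. inv_fourier \<psi> \<xi> = 0"
  have Fp: "integrable lborel (\<lambda>y. F y * \<psi> y)" by (rule integrable_bounded_mult[OF F(1,2) schwartz_integrable[OF p]])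
  have "(LBINT y. F y * conv g (inv_fourier M) y * \<psi> y) = (LBINT y. (F y * \<psi> y) * conv g (inv_fourier M) y)"
    by (simp add: mult_ac)
  also have "\<dots> = (LBINT z. g z * (LBINT y. (F y * \<psi> y) * inv_fourier M (y - z)))"
    by (rule conv_Fubini[OF Fp g schwartz_inv_fourier[OF M(1)]])
  also have "\<dots> = (LBINT z. g z * 0)"
  proof -
    have "(LBINT y. (F y * \<psi> y) * inv_fourier M (y - z)) = 0" for z
    proof -
      let ?\<psi> = "\<lambda>y. \<psi> y * inv_fourier M (y - z)"
      have "?\<psi> \<in> schwartz"
        using schwartz_mult[OF p schwartz_translate[OF schwartz_inv_fourier[OF M(1)], of "- z"]] by simp
      moreover have "\<forall>\<xi>\<in>{\<alpha>..\<beta>}. inv_fourier ?\<psi> \<xi> = 0"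
      proof
        fix \<xi> assume \<xi>: "\<xi> \<in> {\<alpha>..\<beta>}"
        have "(cis (- (z * \<eta>)) * M \<eta> / (2 * pi)) * inv_fourier \<psi> (\<xi> + \<eta>) = 0" for \<eta>
        proof (cases "\<eta> \<in> {\<gamma>..\<delta>}")
          case True
          then show ?thesis using \<open>\<forall>\<xi>\<in>{\<alpha> + \<gamma>..\<beta> + \<delta>}. inv_fourier \<psi> \<xi> = 0\<close> \<xi> by auto
        qed (simp add: M(2))
        then show "inv_fourier ?\<psi> \<xi> = 0" unfolding inv_fourier_mult_kernel[OF M(1) p] by (simp only: integral_zero)
      qed
      ultimately have "(LBINT y. F y * ?\<psi> y) = 0" using F(3) unfolding spectrum_in_def by blast
      then show ?thesis by (simp add: mult.assoc)
    qed
    then show ?thesis by simp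
  qed
  finally show "(LBINT y. F y * conv g (inv_fourier M) y * \<psi> y) = 0" by simp
qed

lemma cnj_inv_fourier: "cnj (inv_fourier M x) = inv_fourier (\<lambda>\<eta>. cnj (M (- \<eta>))) x"
proof -
  have "cnj (LBINT \<eta>. cis (x * \<eta>) * M \<eta>) = (LBINT \<eta>. cis (- (x * \<eta>)) * cnj (M \<eta>))"
    by (subst Bochner_Integration.integral_cnj[symmetric]) (simp add: cis_cnj)
  also have "\<dots> = (LBINT \<eta>. cis (x * \<eta>) * cnj (M (- \<eta>)))"
    by (subst lborel_integral_real_affine[of "-1" _ 0]) auto
  finally show ?thesis by (simp add: inv_fourier_def)
qed

lemma cnj_conv: "cnj (conv g (inv_fourier M) x) = conv (\<lambda>y. cnj (g y)) (inv_fourier (\<lambda>\<eta>. cnj (M (- \<eta>)))) x"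
  unfolding conv_def by (subst Bochner_Integration.integral_cnj[symmetric]) (simp add: cnj_inv_fourier)

lemma represents_cong:
  assumes "\<And>\<phi>. \<phi> \<in> schwartz \<Longrightarrow> T \<phi> = T' \<phi>" shows "represents g T = represents g T'"
  unfolding represents_def using assms by auto

lemma represents_distr_of:
  assumes [measurable]: "F \<in> borel_measurable borel" and b: "AE y in lborel. norm (F y) \<le> B"
  shows "represents F (distr_of F)"
  unfolding represents_def using integrable_bounded_mult(1)[OF assms schwartz_integrable] by auto

context freq_partition
begin

text \<open>The box \<open>k\<close> of \<open>U(t) f\<close>, in terms of a function \<open>g\<close>
representing \<open>\<langle>\<partial>\<rangle>\<^sup>s f\<close>.\<close>

lemma free_box_represents:
  assumes g: "loc_bounded g B"
    and r: "represents g (fourier_multiplier (\<lambda>\<xi>. of_real ((1 + \<xi>\<^sup>2) powr (s / 2))) f)"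
    and t: "t \<in> {-1..1}"
  shows "represents (conv g (box_kernel s k t)) (freq_box \<sigma> k (schroedinger t f))"
  unfolding represents_def
proof (intro conjI ballI)
  show "conv g (box_kernel s k t) \<in> borel_measurable lborel"
    using conv_measurable[of g "box_kernel s k t"] g schwartz_measurable[OF schwartz_box_kernel[OF t]]
    by (simp add: loc_bounded_def)
  fix \<phi> :: "real \<Rightarrow> complex" assume p: "\<phi> \<in> schwartz"
  note M = schwartz_box_mult[OF t, of s k]
  show "integrable lborel (\<lambda>x. conv g (box_kernel s k t) x * \<phi> x)"
    unfolding box_kernel_def by (rule conv_mult_op[OF g M p])
  let ?w = "\<lambda>\<xi>. complex_of_real ((1 + \<xi>\<^sup>2) powr (s / 2))"
  have sM: "slow_family {box_mult s k t}" by (rule schwartz_slow_family[OF M])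
  have "freq_box \<sigma> k (schroedinger t f) \<phi> = f (mult_op (phase t) (mult_op (box_symbol k) \<phi>))"
    unfolding freq_box_eq schroedinger_def fourier_multiplier_eq phase_def[abs_def] ..
  also have "\<dots> = f (mult_op (\<lambda>\<xi>. phase t \<xi> * box_symbol k \<xi>) \<phi>)"
    by (simp add: mult_op_mult_op[OF slow_family_box_symbol p])
  also have "(\<lambda>\<xi>. phase t \<xi> * box_symbol k \<xi>) = (\<lambda>\<xi>. ?w \<xi> * box_mult s k t \<xi>)"
  proof
    fix \<xi>
    have "(1 + \<xi>\<^sup>2) powr (s / 2) * (1 + \<xi>\<^sup>2) powr (- s / 2) = 1"
      using one_plus_square_pos[of \<xi>] by (simp flip: powr_add)
    then have "?w \<xi> * of_real ((1 + \<xi>\<^sup>2) powr (- s / 2)) = 1" by (simp flip: of_real_mult)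
    then show "phase t \<xi> * box_symbol k \<xi> = ?w \<xi> * box_mult s k t \<xi>"
      unfolding box_mult_def by (simp add: mult_ac)
  qed
  also have "f (mult_op (\<lambda>\<xi>. ?w \<xi> * box_mult s k t \<xi>) \<phi>) = f (mult_op ?w (mult_op (box_mult s k t) \<phi>))"
    by (simp add: mult_op_mult_op[OF sM p])
  also have "\<dots> = fourier_multiplier ?w f (mult_op (box_mult s k t) \<phi>)" by (simp add: fourier_multiplier_eq)
  also have "\<dots> = (LBINT y. g y * mult_op (box_mult s k t) \<phi> y)"
    using r schwartz_mult_op[OF sM p] by (simp add: represents_def distr_of_def)
  also have "\<dots> = distr_of (conv g (box_kernel s k t)) \<phi>"
    unfolding box_kernel_def distr_of_def by (rule conv_mult_op[OF g M p])
  finally show "freq_box \<sigma> k (schroedinger t f) \<phi> = distr_of (conv g (box_kernel s k t)) \<phi>" .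
qed

lemma represents_weight_0:
  assumes "represents g T"
  shows "represents g (fourier_multiplier (\<lambda>\<xi>. of_real ((1 + \<xi>\<^sup>2) powr (0 / 2))) T)"
proof (rule represents_cong[THEN iffD1, OF _ assms])
  fix \<phi> assume p: "\<phi> \<in> schwartz"
  have "(\<lambda>\<xi>. complex_of_real ((1 + \<xi>\<^sup>2) powr (0 / 2))) = (\<lambda>\<xi>. 1)"
  proof
    fix \<xi> :: real show "complex_of_real ((1 + \<xi>\<^sup>2) powr (0 / 2)) = 1" using one_plus_square_pos[of \<xi>] by simp
  qed
  then show "T \<phi> = fourier_multiplier (\<lambda>\<xi>. of_real ((1 + \<xi>\<^sup>2) powr (0 / 2))) T \<phi>"
    by (simp only: fourier_multiplier_eq mult_op_1[OF p])
qed

lemma box_represents: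
  assumes "loc_bounded g B" "represents g T" "t \<in> {-1..1}"
  shows "represents (conv g (box_kernel 0 k t)) (freq_box \<sigma> k (schroedinger t T))"
  by (rule free_box_represents[OF assms(1) represents_weight_0[OF assms(2)] assms(3)])

lemma box_represents_0:
  assumes "loc_bounded g B" "represents g T"
  shows "represents (conv g (box_kernel 0 k 0)) (freq_box \<sigma> k T)"
proof (rule represents_cong[THEN iffD1, OF _ box_represents[OF assms]])
  fix \<phi> assume p: "\<phi> \<in> schwartz"
  have "schroedinger 0 T (mult_op (box_symbol k) \<phi>) = T (mult_op (\<lambda>\<xi>. 1) (mult_op (box_symbol k) \<phi>))"
    by (simp add: schroedinger_def fourier_multiplier_eq)
  then show "freq_box \<sigma> k (schroedinger 0 T) \<phi> = freq_box \<sigma> k T \<phi>"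
    by (simp add: freq_box_eq mult_op_1 schwartz_mult_op slow_family_box_symbol p)
qed simp

lemma spectrum_in_box:
  assumes T: "T \<in> tempered" and r: "represents g (freq_box \<sigma> k T)"
  shows "spectrum_in g (of_int k - \<rho>) (of_int k + \<rho>)"
  unfolding spectrum_in_def
proof (intro ballI impI)
  fix \<psi> assume p: "\<psi> \<in> schwartz" and z: "\<forall>\<xi>\<in>{of_int k - \<rho>..of_int k + \<rho>}. inv_fourier \<psi> \<xi> = 0"
  have "(LBINT y. g y * \<psi> y) = T (mult_op (box_symbol k) \<psi>)"
    using r p by (simp add: represents_def distr_of_def freq_box_eq)
  also have "mult_op (box_symbol k) \<psi> = (\<lambda>x. 0)"
  proof -
    have "box_symbol k \<xi> * inv_fourier \<psi> \<xi> = 0" for \<xi>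
    proof (cases "\<rho> < \<bar>\<xi> - of_int k\<bar>")
      case True
      then show ?thesis by (simp add: box_symbol_supp)
    next
      case False
      then have "\<xi> \<in> {of_int k - \<rho>..of_int k + \<rho>}" unfolding atLeastAtMost_iff by linarith
      with z show ?thesis by simp
    qed
    then show ?thesis unfolding mult_op_def fourier_def by (simp only: mult_zero_right integral_zero)
  qed
  also have "T (\<lambda>x. 0) = 0" using tempered_linear[OF T schwartz_zero schwartz_zero, of 0 0] by simp
  finally show "(LBINT y. g y * \<psi> y) = 0" .
qed

lemma inv_fourier_box_kernel_reflect:
  assumes t: "t \<in> {-1..1}"
  shows "inv_fourier (\<lambda>y. box_kernel s k t (x - y)) \<xi> = cis (x * \<xi>) * box_mult s k t \<xi> / (2 * pi)"
proof -
  have "(LBINT y. cis (\<xi> * y) * box_kernel s k t (x - y)) = (LBINT w. cis (\<xi> * (x + (-1) * w)) * box_kernel s k t (x - (x + (-1) * w)))"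
    by (subst lborel_integral_real_affine[of "-1" _ x]) auto
  also have "\<dots> = (LBINT w. cis (x * \<xi>) * (cis (- (w * \<xi>)) * box_kernel s k t w))"
  proof (intro Bochner_Integration.integral_cong refl)
    fix w
    have "cis (\<xi> * (x + (-1) * w)) = cis (x * \<xi>) * cis (- (w * \<xi>))" by (simp add: cis_mult algebra_simps)
    then show "cis (\<xi> * (x + (-1) * w)) * box_kernel s k t (x - (x + (-1) * w)) = cis (x * \<xi>) * (cis (- (w * \<xi>)) * box_kernel s k t w)"
      by simp
  qed
  also have "\<dots> = cis (x * \<xi>) * fourier (box_kernel s k t) \<xi>" unfolding fourier_def by (rule integral_mult_right_zero)
  also have "fourier (box_kernel s k t) = box_mult s k t" unfolding box_kernel_def by (rule fourier_inv_fourier[OF schwartz_box_mult[OF t]])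
  finally show ?thesis by (simp add: inv_fourier_def[of "\<lambda>y. box_kernel s k t (x - y)"])
qed

lemma schwartz_box_kernel_reflect:
  assumes "t \<in> {-1..1}" shows "(\<lambda>y. box_kernel s k t (x - y)) \<in> schwartz"
proof -
  have "(\<lambda>y. (\<lambda>z. box_kernel s k t (- z)) (y + (- x))) \<in> schwartz"
    by (intro schwartz_translate schwartz_reflect schwartz_box_kernel assms)
  then show ?thesis by simp
qed

lemma spectrum_in_conv_box_kernel:
  assumes "spectrum_in F \<alpha> \<beta>" "t \<in> {-1..1}" "\<And>\<xi>. \<xi> \<in> {\<alpha>..\<beta>} \<Longrightarrow> \<rho> < \<bar>\<xi> - of_int k\<bar>"
  shows "conv F (box_kernel s k t) x = 0"
proof -
  have "\<forall>\<xi>\<in>{\<alpha>..\<beta>}. inv_fourier (\<lambda>y. box_kernel s k t (x - y)) \<xi> = 0"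
    using assms(3) by (simp add: inv_fourier_box_kernel_reflect[OF assms(2)] box_mult_supp)
  with assms(1) schwartz_box_kernel_reflect[OF assms(2)] show ?thesis
    unfolding spectrum_in_def conv_def by blast
qed

end

section \<open>The trilinear estimate at a fixed time\<close>

lemma borel_measurable_cnj [measurable (raw)]:
  "f \<in> borel_measurable M \<Longrightarrow> (\<lambda>x. cnj (f x)) \<in> borel_measurable M"
  by (rule borel_measurable_continuous_on[where f = cnj]) (auto intro!: continuous_intros)

lemma sum_product3:
  fixes f g h :: "'a \<Rightarrow> 'b::comm_semiring_0"
  shows "(\<Sum>a\<in>I. f a) * (\<Sum>b\<in>I. g b) * (\<Sum>c\<in>I. h c) = (\<Sum>a\<in>I. \<Sum>b\<in>I. \<Sum>c\<in>I. f a * g b * h c)"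
proof -
  have "(\<Sum>a\<in>I. f a) * (\<Sum>b\<in>I. g b) * (\<Sum>c\<in>I. h c) = (\<Sum>a\<in>I. \<Sum>b\<in>I. f a * g b * (\<Sum>c\<in>I. h c))"
    by (subst sum_product) (simp only: sum_distrib_right)
  then show ?thesis by (simp only: sum_distrib_left)
qed

lemma ennreal_sum3:
  fixes R :: "'a \<Rightarrow> 'a \<Rightarrow> 'a \<Rightarrow> real"
  assumes "\<And>a b c. R a b c \<ge> 0"
  shows "ennreal (\<Sum>a\<in>I. \<Sum>b\<in>I. \<Sum>c\<in>I. R a b c) = (\<Sum>a\<in>I. \<Sum>b\<in>I. \<Sum>c\<in>I. ennreal (R a b c))"
  using assms by (simp add: sum_nonneg)

context freq_partition
begin

text \<open>The supremum norm of the box \<open>k\<close> of \<open>u\<close>.\<close>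

definition box_norm :: "int \<Rightarrow> distr \<Rightarrow> ennreal" where
  "box_norm k u = Lp_norm \<infinity> (freq_box \<sigma> k u)"

text \<open>The frequencies \<open>a\<close>, \<open>b\<close>, \<open>c\<close> can produce the frequency \<open>k\<close>. Each of the four boxes involved has
radius \<open>\<rho>\<close>, whence the threshold \<open>4 \<rho>\<close>.\<close>

definition resonant :: "int \<Rightarrow> int \<Rightarrow> int \<Rightarrow> int \<Rightarrow> bool" where
  "resonant k a b c \<longleftrightarrow> \<bar>real_of_int (a - b + c) - of_int k\<bar> \<le> 4 * \<rho>"

text \<open>The sum of the products of the box norms over the resonant triples with entries in
\<open>{-n..n}\<close>.\<close>

definition trilinear_part :: "nat \<Rightarrow> int \<Rightarrow> distr \<Rightarrow> distr \<Rightarrow> distr \<Rightarrow> ennreal" where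
  "trilinear_part n k u v w = (\<Sum>a\<in>{- int n..int n}. \<Sum>b\<in>{- int n..int n}. \<Sum>c\<in>{- int n..int n}.
     if resonant k a b c then box_norm a u * box_norm b v * box_norm c w else 0)"

text \<open>The sum over all resonant triples.\<close>

definition trilinear_sum :: "int \<Rightarrow> distr \<Rightarrow> distr \<Rightarrow> distr \<Rightarrow> ennreal" where
  "trilinear_sum k u v w = (SUP n. trilinear_part n k u v w)"

lemma trilinear_part_mono: "m \<le> n \<Longrightarrow> trilinear_part m k u v w \<le> trilinear_part n k u v w"
  unfolding trilinear_part_def
  by (intro order_trans[OF sum_mono sum_mono2] order_trans[OF sum_mono sum_mono2] sum_mono2) auto

lemma sum_resonant_le:
  assumes "finite K"
  shows "(\<Sum>k\<in>K. if resonant k a b c then X else (0::ennreal)) \<le> ennreal (8 * \<rho> + 1) * X"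
proof -
  let ?I = "{k::int. \<bar>real_of_int (a - b + c) - of_int k\<bar> \<le> 4 * \<rho>}"
  have I: "finite ?I" "real (card ?I) \<le> 8 * \<rho> + 1"
    using card_int_interval[of "4 * \<rho>" "real_of_int (a - b + c)"] \<rho>_pos by auto
  have "(\<Sum>k\<in>K. if resonant k a b c then X else 0) = (\<Sum>k\<in>{k \<in> K. resonant k a b c}. X)"
    by (rule sum.inter_filter[symmetric, OF assms])
  also have "{k \<in> K. resonant k a b c} = K \<inter> ?I" by (auto simp: resonant_def)
  also have "(\<Sum>k\<in>K \<inter> ?I. X) = of_nat (card (K \<inter> ?I)) * X" by simp
  also have "\<dots> \<le> of_nat (card ?I) * X" using I(1) by (intro mult_right_mono of_nat_mono card_mono) auto
  also have "of_nat (card ?I) \<le> ennreal (8 * \<rho> + 1)" using I(2) by (simp add: ennreal_of_nat_eq_real_of_nat ennreal_leI)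
  then have "of_nat (card ?I) * X \<le> ennreal (8 * \<rho> + 1) * X" by (intro mult_right_mono) auto
  finally show ?thesis .
qed

lemma sum_trilinear_part_le:
  assumes "finite K"
  shows "(\<Sum>k\<in>K. trilinear_part n k u v w) \<le> ennreal (8 * \<rho> + 1) * (mod_norm \<sigma> u * mod_norm \<sigma> v * mod_norm \<sigma> w)"
proof -
  let ?I = "{- int n..int n}"
  let ?T = "\<lambda>k a b c. if resonant k a b c then box_norm a u * box_norm b v * box_norm c w else 0"
  have "(\<Sum>k\<in>K. trilinear_part n k u v w) = (\<Sum>a\<in>?I. \<Sum>b\<in>?I. \<Sum>c\<in>?I. \<Sum>k\<in>K. ?T k a b c)"
    unfolding trilinear_part_def
  proof -
    have "(\<Sum>k\<in>K. \<Sum>a\<in>?I. \<Sum>b\<in>?I. \<Sum>c\<in>?I. ?T k a b c) = (\<Sum>a\<in>?I. \<Sum>k\<in>K. \<Sum>b\<in>?I. \<Sum>c\<in>?I. ?T k a b c)"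
      by (rule sum.swap)
    also have "\<dots> = (\<Sum>a\<in>?I. \<Sum>b\<in>?I. \<Sum>k\<in>K. \<Sum>c\<in>?I. ?T k a b c)"
      by (rule sum.cong[OF refl], rule sum.swap)
    also have "\<dots> = (\<Sum>a\<in>?I. \<Sum>b\<in>?I. \<Sum>c\<in>?I. \<Sum>k\<in>K. ?T k a b c)"
      by (rule sum.cong[OF refl], rule sum.cong[OF refl], rule sum.swap)
    finally show "(\<Sum>k\<in>K. \<Sum>a\<in>?I. \<Sum>b\<in>?I. \<Sum>c\<in>?I. ?T k a b c) = (\<Sum>a\<in>?I. \<Sum>b\<in>?I. \<Sum>c\<in>?I. \<Sum>k\<in>K. ?T k a b c)" .
  qed
  also have "\<dots> \<le> (\<Sum>a\<in>?I. \<Sum>b\<in>?I. \<Sum>c\<in>?I. ennreal (8 * \<rho> + 1) * (box_norm a u * box_norm b v * box_norm c w))"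
    by (intro sum_mono sum_resonant_le assms)
  also have "\<dots> = ennreal (8 * \<rho> + 1) * ((\<Sum>a\<in>?I. box_norm a u) * (\<Sum>b\<in>?I. box_norm b v) * (\<Sum>c\<in>?I. box_norm c w))"
    unfolding sum_product3 by (simp only: sum_distrib_left)
  also have "\<dots> \<le> ennreal (8 * \<rho> + 1) * (mod_norm \<sigma> u * mod_norm \<sigma> v * mod_norm \<sigma> w)"
    unfolding box_norm_def by (intro mult_left_mono mult_mono sum_le_mod_norm) auto
  finally show ?thesis .
qed

lemma sum_trilinear_sum_le:
  assumes "finite K"
  shows "(\<Sum>k\<in>K. trilinear_sum k u v w) \<le> ennreal (8 * \<rho> + 1) * (mod_norm \<sigma> u * mod_norm \<sigma> v * mod_norm \<sigma> w)"
proof -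
  have "(\<lambda>n. trilinear_part n k u v w) \<longlonglongrightarrow> trilinear_sum k u v w" for k
    unfolding trilinear_sum_def by (rule LIMSEQ_SUP) (auto simp: incseq_def trilinear_part_mono)
  then have "(\<lambda>n. \<Sum>k\<in>K. trilinear_part n k u v w) \<longlonglongrightarrow> (\<Sum>k\<in>K. trilinear_sum k u v w)"
    by (intro tendsto_sum) auto
  then show ?thesis by (rule LIMSEQ_le_const2) (use sum_trilinear_part_le[OF assms] in blast)
qed

text \<open>The boxes of \<open>u\<close> as the concrete functions \<open>f a\<close>, which are defined at every point, their bounds, and
the expansion of \<open>u\<close> with bounded partial sums.\<close>

lemma mod_space_boxes:
  assumes u: "u \<in> mod_space \<sigma>"
  defines "f \<equiv> \<lambda>a. conv (density_of u) (box_kernel 0 a 0)"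
  shows "loc_bounded (density_of u) (enn2real (mod_norm \<sigma> u) * pi)"
    "f a \<in> borel_measurable borel"
    "represents (f a) (freq_box \<sigma> a u)"
    "AE x in lborel. norm (f a x) \<le> enn2real (box_norm a u)"
    "ennreal (enn2real (box_norm a u)) = box_norm a u"
    "AE x in lborel. (\<lambda>n. \<Sum>a\<in>{- int n..int n}. f a x) \<longlonglongrightarrow> density_of u x"
    "AE x in lborel. norm (\<Sum>a\<in>{- int n..int n}. f a x) \<le> enn2real (mod_norm \<sigma> u)"
    "AE x in lborel. norm (density_of u x) \<le> enn2real (mod_norm \<sigma> u)"
proof -
  have u': "u \<in> tempered" "mod_norm \<sigma> u < \<infinity>" using u by (auto simp: mod_space_def)
  have M: "ennreal (enn2real (mod_norm \<sigma> u)) = mod_norm \<sigma> u" using u'(2) by simp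
  note r = mod_space_represents[OF u]
  have [measurable]: "density_of u \<in> borel_measurable borel" by (rule represents_measurable[OF r(1)])
  have "AE x in lborel. ennreal (norm (density_of u x)) \<le> ennreal (enn2real (mod_norm \<sigma> u))"
    unfolding M by (rule r(2))
  then show b: "AE x in lborel. norm (density_of u x) \<le> enn2real (mod_norm \<sigma> u)"
    by eventually_elim simp
  show l: "loc_bounded (density_of u) (enn2real (mod_norm \<sigma> u) * pi)" by (rule loc_bounded_AE_bounded[OF _ b]) simp
  show rep: "represents (f a) (freq_box \<sigma> a u)" for a unfolding f_def by (rule box_represents_0[OF l r(1)])
  then show meas: "f a \<in> borel_measurable borel" for a by (rule represents_measurable)
  have fin: "box_norm a u < \<infinity>" for a
    unfolding box_norm_def using Linf_le_mod_norm u'(2) by (rule le_less_trans)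
  then show e: "ennreal (enn2real (box_norm a u)) = box_norm a u" for a by simp
  have "AE x in lborel. ennreal (norm (f a x)) \<le> ennreal (enn2real (box_norm a u))" for a
    unfolding e unfolding box_norm_def by (rule Linf_AE[OF rep])
  then show fb: "AE x in lborel. norm (f a x) \<le> enn2real (box_norm a u)" for a
    by eventually_elim simp
  have "AE x in lborel. \<forall>a. f a x = density_of (freq_box \<sigma> a u) x"
    unfolding AE_all_countable using represents_unique[OF rep mod_norm_represents[OF u']] by blast
  with r(3) show "AE x in lborel. (\<lambda>n. \<Sum>a\<in>{- int n..int n}. f a x) \<longlonglongrightarrow> density_of u x"
    by eventually_elim simp
  have "AE x in lborel. \<forall>a. norm (f a x) \<le> enn2real (box_norm a u)" unfolding AE_all_countable using fb by blast
  then show "AE x in lborel. norm (\<Sum>a\<in>{- int n..int n}. f a x) \<le> enn2real (mod_norm \<sigma> u)"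
  proof eventually_elim
    case (elim x)
    have "norm (\<Sum>a\<in>{- int n..int n}. f a x) \<le> (\<Sum>a\<in>{- int n..int n}. enn2real (box_norm a u))"
      using elim by (intro sum_norm_le) auto
    also have "\<dots> = enn2real (\<Sum>a\<in>{- int n..int n}. box_norm a u)"
      using enn2real_sum[of "{- int n..int n}" "\<lambda>a. box_norm a u"] fin by (simp add: o_def)
    also have "\<dots> \<le> enn2real (mod_norm \<sigma> u)"
      unfolding box_norm_def using u'(2) by (intro enn2real_mono sum_le_mod_norm) auto
    finally show ?case .
  qed
qed

lemma AE_norm_mult_le:
  fixes F G :: "real \<Rightarrow> complex"
  assumes "AE x in lborel. norm (F x) \<le> A" "AE x in lborel. norm (G x) \<le> B" "A \<ge> 0"
  shows "AE x in lborel. norm (F x * G x) \<le> A * B"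
  using assms(1,2) by eventually_elim (simp add: norm_mult mult_mono assms(3))

text \<open>The product of the three boxes has its spectrum within \<open>3 \<rho>\<close> of \<open>a - b +
c\<close>, which is disjoint from the box \<open>k\<close>.\<close>

lemma conv_triple_nonresonant:
  assumes u: "u \<in> mod_space \<sigma>" "v \<in> mod_space \<sigma>" "w \<in> mod_space \<sigma>" and t: "t \<in> {-1..1}"
    and nr: "\<not> resonant k a b c"
  shows "conv (\<lambda>y. conv (density_of u) (box_kernel 0 a 0) y * cnj (conv (density_of v) (box_kernel 0 b 0) y)
      * conv (density_of w) (box_kernel 0 c 0) y) (box_kernel 0 k t) x = 0"
proof -
  note U = mod_space_boxes[OF u(1)] and V = mod_space_boxes[OF u(2)] and W = mod_space_boxes[OF u(3)]
  let ?f = "conv (density_of u) (box_kernel 0 a 0)" and ?g = "conv (density_of v) (box_kernel 0 b 0)"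
    and ?h = "conv (density_of w) (box_kernel 0 c 0)"
  have t0: "(0::real) \<in> {-1..1}" by simp
  have lg: "loc_bounded (\<lambda>y. cnj (density_of v y)) (enn2real (mod_norm \<sigma> v) * pi)"
    using V(1) by (simp add: loc_bounded_def borel_measurable_cnj)
  have Mg: "(\<lambda>\<eta>. cnj (box_mult 0 b 0 (- \<eta>))) \<in> schwartz"
    by (rule schwartz_cnj[OF schwartz_reflect[OF schwartz_box_mult[OF t0]]])
  have g: "cnj (?g y) = conv (\<lambda>y. cnj (density_of v y)) (inv_fourier (\<lambda>\<eta>. cnj (box_mult 0 b 0 (- \<eta>)))) y" for y
    unfolding box_kernel_def by (rule cnj_conv)
  have s1: "spectrum_in ?f (of_int a - \<rho>) (of_int a + \<rho>)"
    using u(1) by (intro spectrum_in_box[OF _ U(3)]) (simp add: mod_space_def)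
  have s2: "spectrum_in (\<lambda>y. ?f y * cnj (?g y)) ((of_int a - \<rho>) + (- of_int b - \<rho>)) ((of_int a + \<rho>) + (- of_int b + \<rho>))"
    unfolding g
  proof (rule spectrum_in_mult[OF U(2) U(4) s1 lg Mg])
    fix \<eta> :: real assume "\<eta> \<notin> {- of_int b - \<rho>..- of_int b + \<rho>}"
    then have "\<rho> < \<bar>- \<eta> - of_int b\<bar>" unfolding atLeastAtMost_iff by linarith
    then show "cnj (box_mult 0 b 0 (- \<eta>)) = 0" by (simp add: box_mult_supp)
  qed
  have m: "(\<lambda>y. ?f y * cnj (?g y)) \<in> borel_measurable borel"
    using U(2) V(2) by measurable
  have "AE y in lborel. norm (cnj (?g y)) \<le> enn2real (box_norm b v)" using V(4) by simp
  from AE_norm_mult_le[OF U(4) this enn2real_nonneg]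
  have bd: "AE y in lborel. norm (?f y * cnj (?g y)) \<le> enn2real (box_norm a u) * enn2real (box_norm b v)" .
  have s3: "spectrum_in (\<lambda>y. ?f y * cnj (?g y) * conv (density_of w) (inv_fourier (box_mult 0 c 0)) y)
     (((of_int a - \<rho>) + (- of_int b - \<rho>)) + (of_int c - \<rho>)) (((of_int a + \<rho>) + (- of_int b + \<rho>)) + (of_int c + \<rho>))"
  proof (rule spectrum_in_mult[OF m bd s2 W(1) schwartz_box_mult[OF t0]])
    fix \<eta> :: real assume "\<eta> \<notin> {of_int c - \<rho>..of_int c + \<rho>}"
    then have "\<rho> < \<bar>\<eta> - of_int c\<bar>" unfolding atLeastAtMost_iff by linarith
    then show "box_mult 0 c 0 \<eta> = 0" by (rule box_mult_supp)
  qed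
  show ?thesis
  proof (rule spectrum_in_conv_box_kernel[OF s3[folded box_kernel_def] t])
    fix \<xi> :: real
    assume "\<xi> \<in> {((of_int a - \<rho>) + (- of_int b - \<rho>)) + (of_int c - \<rho>)..((of_int a + \<rho>) + (- of_int b + \<rho>)) + (of_int c + \<rho>)}"
    with nr show "\<rho> < \<bar>\<xi> - of_int k\<bar>" unfolding resonant_def atLeastAtMost_iff of_int_add of_int_diff by linarith
  qed
qed

text \<open>The density of \<open>cubic_product\<close>.\<close>

definition cubic :: "distr \<Rightarrow> distr \<Rightarrow> distr \<Rightarrow> real \<Rightarrow> complex" where
  "cubic u v w x = density_of u x * cnj (density_of v x) * density_of w x"

lemma cubic_bounded:
  assumes u: "u \<in> mod_space \<sigma>" "v \<in> mod_space \<sigma>" "w \<in> mod_space \<sigma>"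
  shows "cubic u v w \<in> borel_measurable borel"
    "AE x in lborel. norm (cubic u v w x) \<le> enn2real (mod_norm \<sigma> u) * enn2real (mod_norm \<sigma> v) * enn2real (mod_norm \<sigma> w)"
proof -
  note U = mod_space_boxes[OF u(1)] and V = mod_space_boxes[OF u(2)] and W = mod_space_boxes[OF u(3)]
  note [measurable] = mod_space_represents(1)[OF u(1), THEN represents_measurable]
    mod_space_represents(1)[OF u(2), THEN represents_measurable] mod_space_represents(1)[OF u(3), THEN represents_measurable]
  show "cubic u v w \<in> borel_measurable borel" unfolding cubic_def[abs_def] by measurable
  have "AE x in lborel. norm (cnj (density_of v x)) \<le> enn2real (mod_norm \<sigma> v)" using V(8) by simp
  then show "AE x in lborel. norm (cubic u v w x) \<le> enn2real (mod_norm \<sigma> u) * enn2real (mod_norm \<sigma> v) * enn2real (mod_norm \<sigma> w)"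
    unfolding cubic_def by (intro AE_norm_mult_le U(8) W(8) mult_nonneg_nonneg enn2real_nonneg)
qed

text \<open>The bound is pointwise and uniform in \<open>t\<close>, \<open>k\<close> and \<open>x\<close>. The partial sums over boxes are expanded into
triples; the nonresonant ones vanish, and dominated convergence passes to the limit.\<close>

lemma conv_cubic_bound:
  "\<exists>C\<ge>0. \<forall>u\<in>mod_space \<sigma>. \<forall>v\<in>mod_space \<sigma>. \<forall>w\<in>mod_space \<sigma>. \<forall>t\<in>{-1..1}. \<forall>k x.
     ennreal (norm (conv (cubic u v w) (box_kernel 0 k t) x)) \<le> ennreal C * trilinear_sum k u v w"
proof -
  from box_kernel_bound[of 0] obtain C where C: "C \<ge> 0"
    "\<forall>k t x. t \<in> {-1..1} \<longrightarrow> norm (box_kernel 0 k t x) \<le> C * (1 + (of_int k)\<^sup>2) powr (- 0 / 2) * (1 / (1 + (x - 2 * t * of_int k)\<^sup>2))"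
    by blast
  have C': "norm (box_kernel 0 k t x) \<le> C * (1 / (1 + (x - 2 * t * of_int k)\<^sup>2))" if "t \<in> {-1..1}" for k t x
    using C(2)[rule_format, OF that, of k x] one_plus_square_pos[of "of_int k"] by simp
  have "ennreal (norm (conv (cubic u v w) (box_kernel 0 k t) x)) \<le> ennreal (C * pi) * trilinear_sum k u v w"
    if uvw: "u \<in> mod_space \<sigma>" "v \<in> mod_space \<sigma>" "w \<in> mod_space \<sigma>" and t: "t \<in> {-1..1}" for u v w k t x
  proof -
    note U = mod_space_boxes[OF uvw(1)] and V = mod_space_boxes[OF uvw(2)] and W = mod_space_boxes[OF uvw(3)]
    define f where "f a = conv (density_of u) (box_kernel 0 a 0)" for a
    define g where "g a = conv (density_of v) (box_kernel 0 a 0)" for a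
    define h where "h a = conv (density_of w) (box_kernel 0 a 0)" for a
    define A where "A a = enn2real (box_norm a u)" for a
    define B where "B a = enn2real (box_norm a v)" for a
    define D where "D a = enn2real (box_norm a w)" for a
    define N where "N = enn2real (mod_norm \<sigma> u) * enn2real (mod_norm \<sigma> v) * enn2real (mod_norm \<sigma> w)"
    define I where "I n = {- int n..int n}" for n :: nat
    define F where "F n y = (\<Sum>a\<in>I n. f a y) * cnj (\<Sum>b\<in>I n. g b y) * (\<Sum>c\<in>I n. h c y)" for n y
    have [measurable]: "f a \<in> borel_measurable borel" "g a \<in> borel_measurable borel" "h a \<in> borel_measurable borel" for a
      unfolding f_def g_def h_def by (rule U(2) V(2) W(2))+
    have [measurable]: "F n \<in> borel_measurable borel" for n unfolding F_def[abs_def] by measurable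
    have ABD0: "A a \<ge> 0" "B a \<ge> 0" "D a \<ge> 0" for a by (simp_all add: A_def B_def D_def)
    let ?K = "box_kernel 0 k t"
    have KS: "(\<lambda>y. ?K (x - y)) \<in> schwartz" by (rule schwartz_box_kernel_reflect[OF t])
    note [measurable] = schwartz_measurable[OF schwartz_box_kernel[OF t, of 0 k]]
    have Fb: "AE y in lborel. norm (F n y) \<le> N" for n
    proof -
      have "AE y in lborel. norm (cnj (\<Sum>b\<in>I n. g b y)) \<le> enn2real (mod_norm \<sigma> v)"
        using V(7)[of n] unfolding complex_mod_cnj I_def g_def .
      then show ?thesis
        unfolding F_def N_def
        by (intro AE_norm_mult_le U(7)[of n, folded f_def I_def] W(7)[of n, folded h_def I_def] mult_nonneg_nonneg enn2real_nonneg)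
    qed
    have lim: "AE y in lborel. (\<lambda>n. F n y) \<longlonglongrightarrow> cubic u v w y"
      using U(6)[folded f_def I_def] V(6)[folded g_def I_def] W(6)[folded h_def I_def]
      unfolding F_def cubic_def by eventually_elim (intro tendsto_mult tendsto_cnj)
    have cl: "(\<lambda>n. conv (F n) ?K x) \<longlonglongrightarrow> conv (cubic u v w) ?K x"
      unfolding conv_def
    proof (rule integral_dominated_convergence[where w = "\<lambda>y. N * norm (?K (x - y))"])
      show "integrable lborel (\<lambda>y. N * norm (?K (x - y)))"
        using schwartz_integrable[OF KS] by simp
      show "AE y in lborel. (\<lambda>n. F n y * ?K (x - y)) \<longlonglongrightarrow> cubic u v w y * ?K (x - y)"
        using lim by eventually_elim (intro tendsto_mult tendsto_const)
      show "AE y in lborel. norm (F n y * ?K (x - y)) \<le> N * norm (?K (x - y))" for n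
        using Fb[of n] by eventually_elim (simp add: norm_mult mult_right_mono)
      show "(\<lambda>y. cubic u v w y * ?K (x - y)) \<in> borel_measurable lborel"
        using cubic_bounded(1)[OF uvw] by simp
    qed simp
    define G where "G a b c y = f a y * cnj (g b y) * h c y" for a b c y
    have Gm [measurable]: "G a b c \<in> borel_measurable borel" for a b c unfolding G_def[abs_def] by measurable
    have Gb: "AE y in lborel. norm (G a b c y) \<le> A a * B b * D c" for a b c
    proof -
      have "AE y in lborel. norm (cnj (g b y)) \<le> B b" using V(4)[of b] unfolding complex_mod_cnj g_def B_def .
      then show ?thesis unfolding G_def
        by (intro AE_norm_mult_le U(4)[of a, folded f_def A_def] W(4)[of c, folded h_def D_def] mult_nonneg_nonneg ABD0)
    qed
    have Gi: "integrable lborel (\<lambda>y. G a b c y * ?K (x - y))" for a b c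
      by (rule integrable_bounded_mult[OF Gm Gb schwartz_integrable[OF KS]])
    have cb: "norm (conv (G a b c) ?K x) \<le> (if resonant k a b c then (C * pi) * (A a * B b * D c) else 0)" for a b c
    proof (cases "resonant k a b c")
      case True
      have "norm (conv (G a b c) ?K x) \<le> C * (A a * B b * D c * pi)"
        by (rule conv_bound[OF loc_bounded_AE_bounded[OF Gm Gb] _ C'[OF t] C(1)]) simp
      with True show ?thesis by (simp add: mult_ac)
    next
      case False
      then show ?thesis using conv_triple_nonresonant[OF uvw t False, of x]
        unfolding G_def[abs_def] f_def g_def h_def by simp
    qed
    have Fs: "conv (F n) ?K x = (\<Sum>a\<in>I n. \<Sum>b\<in>I n. \<Sum>c\<in>I n. conv (G a b c) ?K x)" for n
    proof -
      have "F n y * ?K (x - y) = (\<Sum>a\<in>I n. \<Sum>b\<in>I n. \<Sum>c\<in>I n. G a b c y * ?K (x - y))" for y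
        unfolding F_def G_def cnj_sum sum_product3 by (simp only: sum_distrib_right)
      then show ?thesis
        unfolding conv_def by (simp add: Bochner_Integration.integral_sum Gi integrable_sum)
    qed
    have le: "ennreal (norm (conv (F n) ?K x)) \<le> ennreal (C * pi) * trilinear_sum k u v w" for n
    proof -
      let ?R = "\<lambda>a b c. if resonant k a b c then (C * pi) * (A a * B b * D c) else 0"
      have "norm (conv (F n) ?K x) \<le> (\<Sum>a\<in>I n. \<Sum>b\<in>I n. \<Sum>c\<in>I n. ?R a b c)"
        unfolding Fs by (intro sum_norm_le cb)
      then have "ennreal (norm (conv (F n) ?K x)) \<le> ennreal (\<Sum>a\<in>I n. \<Sum>b\<in>I n. \<Sum>c\<in>I n. ?R a b c)"
        by (rule ennreal_leI)
      also have "\<dots> = (\<Sum>a\<in>I n. \<Sum>b\<in>I n. \<Sum>c\<in>I n. ennreal (?R a b c))"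
        by (rule ennreal_sum3) (use C(1) ABD0 in simp)
      also have "\<dots> = ennreal (C * pi) * trilinear_part n k u v w"
        unfolding trilinear_part_def sum_distrib_left I_def
      proof (intro sum.cong refl)
        fix a b c
        have "ennreal ((C * pi) * (A a * B b * D c)) = ennreal (C * pi) * (box_norm a u * box_norm b v * box_norm c w)"
          using C(1) ABD0 U(5)[of a] V(5)[of b] W(5)[of c] by (simp add: ennreal_mult A_def B_def D_def)
        then show "ennreal (?R a b c) = ennreal (C * pi) * (if resonant k a b c then box_norm a u * box_norm b v * box_norm c w else 0)"
          by simp
      qed
      also have "\<dots> \<le> ennreal (C * pi) * trilinear_sum k u v w"
        unfolding trilinear_sum_def by (intro mult_left_mono SUP_upper) auto
      finally show ?thesis .
    qed
    have "(\<lambda>n. ennreal (norm (conv (F n) ?K x))) \<longlonglongrightarrow> ennreal (norm (conv (cubic u v w) ?K x))"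
      by (intro tendsto_ennrealI tendsto_norm cl)
    then show ?thesis by (rule LIMSEQ_le_const2) (use le in blast)
  qed
  moreover have "C * pi \<ge> 0" using C(1) by simp
  ultimately show ?thesis by blast
qed

end

section \<open>Summing the frequency pieces of a function in \<open>L\<^sup>p\<close>\<close>

text \<open>\<open>g\<close> is measurable and its \<open>L\<^sup>p\<close> norm is at most the real number \<open>G\<close>. For finite \<open>p\<close> the power
of the norm is bounded by the power of \<open>G\<close>, which is the intended meaning for \<open>G \<ge> 0\<close>.\<close>

definition Lp_le :: "ereal \<Rightarrow> (real \<Rightarrow> complex) \<Rightarrow> real \<Rightarrow> bool" where
  "Lp_le p g G \<longleftrightarrow> g \<in> borel_measurable borel \<and>
     (if p = \<infinity> then AE x in lborel. norm (g x) \<le> G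
      else integrable lborel (\<lambda>x. norm (g x) powr real_of_ereal p) \<and>
        (LBINT x. norm (g x) powr real_of_ereal p) \<le> G powr real_of_ereal p)"

lemma Lp_le_loc_bounded:
  assumes "Lp_le p g G" "1 \<le> p" shows "\<exists>B. loc_bounded g B"
proof (cases "p = \<infinity>")
  case True
  then show ?thesis using assms(1) loc_bounded_AE_bounded[of g G] by (auto simp: Lp_le_def)
next
  case False
  then obtain q where "p = ereal q" using assms(2) by (cases p) auto
  then show ?thesis using assms loc_bounded_Lp[of g q] by (auto simp: Lp_le_def)
qed

lemma Lp_le_of_norm:
  assumes m: "g \<in> borel_measurable borel" and p: "1 \<le> p" and n: "Lp_norm_fun p g \<noteq> \<infinity>"
    and G: "enn2real (Lp_norm_fun p g) < G"
  shows "Lp_le p g G"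
proof (cases "p = \<infinity>")
  case True
  note [measurable] = m
  have "AE x in lborel. ennreal (norm (g x)) \<le> esssup lborel (\<lambda>x. ennreal (norm (g x)))" by (rule esssup_AE)
  moreover have "esssup lborel (\<lambda>x. ennreal (norm (g x))) = ennreal (enn2real (Lp_norm_fun p g))"
    using True n by (simp add: Lp_norm_fun_def less_top)
  ultimately have "AE x in lborel. ennreal (norm (g x)) \<le> ennreal (enn2real (Lp_norm_fun p g))" by simp
  then have "AE x in lborel. norm (g x) \<le> G"
  proof eventually_elim
    case (elim x)
    then have "norm (g x) \<le> enn2real (Lp_norm_fun p g)" by simp
    then show ?case using G by linarith
  qed
  then show ?thesis using True m by (simp add: Lp_le_def)
next
  case False
  note [measurable] = m
  from False p obtain q where q: "p = ereal q" "q \<ge> 1" by (cases p) auto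
  define I where "I = (\<integral>\<^sup>+x. ennreal (norm (g x) powr q) \<partial>lborel)"
  have I: "I \<noteq> \<infinity>" "Lp_norm_fun p g = ennreal (enn2real I powr (1 / q))"
    using n q by (auto simp: Lp_norm_fun_def I_def[symmetric] Let_def split: if_splits)
  have i: "integrable lborel (\<lambda>x. norm (g x) powr q)"
    by (rule integrableI_nonneg) (use I(1) in \<open>auto simp: I_def top.not_eq_extremum\<close>)
  have e: "(LBINT x. norm (g x) powr q) = enn2real I"
    unfolding I_def by (rule integral_eq_nn_integral) auto
  have "enn2real I powr (1 / q) \<le> G" using G I(2) by simp
  then have "(enn2real I powr (1 / q)) powr q \<le> G powr q" using q(2) by (intro powr_mono2) auto
  then have "enn2real I \<le> G powr q" using q(2) by (simp add: powr_powr)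
  then show ?thesis using i e m q by (simp add: Lp_le_def)
qed

text \<open>A substitute for interpolation: the product is at most \<open>\<mu> b\<close> where \<open>a \<le> \<mu>\<close>, and otherwise Young's
inequality and \<open>a\<^sup>2 \<le> \<mu>\<^bsup>2 - q\<^esup> a\<^sup>q\<close> apply. After integration the right-hand side involves the \<open>L\<^sup>1\<close> and
\<open>L\<^sup>2\<close> norms of \<open>b\<close> and the \<open>L\<^sup>q\<close> norm of \<open>a\<close>.\<close>

lemma split_bound:
  fixes a b :: real
  assumes "a \<ge> 0" "b \<ge> 0" "\<mu> > 0" "\<nu> > 0" "q \<ge> 2"
  shows "a * b \<le> \<mu> * b + (\<nu> * \<mu> powr (2 - q) * a powr q + b\<^sup>2 / \<nu>) / 2"
proof (cases "a \<le> \<mu>")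
  case True
  then have "a * b \<le> \<mu> * b" using assms by (intro mult_right_mono) auto
  moreover have "0 \<le> (\<nu> * \<mu> powr (2 - q) * a powr q + b\<^sup>2 / \<nu>) / 2" using assms by auto
  ultimately show ?thesis by linarith
next
  case False
  then have a: "a > 0" using assms by simp
  have "0 \<le> (\<nu> * a - b)\<^sup>2 / \<nu>" using assms by simp
  also have "\<dots> = \<nu> * a\<^sup>2 + b\<^sup>2 / \<nu> - 2 * (a * b)" using assms(4) by (simp add: power2_eq_square field_simps)
  finally have 1: "a * b \<le> (\<nu> * a\<^sup>2 + b\<^sup>2 / \<nu>) / 2" by simp
  have "a\<^sup>2 = a powr (2 - q) * a powr q" using a by (simp flip: powr_add)
  also have "\<dots> \<le> \<mu> powr (2 - q) * a powr q"
    using False assms by (intro mult_right_mono powr_mono2') auto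
  finally have "\<nu> * a\<^sup>2 \<le> \<nu> * (\<mu> powr (2 - q) * a powr q)" using assms by (intro mult_left_mono) auto
  then have "\<nu> * a\<^sup>2 \<le> \<nu> * \<mu> powr (2 - q) * a powr q" by (simp only: mult.assoc)
  moreover have "0 \<le> \<mu> * b" using assms by simp
  moreover have "u \<le> m + (y + r) / 2" if "x \<le> y" "0 \<le> m" "u \<le> (x + r) / 2" for u m x y r :: real
  proof -
    have "(x + r) / 2 \<le> (y + r) / 2" using that(1) by (intro divide_right_mono add_right_mono) auto
    then have "u \<le> (y + r) / 2" using that(3) by (rule order_trans[rotated])
    then show ?thesis using that(2) by (rule add_increasing[rotated])
  qed
  ultimately show ?thesis using 1 by blast
qed

context freq_partition
begin

text \<open>The two kernels have disjoint frequency supports, whatever the times and the points.\<close>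

lemma box_kernels_orthogonal:
  assumes t: "t \<in> {-1..1}" "t' \<in> {-1..1}" and kl: "2 * \<rho> < \<bar>real_of_int (k - l)\<bar>"
  shows "(LBINT y. box_kernel s k t (x - y) * cnj (box_kernel s l t' (x' - y))) = 0"
proof -
  let ?A = "\<lambda>y. box_kernel s k t (x - y)" and ?M = "\<lambda>\<eta>. cnj (box_mult s l t' (- \<eta>))"
  have A: "?A \<in> schwartz" by (rule schwartz_box_kernel_reflect[OF t(1)])
  have M: "?M \<in> schwartz" by (rule schwartz_cnj[OF schwartz_reflect[OF schwartz_box_mult[OF t(2)]]])
  have M': "integrable lborel (\<lambda>\<eta>. cis (x' * \<eta>) * ?M \<eta> / (2 * pi))"
    using integrable_cis_mult[OF schwartz_integrable[OF M], of "\<lambda>\<eta>. x' * \<eta>"] by simp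
  have e: "cnj (box_kernel s l t' (x' - y)) = (LBINT \<eta>. (cis (x' * \<eta>) * ?M \<eta> / (2 * pi)) * cis (- (y * \<eta>)))" for y
  proof -
    have c: "cis (x' * \<eta>) * cis (- (y * \<eta>)) = cis ((x' - y) * \<eta>)" for \<eta> by (simp add: cis_mult algebra_simps)
    have d: "(cis (x' * \<eta>) * ?M \<eta> / (2 * pi)) * cis (- (y * \<eta>)) = cis ((x' - y) * \<eta>) * ?M \<eta> / (2 * pi)" for \<eta>
      by (simp flip: c)
    show ?thesis unfolding d box_kernel_def cnj_inv_fourier inv_fourier_def[of ?M] by simp
  qed
  have "(LBINT y. ?A y * cnj (box_kernel s l t' (x' - y))) =
     (LBINT y. ?A y * (LBINT \<eta>. (cis (x' * \<eta>) * ?M \<eta> / (2 * pi)) * cis (- (y * \<eta>))))"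
    unfolding e ..
  also have "\<dots> = (LBINT \<eta>. (cis (x' * \<eta>) * ?M \<eta> / (2 * pi)) * (LBINT y. ?A y * cis (- (y * \<eta>))))"
    by (rule Fubini_bounded_kernel[OF schwartz_integrable[OF A] M', where B = 1]) auto
  also have "\<dots> = integral\<^sup>L lborel (\<lambda>\<eta>::real. 0 :: complex)"
  proof (intro Bochner_Integration.integral_cong refl)
    fix \<eta>
    have f: "(LBINT y. ?A y * cis (- (y * \<eta>))) = 2 * pi * inv_fourier ?A (- \<eta>)"
      by (simp add: inv_fourier_def mult.commute)
    have "?M \<eta> * box_mult s k t (- \<eta>) = 0"
    proof (cases "\<rho> < \<bar>- \<eta> - of_int l\<bar>")
      case True
      then show ?thesis by (simp add: box_mult_supp)
    next
      case False
      then have "\<rho> < \<bar>- \<eta> - of_int k\<bar>" using kl unfolding of_int_diff by linarith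
      then show ?thesis by (simp add: box_mult_supp)
    qed
    then show "(cis (x' * \<eta>) * ?M \<eta> / (2 * pi)) * (LBINT y. ?A y * cis (- (y * \<eta>))) = 0"
      unfolding f inv_fourier_box_kernel_reflect[OF t(1)] by auto
  qed
  finally show ?thesis by simp
qed

text \<open>The \<open>L\<^sup>1\<close> and \<open>L\<^sup>2\<close> norms of a packet of kernels. For the \<open>L\<^sup>2\<close> norm the square is expanded: for every
\<open>k\<close> at most \<open>4 \<rho> + 1\<close> indices \<open>l\<close> contribute, by orthogonality.\<close>

lemma box_kernel_packet_bounds:
  "\<exists>C\<ge>0. \<forall>J t x c W. finite J \<longrightarrow> (\<forall>k\<in>J. t k \<in> {-1..1} \<and> norm (c k) \<le> 1 \<and> (1 + (real_of_int k)\<^sup>2) powr (- s / 2) \<le> W) \<longrightarrow> W \<ge> 0 \<longrightarrow>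
     (\<lambda>y. \<Sum>k\<in>J. c k * box_kernel s k (t k) (x k - y)) \<in> schwartz \<and>
     (LBINT y. norm (\<Sum>k\<in>J. c k * box_kernel s k (t k) (x k - y))) \<le> C * real (card J) * W \<and>
     (LBINT y. (norm (\<Sum>k\<in>J. c k * box_kernel s k (t k) (x k - y)))\<^sup>2) \<le> C * real (card J) * W\<^sup>2"
proof -
  from box_kernel_bound[of s] obtain C where C: "C \<ge> 0"
    "\<forall>k t x. t \<in> {-1..1} \<longrightarrow> norm (box_kernel s k t x) \<le> C * (1 + (of_int k)\<^sup>2) powr (- s / 2) * (1 / (1 + (x - 2 * t * of_int k)\<^sup>2))"
    by blast
  define D where "D = max (C * pi) (C * C * pi * (4 * \<rho> + 1))"
  have D: "C * pi \<le> D" "C * C * pi * (4 * \<rho> + 1) \<le> D" "0 \<le> D"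
    using C(1) by (auto simp: D_def le_max_iff_disj)
  show ?thesis
  proof (intro exI[of _ D] conjI allI impI D(3))
    fix J :: "int set" and t x :: "int \<Rightarrow> real" and c :: "int \<Rightarrow> complex" and W :: real
    assume J: "finite J" and tc: "\<forall>k\<in>J. t k \<in> {-1..1} \<and> norm (c k) \<le> 1 \<and> (1 + (real_of_int k)\<^sup>2) powr (- s / 2) \<le> W"
      and W: "W \<ge> 0"
    define K where "K k y = box_kernel s k (t k) (x k - y)" for k y
    define P where "P y = (\<Sum>k\<in>J. c k * K k y)" for y
    have KS: "K k \<in> schwartz" if "k \<in> J" for k
      unfolding K_def[abs_def] using tc that by (intro schwartz_box_kernel_reflect) auto
    have Kb: "norm (K k y) \<le> (C * W) * (1 / (1 + ((x k - 2 * t k * of_int k) - y)\<^sup>2))" if k: "k \<in> J" for k y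
    proof -
      have "norm (K k y) \<le> (C * (1 + (of_int k)\<^sup>2) powr (- s / 2)) * (1 / (1 + (x k - y - 2 * t k * of_int k)\<^sup>2))"
        unfolding K_def using C(2) tc k by blast
      also have "\<dots> \<le> (C * W) * (1 / (1 + (x k - y - 2 * t k * of_int k)\<^sup>2))"
        using tc k C(1) by (intro mult_right_mono mult_left_mono) auto
      also have "x k - y - 2 * t k * of_int k = (x k - 2 * t k * of_int k) - y" by simp
      finally show ?thesis .
    qed
    have Kb1: "norm (K k y) \<le> C * W" if "k \<in> J" for k y
    proof -
      have "(C * W) * (1 / (1 + ((x k - 2 * t k * of_int k) - y)\<^sup>2)) \<le> (C * W) * 1"
        using C(1) W by (intro mult_left_mono) (auto simp: divide_le_eq add_pos_nonneg)
      with Kb[OF that, of y] show ?thesis by linarith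
    qed
    have KL1: "(LBINT y. norm (K k y)) \<le> C * W * pi" if "k \<in> J" for k
    proof -
      have "(LBINT y. norm (K k y)) \<le> (LBINT y. (C * W) * (1 / (1 + ((x k - 2 * t k * of_int k) - y)\<^sup>2)))"
        by (intro integral_mono integrable_norm schwartz_integrable KS that integrable_mult_right integral_inverse_square_translate Kb)
      also have "\<dots> = C * W * pi" by (subst integral_mult_right_zero) (simp only: integral_inverse_square_translate)
      finally show ?thesis .
    qed
    have PS: "P \<in> schwartz" unfolding P_def[abs_def] by (intro schwartz_sum schwartz_cmult KS)
    have cK: "norm (c k * K k y) \<le> norm (K k y)" if "k \<in> J" for k y
      using tc that by (auto simp: norm_mult intro!: mult_left_le_one_le)
    have "(LBINT y. norm (P y)) \<le> (LBINT y. \<Sum>k\<in>J. norm (K k y))"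
      unfolding P_def
      by (intro integral_mono integrable_norm schwartz_integrable Bochner_Integration.integrable_sum KS sum_norm_le cK PS[unfolded P_def[abs_def]])
    also have "\<dots> = (\<Sum>k\<in>J. LBINT y. norm (K k y))"
      by (intro Bochner_Integration.integral_sum integrable_norm schwartz_integrable KS)
    also have "\<dots> \<le> (\<Sum>k\<in>J. C * W * pi)" by (intro sum_mono KL1)
    also have "\<dots> = (C * pi) * real (card J) * W" by simp
    also have "\<dots> \<le> D * real (card J) * W" using D(1) W by (intro mult_right_mono) auto
    finally have 1: "(LBINT y. norm (P y)) \<le> D * real (card J) * W" .
    have KK: "(\<lambda>y. (c k * K k y) * cnj (c l * K l y)) \<in> schwartz" if "k \<in> J" "l \<in> J" for k l
      by (intro schwartz_mult schwartz_cnj schwartz_cmult KS that)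
    have near: "norm (LBINT y. (c k * K k y) * cnj (c l * K l y)) \<le> (if \<bar>real_of_int k - of_int l\<bar> \<le> 2 * \<rho> then C * C * pi * W\<^sup>2 else 0)"
      if kl: "k \<in> J" "l \<in> J" for k l
    proof (cases "\<bar>real_of_int k - of_int l\<bar> \<le> 2 * \<rho>")
      case True
      have "norm (LBINT y. (c k * K k y) * cnj (c l * K l y)) \<le> (LBINT y. norm ((c k * K k y) * cnj (c l * K l y)))"
        by (rule integral_norm_bound)
      also have "\<dots> \<le> (LBINT y. (C * W) * norm (K k y))"
      proof (intro integral_mono integrable_norm schwartz_integrable KK kl integrable_mult_right KS)
        fix y
        have "norm ((c k * K k y) * cnj (c l * K l y)) = norm (c k * K k y) * norm (c l * K l y)"
          unfolding norm_mult complex_mod_cnj ..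
        also have "\<dots> \<le> norm (K k y) * (C * W)"
          using C(1) W by (intro mult_mono cK kl order_trans[OF cK[OF kl(2)] Kb1[OF kl(2)]]) auto
        finally show "norm ((c k * K k y) * cnj (c l * K l y)) \<le> (C * W) * norm (K k y)" by (simp only: mult.commute)
      qed
      also have "\<dots> = (C * W) * (LBINT y. norm (K k y))" by (rule integral_mult_right_zero)
      also have "\<dots> \<le> (C * W) * (C * W * pi)" using C(1) W by (intro mult_left_mono KL1 kl) auto
      also have "\<dots> = C * C * pi * W\<^sup>2" by (simp add: power2_eq_square)
      finally show ?thesis using True by simp
    next
      case False
      have "(LBINT y. (c k * K k y) * cnj (c l * K l y)) = (LBINT y. (c k * cnj (c l)) * (K k y * cnj (K l y)))"
        by (simp add: mult_ac)
      also have "\<dots> = (c k * cnj (c l)) * (LBINT y. K k y * cnj (K l y))" by (rule integral_mult_right_zero)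
      also have "(LBINT y. K k y * cnj (K l y)) = 0"
        unfolding K_def using tc kl False by (intro box_kernels_orthogonal) auto
      finally show ?thesis using False by simp
    qed
    have PP: "complex_of_real ((norm (P y))\<^sup>2) = (\<Sum>k\<in>J. \<Sum>l\<in>J. (c k * K k y) * cnj (c l * K l y))" for y
      unfolding complex_norm_square P_def cnj_sum sum_product ..
    have "complex_of_real (LBINT y. (norm (P y))\<^sup>2) = (LBINT y. \<Sum>k\<in>J. \<Sum>l\<in>J. (c k * K k y) * cnj (c l * K l y))"
    proof -
      have "integrable lborel (\<lambda>y. (norm (P y))\<^sup>2)"
        using integrable_norm[OF schwartz_integrable[OF schwartz_mult[OF PS PS]]] by (simp add: norm_mult power2_eq_square)
      then show ?thesis unfolding PP[symmetric] by (rule integral_of_real[symmetric])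
    qed
    also have "\<dots> = (\<Sum>k\<in>J. \<Sum>l\<in>J. LBINT y. (c k * K k y) * cnj (c l * K l y))"
      by (subst Bochner_Integration.integral_sum, intro Bochner_Integration.integrable_sum schwartz_integrable KK, assumption+,
        intro sum.cong refl Bochner_Integration.integral_sum schwartz_integrable KK)
    finally have "norm (complex_of_real (LBINT y. (norm (P y))\<^sup>2)) \<le>
       (\<Sum>k\<in>J. \<Sum>l\<in>J. if \<bar>real_of_int k - of_int l\<bar> \<le> 2 * \<rho> then C * C * pi * W\<^sup>2 else 0)"
      by (simp only:) (intro sum_norm_le near)
    also have "\<dots> \<le> (\<Sum>k\<in>J. (4 * \<rho> + 1) * (C * C * pi * W\<^sup>2))"
    proof (rule sum_mono)
      fix k assume "k \<in> J"
      let ?I = "{l::int. \<bar>real_of_int k - of_int l\<bar> \<le> 2 * \<rho>}"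
      have I: "finite ?I" "real (card ?I) \<le> 4 * \<rho> + 1" using card_int_interval[of "2 * \<rho>" "real_of_int k"] \<rho>_pos by auto
      have "(\<Sum>l\<in>J. if \<bar>real_of_int k - of_int l\<bar> \<le> 2 * \<rho> then C * C * pi * W\<^sup>2 else 0) = (\<Sum>l\<in>{l\<in>J. \<bar>real_of_int k - of_int l\<bar> \<le> 2 * \<rho>}. C * C * pi * W\<^sup>2)"
        by (rule sum.inter_filter[symmetric, OF J])
      also have "\<dots> = real (card {l\<in>J. \<bar>real_of_int k - of_int l\<bar> \<le> 2 * \<rho>}) * (C * C * pi * W\<^sup>2)" by simp
      also have "\<dots> \<le> real (card ?I) * (C * C * pi * W\<^sup>2)"
        using C(1) I(1) by (intro mult_right_mono of_nat_mono card_mono) auto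
      also have "\<dots> \<le> (4 * \<rho> + 1) * (C * C * pi * W\<^sup>2)" using C(1) I(2) by (intro mult_right_mono) auto
      finally show "(\<Sum>l\<in>J. if \<bar>real_of_int k - of_int l\<bar> \<le> 2 * \<rho> then C * C * pi * W\<^sup>2 else 0) \<le> (4 * \<rho> + 1) * (C * C * pi * W\<^sup>2)" .
    qed
    also have "\<dots> = (C * C * pi * (4 * \<rho> + 1)) * real (card J) * W\<^sup>2" by simp
    also have "\<dots> \<le> D * real (card J) * W\<^sup>2" using D(2) by (intro mult_right_mono) auto
    finally have "norm (complex_of_real (LBINT y. (norm (P y))\<^sup>2)) \<le> D * real (card J) * W\<^sup>2" .
    then have 2: "(LBINT y. (norm (P y))\<^sup>2) \<le> D * real (card J) * W\<^sup>2"
      unfolding norm_of_real by (rule order_trans[OF abs_ge_self])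
    show "(\<lambda>y. \<Sum>k\<in>J. c k * box_kernel s k (t k) (x k - y)) \<in> schwartz"
      "(LBINT y. norm (\<Sum>k\<in>J. c k * box_kernel s k (t k) (x k - y))) \<le> D * real (card J) * W"
      "(LBINT y. (norm (\<Sum>k\<in>J. c k * box_kernel s k (t k) (x k - y)))\<^sup>2) \<le> D * real (card J) * W\<^sup>2"
      using PS 1 2 unfolding P_def[abs_def] K_def by auto
  qed
qed

text \<open>The coefficients \<open>c k\<close> are the conjugate signs of the summands.\<close>

lemma sum_conv_duality:
  assumes g: "loc_bounded g B" and J: "finite J" "\<And>k. k \<in> J \<Longrightarrow> t k \<in> {-1..1}"
  shows "\<exists>c. (\<forall>k. norm (c k) \<le> 1) \<and>
    integrable lborel (\<lambda>y. g y * (\<Sum>k\<in>J. c k * box_kernel s k (t k) (x k - y))) \<and>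
    (\<Sum>k\<in>J. norm (conv g (box_kernel s k (t k)) (x k))) \<le>
       (LBINT y. norm (g y) * norm (\<Sum>k\<in>J. c k * box_kernel s k (t k) (x k - y)))"
proof -
  let ?b = "\<lambda>k. conv g (box_kernel s k (t k)) (x k)"
  define c where "c k = cnj (sgn (?b k))" for k
  have c: "norm (c k) \<le> 1" for k by (simp add: c_def norm_sgn)
  have cb: "c k * ?b k = of_real (norm (?b k))" for k
    by (cases "?b k = 0") (simp_all add: c_def sgn_div_norm scaleR_conv_of_real complex_norm_square[symmetric] power2_eq_square field_simps flip: of_real_mult)
  have i: "integrable lborel (\<lambda>y. c k * (g y * box_kernel s k (t k) (x k - y)))" if "k \<in> J" for k
    by (intro integrable_mult_right conv_bound(1)[OF g schwartz_measurable schwartz_kernel_bound] schwartz_box_kernel J(2) that)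
  have e: "(\<Sum>k\<in>J. c k * (g y * box_kernel s k (t k) (x k - y))) = g y * (\<Sum>k\<in>J. c k * box_kernel s k (t k) (x k - y))" for y
    by (simp add: sum_distrib_left mult_ac)
  have I: "integrable lborel (\<lambda>y. g y * (\<Sum>k\<in>J. c k * box_kernel s k (t k) (x k - y)))"
    unfolding e[symmetric] by (intro Bochner_Integration.integrable_sum i)
  have "complex_of_real (\<Sum>k\<in>J. norm (?b k)) = (\<Sum>k\<in>J. c k * ?b k)" by (simp add: cb)
  also have "\<dots> = (\<Sum>k\<in>J. LBINT y. c k * (g y * box_kernel s k (t k) (x k - y)))"
    unfolding conv_def by (simp only: integral_mult_right_zero)
  also have "\<dots> = (LBINT y. \<Sum>k\<in>J. c k * (g y * box_kernel s k (t k) (x k - y)))"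
    by (rule Bochner_Integration.integral_sum[symmetric, OF i])
  finally have "complex_of_real (\<Sum>k\<in>J. norm (?b k)) = (LBINT y. g y * (\<Sum>k\<in>J. c k * box_kernel s k (t k) (x k - y)))"
    unfolding e .
  then have "\<bar>\<Sum>k\<in>J. norm (?b k)\<bar> \<le> (LBINT y. norm (g y * (\<Sum>k\<in>J. c k * box_kernel s k (t k) (x k - y))))"
    unfolding norm_of_real[where 'a = complex, symmetric] by (simp only: integral_norm_bound)
  then have "(\<Sum>k\<in>J. norm (?b k)) \<le> (LBINT y. norm (g y) * norm (\<Sum>k\<in>J. c k * box_kernel s k (t k) (x k - y)))"
    unfolding norm_mult by linarith
  with c I show ?thesis by blast
qed

text \<open>The estimate for one dyadic block; \<open>J\<close> stands for a finite set of frequencies \<open>k\<close> with \<open>\<bar>k\<bar> \<sim> 2\<^sup>j\<close>; the factor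
\<open>4\<close> and the power \<open>2\<^bsup>s/2\<^esup>\<close> come from \<open>card_level\<close> and \<open>weight_level\<close>.\<close>

lemma sum_conv_Lp_level:
  assumes p: "2 \<le> p"
  shows "\<exists>C\<ge>0. \<forall>g G J t x j. Lp_le p g G \<longrightarrow> G > 0 \<longrightarrow> finite J \<longrightarrow>
    (\<forall>k\<in>J. t k \<in> {-1..1} \<and> (1 + (real_of_int k)\<^sup>2) powr (- s / 2) \<le> 2 powr (s / 2) * 2 powr (- s * j)) \<longrightarrow>
    real (card J) \<le> 4 * 2 powr j \<longrightarrow>
    (\<Sum>k\<in>J. norm (conv g (box_kernel s k (t k)) (x k))) \<le> C * G * 2 powr ((1 - real_of_ereal (1 / p) - s) * j)"
proof -
  from box_kernel_packet_bounds[of s] obtain C where C0: "C \<ge> 0" and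
    C: "\<forall>J t x c W. finite J \<longrightarrow> (\<forall>k\<in>J. t k \<in> {-1..1} \<and> norm (c k) \<le> 1 \<and> (1 + (real_of_int k)\<^sup>2) powr (- s / 2) \<le> W) \<longrightarrow> W \<ge> 0 \<longrightarrow>
     (\<lambda>y. \<Sum>k\<in>J. c k * box_kernel s k (t k) (x k - y)) \<in> schwartz \<and>
     (LBINT y. norm (\<Sum>k\<in>J. c k * box_kernel s k (t k) (x k - y))) \<le> C * real (card J) * W \<and>
     (LBINT y. (norm (\<Sum>k\<in>J. c k * box_kernel s k (t k) (x k - y)))\<^sup>2) \<le> C * real (card J) * W\<^sup>2" by blast
  let ?a = "2 powr (s / 2)"
  define D where "D = 4 * C * ?a + 1 + 4 * C * ?a\<^sup>2"
  have D0: "D \<ge> 0" using C0 by (simp add: D_def)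
  show ?thesis
  proof (intro exI[of _ D] conjI D0 allI impI)
    fix g G and J :: "int set" and t x :: "int \<Rightarrow> real" and j :: real
    assume g: "Lp_le p g G" and G: "G > 0" and J: "finite J"
      and tW: "\<forall>k\<in>J. t k \<in> {-1..1} \<and> (1 + (real_of_int k)\<^sup>2) powr (- s / 2) \<le> ?a * 2 powr (- s * j)"
      and card: "real (card J) \<le> 4 * 2 powr j"
    have "1 \<le> p" using p by (rule order_trans[rotated]) simp
    from Lp_le_loc_bounded[OF g this] obtain B where B: "loc_bounded g B" by blast
    note [measurable] = g[unfolded Lp_le_def, THEN conjunct1]
    define W where "W = ?a * 2 powr (- s * j)"
    have W0: "W \<ge> 0" by (simp add: W_def)
    from sum_conv_duality[OF B J, of t s x] tW obtain c where c: "\<forall>k. norm (c k) \<le> 1"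
      "integrable lborel (\<lambda>y. g y * (\<Sum>k\<in>J. c k * box_kernel s k (t k) (x k - y)))"
      "(\<Sum>k\<in>J. norm (conv g (box_kernel s k (t k)) (x k))) \<le>
       (LBINT y. norm (g y) * norm (\<Sum>k\<in>J. c k * box_kernel s k (t k) (x k - y)))" by blast
    define P where "P y = (\<Sum>k\<in>J. c k * box_kernel s k (t k) (x k - y))" for y
    have tcW: "\<forall>k\<in>J. t k \<in> {-1..1} \<and> norm (c k) \<le> 1 \<and> (1 + (real_of_int k)\<^sup>2) powr (- s / 2) \<le> W"
      using tW c(1) by (auto simp: W_def)
    have PS: "P \<in> schwartz"
      and P1: "(LBINT y. norm (P y)) \<le> C * real (card J) * W" and P2: "(LBINT y. (norm (P y))\<^sup>2) \<le> C * real (card J) * W\<^sup>2"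
      using C[rule_format, OF J _ W0, of t c x] tcW unfolding P_def[abs_def] by auto
    have gP: "integrable lborel (\<lambda>y. norm (g y) * norm (P y))"
      using integrable_norm[OF c(2)] unfolding norm_mult P_def .
    have Pi: "integrable lborel (\<lambda>y. norm (P y))" by (intro integrable_norm schwartz_integrable PS)
    have Pi2: "integrable lborel (\<lambda>y. (norm (P y))\<^sup>2)"
      using integrable_norm[OF schwartz_integrable[OF schwartz_mult[OF PS PS]]] by (simp add: norm_mult power2_eq_square)
    have P1': "(LBINT y. norm (P y)) \<le> 4 * C * ?a * (2 powr j * 2 powr (- s * j))"
    proof -
      have "C * real (card J) * W \<le> C * (4 * 2 powr j) * W" using card C0 W0 by (intro mult_right_mono mult_left_mono) auto
      also have "\<dots> = 4 * C * ?a * (2 powr j * 2 powr (- s * j))" by (simp add: W_def)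
      finally show ?thesis using P1 by linarith
    qed
    have P2': "(LBINT y. (norm (P y))\<^sup>2) \<le> 4 * C * ?a\<^sup>2 * (2 powr j * (2 powr (- s * j))\<^sup>2)"
    proof -
      have "C * real (card J) * W\<^sup>2 \<le> C * (4 * 2 powr j) * W\<^sup>2" using card C0 by (intro mult_right_mono mult_left_mono) auto
      also have "\<dots> = 4 * C * ?a\<^sup>2 * (2 powr j * (2 powr (- s * j))\<^sup>2)" by (simp add: W_def power_mult_distrib)
      finally show ?thesis using P2 by linarith
    qed
    show "(\<Sum>k\<in>J. norm (conv g (box_kernel s k (t k)) (x k))) \<le> D * G * 2 powr ((1 - real_of_ereal (1 / p) - s) * j)"
    proof (cases "p = \<infinity>")
      case True
      have ae: "AE y in lborel. norm (g y) * norm (P y) \<le> G * norm (P y)"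
      proof -
        have "AE y in lborel. norm (g y) \<le> G" using g True by (simp add: Lp_le_def)
        then show ?thesis by eventually_elim (simp add: mult_right_mono)
      qed
      have "(LBINT y. norm (g y) * norm (P y)) \<le> (LBINT y. G * norm (P y))"
        by (rule integral_mono_AE[OF gP integrable_mult_right[OF Pi] ae])
      also have "\<dots> = G * (LBINT y. norm (P y))" by (rule integral_mult_right_zero)
      also have "\<dots> \<le> G * (4 * C * ?a * (2 powr j * 2 powr (- s * j)))" using G by (intro mult_left_mono P1') auto
      also have "2 powr j * 2 powr (- s * j) = 2 powr ((1 - real_of_ereal (1 / p) - s) * j)"
        using True by (simp add: algebra_simps flip: powr_add)
      also have "G * (4 * C * ?a * 2 powr ((1 - real_of_ereal (1 / p) - s) * j)) \<le> D * G * 2 powr ((1 - real_of_ereal (1 / p) - s) * j)"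
      proof -
        have "4 * C * ?a \<le> D" using C0 by (simp add: D_def)
        then have "(4 * C * ?a) * (G * 2 powr ((1 - real_of_ereal (1 / p) - s) * j)) \<le> D * (G * 2 powr ((1 - real_of_ereal (1 / p) - s) * j))"
          using G by (intro mult_right_mono) auto
        then show ?thesis by (simp only: mult_ac)
      qed
      finally show ?thesis using c(3) unfolding P_def by linarith
    next
      case False
      with p obtain q where q: "p = ereal q" "q \<ge> 2" by (cases p) auto
      have gq: "integrable lborel (\<lambda>x. norm (g x) powr q)" "(LBINT x. norm (g x) powr q) \<le> G powr q"
        using g q by (auto simp: Lp_le_def)
      have rp: "real_of_ereal (1 / p) = 1 / q" using q by (simp add: one_ereal_def)
      define X where "X = 2 powr ((1 - 1 / q - s) * j)"
      \<comment> \<open>These values balance the terms of \<open>split_bound\<close>: each becomes a multiple of \<open>G * X\<close>.\<close>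
      define \<mu> where "\<mu> = G * 2 powr (- j / q)"
      define \<nu> where "\<nu> = 2 powr (- s * j + j / q) / G"
      have pos: "\<mu> > 0" "\<nu> > 0" using G by (auto simp: \<mu>_def \<nu>_def)
      have i2: "integrable lborel (\<lambda>y. \<mu> * norm (P y) + (\<nu> * \<mu> powr (2 - q) * norm (g y) powr q + (norm (P y))\<^sup>2 / \<nu>) / 2)"
        by (intro Bochner_Integration.integrable_add integrable_mult_right Pi integrable_divide gq Pi2)
      have "(LBINT y. norm (g y) * norm (P y)) \<le> (LBINT y. \<mu> * norm (P y) + (\<nu> * \<mu> powr (2 - q) * norm (g y) powr q + (norm (P y))\<^sup>2 / \<nu>) / 2)"
        by (rule integral_mono[OF gP i2]) (rule split_bound[OF _ _ pos q(2)], auto)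
      also have "\<dots> = \<mu> * (LBINT y. norm (P y)) + (\<nu> * \<mu> powr (2 - q) * (LBINT y. norm (g y) powr q) + (LBINT y. (norm (P y))\<^sup>2) / \<nu>) / 2"
        using Pi gq Pi2 by simp
      also have "\<dots> \<le> \<mu> * (4 * C * ?a * (2 powr j * 2 powr (- s * j))) + (\<nu> * \<mu> powr (2 - q) * G powr q + (4 * C * ?a\<^sup>2 * (2 powr j * (2 powr (- s * j))\<^sup>2)) / \<nu>) / 2"
        using pos by (intro add_mono mult_left_mono divide_right_mono P1' P2' gq) auto
      also have "\<mu> * (4 * C * ?a * (2 powr j * 2 powr (- s * j))) = 4 * C * ?a * (G * X)"
      proof -
        have X: "2 powr (- j / q) * (2 powr j * 2 powr (- s * j)) = X"
          unfolding X_def by (simp add: algebra_simps flip: powr_add)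
        have "\<mu> * (4 * C * ?a * (2 powr j * 2 powr (- s * j))) = 4 * C * ?a * (G * (2 powr (- j / q) * (2 powr j * 2 powr (- s * j))))"
          unfolding \<mu>_def by (simp only: mult_ac)
        then show ?thesis unfolding X .
      qed
      also have "\<nu> * \<mu> powr (2 - q) * G powr q = G * X"
      proof -
        have "\<mu> powr (2 - q) = G powr (2 - q) * 2 powr ((- j / q) * (2 - q))"
          using G by (simp add: \<mu>_def powr_mult powr_powr)
        then have "\<nu> * \<mu> powr (2 - q) * G powr q = (G powr (2 - q) * G powr q / G) * (2 powr (- s * j + j / q) * 2 powr ((- j / q) * (2 - q)))"
          by (simp add: \<nu>_def mult_ac)
        also have "G powr (2 - q) * G powr q / G = G" using G by (simp add: power2_eq_square flip: powr_add)
        also have "2 powr (- s * j + j / q) * 2 powr ((- j / q) * (2 - q)) = X"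
        proof -
          have "(- s * j + j / q) + (- j / q) * (2 - q) = (1 - 1 / q - s) * j" using q(2) by (simp add: field_simps)
          then show ?thesis unfolding X_def by (simp only: powr_add[symmetric])
        qed
        finally show ?thesis .
      qed
      also have "(4 * C * ?a\<^sup>2 * (2 powr j * (2 powr (- s * j))\<^sup>2)) / \<nu> = 4 * C * ?a\<^sup>2 * (G * X)"
      proof -
        have "2 powr j * (2 powr (- s * j))\<^sup>2 / 2 powr (- s * j + j / q) = X"
          unfolding X_def power2_eq_square by (simp add: algebra_simps flip: powr_add powr_diff)
        then have "(2 powr j * (2 powr (- s * j))\<^sup>2) / \<nu> = G * X"
          using G unfolding \<nu>_def by (simp add: field_simps)
        then show ?thesis by (simp only: times_divide_eq_right[symmetric])
      qed
      also have "4 * C * ?a * (G * X) + (G * X + 4 * C * ?a\<^sup>2 * (G * X)) / 2 \<le> D * G * X"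
      proof -
        have GX: "0 \<le> G * X" using G by (simp add: X_def)
        then have "0 \<le> C * ?a\<^sup>2 * (G * X)" using C0 by simp
        with GX show ?thesis unfolding D_def by (simp add: algebra_simps)
      qed
      finally show ?thesis using c(3) unfolding P_def rp X_def by linarith
    qed
  qed
qed

text \<open>The dyadic block of a frequency: \<open>level k = j\<close> means \<open>2\<^sup>j \<le>
\<bar>k\<bar> + 1 < 2\<^bsup>j + 1\<^esup>\<close>.\<close>

definition level :: "int \<Rightarrow> nat" where
  "level k = nat \<lfloor>log 2 (\<bar>real_of_int k\<bar> + 1)\<rfloor>"

lemma level_bounds: "2 powr real (level k) \<le> \<bar>real_of_int k\<bar> + 1" "\<bar>real_of_int k\<bar> + 1 < 2 * 2 powr real (level k)"
proof -
  have l0: "0 \<le> log 2 (\<bar>real_of_int k\<bar> + 1)" by simp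
  have r: "real (level k) = of_int \<lfloor>log 2 (\<bar>real_of_int k\<bar> + 1)\<rfloor>" using l0 by (simp add: level_def)
  have "2 powr real (level k) \<le> 2 powr log 2 (\<bar>real_of_int k\<bar> + 1)" unfolding r by (intro powr_mono) auto
  then show "2 powr real (level k) \<le> \<bar>real_of_int k\<bar> + 1" by simp
  have "2 powr log 2 (\<bar>real_of_int k\<bar> + 1) < 2 powr (real (level k) + 1)" unfolding r by (intro powr_less_mono) linarith+
  then show "\<bar>real_of_int k\<bar> + 1 < 2 * 2 powr real (level k)" by (simp add: powr_add)
qed

lemma card_level: assumes "finite K" shows "real (card {k \<in> K. level k = j}) \<le> 4 * 2 powr real j"
proof -
  let ?R = "2 * 2 powr real j - 1"
  have R: "?R \<ge> 0" using ge_one_powr_ge_zero[of 2 "real j"] by simp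
  have "{k \<in> K. level k = j} \<subseteq> {k::int. \<bar>0 - real_of_int k\<bar> \<le> ?R}"
  proof clarify
    fix k assume "j = level k"
    with level_bounds(2)[of k] show "\<bar>0 - real_of_int k\<bar> \<le> 2 * 2 powr real (level k) - 1" by simp
  qed
  then have "card {k \<in> K. level k = j} \<le> card {k::int. \<bar>0 - real_of_int k\<bar> \<le> ?R}"
    by (intro card_mono card_int_interval R)
  then have "real (card {k \<in> K. level k = j}) \<le> 2 * ?R + 1"
    using card_int_interval(2)[OF R, of 0] by linarith
  also have "2 * ?R + 1 \<le> 4 * 2 powr real j" by simp
  finally show ?thesis .
qed

lemma weight_level:
  assumes "s \<ge> 0"
  shows "(1 + (real_of_int k)\<^sup>2) powr (- s / 2) \<le> 2 powr (s / 2) * 2 powr (- s * real (level k))"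
proof -
  let ?L = "2 powr real (level k)"
  have "?L\<^sup>2 \<le> (\<bar>real_of_int k\<bar> + 1)\<^sup>2" using level_bounds(1)[of k] by (intro power_mono) auto
  also have "\<dots> \<le> 2 * (1 + (real_of_int k)\<^sup>2)"
  proof -
    have "0 \<le> (\<bar>real_of_int k\<bar> - 1)\<^sup>2" by simp
    then show ?thesis by (simp add: power2_eq_square algebra_simps)
  qed
  finally have "?L\<^sup>2 / 2 \<le> 1 + (real_of_int k)\<^sup>2" by simp
  then have "(1 + (real_of_int k)\<^sup>2) powr (- s / 2) \<le> (?L\<^sup>2 / 2) powr (- s / 2)"
    using assms by (intro powr_mono2') auto
  also have "\<dots> = 2 powr (s / 2) * 2 powr (- s * real (level k))"
  proof -
    have "?L\<^sup>2 / 2 = 2 powr (2 * real (level k) - 1)" by (simp add: power2_eq_square powr_diff flip: powr_add)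
    then have "(?L\<^sup>2 / 2) powr (- s / 2) = 2 powr ((2 * real (level k) - 1) * (- s / 2))" by (simp only: powr_powr)
    also have "(2 * real (level k) - 1) * (- s / 2) = s / 2 + - s * real (level k)" by (simp add: algebra_simps)
    finally show ?thesis by (simp only: powr_add)
  qed
  finally show ?thesis .
qed

text \<open>The times \<open>t k\<close> and the points \<open>x k\<close> may be chosen separately for each frequency, so that this bounds
the sum of the suprema over time and space.\<close>

proposition sum_conv_Lp:
  assumes p: "2 \<le> p" and s: "1 - 1 / p < ereal s"
  shows "\<exists>C\<ge>0. \<forall>g G K t x. Lp_le p g G \<longrightarrow> G > 0 \<longrightarrow> finite K \<longrightarrow> (\<forall>k\<in>K. t k \<in> {-1..1}) \<longrightarrow>
    (\<Sum>k\<in>K. norm (conv g (box_kernel s k (t k)) (x k))) \<le> C * G"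
proof -
  from sum_conv_Lp_level[OF p, of s] obtain C where C0: "C \<ge> 0" and
    C: "\<forall>g G J t x j. Lp_le p g G \<longrightarrow> G > 0 \<longrightarrow> finite J \<longrightarrow>
    (\<forall>k\<in>J. t k \<in> {-1..1} \<and> (1 + (real_of_int k)\<^sup>2) powr (- s / 2) \<le> 2 powr (s / 2) * 2 powr (- s * j)) \<longrightarrow>
    real (card J) \<le> 4 * 2 powr j \<longrightarrow>
    (\<Sum>k\<in>J. norm (conv g (box_kernel s k (t k)) (x k))) \<le> C * G * 2 powr ((1 - real_of_ereal (1 / p) - s) * j)" by blast
  define r where "r = real_of_ereal (1 / p)"
  have r: "0 \<le> r" "r \<le> 1 / 2" "1 - r < s"
  proof -
    have "0 \<le> r \<and> r \<le> 1 / 2 \<and> 1 - r < s"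
    proof (cases p)
      case (real q)
      then have q: "q \<ge> 2" "r = 1 / q" using p by (auto simp: r_def one_ereal_def)
      have "1 - 1 / q < s" using s real q(1) by (simp add: one_ereal_def)
      then show ?thesis using q by (simp add: divide_le_eq)
    next
      case PInf
      then show ?thesis using s by (simp add: r_def one_ereal_def)
    qed (use p in auto)
    then show "0 \<le> r" "r \<le> 1 / 2" "1 - r < s" by auto
  qed
  \<comment> \<open>The hypothesis on \<open>s\<close> makes the dyadic blocks decay geometrically with ratio \<open>z < 1\<close>.\<close>
  define z where "z = 2 powr (1 - r - s)"
  have z: "0 < z" "z < 1" using r(3) by (auto simp: z_def powr_less_one)
  have zj: "2 powr ((1 - r - s) * real j) = z ^ j" for j
    using z(1) by (simp add: z_def powr_powr[symmetric] powr_realpow)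
  have "(\<Sum>k\<in>K. norm (conv g (box_kernel s k (t k)) (x k))) \<le> C * (1 / (1 - z)) * G"
    if g: "Lp_le p g G" "G > 0" and K: "finite K" "\<forall>k\<in>K. t k \<in> {-1..1}" for g G t x and K :: "int set"
  proof -
    have "(\<Sum>k\<in>K. norm (conv g (box_kernel s k (t k)) (x k))) = (\<Sum>j\<in>level ` K. \<Sum>k\<in>{k \<in> K. level k = j}. norm (conv g (box_kernel s k (t k)) (x k)))"
      by (rule sum.image_gen[OF K(1)])
    also have "\<dots> \<le> (\<Sum>j\<in>level ` K. C * G * z ^ j)"
    proof (rule sum_mono)
      fix j
      have "(\<Sum>k\<in>{k \<in> K. level k = j}. norm (conv g (box_kernel s k (t k)) (x k))) \<le> C * G * 2 powr ((1 - real_of_ereal (1 / p) - s) * real j)"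
      proof (rule C[rule_format, OF g])
        show "finite {k \<in> K. level k = j}" using K(1) by simp
        show "real (card {k \<in> K. level k = j}) \<le> 4 * 2 powr real j" by (rule card_level[OF K(1)])
        fix k assume "k \<in> {k \<in> K. level k = j}"
        then have k: "k \<in> K" "level k = j" by auto
        show "t k \<in> {-1..1} \<and> (1 + (real_of_int k)\<^sup>2) powr (- s / 2) \<le> 2 powr (s / 2) * 2 powr (- s * real j)"
          using K(2) k weight_level[of s k] r by auto
      qed
      then show "(\<Sum>k\<in>{k \<in> K. level k = j}. norm (conv g (box_kernel s k (t k)) (x k))) \<le> C * G * z ^ j"
        unfolding r_def[symmetric] zj .
    qed
    also have "\<dots> = C * G * (\<Sum>j\<in>level ` K. z ^ j)" by (simp add: sum_distrib_left)
    also have "\<dots> \<le> C * G * (1 / (1 - z))"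
    proof (intro mult_left_mono)
      have "(\<Sum>j\<in>level ` K. z ^ j) \<le> (\<Sum>j. z ^ j)"
        using z K(1) by (intro sum_le_suminf summable_geometric) auto
      then show "(\<Sum>j\<in>level ` K. z ^ j) \<le> 1 / (1 - z)" using z by (simp add: suminf_geometric)
    qed (use C0 g in simp)
    finally show ?thesis by (simp only: mult_ac)
  qed
  moreover have "C * (1 / (1 - z)) \<ge> 0" using C0 z by simp
  ultimately show ?thesis by blast
qed

end

section \<open>Curves in the modulation space and the free evolution\<close>

lemma represents_diff:
  assumes g: "represents g T" and h: "represents h U"
  shows "represents (\<lambda>x. g x - h x) (\<lambda>\<phi>. T \<phi> - U \<phi>)"
  unfolding represents_def
proof (intro conjI ballI)
  show "(\<lambda>x. g x - h x) \<in> borel_measurable lborel"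
    using represents_measurable[OF g] represents_measurable[OF h] by simp
  fix \<phi> :: "real \<Rightarrow> complex" assume p: "\<phi> \<in> schwartz"
  have i: "integrable lborel (\<lambda>x. g x * \<phi> x)" "integrable lborel (\<lambda>x. h x * \<phi> x)"
    and e: "T \<phi> = (LBINT x. g x * \<phi> x)" "U \<phi> = (LBINT x. h x * \<phi> x)"
    using g h p unfolding represents_def distr_of_def by auto
  show "integrable lborel (\<lambda>x. (g x - h x) * \<phi> x)"
    using Bochner_Integration.integrable_diff[OF i] by (simp add: left_diff_distrib)
  show "T \<phi> - U \<phi> = distr_of (\<lambda>x. g x - h x) \<phi>"
    using Bochner_Integration.integral_diff[OF i] by (simp add: e distr_of_def left_diff_distrib)
qed

lemma tendsto_ennreal_0I:
  assumes "\<And>\<epsilon>. \<epsilon> > 0 \<Longrightarrow> eventually (\<lambda>x. f x \<le> ennreal \<epsilon>) F"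
  shows "(f \<longlongrightarrow> 0) F"
proof (rule order_tendstoI)
  fix a :: ennreal assume "0 < a"
  then obtain c where c: "0 < c" "c < a" using dense by blast
  then have "c < \<top>" by (auto intro: less_le_trans)
  then obtain r where r: "c = ennreal r" "r \<ge> 0" by (cases c) auto
  with c have "r > 0" by simp
  from assms[OF this] show "eventually (\<lambda>x. f x < a) F"
    by eventually_elim (use c r in \<open>auto intro: le_less_trans\<close>)
qed simp

context freq_partition
begin

lemma Linf_triangle:
  assumes g: "represents g T" and h: "represents h U"
  shows "Lp_norm \<infinity> T \<le> Lp_norm \<infinity> U + Lp_norm \<infinity> (\<lambda>\<phi>. T \<phi> - U \<phi>)"
    "Lp_norm \<infinity> U \<le> Lp_norm \<infinity> T + Lp_norm \<infinity> (\<lambda>\<phi>. T \<phi> - U \<phi>)"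
proof -
  have "AE x in lborel. ennreal (norm (g x)) \<le> Lp_norm \<infinity> U + Lp_norm \<infinity> (\<lambda>\<phi>. T \<phi> - U \<phi>)"
    using Linf_AE[OF h] Linf_AE[OF represents_diff[OF g h]]
  proof eventually_elim
    case (elim x)
    have "norm (g x) \<le> norm (h x) + norm (g x - h x)" using norm_triangle_ineq[of "h x" "g x - h x"] by simp
    then have "ennreal (norm (g x)) \<le> ennreal (norm (h x)) + ennreal (norm (g x - h x))"
      by (simp add: ennreal_leI flip: ennreal_plus)
    also have "\<dots> \<le> Lp_norm \<infinity> U + Lp_norm \<infinity> (\<lambda>\<phi>. T \<phi> - U \<phi>)" using elim by (intro add_mono) auto
    finally show ?case .
  qed
  then show "Lp_norm \<infinity> T \<le> Lp_norm \<infinity> U + Lp_norm \<infinity> (\<lambda>\<phi>. T \<phi> - U \<phi>)" by (rule Linf_leI[OF g])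
  have "AE x in lborel. ennreal (norm (h x)) \<le> Lp_norm \<infinity> T + Lp_norm \<infinity> (\<lambda>\<phi>. T \<phi> - U \<phi>)"
    using Linf_AE[OF g] Linf_AE[OF represents_diff[OF g h]]
  proof eventually_elim
    case (elim x)
    have "norm (h x) \<le> norm (g x) + norm (g x - h x)" using norm_triangle_ineq4[of "g x" "g x - h x"] by simp
    then have "ennreal (norm (h x)) \<le> ennreal (norm (g x)) + ennreal (norm (g x - h x))"
      by (simp add: ennreal_leI flip: ennreal_plus)
    also have "\<dots> \<le> Lp_norm \<infinity> T + Lp_norm \<infinity> (\<lambda>\<phi>. T \<phi> - U \<phi>)" using elim by (intro add_mono) auto
    finally show ?case .
  qed
  then show "Lp_norm \<infinity> U \<le> Lp_norm \<infinity> T + Lp_norm \<infinity> (\<lambda>\<phi>. T \<phi> - U \<phi>)" by (rule Linf_leI[OF h])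
qed

lemma freq_box_diff: "freq_box \<sigma> k (\<lambda>\<phi>. u \<phi> - v \<phi>) = (\<lambda>\<phi>. freq_box \<sigma> k u \<phi> - freq_box \<sigma> k v \<phi>)"
  by (simp add: freq_box_eq)

lemma mod_norm_leI:
  assumes "\<And>F. finite F \<Longrightarrow> (\<Sum>k\<in>F. box_norm k u) \<le> B" shows "mod_norm \<sigma> u \<le> B"
  unfolding mod_norm_eq_SUP using assms unfolding box_norm_def by (intro SUP_least) auto

lemma box_norm_le_mod_norm: "box_norm k u \<le> mod_norm \<sigma> u"
  unfolding box_norm_def by (rule Linf_le_mod_norm)

lemma sum_box_norm_le_mod_norm: "finite F \<Longrightarrow> (\<Sum>k\<in>F. box_norm k u) \<le> mod_norm \<sigma> u"
  unfolding box_norm_def by (rule sum_le_mod_norm)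

lemma box_norm_triangle:
  assumes "\<And>k. represents (g k) (freq_box \<sigma> k u)" "\<And>k. represents (h k) (freq_box \<sigma> k v)"
  shows "box_norm k u \<le> box_norm k v + box_norm k (\<lambda>\<phi>. u \<phi> - v \<phi>)"
    "box_norm k v \<le> box_norm k u + box_norm k (\<lambda>\<phi>. u \<phi> - v \<phi>)"
  unfolding box_norm_def freq_box_diff using Linf_triangle[OF assms] by auto

lemma mod_norm_triangle:
  assumes "\<And>k. represents (g k) (freq_box \<sigma> k u)" "\<And>k. represents (h k) (freq_box \<sigma> k v)"
  shows "mod_norm \<sigma> u \<le> mod_norm \<sigma> v + mod_norm \<sigma> (\<lambda>\<phi>. u \<phi> - v \<phi>)"
    "mod_norm \<sigma> v \<le> mod_norm \<sigma> u + mod_norm \<sigma> (\<lambda>\<phi>. u \<phi> - v \<phi>)"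
proof -
  note t = box_norm_triangle[of g u h v, OF assms]
  show "mod_norm \<sigma> u \<le> mod_norm \<sigma> v + mod_norm \<sigma> (\<lambda>\<phi>. u \<phi> - v \<phi>)"
  proof (rule mod_norm_leI)
    fix F :: "int set" assume F: "finite F"
    have "(\<Sum>k\<in>F. box_norm k u) \<le> (\<Sum>k\<in>F. box_norm k v) + (\<Sum>k\<in>F. box_norm k (\<lambda>\<phi>. u \<phi> - v \<phi>))"
      unfolding sum.distrib[symmetric] by (intro sum_mono t)
    also have "\<dots> \<le> mod_norm \<sigma> v + mod_norm \<sigma> (\<lambda>\<phi>. u \<phi> - v \<phi>)" by (intro add_mono sum_box_norm_le_mod_norm F)
    finally show "(\<Sum>k\<in>F. box_norm k u) \<le> mod_norm \<sigma> v + mod_norm \<sigma> (\<lambda>\<phi>. u \<phi> - v \<phi>)" .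
  qed
  show "mod_norm \<sigma> v \<le> mod_norm \<sigma> u + mod_norm \<sigma> (\<lambda>\<phi>. u \<phi> - v \<phi>)"
  proof (rule mod_norm_leI)
    fix F :: "int set" assume F: "finite F"
    have "(\<Sum>k\<in>F. box_norm k v) \<le> (\<Sum>k\<in>F. box_norm k u) + (\<Sum>k\<in>F. box_norm k (\<lambda>\<phi>. u \<phi> - v \<phi>))"
      unfolding sum.distrib[symmetric] by (intro sum_mono t)
    also have "\<dots> \<le> mod_norm \<sigma> u + mod_norm \<sigma> (\<lambda>\<phi>. u \<phi> - v \<phi>)" by (intro add_mono sum_box_norm_le_mod_norm F)
    finally show "(\<Sum>k\<in>F. box_norm k v) \<le> mod_norm \<sigma> u + mod_norm \<sigma> (\<lambda>\<phi>. u \<phi> - v \<phi>)" .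
  qed
qed

lemma finite_sums_tail:
  fixes b :: "int \<Rightarrow> real"
  assumes b: "\<And>k. b k \<ge> 0" and B: "\<And>K. finite K \<Longrightarrow> sum b K \<le> B" and e: "\<epsilon> > 0"
  shows "\<exists>K. finite K \<and> (\<forall>F. finite F \<longrightarrow> F \<inter> K = {} \<longrightarrow> sum b F \<le> \<epsilon>)"
proof -
  let ?S = "SUP K\<in>{K. finite K}. sum b K"
  have bdd: "bdd_above (sum b ` {K. finite K})" using B by (intro bdd_aboveI[of _ B]) auto
  have ne: "{K::int set. finite K} \<noteq> {}" by auto
  have "?S - \<epsilon> < ?S" using e by simp
  then obtain K where K: "finite K" "?S - \<epsilon> < sum b K" using less_cSUP_iff[OF ne bdd] by auto
  have "sum b F \<le> \<epsilon>" if F: "finite F" "F \<inter> K = {}" for F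
  proof -
    have "sum b F + sum b K = sum b (F \<union> K)" using F K by (simp add: sum.union_disjoint)
    also have "\<dots> \<le> ?S" using F K bdd by (intro cSUP_upper) auto
    finally show ?thesis using K(2) by linarith
  qed
  with K(1) show ?thesis by blast
qed

text \<open>The criterion for membership in \<open>S_space\<close> used for both estimates. The Lipschitz constants may depend
on \<open>k\<close>: all but finitely many boxes are small uniformly in time, by \<open>B\<close>, so that \<open>u\<close> is continuous in
the norm of the modulation space.\<close>

lemma S_spaceI:
  fixes u :: "real \<Rightarrow> distr" and D :: "int \<Rightarrow> real \<Rightarrow> real \<Rightarrow> complex"
  assumes T: "\<And>t. t \<in> {0..1} \<Longrightarrow> u t \<in> tempered"
    and rep: "\<And>k t. t \<in> {0..1} \<Longrightarrow> represents (D k t) (freq_box \<sigma> k (u t))"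
    and bd: "\<And>k t x. t \<in> {0..1} \<Longrightarrow> norm (D k t x) \<le> b k"
    and B: "\<And>K. finite K \<Longrightarrow> sum b K \<le> B"
    and lip: "\<And>k. \<exists>L. \<forall>t\<in>{0..1}. \<forall>t'\<in>{0..1}. \<forall>x. norm (D k t x - D k t' x) \<le> L * \<bar>t - t'\<bar>"
  shows "u \<in> S_space \<sigma>" "S_norm \<sigma> u \<le> ennreal B"
proof -
  have b0: "b k \<ge> 0" for k using bd[of 0 k 0] by (intro order_trans[OF norm_ge_zero]) auto
  have mod: "mod_norm \<sigma> (u t) \<le> ennreal B" if t: "t \<in> {0..1}" for t
  proof (rule mod_norm_leI)
    fix F :: "int set" assume F: "finite F"
    have "(\<Sum>k\<in>F. box_norm k (u t)) \<le> (\<Sum>k\<in>F. ennreal (b k))"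
      unfolding box_norm_def by (intro sum_mono Linf_leI[OF rep[OF t]] AE_I2 ennreal_leI bd t)
    also have "\<dots> = ennreal (sum b F)" using b0 by simp
    also have "\<dots> \<le> ennreal B" using B[OF F] by (rule ennreal_leI)
    finally show "(\<Sum>k\<in>F. box_norm k (u t)) \<le> ennreal B" .
  qed
  have mod_space: "u t \<in> mod_space \<sigma>" if t: "t \<in> {0..1}" for t
    using T[OF t] mod[OF t] by (auto simp: mod_space_def intro: le_less_trans)
  have cont: "\<exists>\<delta>>0. \<forall>t\<in>{0..1}. \<forall>t'\<in>{0..1}. \<bar>t - t'\<bar> < \<delta> \<longrightarrow> mod_norm \<sigma> (\<lambda>\<phi>. u t \<phi> - u t' \<phi>) \<le> ennreal \<epsilon>"
    if e: "\<epsilon> > 0" for \<epsilon> :: real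
  proof -
    \<comment> \<open>Outside the finite set \<open>K\<close> the boxes contribute at most \<open>\<epsilon> / 2\<close> to the difference at any two times.\<close>
    from finite_sums_tail[OF b0 B, of "\<epsilon> / 4"] e obtain K where K: "finite K"
      "\<forall>F. finite F \<longrightarrow> F \<inter> K = {} \<longrightarrow> sum b F \<le> \<epsilon> / 4" by auto
    from lip have "\<forall>k. \<exists>L. \<forall>t\<in>{0..1}. \<forall>t'\<in>{0..1}. \<forall>x. norm (D k t x - D k t' x) \<le> L * \<bar>t - t'\<bar>" by blast
    then obtain L where L: "\<And>k t t' x. t \<in> {0..1} \<Longrightarrow> t' \<in> {0..1} \<Longrightarrow> norm (D k t x - D k t' x) \<le> L k * \<bar>t - t'\<bar>"
      by metis
    define M where "M = (\<Sum>k\<in>K. \<bar>L k\<bar>) + 1"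
    have M: "M > 0" unfolding M_def by (intro add_nonneg_pos sum_nonneg) auto
    have "mod_norm \<sigma> (\<lambda>\<phi>. u t \<phi> - u t' \<phi>) \<le> ennreal \<epsilon>"
      if t: "t \<in> {0..1}" "t' \<in> {0..1}" "\<bar>t - t'\<bar> < \<epsilon> / (2 * M)" for t t'
    proof (rule mod_norm_leI)
      fix F :: "int set" assume F: "finite F"
      have rd: "represents (\<lambda>x. D k t x - D k t' x) (freq_box \<sigma> k (\<lambda>\<phi>. u t \<phi> - u t' \<phi>))" for k
        unfolding freq_box_diff by (intro represents_diff rep t)
      have 1: "box_norm k (\<lambda>\<phi>. u t \<phi> - u t' \<phi>) \<le> ennreal (\<bar>L k\<bar> * (\<epsilon> / (2 * M)))" for k
        unfolding box_norm_def
      proof (intro Linf_leI[OF rd] AE_I2 ennreal_leI)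
        fix x
        have "norm (D k t x - D k t' x) \<le> L k * \<bar>t - t'\<bar>" by (rule L[OF t(1,2)])
        also have "\<dots> \<le> \<bar>L k\<bar> * \<bar>t - t'\<bar>" by (intro mult_right_mono) auto
        also have "\<dots> \<le> \<bar>L k\<bar> * (\<epsilon> / (2 * M))" using t(3) by (intro mult_left_mono) auto
        finally show "norm (D k t x - D k t' x) \<le> \<bar>L k\<bar> * (\<epsilon> / (2 * M))" .
      qed
      have 2: "box_norm k (\<lambda>\<phi>. u t \<phi> - u t' \<phi>) \<le> ennreal (2 * b k)" for k
        unfolding box_norm_def
      proof (intro Linf_leI[OF rd] AE_I2 ennreal_leI)
        fix x show "norm (D k t x - D k t' x) \<le> 2 * b k"
          using norm_triangle_ineq4[of "D k t x" "D k t' x"] bd[OF t(1), of k x] bd[OF t(2), of k x] by linarith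
      qed
      have "(\<Sum>k\<in>F. box_norm k (\<lambda>\<phi>. u t \<phi> - u t' \<phi>)) =
          (\<Sum>k\<in>F \<inter> K. box_norm k (\<lambda>\<phi>. u t \<phi> - u t' \<phi>)) + (\<Sum>k\<in>F - K. box_norm k (\<lambda>\<phi>. u t \<phi> - u t' \<phi>))"
        by (rule sum.Int_Diff[OF F])
      also have "\<dots> \<le> (\<Sum>k\<in>F \<inter> K. ennreal (\<bar>L k\<bar> * (\<epsilon> / (2 * M)))) + (\<Sum>k\<in>F - K. ennreal (2 * b k))"
        by (intro add_mono sum_mono 1 2)
      also have "\<dots> = ennreal ((\<Sum>k\<in>F \<inter> K. \<bar>L k\<bar> * (\<epsilon> / (2 * M))) + (\<Sum>k\<in>F - K. 2 * b k))"
      proof -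
        have p: "0 \<le> \<bar>L k\<bar> * (\<epsilon> / (2 * M))" "0 \<le> 2 * b k" for k using e M b0 by auto
        show ?thesis using p by (simp only: sum_ennreal ennreal_plus sum_nonneg)
      qed
      also have "\<dots> \<le> ennreal \<epsilon>"
      proof (rule ennreal_leI)
        have "(\<Sum>k\<in>F \<inter> K. \<bar>L k\<bar> * (\<epsilon> / (2 * M))) = (\<Sum>k\<in>F \<inter> K. \<bar>L k\<bar>) * (\<epsilon> / (2 * M))" by (rule sum_distrib_right[symmetric])
        also have "\<dots> \<le> M * (\<epsilon> / (2 * M))"
        proof (rule mult_right_mono)
          have "(\<Sum>k\<in>F \<inter> K. \<bar>L k\<bar>) \<le> (\<Sum>k\<in>K. \<bar>L k\<bar>)" using K(1) by (intro sum_mono2) auto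
          then show "(\<Sum>k\<in>F \<inter> K. \<bar>L k\<bar>) \<le> M" by (simp add: M_def)
        qed (use e M in simp)
        also have "\<dots> = \<epsilon> / 2" using M by simp
        finally have l: "(\<Sum>k\<in>F \<inter> K. \<bar>L k\<bar> * (\<epsilon> / (2 * M))) \<le> \<epsilon> / 2" .
        have "(\<Sum>k\<in>F - K. 2 * b k) = 2 * sum b (F - K)" by (simp add: sum_distrib_left)
        also have "\<dots> \<le> 2 * (\<epsilon> / 4)"
        proof (rule mult_left_mono)
          have "finite (F - K)" "(F - K) \<inter> K = {}" using F by auto
          then show "sum b (F - K) \<le> \<epsilon> / 4" by (rule K(2)[rule_format])
        qed simp
        finally show "(\<Sum>k\<in>F \<inter> K. \<bar>L k\<bar> * (\<epsilon> / (2 * M))) + (\<Sum>k\<in>F - K. 2 * b k) \<le> \<epsilon>" using l by simp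
      qed
      finally show "(\<Sum>k\<in>F. box_norm k (\<lambda>\<phi>. u t \<phi> - u t' \<phi>)) \<le> ennreal \<epsilon>" .
    qed
    moreover have "\<epsilon> / (2 * M) > 0" using e M by simp
    ultimately show ?thesis by blast
  qed
  define m where "m t = enn2real (mod_norm \<sigma> (u t))" for t
  have m: "ennreal (m t) = mod_norm \<sigma> (u t)" if "t \<in> {0..1}" for t
    using mod_space[OF that] by (simp add: m_def mod_space_def)
  have "continuous_on {0..1} m"
    unfolding continuous_on_iff dist_real_def
  proof (intro ballI allI impI)
    fix t \<epsilon> :: real assume t: "t \<in> {0..1}" and e: "\<epsilon> > 0"
    from cont[OF half_gt_zero[OF e]] obtain \<delta> where \<delta>: "\<delta> > 0"
      "\<forall>t\<in>{0..1}. \<forall>t'\<in>{0..1}. \<bar>t - t'\<bar> < \<delta> \<longrightarrow> mod_norm \<sigma> (\<lambda>\<phi>. u t \<phi> - u t' \<phi>) \<le> ennreal (\<epsilon> / 2)" by blast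
    have "\<bar>m t' - m t\<bar> < \<epsilon>" if t': "t' \<in> {0..1}" "\<bar>t' - t\<bar> < \<delta>" for t'
    proof -
      have d: "mod_norm \<sigma> (\<lambda>\<phi>. u t' \<phi> - u t \<phi>) \<le> ennreal (\<epsilon> / 2)" using \<delta>(2) t t' by blast
      note tr = mod_norm_triangle[of "\<lambda>k. D k t'" "u t'" "\<lambda>k. D k t" "u t", OF rep[OF t'(1)] rep[OF t]]
      have "ennreal (m t') \<le> ennreal (m t) + ennreal (\<epsilon> / 2)" "ennreal (m t) \<le> ennreal (m t') + ennreal (\<epsilon> / 2)"
        unfolding m[OF t] m[OF t'(1)] using tr d by (auto intro: order_trans add_left_mono)
      then have "m t' \<le> m t + \<epsilon> / 2" "m t \<le> m t' + \<epsilon> / 2"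
        using e by (auto simp: m_def simp flip: ennreal_plus)
      then show ?thesis using e by linarith
    qed
    with \<delta>(1) show "\<exists>d>0. \<forall>t'\<in>{0..1}. \<bar>t' - t\<bar> < d \<longrightarrow> \<bar>m t' - m t\<bar> < \<epsilon>" by blast
  qed
  then have "m \<in> borel_measurable (lebesgue_on {0..1})"
    by (intro continuous_imp_measurable_on_sets_lebesgue) auto
  then have "(\<lambda>t. ennreal (m t)) \<in> borel_measurable (lebesgue_on {0..1})" by measurable
  then have meas: "(\<lambda>t. mod_norm \<sigma> (u t)) \<in> borel_measurable (lebesgue_on {0..1})"
    by (rule measurable_cong[THEN iffD1, rotated]) (use m in simp)
  show S: "S_norm \<sigma> u \<le> ennreal B"
    unfolding S_norm_def by (rule esssup_I[OF meas]) (use mod in \<open>auto intro!: AE_I2\<close>)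
  \<comment> \<open>Sampling a continuous curve on the grid of mesh \<open>1 / (n + 1)\<close> gives simple functions.\<close>
  define v where "v n t = u (of_int \<lfloor>real (Suc n) * t\<rfloor> / real (Suc n))" for n t
  have fl: "of_int \<lfloor>real (Suc n) * t\<rfloor> / real (Suc n) \<in> {0..1}" "\<bar>of_int \<lfloor>real (Suc n) * t\<rfloor> / real (Suc n) - t\<bar> \<le> 1 / real (Suc n)"
    if t: "t \<in> {0..1}" for n t
  proof -
    define N where "N = real (Suc n)"
    have N: "N > 0" by (simp add: N_def)
    have f: "of_int \<lfloor>N * t\<rfloor> \<le> N * t" "N * t < of_int \<lfloor>N * t\<rfloor> + 1" by linarith+
    have nt: "0 \<le> N * t" "N * t \<le> N * 1" using t N by (auto intro: mult_left_mono)
    then have "0 \<le> \<lfloor>N * t\<rfloor>" by simp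
    then have "0 \<le> real_of_int \<lfloor>N * t\<rfloor>" by simp
    moreover have "real_of_int \<lfloor>N * t\<rfloor> \<le> N" using f(1) nt by linarith
    ultimately show "of_int \<lfloor>real (Suc n) * t\<rfloor> / real (Suc n) \<in> {0..1}"
      unfolding N_def[symmetric] using N by simp
    have "of_int \<lfloor>N * t\<rfloor> / N - t = (of_int \<lfloor>N * t\<rfloor> - N * t) / N" using N by (simp add: field_simps)
    then have "\<bar>of_int \<lfloor>N * t\<rfloor> / N - t\<bar> = \<bar>of_int \<lfloor>N * t\<rfloor> - N * t\<bar> / N" using N by (simp add: abs_divide)
    also have "\<dots> \<le> 1 / N" using f N by (intro divide_right_mono) linarith+
    finally show "\<bar>of_int \<lfloor>real (Suc n) * t\<rfloor> / real (Suc n) - t\<bar> \<le> 1 / real (Suc n)" unfolding N_def .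
  qed
  have simple: "simple_function (lebesgue_on {0..1}) (v n)" for n
  proof -
    have "simple_function (lebesgue_on {0..1}) (\<lambda>t. \<lfloor>real (Suc n) * t\<rfloor>)"
      unfolding simple_function_eq_measurable
    proof
      have "(\<lambda>t. \<lfloor>real (Suc n) * t\<rfloor>) ` {0..1} \<subseteq> {0..int (Suc n)}"
      proof
        fix i assume "i \<in> (\<lambda>t. \<lfloor>real (Suc n) * t\<rfloor>) ` {0..1}"
        then obtain t where t: "t \<in> {0..1}" "i = \<lfloor>real (Suc n) * t\<rfloor>" by blast
        have "0 \<le> real (Suc n) * t" "real (Suc n) * t \<le> real (Suc n) * 1" using t by (auto intro: mult_left_mono)
        then have "0 \<le> real (Suc n) * t" "\<lfloor>real (Suc n) * t\<rfloor> \<le> \<lfloor>real (Suc n) * 1\<rfloor>"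
          by (blast, intro floor_mono)
        then show "i \<in> {0..int (Suc n)}" unfolding t(2) atLeastAtMost_iff zero_le_floor mult_1_right floor_of_nat by blast
      qed
      then show "finite ((\<lambda>t. \<lfloor>real (Suc n) * t\<rfloor>) ` space (lebesgue_on {0..1}))"
        using finite_subset by auto
      have "(\<lambda>t. \<lfloor>real (Suc n) * t\<rfloor>) \<in> measurable borel (count_space UNIV)" by measurable
      then show "(\<lambda>t. \<lfloor>real (Suc n) * t\<rfloor>) \<in> measurable (lebesgue_on {0..1}) (count_space UNIV)"
        by (intro measurable_restrict_space1 measurable_completion) simp
    qed
    from simple_function_compose[OF this, of "\<lambda>i. u (of_int i / real (Suc n))"]
    show ?thesis by (simp add: v_def[abs_def] o_def)
  qed
  have "strongly_measurable \<sigma> u"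
    unfolding strongly_measurable_def
  proof (intro exI[of _ v] conjI allI)
    show "v n ` {0..1} \<subseteq> mod_space \<sigma>" for n using fl mod_space by (auto simp: v_def)
    show "simple_function (lebesgue_on {0..1}) (v n)" for n by (rule simple)
    show "AE t in lebesgue_on {0..1}. (\<lambda>n. mod_norm \<sigma> (\<lambda>\<phi>. v n t \<phi> - u t \<phi>)) \<longlonglongrightarrow> 0"
    proof (intro AE_I2 tendsto_ennreal_0I)
      fix t \<epsilon> :: real assume "t \<in> space (lebesgue_on {0..1})" and e: "\<epsilon> > 0"
      then have t: "t \<in> {0..1}" by simp
      from cont[OF e] obtain \<delta> where \<delta>: "\<delta> > 0"
        "\<forall>t\<in>{0..1}. \<forall>t'\<in>{0..1}. \<bar>t - t'\<bar> < \<delta> \<longrightarrow> mod_norm \<sigma> (\<lambda>\<phi>. u t \<phi> - u t' \<phi>) \<le> ennreal \<epsilon>" by blast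
      have "eventually (\<lambda>n. 1 / real (Suc n) < \<delta>) sequentially"
        using order_tendstoD(2)[OF LIMSEQ_Suc[OF lim_1_over_n] \<delta>(1)] by simp
      then show "\<forall>\<^sub>F n in sequentially. mod_norm \<sigma> (\<lambda>\<phi>. v n t \<phi> - u t \<phi>) \<le> ennreal \<epsilon>"
      proof eventually_elim
        case (elim n)
        have "\<bar>of_int \<lfloor>real (Suc n) * t\<rfloor> / real (Suc n) - t\<bar> < \<delta>" using fl(2)[OF t, of n] elim by linarith
        then show ?case unfolding v_def using \<delta>(2) fl(1)[OF t] t by blast
      qed
    qed
  qed
  then show "u \<in> S_space \<sigma>"
    using mod_space S by (auto simp: S_space_def intro: le_less_trans)
qed

text \<open>A sum of suprema is bounded if all sums with separately chosen arguments are.\<close>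

lemma sum_sup_le:
  fixes F :: "'k \<Rightarrow> 'i \<Rightarrow> real"
  assumes K: "finite K" and ne: "I \<noteq> {}"
    and bd: "\<And>k. bdd_above (F k ` I)"
    and le: "\<And>c. (\<And>k. c k \<in> I) \<Longrightarrow> (\<Sum>k\<in>K. F k (c k)) \<le> B"
  shows "(\<Sum>k\<in>K. SUP i\<in>I. F k i) \<le> B"
proof (rule field_le_epsilon)
  fix e :: real assume e: "e > 0"
  define d where "d = e / (real (card K) + 1)"
  have d: "d > 0" using e by (simp add: d_def)
  have "\<exists>i\<in>I. (SUP i\<in>I. F k i) - d < F k i" for k
  proof -
    have "(SUP i\<in>I. F k i) - d < (SUP i\<in>I. F k i)" using d by simp
    then show ?thesis using less_cSUP_iff[OF ne bd] by blast
  qed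
  then obtain c where c: "\<And>k. c k \<in> I" "\<And>k. (SUP i\<in>I. F k i) - d < F k (c k)" by metis
  have "(\<Sum>k\<in>K. SUP i\<in>I. F k i) \<le> (\<Sum>k\<in>K. F k (c k) + d)"
  proof (rule sum_mono)
    fix k show "(SUP i\<in>I. F k i) \<le> F k (c k) + d" using c(2)[of k] by linarith
  qed
  also have "\<dots> = (\<Sum>k\<in>K. F k (c k)) + real (card K) * d" by (simp add: sum.distrib)
  also have "\<dots> \<le> B + e"
  proof (rule add_mono[OF le[OF c(1)]])
    have "real (card K) * d \<le> (real (card K) + 1) * d" using d by (intro mult_right_mono) auto
    also have "\<dots> = e" by (simp add: d_def)
    finally show "real (card K) * d \<le> e" .
  qed
  finally show "(\<Sum>k\<in>K. SUP i\<in>I. F k i) \<le> B + e" .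
qed

lemma conv_kernel_lipschitz:
  "\<exists>L\<ge>0. \<forall>g B. loc_bounded g B \<longrightarrow> (\<forall>t\<in>{-1..1}. \<forall>t'\<in>{-1..1}. \<forall>x. norm (conv g (box_kernel s k t) x - conv g (box_kernel s k t') x) \<le> L * \<bar>t - t'\<bar> * B)"
proof -
  from box_kernel_lipschitz[of s k] obtain C where C: "C \<ge> 0"
    "\<forall>t t' x. t \<in> {-1..1} \<longrightarrow> t' \<in> {-1..1} \<longrightarrow> norm (box_kernel s k t x - box_kernel s k t' x) \<le> C * \<bar>t - t'\<bar> * (1 / (1 + x\<^sup>2))"
    by blast
  have "norm (conv g (box_kernel s k t) x - conv g (box_kernel s k t') x) \<le> C * \<bar>t - t'\<bar> * B"
    if g: "loc_bounded g B" and t: "t \<in> {-1..1}" "t' \<in> {-1..1}" for g B t t' x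
  proof -
    let ?K = "\<lambda>z. box_kernel s k t z - box_kernel s k t' z"
    have m: "?K \<in> borel_measurable borel"
      using schwartz_measurable[OF schwartz_box_kernel[OF t(1), of s k]] schwartz_measurable[OF schwartz_box_kernel[OF t(2), of s k]] by simp
    have i: "integrable lborel (\<lambda>y. g y * box_kernel s k t (x - y))" if "t \<in> {-1..1}" for t
      by (rule conv_bound(1)[OF g schwartz_measurable schwartz_kernel_bound]) (intro schwartz_box_kernel that)+
    have "conv g (box_kernel s k t) x - conv g (box_kernel s k t') x = conv g ?K x"
      unfolding conv_def using Bochner_Integration.integral_diff[OF i[OF t(1)] i[OF t(2)]] by (simp add: right_diff_distrib)
    also have "norm \<dots> \<le> (C * \<bar>t - t'\<bar>) * B"
      by (rule conv_bound(2)[OF g m, where a = 0]) (use C t in auto)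
    finally show ?thesis .
  qed
  with C(1) show ?thesis by blast
qed

proposition free_evolution_bound:
  assumes p: "2 \<le> p" and s: "1 - 1 / p < ereal s"
  shows "\<exists>C\<ge>0. \<forall>f\<in>bessel_space p s. free_evolution f \<in> S_space \<sigma> \<and>
    S_norm \<sigma> (free_evolution f) \<le> ennreal C * bessel_norm p s f"
proof -
  from sum_conv_Lp[OF p s] obtain C where C0: "C \<ge> 0" and
    C: "\<forall>g G K t x. Lp_le p g G \<longrightarrow> G > 0 \<longrightarrow> finite K \<longrightarrow> (\<forall>k\<in>K. t k \<in> {-1..1}) \<longrightarrow>
    (\<Sum>k\<in>K. norm (conv g (box_kernel s k (t k)) (x k))) \<le> C * G" by blast
  have p1: "1 \<le> p" using p by (rule order_trans[rotated]) simp
  have main: "free_evolution f \<in> S_space \<sigma> \<and> S_norm \<sigma> (free_evolution f) \<le> ennreal C * bessel_norm p s f"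
    if f: "f \<in> bessel_space p s" for f
  proof -
    let ?T = "fourier_multiplier (\<lambda>\<xi>. complex_of_real ((1 + \<xi>\<^sup>2) powr (s / 2))) f"
    have fT: "f \<in> tempered" and fin: "Lp_norm p ?T < \<infinity>" using f by (auto simp: bessel_space_def bessel_norm_def)
    define g where "g = density_of ?T"
    have r: "represents g ?T" unfolding g_def by (rule Linf_finite_represents[OF fin])
    have n: "bessel_norm p s f = Lp_norm_fun p g" unfolding bessel_norm_def by (rule Lp_norm_eq[OF r])
    define N where "N = enn2real (Lp_norm_fun p g)"
    have N: "Lp_norm_fun p g = ennreal N" "Lp_norm_fun p g \<noteq> \<infinity>"
      using fin unfolding Lp_norm_eq[OF r] by (auto simp: N_def less_top)
    \<comment> \<open>A strict bound \<open>G > N\<close> is positive even if the norm \<open>N\<close> vanishes; in the end \<open>G\<close> tends to \<open>N\<close>.\<close>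
    have *: "free_evolution f \<in> S_space \<sigma> \<and> S_norm \<sigma> (free_evolution f) \<le> ennreal (C * G)" if G: "G > N" for G
    proof -
      have G0: "G > 0" using G by (simp add: N_def le_less_trans[OF enn2real_nonneg])
      have gL: "Lp_le p g G" by (rule Lp_le_of_norm[OF represents_measurable[OF r] p1 N(2) G[unfolded N_def]])
      from Lp_le_loc_bounded[OF gL p1] obtain B where B: "loc_bounded g B" by blast
      let ?F = "\<lambda>k (t, x). norm (conv g (box_kernel s k t) x)"
      let ?I = "{-1..1::real} \<times> (UNIV :: real set)"
      define b where "b k = (SUP i\<in>?I. ?F k i)" for k
      have ne: "?I \<noteq> {}" by auto
      have sing: "norm (conv g (box_kernel s k t) x) \<le> C * G" if "t \<in> {-1..1}" for k t x
        using C[rule_format, OF gL G0, of "{k}" "\<lambda>_. t" "\<lambda>_. x"] that by simp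
      have bdd: "bdd_above (?F k ` ?I)" for k using sing by (intro bdd_aboveI[of _ "C * G"]) auto
      show ?thesis
      proof (rule conjI)
        have T: "free_evolution f t \<in> tempered" if "t \<in> {0..1}" for t
        proof -
          have "slow_family {phase t}" using that by (intro slow_family_phase1) auto
          then show ?thesis unfolding free_evolution_def schroedinger_def phase_def[abs_def, symmetric]
            by (intro tempered_fourier_multiplier fT) (simp add: phase_def[abs_def])
        qed
        have rep: "represents (conv g (box_kernel s k t)) (freq_box \<sigma> k (free_evolution f t))" if "t \<in> {0..1}" for k t
          unfolding free_evolution_def using that by (intro free_box_represents[OF B r]) auto
        have bd: "norm (conv g (box_kernel s k t) x) \<le> b k" if "t \<in> {0..1}" for k t x
        proof -
          have "(t, x) \<in> ?I" using that by auto
          from cSUP_upper[OF this bdd[of k]] show ?thesis by (simp add: b_def)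
        qed
        have sb: "sum b K \<le> C * G" if K: "finite K" for K
          unfolding b_def
        proof (rule sum_sup_le[OF K ne bdd])
          fix c :: "int \<Rightarrow> real \<times> real" assume c: "\<And>k. c k \<in> ?I"
          have "\<forall>k\<in>K. fst (c k) \<in> {-1..1}" using c by (metis mem_Times_iff)
          from C[rule_format, OF gL G0 K, of "\<lambda>k. fst (c k)" "\<lambda>k. snd (c k)"] this
          show "(\<Sum>k\<in>K. case c k of (t, x) \<Rightarrow> norm (conv g (box_kernel s k t) x)) \<le> C * G"
            by (simp add: case_prod_beta)
        qed
        have lip: "\<exists>L. \<forall>t\<in>{0..1}. \<forall>t'\<in>{0..1}. \<forall>x. norm (conv g (box_kernel s k t) x - conv g (box_kernel s k t') x) \<le> L * \<bar>t - t'\<bar>" for k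
        proof -
          from conv_kernel_lipschitz[of s k] B obtain L where
            L: "\<forall>t\<in>{-1..1}. \<forall>t'\<in>{-1..1}. \<forall>x. norm (conv g (box_kernel s k t) x - conv g (box_kernel s k t') x) \<le> L * \<bar>t - t'\<bar> * B" by blast
          show ?thesis
          proof (intro exI[of _ "L * B"] ballI allI)
            fix t t' x :: real assume "t \<in> {0..1}" "t' \<in> {0..1}"
            then have "t \<in> {-1..1}" "t' \<in> {-1..1}" by auto
            from L[rule_format, OF this, of x]
            show "norm (conv g (box_kernel s k t) x - conv g (box_kernel s k t') x) \<le> L * B * \<bar>t - t'\<bar>" by (simp only: mult_ac)
          qed
        qed
        show "free_evolution f \<in> S_space \<sigma>" by (rule S_spaceI(1)[OF T rep bd sb lip])
        show "S_norm \<sigma> (free_evolution f) \<le> ennreal (C * G)" by (rule S_spaceI(2)[OF T rep bd sb lip])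
      qed
    qed
    have "(\<lambda>n. ennreal (C * (N + 1 / real (Suc n)))) \<longlonglongrightarrow> ennreal (C * (N + 0))"
      by (intro tendsto_ennrealI tendsto_mult tendsto_add tendsto_const LIMSEQ_Suc[OF lim_1_over_n])
    then have "S_norm \<sigma> (free_evolution f) \<le> ennreal (C * (N + 0))"
      by (rule LIMSEQ_le_const) (use * in \<open>auto intro!: exI[of _ 0]\<close>)
    also have "\<dots> = ennreal C * bessel_norm p s f" unfolding n N(1) using C0 by (simp add: ennreal_mult N_def)
    finally show ?thesis using *[of "N + 1"] by simp
  qed
  with C0 show ?thesis by blast
qed

end

section \<open>Measurability in time of cubic expressions\<close>

text \<open>Limits that exist only almost everywhere are measurable, because the Lebesgue measure is complete.\<close>

lemma borel_measurable_AE_limit: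
  fixes f :: "nat \<Rightarrow> real \<Rightarrow> 'b::{banach, second_countable_topology}"
  assumes S: "S \<in> sets lebesgue" and f: "\<And>n. f n \<in> borel_measurable (lebesgue_on S)"
    and lim: "AE x in lebesgue_on S. (\<lambda>n. f n x) \<longlonglongrightarrow> g x"
  shows "g \<in> borel_measurable (lebesgue_on S)"
proof -
  let ?M = "lebesgue_on S"
  define h where "h x = lim (\<lambda>n. f n x)" for x
  have h: "h \<in> borel_measurable ?M" unfolding h_def[abs_def] using f by (rule borel_measurable_lim_metric)
  have "AE x in ?M. h x = g x" using lim by eventually_elim (simp add: h_def limI)
  then obtain Z where Z: "{x \<in> space ?M. h x \<noteq> g x} \<subseteq> Z" "emeasure ?M Z = 0" "Z \<in> sets ?M"
    by (rule AE_E)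
  have SS: "S \<inter> space lebesgue \<in> sets lebesgue" using S by simp
  have "Z \<in> null_sets ?M" using Z by (intro null_setsI)
  then have Z': "Z \<subseteq> S" "Z \<in> null_sets lebesgue" using null_sets_restrict_space[OF S] by auto
  have sub: "A \<in> sets ?M" if "A \<subseteq> Z" for A
  proof -
    have "A \<in> sets lebesgue" using completion.complete[OF that Z'(2)] .
    then show ?thesis using that Z'(1) sets_restrict_space_iff[OF SS, of A] by auto
  qed
  show ?thesis
  proof (rule measurableI)
    fix A :: "'b set" assume A: "A \<in> sets borel"
    have "g -` A \<inter> space ?M = (h -` A \<inter> space ?M - Z) \<union> (g -` A \<inter> space ?M \<inter> Z)"
      using Z(1) by auto
    also have "\<dots> \<in> sets ?M"
      using measurable_sets[OF h A] Z(3) sub[of "g -` A \<inter> space ?M \<inter> Z"] by auto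
    finally show "g -` A \<inter> space ?M \<in> sets ?M" .
  qed simp
qed

context freq_partition
begin

lemma mod_norm_diff_AE:
  assumes w: "w \<in> mod_space \<sigma>" and u: "u \<in> mod_space \<sigma>" and fin: "mod_norm \<sigma> (\<lambda>\<phi>. w \<phi> - u \<phi>) < \<infinity>"
  shows "AE x in lborel. norm (density_of w x - density_of u x) \<le> enn2real (mod_norm \<sigma> (\<lambda>\<phi>. w \<phi> - u \<phi>))"
proof -
  have "(\<lambda>\<phi>. w \<phi> - u \<phi>) \<in> tempered" using w u by (intro tempered_diff) (auto simp: mod_space_def)
  from represents_mod_norm_AE[OF this represents_diff[OF mod_space_represents(1)[OF w] mod_space_represents(1)[OF u]]]
  have "AE x in lborel. ennreal (norm (density_of w x - density_of u x)) \<le> ennreal (enn2real (mod_norm \<sigma> (\<lambda>\<phi>. w \<phi> - u \<phi>)))"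
    using fin by simp
  then show ?thesis by eventually_elim simp
qed

text \<open>The difference of two cubic terms is written as a telescoping sum with one difference in each
summand.\<close>

lemma cubic_diff_integral:
  assumes w: "w1 \<in> mod_space \<sigma>" "w2 \<in> mod_space \<sigma>" "w3 \<in> mod_space \<sigma>"
    and u: "u1 \<in> mod_space \<sigma>" "u2 \<in> mod_space \<sigma>" "u3 \<in> mod_space \<sigma>"
    and fin: "mod_norm \<sigma> (\<lambda>\<phi>. w1 \<phi> - u1 \<phi>) < \<infinity>" "mod_norm \<sigma> (\<lambda>\<phi>. w2 \<phi> - u2 \<phi>) < \<infinity>" "mod_norm \<sigma> (\<lambda>\<phi>. w3 \<phi> - u3 \<phi>) < \<infinity>"
    and p: "\<psi> \<in> schwartz"
  defines "d1 \<equiv> enn2real (mod_norm \<sigma> (\<lambda>\<phi>. w1 \<phi> - u1 \<phi>))" and "d2 \<equiv> enn2real (mod_norm \<sigma> (\<lambda>\<phi>. w2 \<phi> - u2 \<phi>))"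
    and "d3 \<equiv> enn2real (mod_norm \<sigma> (\<lambda>\<phi>. w3 \<phi> - u3 \<phi>))"
    and "U1 \<equiv> enn2real (mod_norm \<sigma> u1)" and "U2 \<equiv> enn2real (mod_norm \<sigma> u2)" and "U3 \<equiv> enn2real (mod_norm \<sigma> u3)"
  shows "norm ((LBINT y. cubic w1 w2 w3 y * \<psi> y) - (LBINT y. cubic u1 u2 u3 y * \<psi> y)) \<le>
     (d1 * (U2 + d2) * (U3 + d3) + U1 * d2 * (U3 + d3) + U1 * U2 * d3) * (LBINT y. norm (\<psi> y))"
proof -
  note cw = cubic_bounded[OF w] and cu = cubic_bounded[OF u]
  note pi = schwartz_integrable[OF p]
  have i: "integrable lborel (\<lambda>y. cubic w1 w2 w3 y * \<psi> y)" "integrable lborel (\<lambda>y. cubic u1 u2 u3 y * \<psi> y)"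
    by (rule integrable_bounded_mult(1)[OF cw pi], rule integrable_bounded_mult(1)[OF cu pi])
  have e: "(LBINT y. cubic w1 w2 w3 y * \<psi> y) - (LBINT y. cubic u1 u2 u3 y * \<psi> y) = (LBINT y. (cubic w1 w2 w3 y - cubic u1 u2 u3 y) * \<psi> y)"
    using Bochner_Integration.integral_diff[OF i] by (simp add: left_diff_distrib)
  have nn: "d1 \<ge> 0" "d2 \<ge> 0" "d3 \<ge> 0" "U1 \<ge> 0" "U2 \<ge> 0" "U3 \<ge> 0"
    by (simp_all add: d1_def d2_def d3_def U1_def U2_def U3_def)
  have m: "(\<lambda>y. cubic w1 w2 w3 y - cubic u1 u2 u3 y) \<in> borel_measurable borel" using cw(1) cu(1) by simp
  have b: "AE y in lborel. norm (cubic w1 w2 w3 y - cubic u1 u2 u3 y) \<le> d1 * (U2 + d2) * (U3 + d3) + U1 * d2 * (U3 + d3) + U1 * U2 * d3"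
    using mod_norm_diff_AE[OF w(1) u(1) fin(1)] mod_norm_diff_AE[OF w(2) u(2) fin(2)] mod_norm_diff_AE[OF w(3) u(3) fin(3)]
      mod_space_boxes(8)[OF u(1)] mod_space_boxes(8)[OF u(2)] mod_space_boxes(8)[OF u(3)]
  proof eventually_elim
    case (elim y)
    define a1 a2 a3 b1 b2 b3 where ab: "a1 = density_of w1 y" "a2 = density_of w2 y" "a3 = density_of w3 y"
      "b1 = density_of u1 y" "b2 = density_of u2 y" "b3 = density_of u3 y"
    have n: "norm (a1 - b1) \<le> d1" "norm (a2 - b2) \<le> d2" "norm (a3 - b3) \<le> d3" "norm b1 \<le> U1" "norm b2 \<le> U2" "norm b3 \<le> U3"
      using elim by (simp_all add: ab d1_def d2_def d3_def U1_def U2_def U3_def)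
    have n2: "norm a2 \<le> U2 + d2" "norm a3 \<le> U3 + d3"
      using norm_triangle_ineq[of b2 "a2 - b2"] norm_triangle_ineq[of b3 "a3 - b3"] n by auto
    have c: "norm (cnj a2 - cnj b2) \<le> d2" using n(2) by (simp flip: complex_cnj_diff)
    have "a1 * cnj a2 * a3 - b1 * cnj b2 * b3 = (a1 - b1) * cnj a2 * a3 + b1 * (cnj a2 - cnj b2) * a3 + b1 * cnj b2 * (a3 - b3)"
      by (simp add: algebra_simps)
    also have "norm \<dots> \<le> norm ((a1 - b1) * cnj a2 * a3) + norm (b1 * (cnj a2 - cnj b2) * a3) + norm (b1 * cnj b2 * (a3 - b3))"
      by (intro norm_triangle_le add_right_mono norm_triangle_ineq)
    also have "\<dots> \<le> d1 * (U2 + d2) * (U3 + d3) + U1 * d2 * (U3 + d3) + U1 * U2 * d3"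
      unfolding norm_mult complex_mod_cnj using n n2 c nn by (intro add_mono mult_mono) auto
    finally show ?case unfolding cubic_def ab .
  qed
  show ?thesis unfolding e by (rule integrable_bounded_mult(2)[OF m b pi])
qed

lemma cubic_integral_tendsto:
  assumes w: "\<And>n. w1 n \<in> mod_space \<sigma>" "\<And>n. w2 n \<in> mod_space \<sigma>" "\<And>n. w3 n \<in> mod_space \<sigma>"
    and u: "u1 \<in> mod_space \<sigma>" "u2 \<in> mod_space \<sigma>" "u3 \<in> mod_space \<sigma>"
    and lim: "(\<lambda>n. mod_norm \<sigma> (\<lambda>\<phi>. w1 n \<phi> - u1 \<phi>)) \<longlonglongrightarrow> 0" "(\<lambda>n. mod_norm \<sigma> (\<lambda>\<phi>. w2 n \<phi> - u2 \<phi>)) \<longlonglongrightarrow> 0"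
      "(\<lambda>n. mod_norm \<sigma> (\<lambda>\<phi>. w3 n \<phi> - u3 \<phi>)) \<longlonglongrightarrow> 0"
    and p: "\<psi> \<in> schwartz"
  shows "(\<lambda>n. LBINT y. cubic (w1 n) (w2 n) (w3 n) y * \<psi> y) \<longlonglongrightarrow> (LBINT y. cubic u1 u2 u3 y * \<psi> y)"
proof -
  let ?d1 = "\<lambda>n. enn2real (mod_norm \<sigma> (\<lambda>\<phi>. w1 n \<phi> - u1 \<phi>))" and ?d2 = "\<lambda>n. enn2real (mod_norm \<sigma> (\<lambda>\<phi>. w2 n \<phi> - u2 \<phi>))"
    and ?d3 = "\<lambda>n. enn2real (mod_norm \<sigma> (\<lambda>\<phi>. w3 n \<phi> - u3 \<phi>))"
  let ?U1 = "enn2real (mod_norm \<sigma> u1)" and ?U2 = "enn2real (mod_norm \<sigma> u2)" and ?U3 = "enn2real (mod_norm \<sigma> u3)"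
  let ?B = "\<lambda>n. (?d1 n * (?U2 + ?d2 n) * (?U3 + ?d3 n) + ?U1 * ?d2 n * (?U3 + ?d3 n) + ?U1 * ?U2 * ?d3 n) * (LBINT y. norm (\<psi> y))"
  have d: "?d1 \<longlonglongrightarrow> 0" "?d2 \<longlonglongrightarrow> 0" "?d3 \<longlonglongrightarrow> 0" using lim by (auto intro!: tendsto_enn2real)
  have "?B \<longlonglongrightarrow> (0 * (?U2 + 0) * (?U3 + 0) + ?U1 * 0 * (?U3 + 0) + ?U1 * ?U2 * 0) * (LBINT y. norm (\<psi> y))"
    by (intro tendsto_mult tendsto_add tendsto_const d)
  then have B: "?B \<longlonglongrightarrow> 0" by simp
  have fin: "\<forall>\<^sub>F n in sequentially. X n < \<infinity>" if "X \<longlonglongrightarrow> 0" for X :: "nat \<Rightarrow> ennreal"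
    using order_tendstoD(2)[OF that, of \<infinity>] by simp
  have "\<forall>\<^sub>F n in sequentially. norm ((LBINT y. cubic (w1 n) (w2 n) (w3 n) y * \<psi> y) - (LBINT y. cubic u1 u2 u3 y * \<psi> y)) \<le> ?B n"
    using fin[OF lim(1)] fin[OF lim(2)] fin[OF lim(3)]
    by eventually_elim (rule cubic_diff_integral[OF w u _ _ _ p])
  then have "(\<lambda>n. (LBINT y. cubic (w1 n) (w2 n) (w3 n) y * \<psi> y) - (LBINT y. cubic u1 u2 u3 y * \<psi> y)) \<longlonglongrightarrow> 0"
    by (rule Lim_null_comparison[OF _ B])
  then show ?thesis by (rule LIM_zero_cancel)
qed

text \<open>The simple function takes values in a space without a useful measurable structure; only the
finitely many values matter.\<close>

lemma simple_compose_measurable: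
  assumes s: "simple_function (lebesgue_on {0..1}) v" and v: "v ` {0..1} \<subseteq> A"
    and f: "\<And>a. a \<in> A \<Longrightarrow> f a \<in> borel_measurable (lebesgue_on {0..1})"
  shows "(\<lambda>\<tau>. f (v \<tau>) \<tau> :: complex) \<in> borel_measurable (lebesgue_on {0..1})"
proof (rule measurable_compose_countable'[where I = "v ` {0..1}"])
  show "(\<lambda>\<tau>. f a \<tau>) \<in> borel_measurable (lebesgue_on {0..1})" if "a \<in> v ` {0..1}" for a using f that v by blast
  show "v \<in> measurable (lebesgue_on {0..1}) (count_space (v ` {0..1}))"
  proof (rule measurableI)
    fix B assume "B \<in> sets (count_space (v ` {0..1}))"
    have "v -` B \<inter> space (lebesgue_on {0..1}) \<in> sets (lebesgue_on {0..1})"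
      by (rule measurable_sets[OF measurable_simple_function[OF s]]) simp
    then show "v -` B \<inter> space (lebesgue_on {0..1}) \<in> sets (lebesgue_on {0..1})" .
  qed simp
  show "countable (v ` {0..1})" using s by (auto simp: simple_function_def intro: countable_finite)
qed

text \<open>For constant curves the integral is Lipschitz in \<open>\<tau>\<close>; this extends to simple curves by
\<open>simple_compose_measurable\<close> and to strongly measurable ones by \<open>cubic_integral_tendsto\<close>.\<close>

lemma cubic_integral_measurable:
  assumes u: "u1 \<in> S_space \<sigma>" "u2 \<in> S_space \<sigma>" "u3 \<in> S_space \<sigma>"
    and p: "\<And>\<tau>. \<tau> \<in> {0..1} \<Longrightarrow> \<Phi> \<tau> \<in> schwartz"
    and L: "\<And>\<tau> \<tau>'. \<tau> \<in> {0..1} \<Longrightarrow> \<tau>' \<in> {0..1} \<Longrightarrow> (LBINT y. norm (\<Phi> \<tau> y - \<Phi> \<tau>' y)) \<le> L * \<bar>\<tau> - \<tau>'\<bar>"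
  shows "(\<lambda>\<tau>. LBINT y. cubic (u1 \<tau>) (u2 \<tau>) (u3 \<tau>) y * \<Phi> \<tau> y) \<in> borel_measurable (lebesgue_on {0..1})"
proof -
  let ?M = "lebesgue_on {0..1::real}"
  have L0: "L \<ge> 0"
  proof -
    have "0 \<le> (LBINT y. norm (\<Phi> 0 y - \<Phi> 1 y))" by (rule Bochner_Integration.integral_nonneg) (rule norm_ge_zero)
    also have "\<dots> \<le> L * \<bar>0 - 1\<bar>" by (rule L) auto
    finally show ?thesis by simp
  qed
  obtain v1 where
    v1: "\<And>n. simple_function ?M (v1 n)" "\<And>n. v1 n ` {0..1} \<subseteq> mod_space \<sigma>" "AE t in ?M. (\<lambda>n. mod_norm \<sigma> (\<lambda>\<phi>. v1 n t \<phi> - u1 t \<phi>)) \<longlonglongrightarrow> 0"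
    using u(1) unfolding S_space_def strongly_measurable_def by blast
  obtain v2 where
    v2: "\<And>n. simple_function ?M (v2 n)" "\<And>n. v2 n ` {0..1} \<subseteq> mod_space \<sigma>" "AE t in ?M. (\<lambda>n. mod_norm \<sigma> (\<lambda>\<phi>. v2 n t \<phi> - u2 t \<phi>)) \<longlonglongrightarrow> 0"
    using u(2) unfolding S_space_def strongly_measurable_def by blast
  obtain v3 where
    v3: "\<And>n. simple_function ?M (v3 n)" "\<And>n. v3 n ` {0..1} \<subseteq> mod_space \<sigma>" "AE t in ?M. (\<lambda>n. mod_norm \<sigma> (\<lambda>\<phi>. v3 n t \<phi> - u3 t \<phi>)) \<longlonglongrightarrow> 0"
    using u(3) unfolding S_space_def strongly_measurable_def by blast
  have um: "u1 \<tau> \<in> mod_space \<sigma>" "u2 \<tau> \<in> mod_space \<sigma>" "u3 \<tau> \<in> mod_space \<sigma>" if "\<tau> \<in> {0..1}" for \<tau>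
    using u that unfolding S_space_def by blast+
  define c where "c w \<tau> = (LBINT y. cubic (fst w) (fst (snd w)) (snd (snd w)) y * \<Phi> \<tau> y)" for w \<tau>
  have cm: "c w \<in> borel_measurable ?M" if w: "w \<in> mod_space \<sigma> \<times> mod_space \<sigma> \<times> mod_space \<sigma>" for w
  proof -
    from w have ws: "fst w \<in> mod_space \<sigma>" "fst (snd w) \<in> mod_space \<sigma>" "snd (snd w) \<in> mod_space \<sigma>" by auto
    note cb = cubic_bounded[OF ws]
    let ?N = "enn2real (mod_norm \<sigma> (fst w)) * enn2real (mod_norm \<sigma> (fst (snd w))) * enn2real (mod_norm \<sigma> (snd (snd w)))"
    have N0: "?N \<ge> 0" by simp
    have lip: "norm (c w \<tau> - c w \<tau>') \<le> (?N * L) * \<bar>\<tau> - \<tau>'\<bar>" if t: "\<tau> \<in> {0..1}" "\<tau>' \<in> {0..1}" for \<tau> \<tau>'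
    proof -
      have i: "integrable lborel (\<lambda>y. cubic (fst w) (fst (snd w)) (snd (snd w)) y * \<Phi> \<tau> y)" if "\<tau> \<in> {0..1}" for \<tau>
        by (rule integrable_bounded_mult(1)[OF cb schwartz_integrable[OF p[OF that]]])
      have "c w \<tau> - c w \<tau>' = (LBINT y. cubic (fst w) (fst (snd w)) (snd (snd w)) y * (\<Phi> \<tau> y - \<Phi> \<tau>' y))"
        unfolding c_def using Bochner_Integration.integral_diff[OF i[OF t(1)] i[OF t(2)]] by (simp add: right_diff_distrib)
      also have "norm \<dots> \<le> ?N * (LBINT y. norm (\<Phi> \<tau> y - \<Phi> \<tau>' y))"
        by (intro integrable_bounded_mult(2)[OF cb] Bochner_Integration.integrable_diff schwartz_integrable p t)
      also have "\<dots> \<le> ?N * (L * \<bar>\<tau> - \<tau>'\<bar>)" by (intro mult_left_mono L t N0)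
      finally show ?thesis by (simp only: mult.assoc)
    qed
    have "(?N * L)-lipschitz_on {0..1} (c w)"
      by (rule lipschitz_onI) (use lip N0 L0 in \<open>auto simp: dist_norm\<close>)
    then have "continuous_on {0..1} (c w)" by (rule lipschitz_on_continuous_on)
    then show ?thesis by (intro continuous_imp_measurable_on_sets_lebesgue) auto
  qed
  show ?thesis
  proof (rule borel_measurable_AE_limit)
    show "(\<lambda>\<tau>. c (v1 n \<tau>, v2 n \<tau>, v3 n \<tau>) \<tau>) \<in> borel_measurable ?M" for n
    proof (rule simple_compose_measurable[where f = c])
      show "simple_function ?M (\<lambda>\<tau>. (v1 n \<tau>, v2 n \<tau>, v3 n \<tau>))" using v1(1) v2(1) v3(1) by (intro simple_function_Pair)
      show "(\<lambda>\<tau>. (v1 n \<tau>, v2 n \<tau>, v3 n \<tau>)) ` {0..1} \<subseteq> mod_space \<sigma> \<times> mod_space \<sigma> \<times> mod_space \<sigma>"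
        using v1(2)[of n] v2(2)[of n] v3(2)[of n] by (intro image_subsetI) (simp add: image_subset_iff)
    qed (rule cm)
    have sp: "AE \<tau> in ?M. \<tau> \<in> {0..1}" by (rule AE_I2) simp
    show "AE \<tau> in ?M. (\<lambda>n. c (v1 n \<tau>, v2 n \<tau>, v3 n \<tau>) \<tau>) \<longlonglongrightarrow> (LBINT y. cubic (u1 \<tau>) (u2 \<tau>) (u3 \<tau>) y * \<Phi> \<tau> y)"
      using v1(3) v2(3) v3(3) sp
    proof eventually_elim
      case (elim \<tau>)
      have "v1 n \<tau> \<in> mod_space \<sigma>" "v2 n \<tau> \<in> mod_space \<sigma>" "v3 n \<tau> \<in> mod_space \<sigma>" for n
        using v1(2)[of n] v2(2)[of n] v3(2)[of n] elim(4) by (simp_all add: image_subset_iff)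
      then show ?case unfolding c_def fst_conv snd_conv
        by (intro cubic_integral_tendsto um elim p)
    qed
  qed simp
qed

lemma box_norm_measurable:
  assumes u: "u \<in> S_space \<sigma>"
  shows "(\<lambda>\<tau>. box_norm k (u \<tau>)) \<in> borel_measurable (lebesgue_on {0..1})"
proof -
  let ?M = "lebesgue_on {0..1::real}"
  from u obtain v where v: "\<And>n. simple_function ?M (v n)" "\<And>n. v n ` {0..1} \<subseteq> mod_space \<sigma>"
    "AE t in ?M. (\<lambda>n. mod_norm \<sigma> (\<lambda>\<phi>. v n t \<phi> - u t \<phi>)) \<longlonglongrightarrow> 0"
    unfolding S_space_def strongly_measurable_def by blast
  have um: "u \<tau> \<in> mod_space \<sigma>" if "\<tau> \<in> {0..1}" for \<tau> using u that unfolding S_space_def by blast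
  let ?r = "\<lambda>w. enn2real (box_norm k w)"
  have fin: "ennreal (?r w) = box_norm k w" if "w \<in> mod_space \<sigma>" for w
    by (rule mod_space_boxes(5)[OF that])
  have rm: "(\<lambda>\<tau>. ?r (u \<tau>)) \<in> borel_measurable ?M"
  proof (rule borel_measurable_AE_limit)
    show "(\<lambda>\<tau>. ?r (v n \<tau>)) \<in> borel_measurable ?M" for n
      using borel_measurable_simple_function[OF simple_function_compose[OF v(1), of ?r n]] by (simp add: o_def)
    have sp: "AE \<tau> in ?M. \<tau> \<in> {0..1}" by (rule AE_I2) simp
    show "AE \<tau> in ?M. (\<lambda>n. ?r (v n \<tau>)) \<longlonglongrightarrow> ?r (u \<tau>)"
      using v(3) sp
    proof eventually_elim
      case (elim \<tau>)
      let ?d = "\<lambda>n. mod_norm \<sigma> (\<lambda>\<phi>. v n \<tau> \<phi> - u \<tau> \<phi>)"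
      have vm: "v n \<tau> \<in> mod_space \<sigma>" for n using v(2) elim(2) by blast
      have d: "(\<lambda>n. enn2real (?d n)) \<longlonglongrightarrow> 0" using elim(1) by (auto intro!: tendsto_enn2real)
      have "\<forall>\<^sub>F n in sequentially. ?d n < \<infinity>" using order_tendstoD(2)[OF elim(1), of \<infinity>] by simp
      then have "\<forall>\<^sub>F n in sequentially. norm (?r (v n \<tau>) - ?r (u \<tau>)) \<le> enn2real (?d n)"
      proof eventually_elim
        case (elim n)
        have fd: "ennreal (enn2real (?d n)) = ?d n" using elim by simp
        have rep: "represents (density_of (freq_box \<sigma> k w)) (freq_box \<sigma> k w)" if "w \<in> mod_space \<sigma>" for w k
          using that by (intro mod_norm_represents) (auto simp: mod_space_def)
        have t: "box_norm k (v n \<tau>) \<le> box_norm k (u \<tau>) + ?d n" "box_norm k (u \<tau>) \<le> box_norm k (v n \<tau>) + ?d n"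
          using box_norm_triangle[of "\<lambda>k. density_of (freq_box \<sigma> k (v n \<tau>))" "v n \<tau>" "\<lambda>k. density_of (freq_box \<sigma> k (u \<tau>))" "u \<tau>" k,
              OF rep[OF vm] rep[OF um[OF \<open>\<tau> \<in> {0..1}\<close>]]]
            box_norm_le_mod_norm[of k "\<lambda>\<phi>. v n \<tau> \<phi> - u \<tau> \<phi>"]
          by (auto intro: order_trans add_left_mono)
        have "ennreal (?r (v n \<tau>)) \<le> ennreal (?r (u \<tau>) + enn2real (?d n))" "ennreal (?r (u \<tau>)) \<le> ennreal (?r (v n \<tau>) + enn2real (?d n))"
          using t by (simp_all only: ennreal_plus[OF enn2real_nonneg enn2real_nonneg] fin[OF vm] fin[OF um[OF \<open>\<tau> \<in> {0..1}\<close>]] fd)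
        then have "?r (v n \<tau>) \<le> ?r (u \<tau>) + enn2real (?d n)" "?r (u \<tau>) \<le> ?r (v n \<tau>) + enn2real (?d n)"
          by (simp_all only: ennreal_le_iff add_nonneg_nonneg enn2real_nonneg)
        then show ?case unfolding real_norm_def by linarith
      qed
      then have "(\<lambda>n. ?r (v n \<tau>) - ?r (u \<tau>)) \<longlonglongrightarrow> 0" by (rule Lim_null_comparison[OF _ d])
      then show ?case by (rule LIM_zero_cancel)
    qed
  qed simp
  then have "(\<lambda>\<tau>. ennreal (?r (u \<tau>))) \<in> borel_measurable ?M" by measurable
  then show ?thesis by (rule measurable_cong[THEN iffD1, rotated]) (use fin um in simp)
qed

lemma trilinear_sum_measurable:
  assumes u: "u1 \<in> S_space \<sigma>" "u2 \<in> S_space \<sigma>" "u3 \<in> S_space \<sigma>"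
  shows "(\<lambda>\<tau>. trilinear_sum k (u1 \<tau>) (u2 \<tau>) (u3 \<tau>)) \<in> borel_measurable (lebesgue_on {0..1})"
proof -
  note [measurable] = box_norm_measurable[OF u(1)] box_norm_measurable[OF u(2)] box_norm_measurable[OF u(3)]
  show ?thesis unfolding trilinear_sum_def trilinear_part_def by measurable
qed

lemma S_space_AE:
  assumes u: "u \<in> S_space \<sigma>"
  shows "AE \<tau> in lebesgue_on {0..1}. mod_norm \<sigma> (u \<tau>) \<le> S_norm \<sigma> u"
    "S_norm \<sigma> u < \<infinity>" "\<And>\<tau>. \<tau> \<in> {0..1} \<Longrightarrow> u \<tau> \<in> mod_space \<sigma>"
proof -
  show "AE \<tau> in lebesgue_on {0..1}. mod_norm \<sigma> (u \<tau>) \<le> S_norm \<sigma> u" unfolding S_norm_def by (rule esssup_AE)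
qed (use u in \<open>auto simp: S_space_def\<close>)

end

section \<open>The Duhamel term\<close>

lemma mult_op_phase_lipschitz:
  assumes p: "\<phi> \<in> schwartz"
  shows "\<exists>L\<ge>0. \<forall>t\<in>{-1..1}. \<forall>t'\<in>{-1..1}.
    (LBINT y. norm (mult_op (phase t) \<phi> y - mult_op (phase t') \<phi> y)) \<le> L * \<bar>t - t'\<bar>"
proof -
  let ?Q = "{phase_quotient t t' |t t'. t \<in> {-1..1} \<and> t' \<in> {-1..1} \<and> t \<noteq> t'}"
  note tame = tame_mult_op[OF slow_family_phase_quotient]
  from tame_bound[OF tame, of 2] obtain D M where D: "D \<ge> 0"
    "\<forall>P\<in>mult_op ` ?Q. \<forall>\<phi>\<in>schwartz. schwartz_norm 2 (P \<phi>) \<le> D * schwartz_norm M \<phi>" by blast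
  have "(LBINT y. norm (mult_op (phase t) \<phi> y - mult_op (phase t') \<phi> y)) \<le> (2 * pi * (D * schwartz_norm M \<phi>)) * \<bar>t - t'\<bar>"
    if t: "t \<in> {-1..1}" "t' \<in> {-1..1}" for t t'
  proof (cases "t = t'")
    case False
    have q: "mult_op (phase_quotient t t') \<in> mult_op ` ?Q" using t False by (intro imageI CollectI exI[of _ t] exI[of _ t']) simp
    have S: "mult_op (phase_quotient t t') \<phi> \<in> schwartz" by (rule tame_schwartz[OF tame q p])
    let ?a = "1 / complex_of_real (t - t')"
    have pq: "phase_quotient t t' = (\<lambda>\<xi>. ?a * phase t \<xi> + (- ?a) * phase t' \<xi>)"
      by (rule ext) (simp only: phase_quotient_def diff_divide_distrib times_divide_eq_left mult_1_left minus_divide_left[symmetric] mult_minus_left add_uminus_conv_diff)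
    have m: "mult_op (phase_quotient t t') \<phi> = (\<lambda>x. ?a * mult_op (phase t) \<phi> x + (- ?a) * mult_op (phase t') \<phi> x)"
      unfolding pq by (intro mult_op_add_symbol slow_family_single[OF slow_family_phase] imageI t p)
    have e: "norm (mult_op (phase t) \<phi> y - mult_op (phase t') \<phi> y) = \<bar>t - t'\<bar> * norm (mult_op (phase_quotient t t') \<phi> y)" for y
    proof -
      have "mult_op (phase_quotient t t') \<phi> y = ?a * (mult_op (phase t) \<phi> y - mult_op (phase t') \<phi> y)"
        by (simp only: m right_diff_distrib mult_minus_left add_uminus_conv_diff)
      then have "norm (mult_op (phase_quotient t t') \<phi> y) = (1 / \<bar>t - t'\<bar>) * norm (mult_op (phase t) \<phi> y - mult_op (phase t') \<phi> y)"
        by (simp only: norm_mult norm_divide norm_one norm_of_real)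
      then show ?thesis using False by simp
    qed
    have "(LBINT y. norm (mult_op (phase t) \<phi> y - mult_op (phase t') \<phi> y)) = \<bar>t - t'\<bar> * (LBINT y. norm (mult_op (phase_quotient t t') \<phi> y))"
      unfolding e by simp
    also have "\<dots> \<le> \<bar>t - t'\<bar> * (2 * pi * schwartz_norm 2 (mult_op (phase_quotient t t') \<phi>))"
      by (intro mult_left_mono schwartz_L1_bound S) simp
    also have "\<dots> \<le> \<bar>t - t'\<bar> * (2 * pi * (D * schwartz_norm M \<phi>))"
      using D(2)[rule_format, OF q p] by (intro mult_left_mono) auto
    finally show ?thesis by (simp only: mult.commute)
  qed simp
  moreover have "2 * pi * (D * schwartz_norm M \<phi>) \<ge> 0" using D(1) schwartz_norm_nonneg[OF p, of M] by simp
  ultimately show ?thesis by blast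
qed

lemma integral_lebesgue_on_initial:
  fixes f :: "real \<Rightarrow> 'b::{banach, second_countable_topology}"
  assumes "a \<in> {0..1}" "b \<in> {0..1}"
  shows "(LINT \<tau>|lebesgue_on {a..b}. f \<tau>) = (LINT \<tau>|lebesgue_on {0..1}. indicator {a..b} \<tau> *\<^sub>R f \<tau>)"
proof -
  have "(LINT \<tau>|lebesgue_on {0..1}. indicator {a..b} \<tau> *\<^sub>R f \<tau>) =
      (LINT \<tau>|lebesgue. indicator {0..1} \<tau> *\<^sub>R indicator {a..b} \<tau> *\<^sub>R f \<tau>)"
    by (rule integral_restrict_space) simp
  also have "\<dots> = (LINT \<tau>|lebesgue. indicator {a..b} \<tau> *\<^sub>R f \<tau>)"
    using assms by (intro Bochner_Integration.integral_cong refl) (auto simp: indicator_def)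
  also have "\<dots> = (LINT \<tau>|lebesgue_on {a..b}. f \<tau>)"
    by (rule integral_restrict_space[symmetric]) simp
  finally show ?thesis by simp
qed

lemma integral_indicator_unit_interval:
  assumes "a \<in> {0..1}" "b \<in> {0..1}" "a \<le> b"
  shows "(LINT \<tau>|lebesgue_on {0..1::real}. indicator {a..b} \<tau>) = b - a"
proof -
  have "(LINT \<tau>|lebesgue_on {0..1::real}. indicator {a..b} \<tau>) = measure (lebesgue_on {0..1}) ({a..b} \<inter> space (lebesgue_on {0..1}))"
    by (rule Bochner_Integration.integral_indicator)
  also have "{a..b} \<inter> space (lebesgue_on {0..1}) = {a..b}" using assms by auto
  also have "measure (lebesgue_on {0..1}) {a..b} = measure lebesgue {a..b}"
    using assms by (intro measure_restrict_space) auto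
  finally show ?thesis using assms by simp
qed

lemma finite_measure_unit_interval: "finite_measure (lebesgue_on {0..1::real})"
  by (rule finite_measure_lebesgue_on) simp

lemma floor_approx_tendsto: "(\<lambda>n. real_of_int \<lfloor>real (Suc n) * x\<rfloor> / real (Suc n)) \<longlonglongrightarrow> x"
proof -
  have e: "norm (real_of_int \<lfloor>real (Suc n) * x\<rfloor> / real (Suc n) - x) \<le> inverse (real (Suc n))" for n
  proof -
    have "real_of_int \<lfloor>real (Suc n) * x\<rfloor> / real (Suc n) - x = (real_of_int \<lfloor>real (Suc n) * x\<rfloor> - real (Suc n) * x) / real (Suc n)"
      by (simp add: diff_divide_distrib)
    moreover have "\<bar>real_of_int \<lfloor>real (Suc n) * x\<rfloor> - real (Suc n) * x\<bar> \<le> 1" by linarith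
    ultimately show ?thesis
      by (simp only: real_norm_def abs_divide abs_of_nat inverse_eq_divide) (intro divide_right_mono, auto)
  qed
  have "(\<lambda>n. real_of_int \<lfloor>real (Suc n) * x\<rfloor> / real (Suc n) - x) \<longlonglongrightarrow> 0"
    by (rule Lim_null_comparison[OF _ LIMSEQ_inverse_real_of_nat]) (use e in simp)
  then show ?thesis by (rule LIM_zero_cancel)
qed

text \<open>Three curves in \<open>S_space\<close>, for which the Duhamel term is studied. Pointwise bounds for their values
hold only for almost every time, but membership in the modulation space holds for every time.\<close>

locale duhamel_terms = freq_partition +
  fixes u v w :: "real \<Rightarrow> distr"
  assumes S_space: "u \<in> S_space \<sigma>" "v \<in> S_space \<sigma>" "w \<in> S_space \<sigma>"
begin

text \<open>The nonlinearity at time \<open>\<tau>\<close>.\<close>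

definition nonlin :: "real \<Rightarrow> real \<Rightarrow> complex" where
  "nonlin \<tau> = cubic (u \<tau>) (v \<tau>) (w \<tau>)"

text \<open>The product of the norms of the three curves, as a real number.\<close>

definition data_norm :: real where
  "data_norm = enn2real (S_norm \<sigma> u) * enn2real (S_norm \<sigma> v) * enn2real (S_norm \<sigma> w)"

text \<open>The value at \<open>x\<close> of the box \<open>k\<close> of \<open>U(t - \<tau>)\<close> applied
to the nonlinearity at time \<open>\<tau>\<close>.\<close>

definition piece :: "int \<Rightarrow> real \<Rightarrow> real \<Rightarrow> real \<Rightarrow> complex" where
  "piece k t x \<tau> = conv (nonlin \<tau>) (box_kernel 0 k (t - \<tau>)) x"

text \<open>The box \<open>k\<close> of the Duhamel term at time \<open>t\<close>. The integral runs over the fixed interval \<open>{0..1}\<close> with an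
indicator function, so that terms with different \<open>t\<close> can be compared.\<close>

definition duhamel_box :: "int \<Rightarrow> real \<Rightarrow> real \<Rightarrow> complex" where
  "duhamel_box k t x = - \<i> * (LINT \<tau>|lebesgue_on {0..1}. indicator {0..t} \<tau> *\<^sub>R piece k t x \<tau>)"

lemma data_norm_nonneg: "data_norm \<ge> 0"
  by (simp add: data_norm_def)

lemma in_mod_space: "\<tau> \<in> {0..1} \<Longrightarrow> u \<tau> \<in> mod_space \<sigma>" "\<tau> \<in> {0..1} \<Longrightarrow> v \<tau> \<in> mod_space \<sigma>" "\<tau> \<in> {0..1} \<Longrightarrow> w \<tau> \<in> mod_space \<sigma>"
  by (rule S_space_AE(3)[OF S_space(1)] S_space_AE(3)[OF S_space(2)] S_space_AE(3)[OF S_space(3)], assumption)+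

text \<open>For \<open>\<tau> > t\<close> the difference is negative; the kernel bounds hold for
\<open>\<bar>t\<bar> \<le> 1\<close>, which covers both signs.\<close>

lemma time_diff: "t \<in> {0..1} \<Longrightarrow> \<tau> \<in> {0..1} \<Longrightarrow> t - \<tau> \<in> {-1..(1::real)}"
  by simp

lemma nonlin_bounded: "\<tau> \<in> {0..1} \<Longrightarrow> \<exists>B. AE x in lborel. norm (nonlin \<tau> x) \<le> B"
  unfolding nonlin_def by (rule exI, rule cubic_bounded(2)[OF in_mod_space])

lemma nonlin_measurable: "\<tau> \<in> {0..1} \<Longrightarrow> nonlin \<tau> \<in> borel_measurable borel"
  unfolding nonlin_def by (rule cubic_bounded(1)[OF in_mod_space])

lemma AE_unit_interval: "AE \<tau> in lebesgue_on {0..1}. \<tau> \<in> {0..1::real}"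
  by (rule AE_I2) simp

lemma AE_nonlin_bounded: "AE \<tau> in lebesgue_on {0..1}. AE x in lborel. norm (nonlin \<tau> x) \<le> data_norm"
  using S_space_AE(1)[OF S_space(1)] S_space_AE(1)[OF S_space(2)] S_space_AE(1)[OF S_space(3)] AE_unit_interval
proof eventually_elim
  case (elim \<tau>)
  note m = in_mod_space[OF elim(4)]
  have le: "enn2real (mod_norm \<sigma> (u \<tau>)) \<le> enn2real (S_norm \<sigma> u)" "enn2real (mod_norm \<sigma> (v \<tau>)) \<le> enn2real (S_norm \<sigma> v)"
    "enn2real (mod_norm \<sigma> (w \<tau>)) \<le> enn2real (S_norm \<sigma> w)"
    using elim(1-3) S_space_AE(2)[OF S_space(1)] S_space_AE(2)[OF S_space(2)] S_space_AE(2)[OF S_space(3)]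
    by (simp_all add: enn2real_mono)
  have b: "enn2real (mod_norm \<sigma> (u \<tau>)) * enn2real (mod_norm \<sigma> (v \<tau>)) * enn2real (mod_norm \<sigma> (w \<tau>)) \<le> data_norm"
    unfolding data_norm_def by (intro mult_mono le) auto
  show ?case using cubic_bounded(2)[OF m]
  proof eventually_elim
    case (elim x) then show ?case unfolding nonlin_def by (rule order_trans[OF _ b])
  qed
qed

lemma nonlin_loc_bounded: "\<tau> \<in> {0..1} \<Longrightarrow> \<exists>B. loc_bounded (nonlin \<tau>) B"
  using nonlin_bounded[of \<tau>] loc_bounded_AE_bounded[OF nonlin_measurable[of \<tau>]] by auto

lemma AE_nonlin_loc_bounded: "AE \<tau> in lebesgue_on {0..1}. loc_bounded (nonlin \<tau>) (data_norm * pi)"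
  using AE_nonlin_bounded AE_unit_interval
  by eventually_elim (rule loc_bounded_AE_bounded[OF nonlin_measurable])

lemma schroedinger_cubic_product:
  "schroedinger r (cubic_product (u \<tau>) (v \<tau>) (w \<tau>)) = (\<lambda>\<phi>. LBINT y. nonlin \<tau> y * mult_op (phase r) \<phi> y)"
proof
  fix \<phi>
  have "phase r = (\<lambda>\<xi>. cis (- (r * \<xi>\<^sup>2)))" by (rule ext) (simp add: phase_def)
  then show "schroedinger r (cubic_product (u \<tau>) (v \<tau>) (w \<tau>)) \<phi> = (LBINT y. nonlin \<tau> y * mult_op (phase r) \<phi> y)"
    by (simp add: schroedinger_def fourier_multiplier_eq cubic_product_def distr_of_def nonlin_def cubic_def)
qed

lemma piece_measurable:
  assumes t: "t \<in> {0..1}"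
  shows "piece k t x \<in> borel_measurable (lebesgue_on {0..1})"
proof -
  from box_kernel_lipschitz[of 0 k] obtain C where C: "C \<ge> 0"
    "\<forall>t t' x. t \<in> {-1..1} \<longrightarrow> t' \<in> {-1..1} \<longrightarrow> norm (box_kernel 0 k t x - box_kernel 0 k t' x) \<le> C * \<bar>t - t'\<bar> * (1 / (1 + x\<^sup>2))"
    by blast
  have "(\<lambda>\<tau>. LBINT y. cubic (u \<tau>) (v \<tau>) (w \<tau>) y * box_kernel 0 k (t - \<tau>) (x - y)) \<in> borel_measurable (lebesgue_on {0..1})"
  proof (rule cubic_integral_measurable[OF S_space, where L = "C * pi"])
    fix \<tau> :: real assume s: "\<tau> \<in> {0..1}"
    show "(\<lambda>y. box_kernel 0 k (t - \<tau>) (x - y)) \<in> schwartz" by (rule schwartz_box_kernel_reflect[OF time_diff[OF t s]])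
    fix \<tau>' :: real assume s': "\<tau>' \<in> {0..1}"
    have "(LBINT y. norm (box_kernel 0 k (t - \<tau>) (x - y) - box_kernel 0 k (t - \<tau>') (x - y)))
        \<le> (LBINT y. C * \<bar>\<tau> - \<tau>'\<bar> * (1 / (1 + (x - y)\<^sup>2)))"
    proof (rule integral_mono)
      show "integrable lborel (\<lambda>y. norm (box_kernel 0 k (t - \<tau>) (x - y) - box_kernel 0 k (t - \<tau>') (x - y)))"
        by (intro integrable_norm Bochner_Integration.integrable_diff schwartz_integrable schwartz_box_kernel_reflect time_diff t s s')
      show "integrable lborel (\<lambda>y. C * \<bar>\<tau> - \<tau>'\<bar> * (1 / (1 + (x - y)\<^sup>2)))"
        by (intro integrable_mult_right integral_inverse_square_translate)
      fix y
      have "\<bar>(t - \<tau>) - (t - \<tau>')\<bar> = \<bar>\<tau> - \<tau>'\<bar>" by simp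
      with C(2)[rule_format, OF time_diff[OF t s] time_diff[OF t s'], of "x - y"]
      show "norm (box_kernel 0 k (t - \<tau>) (x - y) - box_kernel 0 k (t - \<tau>') (x - y)) \<le> C * \<bar>\<tau> - \<tau>'\<bar> * (1 / (1 + (x - y)\<^sup>2))"
        by (simp only:)
    qed
    also have "\<dots> = C * \<bar>\<tau> - \<tau>'\<bar> * (LBINT y. 1 / (1 + (x - y)\<^sup>2))"
      by (rule integral_mult_right_zero)
    also have "\<dots> = C * pi * \<bar>\<tau> - \<tau>'\<bar>" unfolding integral_inverse_square_translate by (simp only: mult.assoc mult.commute mult.left_commute)
    finally show "(LBINT y. norm (box_kernel 0 k (t - \<tau>) (x - y) - box_kernel 0 k (t - \<tau>') (x - y))) \<le> C * pi * \<bar>\<tau> - \<tau>'\<bar>" .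
  qed
  then show ?thesis by (simp only: piece_def[abs_def] conv_def nonlin_def)
qed

lemma AE_piece_bounded: "\<exists>A\<ge>0. \<forall>t\<in>{0..1}. AE \<tau> in lebesgue_on {0..1}. \<forall>x. norm (piece k t x \<tau>) \<le> A"
proof -
  from box_kernel_bound[of 0] obtain C where C: "C \<ge> 0"
    "\<forall>k t x. t \<in> {-1..1} \<longrightarrow> norm (box_kernel 0 k t x) \<le> C * (1 + (of_int k)\<^sup>2) powr (- 0 / 2) * (1 / (1 + (x - 2 * t * of_int k)\<^sup>2))"
    by blast
  have C': "norm (box_kernel 0 k t x) \<le> C * (1 / (1 + (x - 2 * t * of_int k)\<^sup>2))" if "t \<in> {-1..1}" for k t x
    using C(2)[rule_format, OF that, of k x] one_plus_square_pos[of "of_int k"] by simp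
  have "AE \<tau> in lebesgue_on {0..1}. \<forall>x. norm (piece k t x \<tau>) \<le> C * (data_norm * pi)" if t: "t \<in> {0..1}" for t
    using AE_nonlin_loc_bounded AE_unit_interval
  proof eventually_elim
    case (elim \<tau>)
    show ?case unfolding piece_def
      by (intro allI conv_bound(2)[OF elim(1) schwartz_measurable[OF schwartz_box_kernel[OF time_diff[OF t elim(2)]]] C'[OF time_diff[OF t elim(2)]] C(1)])
  qed
  moreover have "C * (data_norm * pi) \<ge> 0" using C(1) data_norm_nonneg by simp
  ultimately show ?thesis by blast
qed

lemma piece_integrable:
  assumes t: "t \<in> {0..1}" "t' \<in> {0..1}"
  shows "integrable (lebesgue_on {0..1}) (\<lambda>\<tau>. indicator {0..t'} \<tau> *\<^sub>R piece k t x \<tau>)"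
proof -
  note [measurable] = piece_measurable[OF t(1), of k x]
  from AE_piece_bounded[of k] obtain A where A: "A \<ge> 0" "\<forall>t\<in>{0..1}. AE \<tau> in lebesgue_on {0..1}. \<forall>x. norm (piece k t x \<tau>) \<le> A" by blast
  have ind: "indicator {0..t'} \<in> borel_measurable (lebesgue_on {0..1::real})"
    by (intro borel_measurable_indicator) (simp add: sets_restrict_space_iff t, use t in auto)
  show ?thesis
  proof (rule finite_measure.integrable_const_bound[OF finite_measure_unit_interval])
    show "AE \<tau> in lebesgue_on {0..1}. norm (indicator {0..t'} \<tau> *\<^sub>R piece k t x \<tau>) \<le> A"
      using A(2)[rule_format, OF t(1)]
    proof eventually_elim
      case (elim \<tau>)
      then show ?case using A(1) by (cases "\<tau> \<in> {0..t'}") simp_all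
    qed
    show "(\<lambda>\<tau>. indicator {0..t'} \<tau> *\<^sub>R piece k t x \<tau>) \<in> borel_measurable (lebesgue_on {0..1})"
      by (intro borel_measurable_scaleR ind piece_measurable t)
  qed
qed

text \<open>The integrand is measurable in \<open>\<tau>\<close> and continuous in \<open>x\<close>, and is therefore the limit of functions that
depend on \<open>x\<close> only through \<open>\<lfloor>(n + 1) x\<rfloor>\<close>.\<close>

lemma piece_jointly_measurable:
  assumes t: "t \<in> {0..1}"
  shows "(\<lambda>z. piece k t (snd z) (fst z)) \<in> borel_measurable (lebesgue_on {0..1} \<Otimes>\<^sub>M lborel)"
proof (rule borel_measurable_LIMSEQ_metric)
  let ?X = "\<lambda>n x. real_of_int \<lfloor>real (Suc n) * x\<rfloor> / real (Suc n)"
  show "(\<lambda>z. piece k t (?X n (snd z)) (fst z)) \<in> borel_measurable (lebesgue_on {0..1} \<Otimes>\<^sub>M lborel)" for n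
  proof (rule measurable_compose_countable[where f = "\<lambda>(i::int) z. piece k t (of_int i / real (Suc n)) (fst z)"])
    show "(\<lambda>z. piece k t (of_int i / real (Suc n)) (fst z)) \<in> borel_measurable (lebesgue_on {0..1} \<Otimes>\<^sub>M lborel)" for i
      by (rule measurable_compose[OF measurable_fst piece_measurable[OF t]])
    show "(\<lambda>z. \<lfloor>real (Suc n) * snd z\<rfloor>) \<in> measurable (lebesgue_on {0..1} \<Otimes>\<^sub>M lborel) (count_space UNIV)"
      by measurable
  qed
  fix z :: "real \<times> real" assume "z \<in> space (lebesgue_on {0..1} \<Otimes>\<^sub>M lborel)"
  then have z: "fst z \<in> {0..1}" by (auto simp: space_pair_measure)
  obtain B where "loc_bounded (nonlin (fst z)) B" using nonlin_loc_bounded[OF z] by blast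
  then show "(\<lambda>n. piece k t (?X n (snd z)) (fst z)) \<longlonglongrightarrow> piece k t (snd z) (fst z)"
    unfolding piece_def by (rule conv_tendsto[OF _ schwartz_box_kernel[OF time_diff[OF t z]] floor_approx_tendsto])
qed

lemma piece_Fubini:
  assumes t: "t \<in> {0..1}" and p: "\<phi> \<in> schwartz"
  shows "duhamel_box k t \<in> borel_measurable borel"
    "integrable lborel (\<lambda>x. duhamel_box k t x * \<phi> x)"
    "(LBINT x. duhamel_box k t x * \<phi> x) =
       - \<i> * (LINT \<tau>|lebesgue_on {0..1}. indicator {0..t} \<tau> *\<^sub>R (LBINT x. piece k t x \<tau> * \<phi> x))"
proof -
  let ?L = "lebesgue_on {0..1::real}"
  interpret L: finite_measure ?L by (rule finite_measure_unit_interval)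
  interpret P: pair_sigma_finite ?L lborel ..
  from AE_piece_bounded[of k] obtain A where A: "A \<ge> 0" "\<forall>t\<in>{0..1}. AE \<tau> in ?L. \<forall>x. norm (piece k t x \<tau>) \<le> A" by blast
  have ind: "indicator {0..t} \<in> borel_measurable ?L"
    by (intro borel_measurable_indicator) (simp add: sets_restrict_space_iff t, use t in auto)
  have ind2: "(\<lambda>z. indicator {0..t} (fst z) :: real) \<in> borel_measurable (?L \<Otimes>\<^sub>M lborel)"
    by (rule measurable_compose[OF measurable_fst ind])
  have pm: "(\<lambda>z. \<phi> (snd z)) \<in> borel_measurable (?L \<Otimes>\<^sub>M lborel)"
    by (rule measurable_compose[OF measurable_snd]) (use schwartz_measurable[OF p] in simp)
  let ?f = "\<lambda>\<tau> x. indicator {0..t} \<tau> *\<^sub>R piece k t x \<tau>"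
  have m: "(\<lambda>z. ?f (fst z) (snd z)) \<in> borel_measurable (?L \<Otimes>\<^sub>M lborel)"
    by (intro borel_measurable_scaleR ind2 piece_jointly_measurable t)
  have m2: "(\<lambda>z. ?f (fst z) (snd z) * \<phi> (snd z)) \<in> borel_measurable (?L \<Otimes>\<^sub>M lborel)"
    by (intro borel_measurable_times m pm)
  have "(\<lambda>x. LINT \<tau>|?L. (\<lambda>(x, \<tau>). ?f \<tau> x) (x, \<tau>)) \<in> borel_measurable lborel"
    by (rule L.borel_measurable_lebesgue_integral) (use measurable_pair_swap[OF m] in \<open>simp add: case_prod_beta'\<close>)
  then show 1: "duhamel_box k t \<in> borel_measurable borel"
    unfolding duhamel_box_def[abs_def] by simp
  have fb: "AE \<tau> in ?L. \<forall>x. norm (?f \<tau> x * \<phi> x) \<le> A * norm (\<phi> x)"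
    using A(2)[rule_format, OF t]
  proof eventually_elim
    case (elim \<tau>)
    have "norm (?f \<tau> x) \<le> A" for x using elim A(1) by (cases "\<tau> \<in> {0..t}") simp_all
    then show ?case unfolding norm_mult by (intro allI mult_right_mono) auto
  qed
  have iA: "integrable lborel (\<lambda>x. A * norm (\<phi> x))" by (intro integrable_mult_right integrable_norm schwartz_integrable p)
  have sm: "(\<lambda>x. ?f \<tau> x * \<phi> x) \<in> borel_measurable lborel" if "\<tau> \<in> {0..1}" for \<tau>
  proof -
    have "(\<lambda>x. (\<tau>, x)) \<in> measurable lborel (?L \<Otimes>\<^sub>M lborel)" using that by (intro measurable_Pair1') simp
    from measurable_compose[OF this m2] show ?thesis by simp
  qed
  have ix: "AE \<tau> in ?L. integrable lborel (\<lambda>x. ?f \<tau> x * \<phi> x)"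
    using fb AE_unit_interval
  proof eventually_elim
    case (elim \<tau>)
    show ?case by (rule Bochner_Integration.integrable_bound[OF iA sm[OF elim(2)]]) (use elim(1) A(1) in simp)
  qed
  have int: "integrable (?L \<Otimes>\<^sub>M lborel) (\<lambda>z. ?f (fst z) (snd z) * \<phi> (snd z))"
  proof (rule P.Fubini_integrable[OF m2])
    show "AE \<tau> in ?L. integrable lborel (\<lambda>x. ?f (fst (\<tau>, x)) (snd (\<tau>, x)) * \<phi> (snd (\<tau>, x)))" using ix by simp
    show "integrable ?L (\<lambda>\<tau>. LBINT x. norm (?f (fst (\<tau>, x)) (snd (\<tau>, x)) * \<phi> (snd (\<tau>, x))))"
    proof (rule L.integrable_const_bound)
      show "AE \<tau> in ?L. norm (LBINT x. norm (?f (fst (\<tau>, x)) (snd (\<tau>, x)) * \<phi> (snd (\<tau>, x)))) \<le> (LBINT x. A * norm (\<phi> x))"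
        using fb ix
      proof eventually_elim
        case (elim \<tau>)
        have "(LBINT x. norm (?f \<tau> x * \<phi> x)) \<le> (LBINT x. A * norm (\<phi> x))"
          by (rule integral_mono[OF integrable_norm[OF elim(2)] iA]) (use elim(1) in blast)
        then show ?case by simp
      qed
      have "(\<lambda>\<tau>. LBINT x. (\<lambda>(\<tau>, x). norm (?f \<tau> x * \<phi> x)) (\<tau>, x)) \<in> borel_measurable ?L"
        by (rule lborel.borel_measurable_lebesgue_integral) (use measurable_compose[OF m2 borel_measurable_norm] in \<open>simp add: case_prod_beta'\<close>)
      then show "(\<lambda>\<tau>. LBINT x. norm (?f (fst (\<tau>, x)) (snd (\<tau>, x)) * \<phi> (snd (\<tau>, x)))) \<in> borel_measurable ?L" by simp
    qed
  qed
  then have int': "integrable (?L \<Otimes>\<^sub>M lborel) (case_prod (\<lambda>\<tau> x. ?f \<tau> x * \<phi> x))" by (simp add: case_prod_beta')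
  have e: "duhamel_box k t x * \<phi> x = - \<i> * (LINT \<tau>|?L. ?f \<tau> x * \<phi> x)" for x
    by (simp only: duhamel_box_def mult.assoc integral_mult_left_zero)
  show "integrable lborel (\<lambda>x. duhamel_box k t x * \<phi> x)"
    unfolding e by (intro integrable_mult_right P.integrable_snd[OF int'])
  have "(LBINT x. duhamel_box k t x * \<phi> x) = - \<i> * (LBINT x. LINT \<tau>|?L. ?f \<tau> x * \<phi> x)"
    unfolding e by (rule integral_mult_right_zero)
  also have "(LBINT x. LINT \<tau>|?L. ?f \<tau> x * \<phi> x) = (LINT \<tau>|?L. (LBINT x. ?f \<tau> x * \<phi> x))"
    by (rule P.Fubini_integral[OF int'])
  also have "\<dots> = (LINT \<tau>|?L. indicator {0..t} \<tau> *\<^sub>R (LBINT x. piece k t x \<tau> * \<phi> x))"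
    by (intro Bochner_Integration.integral_cong refl) (simp only: scaleR_left_distrib mult_scaleR_left integral_scaleR_right)
  finally show "(LBINT x. duhamel_box k t x * \<phi> x) =
       - \<i> * (LINT \<tau>|?L. indicator {0..t} \<tau> *\<^sub>R (LBINT x. piece k t x \<tau> * \<phi> x))" .
qed

lemma duhamel_box_represents:
  assumes t: "t \<in> {0..1}"
  shows "represents (duhamel_box k t) (freq_box \<sigma> k (duhamel u v w t))"
  unfolding represents_def
proof (intro conjI ballI)
  have z: "(\<lambda>x. 0) \<in> schwartz" by (rule schwartz_zero)
  show "duhamel_box k t \<in> borel_measurable lborel" using piece_Fubini(1)[OF t z] by simp
  fix \<phi> :: "real \<Rightarrow> complex" assume p: "\<phi> \<in> schwartz"
  show "integrable lborel (\<lambda>x. duhamel_box k t x * \<phi> x)" by (rule piece_Fubini(2)[OF t p])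
  let ?c = "\<lambda>\<tau>. cubic_product (u \<tau>) (v \<tau>) (w \<tau>)"
  have c: "?c \<tau> = distr_of (nonlin \<tau>)" for \<tau>
    by (simp add: cubic_product_def nonlin_def cubic_def[abs_def])
  have t0: "(0::real) \<in> {0..1}" by simp
  have "freq_box \<sigma> k (duhamel u v w t) \<phi> = - \<i> * (LINT \<tau>|lebesgue_on {0..t}. freq_box \<sigma> k (schroedinger (t - \<tau>) (?c \<tau>)) \<phi>)"
    by (simp add: freq_box_eq duhamel_def)
  also have "(LINT \<tau>|lebesgue_on {0..t}. freq_box \<sigma> k (schroedinger (t - \<tau>) (?c \<tau>)) \<phi>) =
      (LINT \<tau>|lebesgue_on {0..t}. (LBINT x. piece k t x \<tau> * \<phi> x))"
  proof (rule Bochner_Integration.integral_cong[OF refl])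
    fix \<tau> assume "\<tau> \<in> space (lebesgue_on {0..t})"
    then have s: "\<tau> \<in> {0..1}" using t by simp
    obtain B where B: "loc_bounded (nonlin \<tau>) B" using nonlin_loc_bounded[OF s] by blast
    obtain B' where B': "AE x in lborel. norm (nonlin \<tau> x) \<le> B'" using nonlin_bounded[OF s] by blast

    have "represents (conv (nonlin \<tau>) (box_kernel 0 k (t - \<tau>))) (freq_box \<sigma> k (schroedinger (t - \<tau>) (?c \<tau>)))"
      unfolding c by (rule box_represents[OF B represents_distr_of[OF nonlin_measurable[OF s] B'] time_diff[OF t s]])
    then show "freq_box \<sigma> k (schroedinger (t - \<tau>) (?c \<tau>)) \<phi> = (LBINT x. piece k t x \<tau> * \<phi> x)"
      using p unfolding represents_def distr_of_def piece_def by blast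
  qed
  also have "\<dots> = (LINT \<tau>|lebesgue_on {0..1}. indicator {0..t} \<tau> *\<^sub>R (LBINT x. piece k t x \<tau> * \<phi> x))"
    by (rule integral_lebesgue_on_initial[OF t0 t])
  finally show "freq_box \<sigma> k (duhamel u v w t) \<phi> = distr_of (duhamel_box k t) \<phi>"
    unfolding distr_of_def piece_Fubini(3)[OF t p] .
qed

text \<open>The first summand of the constant accounts for the change of the interval of integration, the second
for the change of the kernel.\<close>

lemma duhamel_box_lipschitz:
  "\<exists>L. \<forall>t\<in>{0..1}. \<forall>t'\<in>{0..1}. \<forall>x. norm (duhamel_box k t x - duhamel_box k t' x) \<le> L * \<bar>t - t'\<bar>"
proof -
  let ?L = "lebesgue_on {0..1::real}"
  from AE_piece_bounded[of k] obtain A where A: "A \<ge> 0" "\<forall>t\<in>{0..1}. AE \<tau> in ?L. \<forall>x. norm (piece k t x \<tau>) \<le> A" by blast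
  from conv_kernel_lipschitz[of 0 k] obtain L where L: "L \<ge> 0"
    "\<forall>g B. loc_bounded g B \<longrightarrow> (\<forall>t\<in>{-1..1}. \<forall>t'\<in>{-1..1}. \<forall>x. norm (conv g (box_kernel 0 k t) x - conv g (box_kernel 0 k t') x) \<le> L * \<bar>t - t'\<bar> * B)"
    by blast
  have "norm (duhamel_box k t x - duhamel_box k t' x) \<le> (A + L * (data_norm * pi)) * \<bar>t - t'\<bar>"
    if t: "t \<in> {0..1}" "t' \<in> {0..1}" for t t' x
  proof -
    interpret Lm: finite_measure ?L by (rule finite_measure_unit_interval)
    let ?f = "\<lambda>t \<tau>. indicator {0..t} \<tau> *\<^sub>R piece k t x \<tau>"
    let ?I = "{min t t'..max t t'}"
    have tI: "min t t' \<in> {0..1}" "max t t' \<in> {0..1}" "min t t' \<le> max t t'" using t by auto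
    have i: "integrable ?L (?f t)" "integrable ?L (?f t')" by (intro piece_integrable t)+
    have iI: "integrable ?L (indicator ?I :: real \<Rightarrow> real)"
      using tI by (intro Lm.integrable_const_bound[of _ 1] AE_I2 borel_measurable_indicator) (auto simp: indicator_def sets_restrict_space_iff)
    have ib: "integrable ?L (\<lambda>\<tau>. A * indicator ?I \<tau> + L * \<bar>t - t'\<bar> * (data_norm * pi))"
      by (intro Bochner_Integration.integrable_add integrable_mult_right iI Lm.integrable_const)
    have c0: "0 \<le> L * \<bar>t - t'\<bar> * (data_norm * pi)" using L(1) data_norm_nonneg by simp
    have "AE \<tau> in ?L. norm (?f t \<tau> - ?f t' \<tau>) \<le> A * indicator ?I \<tau> + L * \<bar>t - t'\<bar> * (data_norm * pi)"
      using A(2)[rule_format, OF t(1)] A(2)[rule_format, OF t(2)] AE_nonlin_loc_bounded AE_unit_interval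
    proof eventually_elim
      case (elim \<tau>)
      note s = elim(4)
      have lip: "norm (piece k t x \<tau> - piece k t' x \<tau>) \<le> L * \<bar>t - t'\<bar> * (data_norm * pi)"
      proof -
        have "\<bar>(t - \<tau>) - (t' - \<tau>)\<bar> = \<bar>t - t'\<bar>" by simp
        with L(2)[rule_format, OF elim(3) time_diff[OF t(1) s] time_diff[OF t(2) s], of x]
        show ?thesis unfolding piece_def by (simp only:)
      qed
      have A1: "norm (piece k t x \<tau>) \<le> A" "norm (piece k t' x \<tau>) \<le> A" using elim(1,2) by blast+
      have ind0: "0 \<le> A * indicator ?I \<tau>" using A(1) by simp
      consider "\<tau> \<le> t" "\<tau> \<le> t'" | "\<tau> \<le> t" "\<not> \<tau> \<le> t'" | "\<not> \<tau> \<le> t" "\<tau> \<le> t'" | "\<not> \<tau> \<le> t" "\<not> \<tau> \<le> t'" by blast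
      then show ?case
      proof cases
        case 1
        then have "?f t \<tau> - ?f t' \<tau> = piece k t x \<tau> - piece k t' x \<tau>" using s by (simp add: indicator_def)
        then show ?thesis using lip ind0 by simp
      next
        case 2
        then have "?f t \<tau> - ?f t' \<tau> = piece k t x \<tau>" "\<tau> \<in> ?I" using s by (auto simp add: indicator_def)
        then show ?thesis using A1(1) c0 by simp
      next
        case 3
        then have "?f t \<tau> - ?f t' \<tau> = - piece k t' x \<tau>" "\<tau> \<in> ?I" using s by (auto simp add: indicator_def)
        then show ?thesis using A1(2) c0 by simp
      next
        case 4
        then have "?f t \<tau> - ?f t' \<tau> = 0" by (simp add: indicator_def)
        then show ?thesis using c0 ind0 by simp
      qed
    qed
    note ae = this
    have "duhamel_box k t x - duhamel_box k t' x = - \<i> * ((LINT \<tau>|?L. ?f t \<tau>) - (LINT \<tau>|?L. ?f t' \<tau>))"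
      unfolding duhamel_box_def by (simp only: right_diff_distrib)
    also have "\<dots> = - \<i> * (LINT \<tau>|?L. ?f t \<tau> - ?f t' \<tau>)" by (simp only: Bochner_Integration.integral_diff[OF i])
    finally have "norm (duhamel_box k t x - duhamel_box k t' x) = norm (LINT \<tau>|?L. ?f t \<tau> - ?f t' \<tau>)"
      by (simp only: norm_mult norm_minus_cancel norm_ii mult_1_left)
    also have "\<dots> \<le> (LINT \<tau>|?L. norm (?f t \<tau> - ?f t' \<tau>))" by (rule integral_norm_bound)
    also have "\<dots> \<le> (LINT \<tau>|?L. A * indicator ?I \<tau> + L * \<bar>t - t'\<bar> * (data_norm * pi))"
      by (rule integral_mono_AE[OF integrable_norm[OF Bochner_Integration.integrable_diff[OF i]] ib ae])
    also have "\<dots> = A * (LINT \<tau>|?L. indicator ?I \<tau>) + (LINT \<tau>|?L. L * \<bar>t - t'\<bar> * (data_norm * pi))"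
      by (subst Bochner_Integration.integral_add[OF integrable_mult_right[OF iI] Lm.integrable_const]) simp
    also have "(LINT \<tau>|?L. L * \<bar>t - t'\<bar> * (data_norm * pi)) = L * \<bar>t - t'\<bar> * (data_norm * pi)"
      by (simp add: measure_restrict_space)
    also have "(LINT \<tau>|?L. indicator ?I \<tau>) = \<bar>t - t'\<bar>" unfolding integral_indicator_unit_interval[OF tI] by linarith
    also have "A * \<bar>t - t'\<bar> + L * \<bar>t - t'\<bar> * (data_norm * pi) = (A + L * (data_norm * pi)) * \<bar>t - t'\<bar>" by (simp add: algebra_simps)
    finally show ?thesis .
  qed
  then show ?thesis by blast
qed

lemma duhamel_tempered:
  assumes t: "t \<in> {0..1}"
  shows "duhamel u v w t \<in> tempered"
proof -
  let ?L = "lebesgue_on {0..1::real}"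
  interpret Lm: finite_measure ?L by (rule finite_measure_unit_interval)
  let ?m = "\<lambda>\<phi> \<tau>. mult_op (phase (t - \<tau>)) \<phi>"
  let ?G = "\<lambda>\<phi> \<tau>. LBINT y. nonlin \<tau> y * ?m \<phi> \<tau> y"
  have t0: "(0::real) \<in> {0..1}" by simp
  have d: "duhamel u v w t \<phi> = - \<i> * (LINT \<tau>|?L. indicator {0..t} \<tau> *\<^sub>R ?G \<phi> \<tau>)" for \<phi>
    unfolding duhamel_def schroedinger_cubic_product integral_lebesgue_on_initial[OF t0 t] ..
  have S: "?m \<phi> \<tau> \<in> schwartz" if "\<phi> \<in> schwartz" "\<tau> \<in> {0..1}" for \<phi> \<tau>
    by (rule schwartz_mult_op[OF slow_family_phase1[OF time_diff[OF t that(2)]] that(1)])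
  from tame_bound[OF tame_mult_op[OF slow_family_phase], of 2] obtain D M where D: "D \<ge> 0"
    "\<forall>P\<in>mult_op ` phase ` {-1..1}. \<forall>\<phi>\<in>schwartz. schwartz_norm 2 (P \<phi>) \<le> D * schwartz_norm M \<phi>" by blast
  have Gb: "AE \<tau> in ?L. norm (indicator {0..t} \<tau> *\<^sub>R ?G \<phi> \<tau>) \<le> data_norm * (2 * pi * (D * schwartz_norm M \<phi>))" if p: "\<phi> \<in> schwartz" for \<phi>
    using AE_nonlin_bounded AE_unit_interval
  proof eventually_elim
    case (elim \<tau>)
    have q: "mult_op (phase (t - \<tau>)) \<in> mult_op ` phase ` {-1..1}" by (intro imageI time_diff t elim(2))
    have "norm (indicator {0..t} \<tau> *\<^sub>R ?G \<phi> \<tau>) \<le> norm (?G \<phi> \<tau>)" by (simp add: indicator_def)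
    also have "\<dots> \<le> data_norm * (LBINT y. norm (?m \<phi> \<tau> y))"
      by (rule integrable_bounded_mult(2)[OF nonlin_measurable[OF elim(2)] elim(1) schwartz_integrable[OF S[OF p elim(2)]]])
    also have "\<dots> \<le> data_norm * (2 * pi * schwartz_norm 2 (?m \<phi> \<tau>))"
      by (intro mult_left_mono schwartz_L1_bound S p elim data_norm_nonneg)
    also have "\<dots> \<le> data_norm * (2 * pi * (D * schwartz_norm M \<phi>))"
      using D(2)[rule_format, OF q p] by (intro mult_left_mono data_norm_nonneg) auto
    finally show ?case .
  qed
  have ind: "indicator {0..t} \<in> borel_measurable ?L"
    by (intro borel_measurable_indicator) (simp add: sets_restrict_space_iff t, use t in auto)
  have Gm: "?G \<phi> \<in> borel_measurable ?L" if p: "\<phi> \<in> schwartz" for \<phi>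
  proof -
    from mult_op_phase_lipschitz[OF p] obtain L where L: "L \<ge> 0" "\<forall>t\<in>{-1..1}. \<forall>t'\<in>{-1..1}.
      (LBINT y. norm (mult_op (phase t) \<phi> y - mult_op (phase t') \<phi> y)) \<le> L * \<bar>t - t'\<bar>" by blast
    show ?thesis unfolding nonlin_def
    proof (rule cubic_integral_measurable[OF S_space, where L = L])
      fix \<tau> \<tau>' :: real assume s: "\<tau> \<in> {0..1}" "\<tau>' \<in> {0..1}"
      have "\<bar>(t - \<tau>) - (t - \<tau>')\<bar> = \<bar>\<tau> - \<tau>'\<bar>" by simp
      with L(2)[rule_format, OF time_diff[OF t s(1)] time_diff[OF t s(2)]]
      show "(LBINT y. norm (?m \<phi> \<tau> y - ?m \<phi> \<tau>' y)) \<le> L * \<bar>\<tau> - \<tau>'\<bar>" by (simp only:)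
    qed (rule S[OF p])
  qed
  have Gi: "integrable ?L (\<lambda>\<tau>. indicator {0..t} \<tau> *\<^sub>R ?G \<phi> \<tau>)" if "\<phi> \<in> schwartz" for \<phi>
    by (rule Lm.integrable_const_bound[OF Gb[OF that]]) (intro borel_measurable_scaleR ind Gm that)
  show ?thesis
  proof (rule temperedI)
    fix \<phi> \<psi> :: "real \<Rightarrow> complex" and a b assume p: "\<phi> \<in> schwartz" "\<psi> \<in> schwartz"
    have G: "indicator {0..t} \<tau> *\<^sub>R ?G (\<lambda>x. a * \<phi> x + b * \<psi> x) \<tau> = a * (indicator {0..t} \<tau> *\<^sub>R ?G \<phi> \<tau>) + b * (indicator {0..t} \<tau> *\<^sub>R ?G \<psi> \<tau>)"
      if s: "\<tau> \<in> {0..1}" for \<tau>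
    proof -
      obtain B where B: "AE x in lborel. norm (nonlin \<tau> x) \<le> B" using nonlin_bounded[OF s] by blast
      have i: "integrable lborel (\<lambda>y. nonlin \<tau> y * ?m \<phi> \<tau> y)" if "\<phi> \<in> schwartz" for \<phi>
        by (rule integrable_bounded_mult(1)[OF nonlin_measurable[OF s] B schwartz_integrable[OF S[OF that s]]])
      have "?G (\<lambda>x. a * \<phi> x + b * \<psi> x) \<tau> = (LBINT y. a * (nonlin \<tau> y * ?m \<phi> \<tau> y) + b * (nonlin \<tau> y * ?m \<psi> \<tau> y))"
        unfolding mult_op_linear[OF slow_family_phase1[OF time_diff[OF t s]] p] by (simp only: distrib_left mult.left_commute)
      also have "\<dots> = a * ?G \<phi> \<tau> + b * ?G \<psi> \<tau>"
        using Bochner_Integration.integral_add[OF integrable_mult_right[OF i[OF p(1)]] integrable_mult_right[OF i[OF p(2)]], of a b]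
        by (simp only: integral_mult_right_zero)
      finally have e: "?G (\<lambda>x. a * \<phi> x + b * \<psi> x) \<tau> = a * ?G \<phi> \<tau> + b * ?G \<psi> \<tau>" .
      show ?thesis unfolding e by (simp only: scaleR_right_distrib mult_scaleR_right)
    qed
    have "(LINT \<tau>|?L. indicator {0..t} \<tau> *\<^sub>R ?G (\<lambda>x. a * \<phi> x + b * \<psi> x) \<tau>) =
        (LINT \<tau>|?L. a * (indicator {0..t} \<tau> *\<^sub>R ?G \<phi> \<tau>) + b * (indicator {0..t} \<tau> *\<^sub>R ?G \<psi> \<tau>))"
      by (rule Bochner_Integration.integral_cong[OF refl G]) simp
    also have "\<dots> = a * (LINT \<tau>|?L. indicator {0..t} \<tau> *\<^sub>R ?G \<phi> \<tau>) + b * (LINT \<tau>|?L. indicator {0..t} \<tau> *\<^sub>R ?G \<psi> \<tau>)"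
      using Bochner_Integration.integral_add[OF integrable_mult_right[OF Gi[OF p(1)]] integrable_mult_right[OF Gi[OF p(2)]], of a b]
      by (simp only: integral_mult_right_zero)
    finally show "duhamel u v w t (\<lambda>x. a * \<phi> x + b * \<psi> x) = a * duhamel u v w t \<phi> + b * duhamel u v w t \<psi>"
      unfolding d by (simp only: distrib_left mult.left_commute)
  next
    fix \<phi> :: "real \<Rightarrow> complex" assume p: "\<phi> \<in> schwartz"
    have "norm (duhamel u v w t \<phi>) = norm (LINT \<tau>|?L. indicator {0..t} \<tau> *\<^sub>R ?G \<phi> \<tau>)"
      unfolding d by (simp only: norm_mult norm_minus_cancel norm_ii mult_1_left)
    also have "\<dots> \<le> (LINT \<tau>|?L. norm (indicator {0..t} \<tau> *\<^sub>R ?G \<phi> \<tau>))" by (rule integral_norm_bound)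
    also have "\<dots> \<le> (LINT \<tau>|?L. data_norm * (2 * pi * (D * schwartz_norm M \<phi>)))"
      by (rule integral_mono_AE[OF integrable_norm[OF Gi[OF p]] Lm.integrable_const Gb[OF p]])
    also have "\<dots> = (data_norm * (2 * pi * D)) * schwartz_norm M \<phi>" by (simp add: measure_restrict_space)
    finally show "norm (duhamel u v w t \<phi>) \<le> (data_norm * (2 * pi * D)) * schwartz_norm M \<phi>" .
  qed
qed

lemma duhamel_bound:
  assumes C: "C \<ge> 0" "\<forall>u\<in>mod_space \<sigma>. \<forall>v\<in>mod_space \<sigma>. \<forall>w\<in>mod_space \<sigma>. \<forall>t\<in>{-1..1}. \<forall>k x.
     ennreal (norm (conv (cubic u v w) (box_kernel 0 k t) x)) \<le> ennreal C * trilinear_sum k u v w"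
  shows "duhamel u v w \<in> S_space \<sigma>"
    "S_norm \<sigma> (duhamel u v w) \<le> ennreal (C * (8 * \<rho> + 1)) * S_norm \<sigma> u * S_norm \<sigma> v * S_norm \<sigma> w"
proof -
  let ?L = "lebesgue_on {0..1::real}"
  let ?T = "\<lambda>k \<tau>. trilinear_sum k (u \<tau>) (v \<tau>) (w \<tau>)"
  let ?\<beta> = "\<lambda>k. \<integral>\<^sup>+\<tau>. ennreal C * ?T k \<tau> \<partial>?L"
  let ?c = "C * (8 * \<rho> + 1)"
  let ?B = "?c * data_norm"
  have c0: "?c \<ge> 0" using C(1) \<rho>_pos by simp
  have L1: "emeasure ?L (space ?L) = 1" by (simp add: emeasure_restrict_space)
  note Tm = trilinear_sum_measurable[OF S_space]
  have Sfin: "ennreal (enn2real (S_norm \<sigma> u)) = S_norm \<sigma> u" "ennreal (enn2real (S_norm \<sigma> v)) = S_norm \<sigma> v"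
    "ennreal (enn2real (S_norm \<sigma> w)) = S_norm \<sigma> w"
    using S_space_AE(2)[OF S_space(1)] S_space_AE(2)[OF S_space(2)] S_space_AE(2)[OF S_space(3)] by simp_all
  have data_norm: "ennreal data_norm = S_norm \<sigma> u * S_norm \<sigma> v * S_norm \<sigma> w"
    unfolding data_norm_def by (simp only: ennreal_mult' enn2real_nonneg mult_nonneg_nonneg Sfin)
  have sum: "(\<Sum>k\<in>K. ?\<beta> k) \<le> ennreal ?B" if K: "finite K" for K
  proof -
    have "(\<Sum>k\<in>K. ?\<beta> k) = (\<integral>\<^sup>+\<tau>. (\<Sum>k\<in>K. ennreal C * ?T k \<tau>) \<partial>?L)"
      by (rule nn_integral_sum[symmetric]) (intro borel_measurable_times_ennreal borel_measurable_const Tm)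
    also have "\<dots> \<le> (\<integral>\<^sup>+\<tau>. ennreal ?B \<partial>?L)"
    proof (rule nn_integral_mono_AE)
      show "AE \<tau> in ?L. (\<Sum>k\<in>K. ennreal C * ?T k \<tau>) \<le> ennreal ?B"
        using S_space_AE(1)[OF S_space(1)] S_space_AE(1)[OF S_space(2)] S_space_AE(1)[OF S_space(3)]
      proof eventually_elim
        case (elim \<tau>)
        have "(\<Sum>k\<in>K. ennreal C * ?T k \<tau>) = ennreal C * (\<Sum>k\<in>K. ?T k \<tau>)" by (rule sum_distrib_left[symmetric])
        also have "\<dots> \<le> ennreal C * (ennreal (8 * \<rho> + 1) * (mod_norm \<sigma> (u \<tau>) * mod_norm \<sigma> (v \<tau>) * mod_norm \<sigma> (w \<tau>)))"
          by (intro mult_left_mono sum_trilinear_sum_le K) simp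
        also have "\<dots> \<le> ennreal C * (ennreal (8 * \<rho> + 1) * (S_norm \<sigma> u * S_norm \<sigma> v * S_norm \<sigma> w))"
          by (intro mult_left_mono mult_mono elim) auto
        also have "\<dots> = ennreal ?B" using C(1) \<rho>_pos data_norm_nonneg
          unfolding data_norm[symmetric] by (simp add: ennreal_mult' mult.assoc)
        finally show ?case .
      qed
    qed
    also have "\<dots> = ennreal ?B" by (simp only: nn_integral_const L1 mult_1_right)
    finally show ?thesis .
  qed
  have fin: "?\<beta> k < \<infinity>" for k using sum[of "{k}"] by (simp add: le_less_trans[OF _ ennreal_less_top])
  have bd: "norm (duhamel_box k t x) \<le> enn2real (?\<beta> k)" if t: "t \<in> {0..1}" for k t x
  proof -
    let ?f = "\<lambda>\<tau>. indicator {0..t} \<tau> *\<^sub>R piece k t x \<tau>"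
    have "norm (duhamel_box k t x) = norm (LINT \<tau>|?L. ?f \<tau>)"
      unfolding duhamel_box_def by (simp only: norm_mult norm_minus_cancel norm_ii mult_1_left)
    then have "ennreal (norm (duhamel_box k t x)) \<le> (\<integral>\<^sup>+\<tau>. ennreal (norm (?f \<tau>)) \<partial>?L)"
      using integral_norm_bound_ennreal[OF piece_integrable[OF t t, of k x]] by simp
    also have "\<dots> \<le> ?\<beta> k"
    proof (rule nn_integral_mono)
      fix \<tau> assume "\<tau> \<in> space ?L"
      then have s: "\<tau> \<in> {0..1}" by simp
      have "ennreal (norm (?f \<tau>)) \<le> ennreal (norm (piece k t x \<tau>))" by (intro ennreal_leI) (simp add: indicator_def)
      also have "\<dots> \<le> ennreal C * ?T k \<tau>" unfolding piece_def nonlin_def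
        by (rule C(2)[rule_format, OF in_mod_space[OF s] time_diff[OF t s]])
      finally show "ennreal (norm (?f \<tau>)) \<le> ennreal C * ?T k \<tau>" .
    qed
    also have "\<dots> = ennreal (enn2real (?\<beta> k))" using fin[of k] by simp
    finally show ?thesis by simp
  qed
  have sumr: "(\<Sum>k\<in>K. enn2real (?\<beta> k)) \<le> ?B" if K: "finite K" for K
  proof -
    have "ennreal (\<Sum>k\<in>K. enn2real (?\<beta> k)) = (\<Sum>k\<in>K. ennreal (enn2real (?\<beta> k)))" by simp
    also have "\<dots> = (\<Sum>k\<in>K. ?\<beta> k)" using fin by (intro sum.cong refl) simp
    also have "\<dots> \<le> ennreal ?B" by (rule sum[OF K])
    finally show ?thesis using c0 data_norm_nonneg by (simp only: ennreal_le_iff mult_nonneg_nonneg)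
  qed
  note I = S_spaceI[OF duhamel_tempered duhamel_box_represents bd sumr duhamel_box_lipschitz]
  show "duhamel u v w \<in> S_space \<sigma>" by (rule I(1))
  have "S_norm \<sigma> (duhamel u v w) \<le> ennreal ?B" by (rule I(2))
  also have "\<dots> = ennreal ?c * (S_norm \<sigma> u * S_norm \<sigma> v * S_norm \<sigma> w)" unfolding data_norm[symmetric] by (rule ennreal_mult'[OF c0])
  finally show "S_norm \<sigma> (duhamel u v w) \<le> ennreal ?c * S_norm \<sigma> u * S_norm \<sigma> v * S_norm \<sigma> w" by (simp only: mult.assoc)
qed

end

section \<open>Quantitative well-posedness\<close>

theorem theorem4p8:
  fixes p :: ereal and s :: real and \<sigma> :: "real \<Rightarrow> real"
  assumes "unit_partition \<sigma>"
    and "6 < p" and "p \<le> \<infinity>"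
    and "1 - 1 / p < ereal s"
  shows "\<exists>C::real. C \<ge> 0 \<and>
    (\<forall>f \<in> bessel_space p s.
       free_evolution f \<in> S_space \<sigma> \<and>
       S_norm \<sigma> (free_evolution f) \<le> ennreal C * bessel_norm p s f) \<and>
    (\<forall>u\<^sub>1 \<in> S_space \<sigma>. \<forall>u\<^sub>2 \<in> S_space \<sigma>. \<forall>u\<^sub>3 \<in> S_space \<sigma>.
       duhamel u\<^sub>1 u\<^sub>2 u\<^sub>3 \<in> S_space \<sigma> \<and>
       S_norm \<sigma> (duhamel u\<^sub>1 u\<^sub>2 u\<^sub>3)
         \<le> ennreal C * S_norm \<sigma> u\<^sub>1 * S_norm \<sigma> u\<^sub>2 * S_norm \<sigma> u\<^sub>3)"
proof -
  from unit_partition_freq_partition[OF assms(1)] obtain \<rho> where "freq_partition \<sigma> \<rho>" by blast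
  then interpret freq_partition \<sigma> \<rho> .
  have p: "2 \<le> p"
  proof -
    have "(2::ereal) \<le> 6" by simp
    then show ?thesis using less_imp_le[OF assms(2)] by (rule order_trans)
  qed
  from free_evolution_bound[OF p assms(4)] obtain C1 where C1: "C1 \<ge> 0"
    "\<forall>f\<in>bessel_space p s. free_evolution f \<in> S_space \<sigma> \<and> S_norm \<sigma> (free_evolution f) \<le> ennreal C1 * bessel_norm p s f"
    by blast
  from conv_cubic_bound obtain C2 where C2: "C2 \<ge> 0" "\<forall>u\<in>mod_space \<sigma>. \<forall>v\<in>mod_space \<sigma>. \<forall>w\<in>mod_space \<sigma>. \<forall>t\<in>{-1..1}. \<forall>k x.
     ennreal (norm (conv (cubic u v w) (box_kernel 0 k t) x)) \<le> ennreal C2 * trilinear_sum k u v w" by blast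
  let ?c = "C2 * (8 * \<rho> + 1)"
  let ?C = "max C1 ?c"
  have le: "ennreal C1 \<le> ennreal ?C" "ennreal ?c \<le> ennreal ?C" by (intro ennreal_leI max.cobounded1 max.cobounded2)+
  show ?thesis
  proof (intro exI[of _ ?C] conjI ballI)
    show "0 \<le> ?C" using C1(1) by simp
    fix f assume f: "f \<in> bessel_space p s"
    show "free_evolution f \<in> S_space \<sigma>" using C1(2) f by blast
    have "S_norm \<sigma> (free_evolution f) \<le> ennreal C1 * bessel_norm p s f" using C1(2) f by blast
    also have "\<dots> \<le> ennreal ?C * bessel_norm p s f" by (intro mult_right_mono le) simp
    finally show "S_norm \<sigma> (free_evolution f) \<le> ennreal ?C * bessel_norm p s f" .
  next
    fix u\<^sub>1 u\<^sub>2 u\<^sub>3 assume u: "u\<^sub>1 \<in> S_space \<sigma>" "u\<^sub>2 \<in> S_space \<sigma>" "u\<^sub>3 \<in> S_space \<sigma>"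
    interpret duhamel_terms \<sigma> \<rho> u\<^sub>1 u\<^sub>2 u\<^sub>3 by unfold_locales (rule u)+
    show "duhamel u\<^sub>1 u\<^sub>2 u\<^sub>3 \<in> S_space \<sigma>" by (rule duhamel_bound(1)[OF C2])
    have "S_norm \<sigma> (duhamel u\<^sub>1 u\<^sub>2 u\<^sub>3) \<le> ennreal ?c * S_norm \<sigma> u\<^sub>1 * S_norm \<sigma> u\<^sub>2 * S_norm \<sigma> u\<^sub>3"
      by (rule duhamel_bound(2)[OF C2])
    also have "\<dots> \<le> ennreal ?C * S_norm \<sigma> u\<^sub>1 * S_norm \<sigma> u\<^sub>2 * S_norm \<sigma> u\<^sub>3" by (intro mult_right_mono le) auto
    finally show "S_norm \<sigma> (duhamel u\<^sub>1 u\<^sub>2 u\<^sub>3) \<le> ennreal ?C * S_norm \<sigma> u\<^sub>1 * S_norm \<sigma> u\<^sub>2 * S_norm \<sigma> u\<^sub>3" .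
  qed
qed

end
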